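(* (1) Let $G$ be a sharply $5$-transitive subgroup of $\mathrm{Alt}(12)$ (in its natural action on $12$ points). Then $G$ has exactly $15$ conjugacy classes: one class consisting of all elements of $G$ of cycle type $\lambda$ for each $\lambda$ in the list $1^{12}, 2^4, 2^6, 3^3, 3^4, 4^2, 2^24^2, 5^2, 2^13^16^1, 6^2, 2^18^1, 4^18^1, 2^110^1$, and two classes, labelled $11^1_A$ and $11^1_B$ in a suitable order, of elements of cycle type $11^1$. The complex irreducible characters of $G$ are exactly the $15$ class functions $\chi_0,\dots,\chi_{14}$ with the following values, where $\omega=\frac12(-1+\sqrt{-11})$: $$\begin{array}{c|rrrrrrrrrrrrrrr} &1^{12}&2^4&2^6&3^3&3^4&4^2&2^24^2&5^2&2^13^16^1&6^2&2^18^1&4^18^1&2^110^1&11^1_A&11^1_B\\ \hline \chi_0&1&1&1&1&1&1&1&1&1&1&1&1&1&1&1\\ \chi_1&11&3&-1&2&-1&3&-1&1&0&-1&1&-1&-1&0&0\\ \chi_2&11&3&-1&2&-1&-1&3&1&0&-1&-1&1&-1&0&0\\ \chi_3&16&0&4&-2&1&0&0&1&0&1&0&0&-1&\omega&\overline\omega\\ \chi_4&16&0&4&-2&1&0&0&1&0&1&0&0&-1&\overline\omega&\omega\\ \chi_5&45&-3&5&0&3&1&1&0&0&-1&-1&-1&0&1&1\\ \chi_6&54&6&6&0&0&2&2&-1&0&0&0&0&1&-1&-1\\ \chi_7&55&7&-5&1&1&-1&-1&0&1&1&-1&-1&0&0&0\\ \chi_8&55&-1&-5&1&1&3&-1&0&-1&1&-1&1&0&0&0\\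 \chi_9&55&-1&-5&1&1&-1&3&0&-1&1&1&-1&0&0&0\\ \chi_{10}&66&2&6&3&0&-2&-2&1&-1&0&0&0&1&0&0\\ \chi_{11}&99&3&-1&0&3&-1&-1&-1&0&-1&1&1&-1&0&0\\ \chi_{12}&120&-8&0&3&0&0&0&0&1&0&0&0&0&-1&-1\\ \chi_{13}&144&0&4&0&-3&0&0&-1&0&1&0&0&-1&1&1\\ \chi_{14}&176&0&-4&-4&-1&0&0&1&0&-1&0&0&1&0&0 \end{array}$$ (2) Let $G$ be a sharply $4$-transitive subgroup of $\mathrm{Alt}(11)$ (in its natural action on $11$ points). Then $G$ has exactly $10$ conjugacy classes: one class consisting of all elements of $G$ of cycle type $\lambda$ for each $\lambda$ in the list $1^{11}, 2^4, 3^3, 4^2, 5^2, 2^13^16^1$; two classes, labelled $2^18^1_A$ and $2^18^1_B$ in a suitable order, of elements of cycle type $2^18^1$; and two classes, labelled $11^1_A$ and $11^1_B$ in a suitable order, of elements of cycle type $11^1$. The complex irreducible characters of $G$ are exactly the $10$ class functions $\chi_0,\dots,\chi_9$ with the following values, where $\alpha=\sqrt{-2}$ and $\beta=\frac12(-1+\sqrt{-11})$: $$\begin{array}{c|rrrrrrrrrr} &1^{11}&2^4&3^3&4^2&5^2&2^13^16^1&2^18^1_A&2^18^1_B&11^1_A&11^1_B\\ \hline \chi_0&1&1&1&1&1&1&1&1&1&1\\ \chi_1&10&2&1&2&0&-1&0&0&-1&-1\\ \chi_2&10&-2&1&0&0&1&\alpha&\overline\alpha&-1&-1\\ \chi_3&10&-2&1&0&0&1&\overline\alpha&\alpha&-1&-1\\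 \chi_4&11&3&2&-1&1&0&-1&-1&0&0\\ \chi_5&16&0&-2&0&1&0&0&0&\beta&\overline\beta\\ \chi_6&16&0&-2&0&1&0&0&0&\overline\beta&\beta\\ \chi_7&44&4&-1&0&-1&1&0&0&0&0\\ \chi_8&45&-3&0&1&0&0&-1&-1&1&1\\ \chi_9&55&-1&1&-1&0&-1&1&1&0&0 \end{array}$$
   Context: A subgroup $G$ of the symmetric group on a finite set $\Omega$ is sharply $k$-transitive if for any two ordered $k$-tuples of pairwise distinct points of $\Omega$ there is exactly one element of $G$ mapping the first to the second. $\mathrm{Alt}(n)$ is the alternating group on $n$ points. Cycle types are written as products $a^{m}b^{n}\cdots$, meaning $m$ cycles of length $a$, $n$ cycles of length $b$, and so on; fixed points (cycles of length $1$) are omitted except for the identity. For instance, on $12$ points $2^4$ denotes a product of four disjoint transpositions with $4$ fixed points, and $2^13^16^1$ denotes an element with one $2$-cycle, one $3$-cycle, one $6$-cycle and one fixed point. Subscript letters distinguish different conjugacy classes with the same cycle type. *)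

theory Defs
  imports
    "HOL-Algebra.Sym_Groups"
    "HOL-Combinatorics.Orbits"
    "HOL-Library.Multiset"
    "Jordan_Normal_Form.VS_Connect"
begin

definition sharply_transitive :: "nat \<Rightarrow> 'a set \<Rightarrow> ('a \<Rightarrow> 'a) set \<Rightarrow> bool" where
  "sharply_transitive k \<Omega> G \<longleftrightarrow>
     (\<forall>xs ys. length xs = k \<and> distinct xs \<and> set xs \<subseteq> \<Omega> \<and>
              length ys = k \<and> distinct ys \<and> set ys \<subseteq> \<Omega> \<longrightarrow>
              (\<exists>!g. g \<in> G \<and> map g xs = ys))"

(* Multiset of the lengths of the cycles of length at least 2 of a finitely supported
   permutation; the identity has cycle type {#}. *)
definition cycle_type :: "('a \<Rightarrow> 'a) \<Rightarrow> nat multiset" where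
  "cycle_type p = image_mset card (mset_set {Orbits.orbit p x |x. p x \<noteq> x})"

definition conj_class :: "('a, 'b) monoid_scheme \<Rightarrow> 'a \<Rightarrow> 'a set" where
  "conj_class G x = {g \<otimes>\<^bsub>G\<^esub> x \<otimes>\<^bsub>G\<^esub> inv\<^bsub>G\<^esub> g |g. g \<in> carrier G}"

definition conj_classes :: "('a, 'b) monoid_scheme \<Rightarrow> 'a set set" where
  "conj_classes G = conj_class G ` carrier G"

definition mat_trace :: "'a :: comm_monoid_add mat \<Rightarrow> 'a" where
  "mat_trace A = (\<Sum>i<dim_row A. A $$ (i, i))"

(* Homomorphisms from G to the general linear group of degree n over the complex numbers. *)
definition complex_rep :: "('a, 'b) monoid_scheme \<Rightarrow> nat \<Rightarrow> ('a \<Rightarrow> complex mat) \<Rightarrow> bool" where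
  "complex_rep G n \<rho> \<longleftrightarrow> \<rho> \<in> hom G (units_of (ring_mat TYPE(complex) n ()))"

definition irreducible_rep :: "('a, 'b) monoid_scheme \<Rightarrow> nat \<Rightarrow> ('a \<Rightarrow> complex mat) \<Rightarrow> bool" where
  "irreducible_rep G n \<rho> \<longleftrightarrow> complex_rep G n \<rho> \<and> n > 0 \<and>
     (\<forall>W. VectorSpace.subspace class_ring W (module_vec TYPE(complex) n) \<and>
          (\<forall>g\<in>carrier G. \<forall>w\<in>W. \<rho> g *\<^sub>v w \<in> W) \<longrightarrow>
          W = {0\<^sub>v n} \<or> W = carrier_vec n)"

(* Characters are extensional functions on the carrier, so that equality of characters is
   equality of their values on the group. *)
definition irr_characters :: "('a, 'b) monoid_scheme \<Rightarrow> ('a \<Rightarrow> complex) set" where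
  "irr_characters G = {\<lambda>g\<in>carrier G. mat_trace (\<rho> g) |n \<rho>. irreducible_rep G n \<rho>}"

(* X is the character table of G, its columns being indexed by the list Cs of all conjugacy
   classes and its rows by the list chis of all irreducible characters. *)
definition is_character_table ::
  "('a, 'b) monoid_scheme \<Rightarrow> 'a set list \<Rightarrow> ('a \<Rightarrow> complex) list \<Rightarrow> complex list list \<Rightarrow> bool" where
  "is_character_table G Cs chis X \<longleftrightarrow>
     distinct Cs \<and> set Cs = conj_classes G \<and>
     distinct chis \<and> set chis = irr_characters G \<and>
     length X = length chis \<and> (\<forall>r\<in>set X. length r = length Cs) \<and>
     (\<forall>i<length chis. \<forall>j<length Cs. \<forall>g\<in>Cs ! j. (chis ! i) g = X ! i ! j)"

definition alpha :: complex where
  "alpha = csqrt (-2)"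

definition omega :: complex where
  "omega = (-1 + csqrt (-11)) / 2"

definition types_12 :: "nat multiset list" where
  "types_12 =
    [{#}, {#2,2,2,2#}, {#2,2,2,2,2,2#}, {#3,3,3#}, {#3,3,3,3#}, {#4,4#}, {#2,2,4,4#},
     {#5,5#}, {#2,3,6#}, {#6,6#}, {#2,8#}, {#4,8#}, {#2,10#}, {#11#}, {#11#}]"

definition table_12 :: "complex list list" where
  "table_12 =
    [[  1,  1,  1,  1,  1,  1,  1,  1,  1,  1,  1,  1,  1,  1,  1],
     [ 11,  3, -1,  2, -1,  3, -1,  1,  0, -1,  1, -1, -1,  0,  0],
     [ 11,  3, -1,  2, -1, -1,  3,  1,  0, -1, -1,  1, -1,  0,  0],
     [ 16,  0,  4, -2,  1,  0,  0,  1,  0,  1,  0,  0, -1,  omega,  cnj omega],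
     [ 16,  0,  4, -2,  1,  0,  0,  1,  0,  1,  0,  0, -1,  cnj omega,  omega],
     [ 45, -3,  5,  0,  3,  1,  1,  0,  0, -1, -1, -1,  0,  1,  1],
     [ 54,  6,  6,  0,  0,  2,  2, -1,  0,  0,  0,  0,  1, -1, -1],
     [ 55,  7, -5,  1,  1, -1, -1,  0,  1,  1, -1, -1,  0,  0,  0],
     [ 55, -1, -5,  1,  1,  3, -1,  0, -1,  1, -1,  1,  0,  0,  0],
     [ 55, -1, -5,  1,  1, -1,  3,  0, -1,  1,  1, -1,  0,  0,  0],
     [ 66,  2,  6,  3,  0, -2, -2,  1, -1,  0,  0,  0,  1,  0,  0],
     [ 99,  3, -1,  0,  3, -1, -1, -1,  0, -1,  1,  1, -1,  0,  0],
     [120, -8,  0,  3,  0,  0,  0,  0,  1,  0,  0,  0,  0, -1, -1],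
     [144,  0,  4,  0, -3,  0,  0, -1,  0,  1,  0,  0, -1,  1,  1],
     [176,  0, -4, -4, -1,  0,  0,  1,  0, -1,  0,  0,  1,  0,  0]]"

definition types_11 :: "nat multiset list" where
  "types_11 =
    [{#}, {#2,2,2,2#}, {#3,3,3#}, {#4,4#}, {#5,5#}, {#2,3,6#}, {#2,8#}, {#2,8#},
     {#11#}, {#11#}]"

definition table_11 :: "complex list list" where
  "table_11 =
    [[ 1,  1,  1,  1,  1,  1,  1,  1,  1,  1],
     [10,  2,  1,  2,  0, -1,  0,  0, -1, -1],
     [10, -2,  1,  0,  0,  1,  alpha,  cnj alpha, -1, -1],
     [10, -2,  1,  0,  0,  1,  cnj alpha,  alpha, -1, -1],
     [11,  3,  2, -1,  1,  0, -1, -1,  0,  0],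
     [16,  0, -2,  0,  1,  0,  0,  0,  omega,  cnj omega],
     [16,  0, -2,  0,  1,  0,  0,  0,  cnj omega,  omega],
     [44,  4, -1,  0, -1,  1,  0,  0,  0,  0],
     [45, -3,  0,  1,  0,  0, -1, -1,  1,  1],
     [55, -1,  1, -1,  0, -1,  1,  1,  0,  0]]"

end

theory Submission
  imports
    Defs
    "HOL-Algebra.Sylow"
    "HOL-Algebra.Multiplicative_Group"
    "Jordan_Normal_Form.Spectral_Radius"
begin

text \<open>
  Elements are counted by cycle type through double counting: an ordered system of disjoint cycles
  with lengths summing to at most \<open>k\<close> occurs in the elements of a sharply \<open>k\<close>-transitive group exactly
  once on average, and centralizers act freely on the systems whose lengths sum to at least \<open>k\<close>, which
  bounds them from above. Together with parity and the fact that only the identity fixes \<open>k\<close> points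
  this determines all conjugacy classes.

  A square array \<open>X\<close> with orthogonal columns is the character table as soon as all
  \<open>c\<^sub>i = \<langle>X\<^sub>i, \<psi>\<rangle>\<close> are integers for every irreducible \<open>\<psi>\<close>: since \<open>\<Sum>|c\<^sub>i|\<^sup>2 = 1\<close>, each \<open>\<psi>\<close> is a row up to
  sign, and a row orthogonal to every \<open>\<psi>\<close> would vanish at the identity. The rational rows, and the sums
  of the two rows conjugate over \<open>\<rat>(\<surd>-11)\<close>, are integral combinations of permutation characters on
  lists of subsets and of one further induced character (from the centralizer of an element of type
  \<open>6\<^sup>2\<close> in degree 12; in degree 11 a linear character of a cyclic group of order 8 separates the rows
  with \<open>\<surd>-2\<close>). For the pair over \<open>\<rat>(\<surd>-11)\<close> the two coefficients \<open>p, q\<close> are real with integral sum,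
  and \<open>p\<^sup>2 + q\<^sup>2 = 1\<close> together with a nonzero degree leaves only integers.
\<close>

section \<open>Schur orthogonality\<close>

text \<open>No generators of \<open>G\<close> are at hand: class sizes, power maps and centralizers
  have to come from sharp transitivity, parity and divisibility. In degree 11 the moments determine
  every count. In degree 12 they leave two parameters free, in effect the numbers of elements of
  types 2^6 and 3^4. For these two types the centralizer bound is too large as well (960 against
  240, 108 against 36). Both defects are repaired by Cauchy's theorem: an element of prime order in
  the centralizer exhibits the given element as a power of one of type 2.10 or 6^2, and these types
  are already single classes. The tables are verified, not derived. Orthogonality is a computation,
  and integrality only uses characters whose values can be read off cycle types or off a small
  subgroup. Such characters do not separate an 11-cycle from its inverse, so only the sum of two
  rows with \<open>omega\<close> is reached, and the pair itself needs a separate argument.\<close>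

lemma mat_trace_mult_comm:
  fixes A B :: "'a :: comm_semiring_0 mat"
  assumes "A \<in> carrier_mat n m" "B \<in> carrier_mat m n"
  shows "mat_trace (A * B) = mat_trace (B * A)"
proof -
  have "mat_trace (A * B) = (\<Sum>i<n. \<Sum>j<m. A $$ (i, j) * B $$ (j, i))"
    using assms by (auto simp: mat_trace_def scalar_prod_def atLeast0LessThan intro!: sum.cong)
  also have "\<dots> = (\<Sum>j<m. \<Sum>i<n. B $$ (j, i) * A $$ (i, j))"
    by (subst sum.swap) (simp add: mult.commute)
  also have "\<dots> = mat_trace (B * A)"
    using assms by (auto simp: mat_trace_def scalar_prod_def atLeast0LessThan intro!: sum.cong)
  finally show ?thesis .
qed

lemma mat_trace_one: "mat_trace (1\<^sub>m n :: 'a :: semiring_1 mat) = of_nat n"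
  by (simp add: mat_trace_def)

lemma mult_mat_index:
  assumes "A \<in> carrier_mat n m" "B \<in> carrier_mat m k" "i < n" "j < k"
  shows "(A * B) $$ (i, j) = (\<Sum>l<m. A $$ (i, l) * B $$ (l, j))"
  using assms by (auto simp: scalar_prod_def atLeast0LessThan intro!: sum.cong)

lemma upper_triangular_mult_diag:
  fixes A B :: "'a :: comm_semiring_1 mat"
  assumes A: "A \<in> carrier_mat n n" and B: "B \<in> carrier_mat n n"
    and "upper_triangular A" "upper_triangular B" and i: "i < n"
  shows "(A * B) $$ (i, i) = A $$ (i, i) * B $$ (i, i)"
proof -
  have "A $$ (i, l) * B $$ (l, i) = 0" if "l < n" "l \<noteq> i" for l
  proof (cases "l < i")
    case True
    then have "A $$ (i, l) = 0" using assms by (auto simp: upper_triangular_def)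
    then show ?thesis by simp
  next
    case False
    then have "B $$ (l, i) = 0" using assms that by (auto simp: upper_triangular_def)
    then show ?thesis by simp
  qed
  then have "(\<Sum>l\<in>{..<n}. A $$ (i, l) * B $$ (l, i)) = (\<Sum>l\<in>{i}. A $$ (i, l) * B $$ (l, i))"
    using i by (intro sum.mono_neutral_right) auto
  then show ?thesis using mult_mat_index[OF A B i i] by simp
qed

lemma upper_triangular_mult:
  fixes A B :: "'a :: comm_semiring_1 mat"
  assumes A: "A \<in> carrier_mat n n" and B: "B \<in> carrier_mat n n"
    and "upper_triangular A" "upper_triangular B"
  shows "upper_triangular (A * B)"
proof -
  have "(A * B) $$ (i, j) = 0" if "i < n" "j < i" for i j
  proof -
    have "A $$ (i, l) * B $$ (l, j) = 0" if "l < n" for l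
    proof (cases "l < i")
      case True
      then have "A $$ (i, l) = 0" using assms \<open>i < n\<close> by (auto simp: upper_triangular_def)
      then show ?thesis by simp
    next
      case False
      then have "B $$ (l, j) = 0" using assms that \<open>j < i\<close> by (auto simp: upper_triangular_def)
      then show ?thesis by simp
    qed
    then show ?thesis using mult_mat_index[OF A B, of i j] that by simp
  qed
  then show ?thesis using A by (auto simp: upper_triangular_def)
qed

lemma upper_triangular_pow:
  fixes B :: "'a :: comm_semiring_1 mat"
  assumes B: "B \<in> carrier_mat n n" "upper_triangular B"
  shows "upper_triangular (B ^\<^sub>m k) \<and> (\<forall>i<n. (B ^\<^sub>m k) $$ (i, i) = (B $$ (i, i)) ^ k)"
proof (induction k)
  case 0
  then show ?case using B by (auto simp: upper_triangular_def)
next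
  case (Suc k)
  have k: "B ^\<^sub>m k \<in> carrier_mat n n" using B by simp
  show ?case
    using upper_triangular_mult[OF k B(1) _ B(2)] upper_triangular_mult_diag[OF k B(1) _ B(2)] Suc
    by (simp add: mult.commute)
qed

lemma root_of_unity_power_cnj:
  fixes z :: complex
  assumes "z ^ Suc k = 1"
  shows "z ^ k = cnj z"
proof -
  have "norm z = 1" using power_eq_1_iff[of z "Suc k"] assms by blast
  then have "z * cnj z = 1" by (simp add: complex_norm_square[symmetric])
  moreover have "z * z ^ k = 1" using assms by simp
  ultimately have "z * z ^ k = z * cnj z" by simp
  moreover have "z \<noteq> 0" using \<open>norm z = 1\<close> by auto
  ultimately show ?thesis by simp
qed

text \<open>Over \<complex> the matrix is similar to an upper triangular one of the same finite
  order. Its diagonal entries are roots of unity, for which the power \<open>k\<close> is the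
  inverse, that is the conjugate. With \<open>A = \<rho> g\<close> this gives the value of a
  character at an inverse.\<close>

lemma mat_trace_power_finite_order:
  fixes A :: "complex mat"
  assumes A: "A \<in> carrier_mat n n" and k: "A ^\<^sub>m Suc k = 1\<^sub>m n"
  shows "mat_trace (A ^\<^sub>m k) = cnj (mat_trace A)"
proof -
  from char_poly_factorized[OF A] obtain es
    where es: "char_poly A = (\<Prod> a \<leftarrow> es. [:- a, 1:])" by auto
  from schur_decomposition_exists[OF A es] obtain B
    where B: "B \<in> carrier_mat n n" "upper_triangular B" and AB: "similar_mat A B" by auto
  from AB[unfolded similar_mat_def] obtain P Q where PQ: "similar_mat_wit A B P Q" by auto
  note P = similar_mat_witD2(6)[OF A PQ] and Q = similar_mat_witD2(7)[OF A PQ]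
    and QP = similar_mat_witD2(2)[OF A PQ]
  have tr: "mat_trace (A ^\<^sub>m j) = mat_trace (B ^\<^sub>m j)" for j
  proof -
    have "similar_mat_wit (A ^\<^sub>m j) (B ^\<^sub>m j) P Q" by (rule similar_mat_wit_pow[OF PQ])
    then have "A ^\<^sub>m j = P * B ^\<^sub>m j * Q" by (rule similar_mat_witD2(3)[OF pow_carrier_mat[OF A]])
    moreover have "mat_trace (P * B ^\<^sub>m j * Q) = mat_trace (Q * (P * B ^\<^sub>m j))"
      by (rule mat_trace_mult_comm[OF mult_carrier_mat[OF P pow_carrier_mat[OF B(1)]] Q])
    ultimately have "mat_trace (A ^\<^sub>m j) = mat_trace (Q * (P * B ^\<^sub>m j))" by (rule ssubst)
    also have "Q * (P * B ^\<^sub>m j) = B ^\<^sub>m j"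
      using assoc_mult_mat[OF Q P pow_carrier_mat[OF B(1)]] QP left_mult_one_mat[OF pow_carrier_mat[OF B(1)]]
      by metis
    finally show ?thesis .
  qed
  have "similar_mat_wit (A ^\<^sub>m Suc k) (B ^\<^sub>m Suc k) P Q" by (rule similar_mat_wit_pow[OF PQ])
  then have "similar_mat_wit (B ^\<^sub>m Suc k) (1\<^sub>m n) Q P"
    unfolding k by (rule similar_mat_wit_sym)
  then have "B ^\<^sub>m Suc k = Q * 1\<^sub>m n * P"
    by (rule similar_mat_witD2(3)[OF pow_carrier_mat[OF B(1)]])
  then have Bk: "B ^\<^sub>m Suc k = 1\<^sub>m n" using QP Q by simp
  note ut = upper_triangular_pow[OF B(1,2)]
  have dk: "(B ^\<^sub>m k) $$ (i, i) = cnj (B $$ (i, i))" if i: "i < n" for i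
  proof -
    have "(B $$ (i, i)) ^ Suc k = (B ^\<^sub>m Suc k) $$ (i, i)" using ut[of "Suc k"] i by (simp del: pow_mat.simps power_Suc)
    also have "\<dots> = 1" using i unfolding Bk by simp
    finally have "(B $$ (i, i)) ^ k = cnj (B $$ (i, i))" by (rule root_of_unity_power_cnj)
    then show ?thesis using ut[of k] i by simp
  qed
  have "mat_trace (A ^\<^sub>m k) = (\<Sum>i<n. (B ^\<^sub>m k) $$ (i, i))"
    unfolding tr using B by (simp add: mat_trace_def)
  also have "\<dots> = cnj (mat_trace B)" using dk B by (simp add: mat_trace_def)
  also have "mat_trace B = mat_trace A" using tr[of 1] A B by simp
  finally show ?thesis .
qed

section \<open>Matrix representations of a group\<close>

lemma units_ring_mat_iff:
  "A \<in> Units (ring_mat TYPE('a :: field) n b) \<longleftrightarrow>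
     A \<in> carrier_mat n n \<and> (\<exists>B\<in>carrier_mat n n. B * A = 1\<^sub>m n \<and> A * B = 1\<^sub>m n)"
  by (auto simp: Units_def ring_mat_def)

text \<open>Membership in the unit group is witnessed by the matrix of the inverse element.\<close>

lemma complex_repI:
  assumes "group G" and "\<And>g. g \<in> carrier G \<Longrightarrow> \<rho> g \<in> carrier_mat n n"
    and "\<And>g h. g \<in> carrier G \<Longrightarrow> h \<in> carrier G \<Longrightarrow> \<rho> (g \<otimes>\<^bsub>G\<^esub> h) = \<rho> g * \<rho> h"
    and "\<rho> \<one>\<^bsub>G\<^esub> = 1\<^sub>m n"
  shows "complex_rep G n \<rho>"
proof -
  interpret group G by fact
  have "\<rho> g \<in> Units (ring_mat TYPE(complex) n ())" if "g \<in> carrier G" for g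
    unfolding units_ring_mat_iff
  proof (intro conjI bexI)
    show "\<rho> (m_inv G g) * \<rho> g = 1\<^sub>m n" using assms(3)[of "m_inv G g" g] assms(4) that by simp
    show "\<rho> g * \<rho> (m_inv G g) = 1\<^sub>m n" using assms(3)[of g "m_inv G g"] assms(4) that by simp
  qed (use assms(2) that in auto)
  then show ?thesis
    using assms unfolding complex_rep_def hom_def by (auto simp: units_of_def ring_mat_def)
qed

lemma complex_repD:
  assumes "group G" "complex_rep G n \<rho>"
  shows "\<And>g. g \<in> carrier G \<Longrightarrow> \<rho> g \<in> carrier_mat n n"
    and "\<And>g h. g \<in> carrier G \<Longrightarrow> h \<in> carrier G \<Longrightarrow> \<rho> (g \<otimes>\<^bsub>G\<^esub> h) = \<rho> g * \<rho> h"
    and "\<rho> \<one>\<^bsub>G\<^esub> = 1\<^sub>m n"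
proof -
  interpret group G by fact
  have hom: "\<rho> \<in> hom G (units_of (ring_mat TYPE(complex) n ()))"
    using assms by (simp add: complex_rep_def)
  have u: "\<rho> g \<in> Units (ring_mat TYPE(complex) n ())" if "g \<in> carrier G" for g
    using hom that by (auto simp: hom_def units_of_def)
  then show c: "\<rho> g \<in> carrier_mat n n" if "g \<in> carrier G" for g
    using that unfolding units_ring_mat_iff by blast
  show m: "\<rho> (g \<otimes>\<^bsub>G\<^esub> h) = \<rho> g * \<rho> h" if "g \<in> carrier G" "h \<in> carrier G" for g h
    using hom that by (auto simp: hom_def units_of_def ring_mat_def)
  \<comment> \<open>A member of \<open>hom\<close> is only multiplicative, so the image of the
    identity is at first an idempotent; cancelling it by its inverse \<open>B\<close> makes it the
    identity matrix.\<close>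
  obtain B where B: "B \<in> carrier_mat n n" "B * \<rho> \<one>\<^bsub>G\<^esub> = 1\<^sub>m n"
    using u[of "\<one>\<^bsub>G\<^esub>"] unfolding units_ring_mat_iff by auto
  have "\<rho> \<one>\<^bsub>G\<^esub> = B * \<rho> \<one>\<^bsub>G\<^esub> * \<rho> \<one>\<^bsub>G\<^esub>" using B c[of "\<one>\<^bsub>G\<^esub>"] by simp
  also have "\<dots> = B * (\<rho> \<one>\<^bsub>G\<^esub> * \<rho> \<one>\<^bsub>G\<^esub>)" by (rule assoc_mult_mat[OF B(1)]) (auto intro: c)
  also have "\<dots> = 1\<^sub>m n" using m[of "\<one>\<^bsub>G\<^esub>" "\<one>\<^bsub>G\<^esub>"] B by simp
  finally show "\<rho> \<one>\<^bsub>G\<^esub> = 1\<^sub>m n" .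
qed

section \<open>Schur's lemma\<close>

lemma subspace_vecI:
  assumes "W \<subseteq> carrier_vec n" "0\<^sub>v n \<in> W" "\<And>v w. v \<in> W \<Longrightarrow> w \<in> W \<Longrightarrow> v + w \<in> W"
    "\<And>(c :: 'a :: field) v. v \<in> W \<Longrightarrow> c \<cdot>\<^sub>v v \<in> W"
  shows "VectorSpace.subspace class_ring W (module_vec TYPE('a) n)"
  unfolding VectorSpace.subspace_def submodule_def using assms vec_vs[where 'a='a and n=n] vec_module[where 'a='a and n=n]
  by (auto simp: module_vec_simps)

lemma mat_eq_zero_if_mult_vec:
  fixes T :: "'a :: semiring_1 mat"
  assumes T: "T \<in> carrier_mat n m" and z: "\<And>v. v \<in> carrier_vec m \<Longrightarrow> T *\<^sub>v v = 0\<^sub>v n"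
  shows "T = 0\<^sub>m n m"
proof (rule mat_col_eqI)
  fix j assume "j < dim_col (0\<^sub>m n m :: 'a mat)"
  then have j: "j < m" by simp
  have "col T j = T *\<^sub>v unit_vec m j"
    using T j by (intro eq_vecI) (auto simp: mult_mat_vec_def)
  then show "col T j = col (0\<^sub>m n m) j" using z[of "unit_vec m j"] j by simp
qed (use T in auto)

lemma mult_mat_vec_zero:
  "A \<in> carrier_mat n m \<Longrightarrow> A *\<^sub>v 0\<^sub>v m = (0\<^sub>v n :: 'a :: semiring_1 vec)"
  by (intro eq_vecI) (auto simp: scalar_prod_def)

lemma mat_right_inverse_if_surj:
  fixes T :: "'a :: semiring_1 mat"
  assumes T: "T \<in> carrier_mat n m"
    and s: "\<And>w. w \<in> carrier_vec n \<Longrightarrow> \<exists>v\<in>carrier_vec m. T *\<^sub>v v = w"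
  obtains S where "S \<in> carrier_mat m n" "T * S = 1\<^sub>m n"
proof -
  have "\<forall>i. \<exists>v\<in>carrier_vec m. T *\<^sub>v v = unit_vec n i" using s by simp
  then obtain v where v: "\<And>i. v i \<in> carrier_vec m" "\<And>i. T *\<^sub>v v i = unit_vec n i" by metis
  define S where "S = mat_of_cols m (map v [0..<n])"
  have S: "S \<in> carrier_mat m n" using mat_of_cols_carrier(1)[of m "map v [0..<n]"] by (simp add: S_def)
  have "T * S = 1\<^sub>m n"
  proof (rule mat_col_eqI)
    fix i assume "i < dim_col (1\<^sub>m n :: 'a mat)"
    then have i: "i < n" by simp
    have "col (T * S) i = T *\<^sub>v col S i" using T S i by (intro col_mult2) auto
    also have "col S i = v i" using i v(1)[of i] by (simp add: S_def)
    finally show "col (T * S) i = col (1\<^sub>m n) i" using v i by simp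
  qed (use T S in auto)
  with S show ?thesis using that by blast
qed

lemma irreducible_repD:
  assumes "irreducible_rep G n \<rho>"
  shows "complex_rep G n \<rho>" "n > 0"
    "\<And>W. VectorSpace.subspace class_ring W (module_vec TYPE(complex) n) \<Longrightarrow>
      (\<And>g w. g \<in> carrier G \<Longrightarrow> w \<in> W \<Longrightarrow> \<rho> g *\<^sub>v w \<in> W) \<Longrightarrow> W = {0\<^sub>v n} \<or> W = carrier_vec n"
  using assms unfolding irreducible_rep_def by blast+

lemma schur_invertible:
  assumes "group G" and \<rho>: "irreducible_rep G n \<rho>" and \<sigma>: "irreducible_rep G m \<sigma>"
    and T: "T \<in> carrier_mat n m" "T \<noteq> 0\<^sub>m n m"
    and I: "\<And>g. g \<in> carrier G \<Longrightarrow> \<rho> g * T = T * \<sigma> g"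
  obtains S where "S \<in> carrier_mat m n" "T * S = 1\<^sub>m n" "S * T = 1\<^sub>m m"
proof -
  note \<rho>c = complex_repD[OF assms(1) irreducible_repD(1)[OF \<rho>]]
  note \<sigma>c = complex_repD[OF assms(1) irreducible_repD(1)[OF \<sigma>]]
  have Ig: "\<rho> g *\<^sub>v (T *\<^sub>v v) = T *\<^sub>v (\<sigma> g *\<^sub>v v)" if "g \<in> carrier G" "v \<in> carrier_vec m" for g v
  proof -
    have "\<rho> g *\<^sub>v (T *\<^sub>v v) = (\<rho> g * T) *\<^sub>v v"
      using \<rho>c(1)[OF that(1)] T(1) that(2) by (simp add: assoc_mult_mat_vec)
    also have "\<dots> = T *\<^sub>v (\<sigma> g *\<^sub>v v)"
      unfolding I[OF that(1)] using \<sigma>c(1)[OF that(1)] T(1) that(2) by (simp add: assoc_mult_mat_vec)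
    finally show ?thesis .
  qed
  define K where "K = {v \<in> carrier_vec m. T *\<^sub>v v = 0\<^sub>v n}"
  have "K = {0\<^sub>v m} \<or> K = carrier_vec m"
  proof (rule irreducible_repD(3)[OF \<sigma>])
    show "VectorSpace.subspace class_ring K (module_vec TYPE(complex) m)"
      using T(1) by (intro subspace_vecI)
        (auto simp: K_def mult_add_distrib_mat_vec mult_mat_vec[OF T(1)])
    show "\<sigma> g *\<^sub>v w \<in> K" if "g \<in> carrier G" "w \<in> K" for g w
      using Ig[OF that(1), of w] \<rho>c(1)[OF that(1)] \<sigma>c(1)[OF that(1)] that(2)
      by (auto simp: K_def mult_mat_vec_zero)
  qed
  moreover have "K \<noteq> carrier_vec m"
    using mat_eq_zero_if_mult_vec[OF T(1)] T(2) by (auto simp: K_def)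
  ultimately have K: "K = {0\<^sub>v m}" by blast
  define J where "J = (\<lambda>v. T *\<^sub>v v) ` carrier_vec m"
  have Jc: "J \<subseteq> carrier_vec n" using T(1) by (auto simp: J_def)
  have "J = {0\<^sub>v n} \<or> J = carrier_vec n"
  proof (rule irreducible_repD(3)[OF \<rho>])
    show "VectorSpace.subspace class_ring J (module_vec TYPE(complex) n)"
    proof (rule subspace_vecI[OF Jc])
      show "0\<^sub>v n \<in> J" unfolding J_def using T(1) by (intro image_eqI[of _ _ "0\<^sub>v m"]) auto
      show "v + w \<in> J" if "v \<in> J" "w \<in> J" for v w
        using that mult_add_distrib_mat_vec[OF T(1)] unfolding J_def
        by (auto simp flip: mult_add_distrib_mat_vec[OF T(1)])
      show "c \<cdot>\<^sub>v v \<in> J" if "v \<in> J" for c v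
        using that unfolding J_def by (auto simp flip: mult_mat_vec[OF T(1)])
    qed
    show "\<rho> g *\<^sub>v w \<in> J" if "g \<in> carrier G" "w \<in> J" for g w
      using Ig[OF that(1)] \<sigma>c(1)[OF that(1)] that(2) by (auto simp: J_def)
  qed
  moreover have "J \<noteq> {0\<^sub>v n}"
    using mat_eq_zero_if_mult_vec[OF T(1)] T(2) by (auto simp: J_def)
  ultimately have J: "J = carrier_vec n" by blast
  obtain S where S: "S \<in> carrier_mat m n" "T * S = 1\<^sub>m n"
  proof (rule mat_right_inverse_if_surj[OF T(1)])
    fix w :: "complex vec" assume "w \<in> carrier_vec n"
    then show "\<exists>v\<in>carrier_vec m. T *\<^sub>v v = w" using J unfolding J_def by (metis imageE)
  qed
  \<comment> \<open>Surjectivity gave a right inverse; injectivity now cancels \<open>T\<close> from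
    \<open>T (S T v) = T v\<close>.\<close>
  have "S * T - 1\<^sub>m m = 0\<^sub>m m m"
  proof (rule mat_eq_zero_if_mult_vec)
    fix v :: "complex vec" assume v: "v \<in> carrier_vec m"
    have ST: "S * T \<in> carrier_mat m m" using S T by simp
    have e: "(S * T - 1\<^sub>m m) *\<^sub>v v = S * T *\<^sub>v v - v"
      using ST v by (simp add: minus_mult_distrib_mat_vec[OF ST])
    have "T *\<^sub>v (S * T *\<^sub>v v) = (T * S * T) *\<^sub>v v"
      unfolding assoc_mult_mat[OF T(1) S(1) T(1)] by (rule assoc_mult_mat_vec[OF T(1) ST v, symmetric])
    then have "T *\<^sub>v (S * T *\<^sub>v v) = T *\<^sub>v v" using S(2) T(1) by simp
    then have "T *\<^sub>v (S * T *\<^sub>v v - v) = 0\<^sub>v n"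
      using ST v T(1) by (simp add: mult_minus_distrib_mat_vec[OF T(1)])
    then have "S * T *\<^sub>v v - v \<in> K" using ST v by (auto simp: K_def)
    then show "(S * T - 1\<^sub>m m) *\<^sub>v v = 0\<^sub>v m" using K e by simp
  qed (use S T in auto)
  then have "S * T = 1\<^sub>m m"
    using S T by (intro eq_matI) (auto dest!: arg_cong[of _ _ "\<lambda>A. A $$ (_, _)"] simp: minus_mat_def mat_eq_iff)
  with S show ?thesis using that by blast
qed

text \<open>For an eigenvalue \<open>c\<close> of \<open>T\<close> the matrix \<open>T - c\<close>
  is again an intertwiner, and it kills an eigenvector. It is therefore not invertible, so it
  vanishes.\<close>

lemma schur_scalar:
  assumes "group G" and \<rho>: "irreducible_rep G n \<rho>" and T: "T \<in> carrier_mat n n"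
    and I: "\<And>g. g \<in> carrier G \<Longrightarrow> \<rho> g * T = T * \<rho> g"
  shows "\<exists>c. T = c \<cdot>\<^sub>m 1\<^sub>m n"
proof -
  note \<rho>c = complex_repD[OF assms(1) irreducible_repD(1)[OF \<rho>]]
  obtain c where "eigenvalue T c"
    using spectrum_non_empty[OF T irreducible_repD(2)[OF \<rho>]] by (auto simp: spectrum_def)
  then obtain v where v: "v \<in> carrier_vec n" "v \<noteq> 0\<^sub>v n" "T *\<^sub>v v = c \<cdot>\<^sub>v v"
    using T by (auto simp: eigenvalue_def eigenvector_def)
  define U where "U = T - c \<cdot>\<^sub>m 1\<^sub>m n"
  have c1: "c \<cdot>\<^sub>m 1\<^sub>m n \<in> carrier_mat n n" by simp
  have U: "U \<in> carrier_mat n n" unfolding U_def by (rule minus_carrier_mat[OF c1])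
  have mult_mat_vec_smult: "(c \<cdot>\<^sub>m 1\<^sub>m n) *\<^sub>v v = c \<cdot>\<^sub>v v"
  proof (rule eq_vecI)
    fix i assume "i < dim_vec (c \<cdot>\<^sub>v v)"
    then have i: "i < n" using v(1) by simp
    have "(\<Sum>j<n. c * (if j = i then 1 else 0) * v $ j) = (\<Sum>j<n. if j = i then c * v $ i else 0)"
      by (intro sum.cong) auto
    then show "((c \<cdot>\<^sub>m 1\<^sub>m n) *\<^sub>v v) $ i = (c \<cdot>\<^sub>v v) $ i"
      using v(1) i by (simp add: scalar_prod_def atLeast0LessThan)
  qed (use v(1) in auto)
  have Uv: "U *\<^sub>v v = 0\<^sub>v n"
    using v T by (simp add: U_def minus_mult_distrib_mat_vec[OF T c1] mult_mat_vec_smult)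
  have "U = 0\<^sub>m n n"
  proof (rule ccontr)
    assume nz: "U \<noteq> 0\<^sub>m n n"
    have IU: "\<rho> g * U = U * \<rho> g" if g: "g \<in> carrier G" for g
    proof -
      note r = \<rho>c(1)[OF g]
      have "\<rho> g * U = \<rho> g * T - \<rho> g * (c \<cdot>\<^sub>m 1\<^sub>m n)"
        unfolding U_def by (rule mult_minus_distrib_mat[OF r T c1])
      also have "\<rho> g * (c \<cdot>\<^sub>m 1\<^sub>m n) = (c \<cdot>\<^sub>m 1\<^sub>m n) * \<rho> g"
        using r by (simp add: mult_smult_distrib[OF r one_carrier_mat] mult_smult_assoc_mat[OF one_carrier_mat r])
      also have "\<rho> g * T - \<dots> = U * \<rho> g"
        unfolding U_def I[OF g] by (rule minus_mult_distrib_mat[OF T c1 r, symmetric])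
      finally show ?thesis .
    qed
    obtain S where S: "S \<in> carrier_mat n n" "S * U = 1\<^sub>m n"
      using schur_invertible[OF assms(1) \<rho> \<rho> U nz IU] by metis
    have "v = (S * U) *\<^sub>v v" using v S by simp
    also have "\<dots> = S *\<^sub>v (U *\<^sub>v v)" using assoc_mult_mat_vec[OF S(1) U v(1)] .
    also have "\<dots> = 0\<^sub>v n" unfolding Uv by (rule mult_mat_vec_zero[OF S(1)])
    finally show False using v by simp
  qed
  then have "T $$ (i, j) - (c \<cdot>\<^sub>m 1\<^sub>m n) $$ (i, j) = 0" if "i < n" "j < n" for i j
    using that T unfolding U_def by (metis c1 index_minus_mat(1) index_zero_mat(1) carrier_matD)
  then have "T = c \<cdot>\<^sub>m 1\<^sub>m n" using T by (intro eq_matI) auto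
  then show ?thesis ..
qed

section \<open>Inner product of class functions and orthogonality relations\<close>

context group
begin

definition cip :: "('a \<Rightarrow> complex) \<Rightarrow> ('a \<Rightarrow> complex) \<Rightarrow> complex" where
  "cip f h = (\<Sum>g\<in>carrier G. f g * cnj (h g)) / of_nat (card (carrier G))"

lemma rep_char_cnj:
  assumes fin: "finite (carrier G)" and \<rho>: "complex_rep G n \<rho>" and g: "g \<in> carrier G"
  shows "mat_trace (\<rho> (inv g)) = cnj (mat_trace (\<rho> g))"
proof -
  note \<rho>c = complex_repD[OF group_axioms \<rho>]
  have p: "\<rho> (g [^] k) = \<rho> g ^\<^sub>m k" for k :: nat
  proof (induction k)
    case 0
    then show ?case using \<rho>c(1,3) g by auto
  next
    case (Suc k)
    then show ?case using \<rho>c(2) g by simp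
  qed
  obtain k where k: "card (carrier G) = Suc k"
    using fin g by (metis card_gt_0_iff empty_iff gr0_conv_Suc)
  have gk: "g [^] Suc k = \<one>" using pow_order_eq_1[OF g] k unfolding Coset.order_def by simp
  then have "g [^] k = inv g" using g by (metis inv_equality nat_pow_Suc nat_pow_closed)
  moreover have "\<rho> g ^\<^sub>m Suc k = 1\<^sub>m n" using p[of "Suc k"] gk \<rho>c(3) by simp
  ultimately show ?thesis using mat_trace_power_finite_order[OF \<rho>c(1)[OF g], of k] p[of k] by simp
qed

lemma rep_char_conj:
  assumes \<rho>: "complex_rep G n \<rho>" and g: "g \<in> carrier G" and h: "h \<in> carrier G"
  shows "mat_trace (\<rho> (h \<otimes> g \<otimes> inv h)) = mat_trace (\<rho> g)"
proof -
  note \<rho>c = complex_repD[OF group_axioms \<rho>]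
  have "mat_trace (\<rho> (h \<otimes> g \<otimes> inv h)) = mat_trace (\<rho> (h \<otimes> g) * \<rho> (inv h))"
    using \<rho>c(2) g h by simp
  also have "\<dots> = mat_trace (\<rho> (inv h) * \<rho> (h \<otimes> g))"
    using \<rho>c(1) g h by (intro mat_trace_mult_comm[of _ n n]) auto
  also have "\<rho> (inv h) * \<rho> (h \<otimes> g) = \<rho> (inv h \<otimes> (h \<otimes> g))" using \<rho>c(2) g h by simp
  also have "inv h \<otimes> (h \<otimes> g) = g" using g h by (simp add: m_assoc[symmetric])
  finally show ?thesis .
qed

text \<open>\<open>T\<close> is the sum over the group of \<open>\<rho> g E \<sigma> (inv g)\<close>
  with \<open>E\<close> the matrix unit at \<open>(i, j)\<close>, written entrywise. Replacing
  \<open>g\<close> by \<open>h g\<close> moves \<open>\<rho> h\<close> from the left to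
  \<open>\<sigma> h\<close> on the right.\<close>

lemma schur_average_intertwines:
  assumes \<rho>: "complex_rep G n \<rho>" and \<sigma>: "complex_rep G m \<sigma>"
    and i: "i < n" and j: "j < m" and h: "h \<in> carrier G"
  defines "T \<equiv> mat n m (\<lambda>(k, l). \<Sum>g\<in>carrier G. \<rho> g $$ (k, i) * \<sigma> (inv g) $$ (j, l))"
  shows "\<rho> h * T = T * \<sigma> h"
proof (rule eq_matI)
  note \<rho>c = complex_repD[OF group_axioms \<rho>]
  note \<sigma>c = complex_repD[OF group_axioms \<sigma>]
  have T: "T \<in> carrier_mat n m" by (simp add: T_def)
  fix k l assume "k < dim_row (T * \<sigma> h)" "l < dim_col (T * \<sigma> h)"
  then have kl: "k < n" "l < m" using T \<sigma>c(1)[OF h] by auto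
  have "(\<rho> h * T) $$ (k, l) = (\<Sum>p<n. \<rho> h $$ (k, p) * (\<Sum>g\<in>carrier G. \<rho> g $$ (p, i) * \<sigma> (inv g) $$ (j, l)))"
    using mult_mat_index[OF \<rho>c(1)[OF h] T kl] kl by (simp add: T_def)
  also have "\<dots> = (\<Sum>g\<in>carrier G. (\<Sum>p<n. \<rho> h $$ (k, p) * \<rho> g $$ (p, i)) * \<sigma> (inv g) $$ (j, l))"
    by (simp add: sum_distrib_left sum_distrib_right mult.assoc) (rule sum.swap)
  also have "\<dots> = (\<Sum>g\<in>carrier G. \<rho> (h \<otimes> g) $$ (k, i) * \<sigma> (inv g) $$ (j, l))"
    using mult_mat_index[OF \<rho>c(1)[OF h] \<rho>c(1) kl(1) i] \<rho>c(2)[OF h] by (intro sum.cong) auto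
  also have "\<dots> = (\<Sum>g\<in>carrier G. \<rho> g $$ (k, i) * \<sigma> (inv g \<otimes> h) $$ (j, l))"
  proof (rule sum.reindex_bij_witness[of _ "\<lambda>g. inv h \<otimes> g" "\<lambda>g. h \<otimes> g"])
    fix g assume g: "g \<in> carrier G"
    show "inv h \<otimes> (h \<otimes> g) = g" "h \<otimes> (inv h \<otimes> g) = g" using g h by (simp_all add: m_assoc[symmetric])
    have "inv (h \<otimes> g) \<otimes> h = inv g" using g h by (simp add: inv_mult_group m_assoc)
    then show "\<rho> (h \<otimes> g) $$ (k, i) * \<sigma> (inv (h \<otimes> g) \<otimes> h) $$ (j, l)
        = \<rho> (h \<otimes> g) $$ (k, i) * \<sigma> (inv g) $$ (j, l)" by simp
  qed (use h in auto)
  also have "\<dots> = (\<Sum>g\<in>carrier G. \<rho> g $$ (k, i) * (\<Sum>q<m. \<sigma> (inv g) $$ (j, q) * \<sigma> h $$ (q, l)))"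
    using mult_mat_index[OF \<sigma>c(1) \<sigma>c(1)[OF h] j kl(2)] \<sigma>c(2)[OF _ h] by (intro sum.cong) auto
  also have "\<dots> = (\<Sum>q<m. (\<Sum>g\<in>carrier G. \<rho> g $$ (k, i) * \<sigma> (inv g) $$ (j, q)) * \<sigma> h $$ (q, l))"
    by (simp add: sum_distrib_left sum_distrib_right mult.assoc) (rule sum.swap)
  also have "\<dots> = (T * \<sigma> h) $$ (k, l)"
    using mult_mat_index[OF T \<sigma>c(1)[OF h] kl] kl by (simp add: T_def)
  finally show "(\<rho> h * T) $$ (k, l) = (T * \<sigma> h) $$ (k, l)" .
qed (use complex_repD(1)[OF group_axioms \<rho> h] complex_repD(1)[OF group_axioms \<sigma> h] in \<open>auto simp: T_def\<close>)

text \<open>Inequivalence is expressed by a point where the traces differ: an invertible intertwiner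
  would make \<open>\<rho> x\<close> and \<open>\<sigma> x\<close> similar. So every averaged matrix
  vanishes, and its entry \<open>(i, j)\<close>, summed over \<open>i\<close> and \<open>j\<close>,
  is the product of the two traces summed over the group.\<close>

lemma schur_orthogonal:
  assumes \<rho>: "irreducible_rep G n \<rho>" and \<sigma>: "irreducible_rep G m \<sigma>"
    and x: "x \<in> carrier G" "mat_trace (\<rho> x) \<noteq> mat_trace (\<sigma> x)"
  shows "(\<Sum>g\<in>carrier G. mat_trace (\<rho> g) * mat_trace (\<sigma> (inv g))) = 0"
proof -
  note \<rho>r = irreducible_repD(1)[OF \<rho>] and \<sigma>r = irreducible_repD(1)[OF \<sigma>]
  note \<rho>c = complex_repD[OF group_axioms \<rho>r]
  note \<sigma>c = complex_repD[OF group_axioms \<sigma>r]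
  have z: "(\<Sum>g\<in>carrier G. \<rho> g $$ (i, i) * \<sigma> (inv g) $$ (j, j)) = 0" if ij: "i < n" "j < m" for i j
  proof -
    let ?T = "mat n m (\<lambda>(k, l). \<Sum>g\<in>carrier G. \<rho> g $$ (k, i) * \<sigma> (inv g) $$ (j, l))"
    have T: "?T \<in> carrier_mat n m" by simp
    have "?T = 0\<^sub>m n m"
    proof (rule ccontr)
      assume nz: "?T \<noteq> 0\<^sub>m n m"
      note I = schur_average_intertwines[OF \<rho>r \<sigma>r ij]
      obtain S where S: "S \<in> carrier_mat m n" "?T * S = 1\<^sub>m n" "S * ?T = 1\<^sub>m m"
        using schur_invertible[OF group_axioms \<rho> \<sigma> T nz I] .
      have "\<rho> x = \<rho> x * (?T * S)" using \<rho>c(1)[OF x(1)] unfolding S(2) by simp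
      also have "\<dots> = \<rho> x * ?T * S" by (rule assoc_mult_mat[OF \<rho>c(1)[OF x(1)] T S(1), symmetric])
      also have "\<dots> = ?T * \<sigma> x * S" by (simp only: I[OF x(1)])
      also have "\<dots> = ?T * (\<sigma> x * S)" by (rule assoc_mult_mat[OF T \<sigma>c(1)[OF x(1)] S(1)])
      finally have "mat_trace (\<rho> x) = mat_trace (?T * (\<sigma> x * S))" by (rule arg_cong)
      also have "\<dots> = mat_trace (\<sigma> x * S * ?T)"
        by (rule mat_trace_mult_comm[OF T mult_carrier_mat[OF \<sigma>c(1)[OF x(1)] S(1)]])
      also have "\<sigma> x * S * ?T = \<sigma> x * (S * ?T)" by (rule assoc_mult_mat[OF \<sigma>c(1)[OF x(1)] S(1) T])
      also have "\<dots> = \<sigma> x" using \<sigma>c(1)[OF x(1)] unfolding S(3) by simp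
      finally show False using x(2) by simp
    qed
    then have "?T $$ (i, j) = 0\<^sub>m n m $$ (i, j)" by (rule arg_cong)
    then show ?thesis using ij by simp
  qed
  have "(\<Sum>g\<in>carrier G. mat_trace (\<rho> g) * mat_trace (\<sigma> (inv g)))
      = (\<Sum>g\<in>carrier G. \<Sum>i<n. \<Sum>j<m. \<rho> g $$ (i, i) * \<sigma> (inv g) $$ (j, j))"
    using \<rho>c(1) \<sigma>c(1) by (intro sum.cong) (auto simp: mat_trace_def sum_product carrier_matD[OF \<rho>c(1)] carrier_matD[OF \<sigma>c(1)])
  also have "\<dots> = (\<Sum>i<n. \<Sum>j<m. \<Sum>g\<in>carrier G. \<rho> g $$ (i, i) * \<sigma> (inv g) $$ (j, j))"
    by (subst sum.swap, intro sum.cong refl, subst sum.swap, simp)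
  also have "\<dots> = 0" using z by simp
  finally show ?thesis .
qed

text \<open>The averaged matrix is a scalar \<open>c\<close>. Its trace is \<open>n c\<close> on the
  one hand and, since \<open>\<rho> (inv g) * \<rho> g\<close> is the identity, the group order or 0
  on the other, according to whether \<open>i = j\<close>.\<close>

lemma schur_norm:
  assumes \<rho>: "irreducible_rep G n \<rho>"
  shows "(\<Sum>g\<in>carrier G. mat_trace (\<rho> g) * mat_trace (\<rho> (inv g))) = of_nat (card (carrier G))"
proof -
  note \<rho>r = irreducible_repD(1)[OF \<rho>] and n = irreducible_repD(2)[OF \<rho>]
  note \<rho>c = complex_repD[OF group_axioms \<rho>r]
  define L where "L i j = (\<Sum>g\<in>carrier G. \<rho> g $$ (i, i) * \<rho> (inv g) $$ (j, j))" for i j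
  have L: "L i j = (if i = j then of_nat (card (carrier G)) / of_nat n else 0)" if ij: "i < n" "j < n" for i j
  proof -
    let ?T = "mat n n (\<lambda>(k, l). \<Sum>g\<in>carrier G. \<rho> g $$ (k, i) * \<rho> (inv g) $$ (j, l))"
    have T: "?T \<in> carrier_mat n n" by simp
    obtain c where c: "?T = c \<cdot>\<^sub>m 1\<^sub>m n"
      using schur_scalar[OF group_axioms \<rho> T schur_average_intertwines[OF \<rho>r \<rho>r ij]] by blast
    have "of_nat n * c = mat_trace ?T" unfolding c by (simp add: mat_trace_def)
    also have "\<dots> = (\<Sum>g\<in>carrier G. \<Sum>k<n. \<rho> (inv g) $$ (j, k) * \<rho> g $$ (k, i))"
      by (simp add: mat_trace_def mult.commute) (rule sum.swap)
    also have "\<dots> = (\<Sum>g\<in>carrier G. \<rho> \<one> $$ (j, i))"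
    proof (intro sum.cong refl)
      fix g assume g: "g \<in> carrier G"
      have "(\<Sum>k<n. \<rho> (inv g) $$ (j, k) * \<rho> g $$ (k, i)) = (\<rho> (inv g) * \<rho> g) $$ (j, i)"
        using mult_mat_index[OF \<rho>c(1) \<rho>c(1)[OF g] ij(2,1), of "inv g"] g by simp
      also have "\<rho> (inv g) * \<rho> g = \<rho> \<one>" using \<rho>c(2)[of "inv g" g] g by simp
      finally show "(\<Sum>k<n. \<rho> (inv g) $$ (j, k) * \<rho> g $$ (k, i)) = \<rho> \<one> $$ (j, i)" .
    qed
    also have "\<dots> = (if i = j then of_nat (card (carrier G)) else 0)"
      using ij by (auto simp: \<rho>c(3))
    finally have cc: "of_nat n * c = (if i = j then of_nat (card (carrier G)) else 0)" .
    have "L i j = ?T $$ (i, j)" using ij by (simp add: L_def)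
    also have "\<dots> = (c \<cdot>\<^sub>m 1\<^sub>m n) $$ (i, j)" by (simp only: c)
    also have "\<dots> = (if i = j then c else 0)" using ij by simp
    finally show ?thesis using cc n by (auto simp: field_simps)
  qed
  have "(\<Sum>g\<in>carrier G. mat_trace (\<rho> g) * mat_trace (\<rho> (inv g)))
      = (\<Sum>g\<in>carrier G. \<Sum>i<n. \<Sum>j<n. \<rho> g $$ (i, i) * \<rho> (inv g) $$ (j, j))"
    using \<rho>c(1) by (intro sum.cong) (auto simp: mat_trace_def sum_product carrier_matD[OF \<rho>c(1)])
  also have "\<dots> = (\<Sum>i<n. \<Sum>j<n. L i j)"
    unfolding L_def by (subst sum.swap, intro sum.cong refl, subst sum.swap, simp)
  also have "\<dots> = (\<Sum>i<n. of_nat (card (carrier G)) / of_nat n)"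
    using L by (intro sum.cong refl) simp
  also have "\<dots> = of_nat (card (carrier G))" using n by simp
  finally show ?thesis .
qed

lemma irr_charactersE:
  assumes "\<psi> \<in> irr_characters G"
  obtains n \<rho> where "irreducible_rep G n \<rho>" "\<psi> = (\<lambda>g\<in>carrier G. mat_trace (\<rho> g))"
  using assms unfolding irr_characters_def by blast

lemma irr_character_inv:
  assumes "finite (carrier G)" "\<psi> \<in> irr_characters G" "g \<in> carrier G"
  shows "\<psi> (inv g) = cnj (\<psi> g)"
  using assms(2) by (rule irr_charactersE) (use assms in \<open>auto dest!: irreducible_repD(1) simp: rep_char_cnj\<close>)

lemma irr_character_conj:
  assumes "\<psi> \<in> irr_characters G" "g \<in> carrier G" "h \<in> carrier G"
  shows "\<psi> (h \<otimes> g \<otimes> inv h) = \<psi> g"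
  using assms(1) by (rule irr_charactersE) (use assms in \<open>auto dest!: irreducible_repD(1) simp: rep_char_conj\<close>)

lemma irr_character_one:
  assumes "\<psi> \<in> irr_characters G"
  obtains n :: nat where "n > 0" "\<psi> \<one> = of_nat n"
  using assms
proof (rule irr_charactersE)
  fix n \<rho> assume "irreducible_rep G n \<rho>" "\<psi> = (\<lambda>g\<in>carrier G. mat_trace (\<rho> g))"
  then show ?thesis
    using irreducible_repD(2)[of G n \<rho>] complex_repD(3)[OF group_axioms irreducible_repD(1)[of G n \<rho>]] that[of n]
    by (simp add: mat_trace_one)
qed

lemma irr_character_undefined:
  assumes "\<psi> \<in> irr_characters G" "g \<notin> carrier G"
  shows "\<psi> g = undefined"
  using assms(1) by (rule irr_charactersE) (use assms in auto)

lemma irr_characters_orthonormal: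
  assumes fin: "finite (carrier G)" and \<phi>: "\<phi> \<in> irr_characters G" and \<psi>: "\<psi> \<in> irr_characters G"
  shows "cip \<phi> \<psi> = (if \<phi> = \<psi> then 1 else 0)"
proof -
  obtain n \<rho> where \<rho>: "irreducible_rep G n \<rho>" "\<phi> = (\<lambda>g\<in>carrier G. mat_trace (\<rho> g))"
    using \<phi> by (rule irr_charactersE)
  obtain m \<sigma> where \<sigma>: "irreducible_rep G m \<sigma>" "\<psi> = (\<lambda>g\<in>carrier G. mat_trace (\<sigma> g))"
    using \<psi> by (rule irr_charactersE)
  have o: "card (carrier G) > 0" using fin by (auto simp: card_gt_0_iff)
  have "cip \<phi> \<psi> = (\<Sum>g\<in>carrier G. mat_trace (\<rho> g) * mat_trace (\<sigma> (inv g))) / of_nat (card (carrier G))"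
    unfolding cip_def using irreducible_repD(1)[OF \<sigma>(1)] fin
    by (auto simp: \<rho>(2) \<sigma>(2) rep_char_cnj intro!: sum.cong)
  also have "\<dots> = (if \<phi> = \<psi> then 1 else 0)"
  proof (cases "\<phi> = \<psi>")
    case True
    then have "mat_trace (\<sigma> (inv g)) = mat_trace (\<rho> (inv g))" if "g \<in> carrier G" for g
      using that \<rho>(2) \<sigma>(2) by (metis inv_closed restrict_apply')
    then have "(\<Sum>g\<in>carrier G. mat_trace (\<rho> g) * mat_trace (\<sigma> (inv g))) = of_nat (card (carrier G))"
      using schur_norm[OF \<rho>(1)] by simp
    then show ?thesis using True o by simp
  next
    case False
    then obtain x where "x \<in> carrier G" "mat_trace (\<rho> x) \<noteq> mat_trace (\<sigma> x)"
      unfolding \<rho>(2) \<sigma>(2) by (metis restrict_ext)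
    from schur_orthogonal[OF \<rho>(1) \<sigma>(1) this] show ?thesis using False by simp
  qed
  finally show ?thesis .
qed

end

section \<open>Decomposition of characters\<close>

lemma maximal_extension:
  assumes bnd: "\<And>A. P A \<Longrightarrow> finite A \<and> card A \<le> N" and "P A0"
  obtains C where "A0 \<subseteq> C" "finite C" "P C" "maximal C P"
proof -
  have "\<exists>C. finite C \<and> maximal C (\<lambda>A. P A \<and> A0 \<subseteq> A)"
    by (rule maximal_exists[of _ N A0]) (use assms in auto)
  then obtain C where "finite C" "maximal C (\<lambda>A. P A \<and> A0 \<subseteq> A)" by blast
  then have "A0 \<subseteq> C" "finite C" "P C" "maximal C P" unfolding maximal_def by auto
  then show ?thesis by (rule that)
qed

text \<open>The columns of \<open>P\<close> are a basis of \<open>W\<close> followed by an extension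
  to a basis of the whole space, so in the new coordinates \<open>W\<close> is cut out by the
  vanishing of the entries from \<open>d\<close> on. Both bases arise as maximal independent
  sets.\<close>

lemma subspace_adapted_basis:
  fixes W :: "'a :: field vec set"
  assumes sub: "VectorSpace.subspace class_ring W (module_vec TYPE('a) n)"
  obtains P Q d where "P \<in> carrier_mat n n" "Q \<in> carrier_mat n n" "P * Q = 1\<^sub>m n" "Q * P = 1\<^sub>m n" "d \<le> n"
    "W = (\<lambda>v. P *\<^sub>v v) ` {v \<in> carrier_vec n. \<forall>i. d \<le> i \<and> i < n \<longrightarrow> v $ i = 0}"
proof -
  interpret vec_space "TYPE('a)" n .
  have Wc: "W \<subseteq> carrier_vec n" using sub by (simp add: VectorSpace.subspace_def submodule_def module_vec_simps)
  have sm: "submodule class_ring W V" using sub by (simp add: VectorSpace.subspace_def)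
  have bnd: "finite A \<and> card A \<le> n" if "A \<subseteq> carrier_vec n \<and> lin_indpt A" for A
    using li_le_dim[of A] that fin_dim dim_is_n by auto
  have emp: "lin_indpt {}" unfolding lin_dep_def by auto
  obtain B where B: "finite B" "B \<subseteq> W \<and> lin_indpt B" "maximal B (\<lambda>S. S \<subseteq> W \<and> lin_indpt S)"
  proof (rule maximal_extension[of "\<lambda>S. S \<subseteq> W \<and> lin_indpt S" n "{}"])
    show "finite A \<and> card A \<le> n" if "A \<subseteq> W \<and> lin_indpt A" for A
      by (rule bnd) (rule conjI[OF subset_trans[OF conjunct1[OF that] Wc] conjunct2[OF that]])
    show "{} \<subseteq> W \<and> lin_indpt {}" using emp by (rule conjI[OF empty_subsetI])
  qed
  note BW = conjunct1[OF B(2)] conjunct2[OF B(2)]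
  have BC: "B \<subseteq> carrier_vec n" by (rule subset_trans[OF BW(1) Wc])
  obtain C where CB: "B \<subseteq> C" and C: "finite C" "C \<subseteq> carrier_vec n \<and> lin_indpt C"
    "maximal C (\<lambda>S. S \<subseteq> carrier_vec n \<and> lin_indpt S)"
    by (rule maximal_extension[of "\<lambda>S. S \<subseteq> carrier_vec n \<and> lin_indpt S" n B, OF bnd conjI[OF BC BW(2)]])
  note CC = conjunct1[OF C(2)] conjunct2[OF C(2)] CB
  have bas: "basis C" using C(3) by (rule max_li_is_basis[unfolded cV])
  have cardC: "card C = n" using dim_basis[OF C(1) bas] dim_is_n by simp
  have spanC: "span C = carrier_vec n" using bas by (simp add: basis_def)
  have spanB: "span B = W"
  proof
    show "span B \<subseteq> W" by (rule span_is_subset[OF BW(1) sm])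
    show "W \<subseteq> span B"
    proof
      fix w assume w: "w \<in> W"
      show "w \<in> span B"
      proof (cases "w \<in> B")
        case True
        then show ?thesis using in_own_span[of B] BC by auto
      next
        case False
        show ?thesis
        proof (rule ccontr)
          assume "w \<notin> span B"
          then have "lin_indpt (B \<union> {w})"
            using lin_dep_iff_in_span[of B w] BC BW(2) w Wc False by auto
          moreover have "B \<union> {w} \<subseteq> W" using w BW(1) by (simp only: Un_subset_iff insert_subset empty_subsetI simp_thms)
          ultimately have "B \<union> {w} = B"
            using conjunct2[OF B(3)[unfolded maximal_def], rule_format, of "B \<union> {w}"] by (simp only: Un_upper1 simp_thms)
          then show False using False by auto
        qed
      qed
    qed
  qed
  obtain bs where bs: "set bs = B" "distinct bs" using finite_distinct_list[OF B(1)] by blast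
  obtain cs where cs: "set cs = C - B" "distinct cs" using finite_distinct_list[of "C - B"] C(1) by blast
  define ws where "ws = bs @ cs"
  define d where "d = length bs"
  define P where "P = mat_of_cols n ws"
  have ws: "set ws = C" "distinct ws" using bs cs CC(3) by (auto simp: ws_def)
  have lws: "length ws = n" using ws cardC distinct_card by metis
  have dn: "d \<le> n" using lws by (simp add: d_def ws_def)
  have P: "P \<in> carrier_mat n n" using mat_of_cols_carrier(1)[of n ws] lws by (simp add: P_def)
  have comb: "lincomb f (set us) = mat_of_cols n us *\<^sub>v vec (length us) (\<lambda>i. f (us ! i))"
    if "set us \<subseteq> carrier_vec n" "distinct us" for f us
  proof -
    have "\<forall>w\<in>set us. dim_vec w = n" using that(1) carrier_vecD by blast
    then show ?thesis
      using lincomb_as_lincomb_list_distinct[OF that] lincomb_list_as_mat_mult[of us "\<lambda>i. f (us ! i)"] by simp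
  qed
  have surj: "\<exists>v\<in>carrier_vec n. P *\<^sub>v v = w" if "w \<in> carrier_vec n" for w
  proof -
    have "w \<in> span C" using that spanC by simp
    then obtain f where "w = lincomb f C" using finite_in_span[OF C(1)] CC(1) by auto
    then have "w = P *\<^sub>v vec n (\<lambda>i. f (ws ! i))"
      using comb[of ws f] ws CC(1) lws by (simp add: P_def)
    then show ?thesis by (intro bexI[of _ "vec n (\<lambda>i. f (ws ! i))"]) auto
  qed
  obtain Q where Q: "Q \<in> carrier_mat n n" "P * Q = 1\<^sub>m n"
    using mat_right_inverse_if_surj[OF P surj] by blast
  have QP: "Q * P = 1\<^sub>m n" using mat_mult_left_right_inverse[OF P Q(1,2)] .
  define Z where "Z = {v \<in> carrier_vec n. \<forall>i. d \<le> i \<and> i < n \<longrightarrow> v $ i = (0 :: 'a)}"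
  have Pv: "P *\<^sub>v v = lincomb_list (\<lambda>i. v $ i) bs" if v: "v \<in> Z" for v
  proof -
    have "P *\<^sub>v v = mat_of_cols n bs *\<^sub>v vec d (\<lambda>i. v $ i)"
    proof (rule eq_vecI)
      fix i assume "i < dim_vec (mat_of_cols n bs *\<^sub>v vec d (\<lambda>i. v $ i))"
      then have i: "i < n" by simp
      have "(P *\<^sub>v v) $ i = (\<Sum>j<n. P $$ (i, j) * v $ j)"
        using i P v by (auto simp: scalar_prod_def Z_def atLeast0LessThan)
      also have "\<dots> = (\<Sum>j<d. P $$ (i, j) * v $ j)"
        using dn v by (intro sum.mono_neutral_right) (auto simp: Z_def)
      also have "\<dots> = (\<Sum>j<d. mat_of_cols n bs $$ (i, j) * v $ j)"
        using i dn lws by (intro sum.cong) (auto simp: P_def mat_of_cols_index ws_def d_def nth_append)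
      also have "\<dots> = (mat_of_cols n bs *\<^sub>v vec d (\<lambda>i. v $ i)) $ i"
        using i by (auto simp: scalar_prod_def atLeast0LessThan d_def)
      finally show "(P *\<^sub>v v) $ i = (mat_of_cols n bs *\<^sub>v vec d (\<lambda>i. v $ i)) $ i" .
    qed (use P in auto)
    moreover have "\<forall>w\<in>set bs. dim_vec w = n" using BC bs carrier_vecD by blast
    ultimately show ?thesis using lincomb_list_as_mat_mult[of bs "\<lambda>i. v $ i"] by (simp add: d_def)
  qed
  have "W = (\<lambda>v. P *\<^sub>v v) ` Z"
  proof (intro equalityI subsetI)
    fix w assume "w \<in> W"
    then have "w \<in> span B" using spanB by simp
    then obtain f where f: "w = lincomb f B" using finite_in_span[OF B(1)] BC by auto
    define v where "v = vec n (\<lambda>i. if i < d then f (bs ! i) else 0)"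
    have v: "v \<in> Z" by (auto simp: Z_def v_def)
    have "w = lincomb_list (\<lambda>i. f (bs ! i)) bs"
      using f lincomb_as_lincomb_list_distinct[of bs f] bs BC by simp
    also have "\<dots> = lincomb_list (\<lambda>i. v $ i) bs"
      unfolding lincomb_list_def using dn by (intro arg_cong[of _ _ sumlist] map_cong) (auto simp: v_def d_def)
    also have "\<dots> = P *\<^sub>v v" using Pv[OF v] by simp
    finally show "w \<in> (\<lambda>v. P *\<^sub>v v) ` Z" using v by blast
  next
    fix w assume "w \<in> (\<lambda>v. P *\<^sub>v v) ` Z"
    then obtain v where v: "v \<in> Z" "w = P *\<^sub>v v" by blast
    have "lincomb_list (\<lambda>i. v $ i) bs \<in> span_list bs" unfolding span_list_def by auto
    then show "w \<in> W" using Pv[OF v(1)] v(2) span_list_as_span[of bs] bs BC spanB by simp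
  qed
  then show ?thesis using that P Q QP dn unfolding Z_def by blast
qed

lemma sum_lessThan_split:
  fixes f :: "nat \<Rightarrow> 'a :: comm_monoid_add"
  assumes "d \<le> n"
  shows "(\<Sum>i<n. f i) = (\<Sum>i<d. f i) + (\<Sum>i<n - d. f (i + d))"
proof -
  have "(\<Sum>i<n. f i) = (\<Sum>i<d + (n - d). f i)" using assms by simp
  also have "\<dots> = (\<Sum>i<d. f i) + (\<Sum>i=d..<d + (n - d). f i)"
    using sum.atLeastLessThan_concat[of 0 d "d + (n - d)" f] by (simp add: atLeast0LessThan)
  also have "(\<Sum>i=d..<d + (n - d). f i) = (\<Sum>i<n - d. f (i + d))"
    using sum.shift_bounds_nat_ivl[of f 0 d "n - d"] by (simp add: atLeast0LessThan add.commute)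
  finally show ?thesis .
qed

text \<open>In coordinates adapted to an invariant subspace all matrices are block upper triangular.
  The diagonal blocks, which are the subrepresentation and the quotient, are multiplicative, and
  their traces add up.\<close>

lemma reducible_rep_blocks:
  assumes G: "group G" and \<rho>: "complex_rep G n \<rho>" and n: "n > 0" and red: "\<not> irreducible_rep G n \<rho>"
  obtains n1 \<rho>1 n2 \<rho>2 where "n1 < n" "n2 < n" "complex_rep G n1 \<rho>1" "complex_rep G n2 \<rho>2"
    "\<And>g. g \<in> carrier G \<Longrightarrow> mat_trace (\<rho> g) = mat_trace (\<rho>1 g) + mat_trace (\<rho>2 g)"
proof -
  note \<rho>c = complex_repD[OF G \<rho>]
  have mc: "g \<otimes>\<^bsub>G\<^esub> h \<in> carrier G" if "g \<in> carrier G" "h \<in> carrier G" for g h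
    using G that by (simp add: group.is_monoid monoid.m_closed)
  have oc: "\<one>\<^bsub>G\<^esub> \<in> carrier G" using G by (simp add: group.is_monoid)
  obtain W where W: "VectorSpace.subspace class_ring W (module_vec TYPE(complex) n)"
    "\<forall>g\<in>carrier G. \<forall>w\<in>W. \<rho> g *\<^sub>v w \<in> W" "W \<noteq> {0\<^sub>v n}" "W \<noteq> carrier_vec n"
    using red \<rho> n unfolding irreducible_rep_def by blast
  obtain P Q d where P: "P \<in> carrier_mat n n" and Q: "Q \<in> carrier_mat n n" and PQ: "P * Q = 1\<^sub>m n"
    and QP: "Q * P = 1\<^sub>m n" and d: "d \<le> n"
    and WZ: "W = (\<lambda>v. P *\<^sub>v v) ` {v \<in> carrier_vec n. \<forall>i. d \<le> i \<and> i < n \<longrightarrow> v $ i = 0}"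
    using subspace_adapted_basis[OF W(1)] .
  define Z where "Z = {v \<in> carrier_vec n. \<forall>i. d \<le> i \<and> i < n \<longrightarrow> v $ i = (0 :: complex)}"
  have Zc: "v \<in> carrier_vec n" if "v \<in> Z" for v using that by (simp add: Z_def)
  have "d \<noteq> 0"
  proof
    assume "d = 0"
    then have "Z = {0\<^sub>v n}" unfolding Z_def by auto
    then show False using W(3) WZ mult_mat_vec_zero[OF P] by (simp add: Z_def)
  qed
  have "d \<noteq> n"
  proof
    assume "d = n"
    then have "Z = carrier_vec n" unfolding Z_def by auto
    then have "W = (\<lambda>v. P *\<^sub>v v) ` carrier_vec n" using WZ by (simp add: Z_def)
    moreover have "v \<in> (\<lambda>v. P *\<^sub>v v) ` carrier_vec n" if v: "v \<in> carrier_vec n" for v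
    proof
      show "v = P *\<^sub>v (Q *\<^sub>v v)" using assoc_mult_mat_vec[OF P Q v] PQ v by simp
    qed (use Q v in auto)
    ultimately show False using W(4) P by auto
  qed
  define R where "R g = Q * \<rho> g * P" for g
  have Rc: "R g \<in> carrier_mat n n" if "g \<in> carrier G" for g
    using P Q \<rho>c(1)[OF that] by (simp add: R_def)
  have Rm: "R (g \<otimes>\<^bsub>G\<^esub> h) = R g * R h" if g: "g \<in> carrier G" and h: "h \<in> carrier G" for g h
  proof -
    note gc = \<rho>c(1)[OF g] and hc = \<rho>c(1)[OF h]
    have "R g * R h = Q * \<rho> g * (P * (Q * \<rho> h * P))"
      unfolding R_def by (rule assoc_mult_mat) (use P Q gc hc in auto)
    also have "P * (Q * \<rho> h * P) = P * (Q * \<rho> h) * P"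
      by (rule assoc_mult_mat[symmetric]) (use P Q gc hc in auto)
    also have "P * (Q * \<rho> h) = P * Q * \<rho> h"
      by (rule assoc_mult_mat[symmetric]) (use P Q gc hc in auto)
    also have "P * Q * \<rho> h = \<rho> h" using hc by (simp add: PQ)
    also have "Q * \<rho> g * (\<rho> h * P) = Q * \<rho> g * \<rho> h * P"
      by (rule assoc_mult_mat[symmetric]) (use P Q gc hc in auto)
    also have "Q * \<rho> g * \<rho> h = Q * (\<rho> g * \<rho> h)"
      by (rule assoc_mult_mat) (use P Q gc hc in auto)
    finally show ?thesis unfolding R_def \<rho>c(2)[OF g h] by simp
  qed
  have R1: "R \<one>\<^bsub>G\<^esub> = 1\<^sub>m n" using P Q QP by (simp add: R_def \<rho>c(3))
  \<comment> \<open>The lower left block vanishes because a unit vector with index below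
    \<open>d\<close> lies in the subspace, and so does its image.\<close>
  have Rz: "R g $$ (i, j) = 0" if g: "g \<in> carrier G" and ij: "d \<le> i" "i < n" "j < d" for g i j
  proof -
    have j: "j < n" using ij d by simp
    have "unit_vec n j \<in> Z" using ij j by (auto simp: Z_def)
    then have "P *\<^sub>v unit_vec n j \<in> W" unfolding WZ Z_def[symmetric] by (rule imageI)
    then have "\<rho> g *\<^sub>v (P *\<^sub>v unit_vec n j) \<in> W" using W(2) g by blast
    then obtain z where z: "z \<in> Z" "\<rho> g *\<^sub>v (P *\<^sub>v unit_vec n j) = P *\<^sub>v z"
      unfolding WZ Z_def[symmetric] by blast
    have "col (R g) j = R g *\<^sub>v unit_vec n j"
      using Rc[OF g] j by (intro eq_vecI) auto
    also have "\<dots> = Q * \<rho> g *\<^sub>v (P *\<^sub>v unit_vec n j)"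
      unfolding R_def by (rule assoc_mult_mat_vec) (use P Q \<rho>c(1)[OF g] in auto)
    also have "\<dots> = Q *\<^sub>v (\<rho> g *\<^sub>v (P *\<^sub>v unit_vec n j))"
      by (rule assoc_mult_mat_vec) (use P Q \<rho>c(1)[OF g] in auto)
    also have "\<dots> = Q *\<^sub>v (P *\<^sub>v z)" by (simp only: z(2))
    also have "\<dots> = Q * P *\<^sub>v z" by (rule assoc_mult_mat_vec[symmetric]) (use P Q Zc[OF z(1)] in auto)
    also have "\<dots> = z" using Zc[OF z(1)] by (simp add: QP)
    finally have "col (R g) j $ i = z $ i" by simp
    then show ?thesis using z(1) ij j Rc[OF g] by (simp add: Z_def)
  qed
  define \<rho>1 where "\<rho>1 g = mat d d (\<lambda>(i, j). R g $$ (i, j))" for g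
  define \<rho>2 where "\<rho>2 g = mat (n - d) (n - d) (\<lambda>(i, j). R g $$ (i + d, j + d))" for g
  have "complex_rep G d \<rho>1"
  proof (rule complex_repI[OF G])
    fix g h assume g: "g \<in> carrier G" and h: "h \<in> carrier G"
    show "\<rho>1 (g \<otimes>\<^bsub>G\<^esub> h) = \<rho>1 g * \<rho>1 h"
    proof (rule eq_matI)
      fix i j assume "i < dim_row (\<rho>1 g * \<rho>1 h)" "j < dim_col (\<rho>1 g * \<rho>1 h)"
      then have ij: "i < d" "j < d" by (auto simp: \<rho>1_def)
      have "\<rho>1 (g \<otimes>\<^bsub>G\<^esub> h) $$ (i, j) = (\<Sum>l<n. R g $$ (i, l) * R h $$ (l, j))"
        using ij d mult_mat_index[OF Rc[OF g] Rc[OF h], of i j] by (simp add: \<rho>1_def Rm[OF g h])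
      also have "\<dots> = (\<Sum>l<d. R g $$ (i, l) * R h $$ (l, j))"
        using ij d Rz[OF h] by (subst sum_lessThan_split[OF d]) simp
      also have "\<dots> = (\<rho>1 g * \<rho>1 h) $$ (i, j)"
        using ij mult_mat_index[of "\<rho>1 g" d d "\<rho>1 h" d i j] by (simp add: \<rho>1_def)
      finally show "\<rho>1 (g \<otimes>\<^bsub>G\<^esub> h) $$ (i, j) = (\<rho>1 g * \<rho>1 h) $$ (i, j)" .
    qed (auto simp: \<rho>1_def)
  next
    show "\<rho>1 \<one>\<^bsub>G\<^esub> = 1\<^sub>m d" using d by (intro eq_matI) (auto simp: \<rho>1_def R1)
  qed (simp add: \<rho>1_def)
  moreover have "complex_rep G (n - d) \<rho>2"
  proof (rule complex_repI[OF G])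
    fix g h assume g: "g \<in> carrier G" and h: "h \<in> carrier G"
    show "\<rho>2 (g \<otimes>\<^bsub>G\<^esub> h) = \<rho>2 g * \<rho>2 h"
    proof (rule eq_matI)
      fix i j assume "i < dim_row (\<rho>2 g * \<rho>2 h)" "j < dim_col (\<rho>2 g * \<rho>2 h)"
      then have ij: "i < n - d" "j < n - d" by (auto simp: \<rho>2_def)
      have "\<rho>2 (g \<otimes>\<^bsub>G\<^esub> h) $$ (i, j) = (\<Sum>l<n. R g $$ (i + d, l) * R h $$ (l, j + d))"
        using ij d mult_mat_index[OF Rc[OF g] Rc[OF h], of "i + d" "j + d"] by (simp add: \<rho>2_def Rm[OF g h])
      also have "\<dots> = (\<Sum>l<n - d. R g $$ (i + d, l + d) * R h $$ (l + d, j + d))"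
        using ij d Rz[OF g] by (subst sum_lessThan_split[OF d]) simp
      also have "\<dots> = (\<rho>2 g * \<rho>2 h) $$ (i, j)"
        using ij mult_mat_index[of "\<rho>2 g" "n - d" "n - d" "\<rho>2 h" "n - d" i j] by (simp add: \<rho>2_def)
      finally show "\<rho>2 (g \<otimes>\<^bsub>G\<^esub> h) $$ (i, j) = (\<rho>2 g * \<rho>2 h) $$ (i, j)" .
    qed (auto simp: \<rho>2_def)
  next
    show "\<rho>2 \<one>\<^bsub>G\<^esub> = 1\<^sub>m (n - d)" using d by (intro eq_matI) (auto simp: \<rho>2_def R1)
  qed (simp add: \<rho>2_def)
  moreover have "mat_trace (\<rho> g) = mat_trace (\<rho>1 g) + mat_trace (\<rho>2 g)" if g: "g \<in> carrier G" for g
  proof -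
    have "mat_trace (R g) = mat_trace (P * (Q * \<rho> g))"
      unfolding R_def by (rule mat_trace_mult_comm[where n = n and m = n]) (use P Q \<rho>c(1)[OF g] in auto)
    also have "P * (Q * \<rho> g) = P * Q * \<rho> g"
      by (rule assoc_mult_mat[symmetric]) (use P Q \<rho>c(1)[OF g] in auto)
    also have "P * Q * \<rho> g = \<rho> g" using \<rho>c(1)[OF g] by (simp add: PQ)
    finally have "mat_trace (\<rho> g) = (\<Sum>i<n. R g $$ (i, i))" using carrier_matD[OF Rc[OF g]] by (simp add: mat_trace_def)
    then show ?thesis by (simp add: sum_lessThan_split[OF d] mat_trace_def \<rho>1_def \<rho>2_def)
  qed
  ultimately show ?thesis
    by (intro that[of d "n - d" \<rho>1 \<rho>2]) (use d \<open>d \<noteq> 0\<close> \<open>d \<noteq> n\<close> in simp_all)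
qed

text \<open>A block triangular form determines the character, so Maschke's theorem is not needed.\<close>

lemma rep_char_decomposition:
  assumes "group G" "complex_rep G n \<rho>"
  shows "\<exists>\<chi>s. set \<chi>s \<subseteq> irr_characters G \<and> (\<forall>g\<in>carrier G. mat_trace (\<rho> g) = (\<Sum>\<chi>\<leftarrow>\<chi>s. \<chi> g))"
  using assms(2)
proof (induction n arbitrary: \<rho> rule: less_induct)
  case (less n)
  note \<rho>c = complex_repD[OF assms(1) less.prems]
  consider "n = 0" | "irreducible_rep G n \<rho>" | "n > 0" "\<not> irreducible_rep G n \<rho>" by blast
  then show ?case
  proof cases
    case 1
    then show ?thesis using carrier_matD[OF \<rho>c(1)] by (intro exI[of _ "[]"]) (simp add: mat_trace_def)
  next
    case 2
    then show ?thesis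
      by (intro exI[of _ "[\<lambda>g\<in>carrier G. mat_trace (\<rho> g)]"]) (auto simp: irr_characters_def)
  next
    case 3
    obtain n1 \<rho>1 n2 \<rho>2 where b: "n1 < n" "n2 < n" "complex_rep G n1 \<rho>1" "complex_rep G n2 \<rho>2"
      "\<And>g. g \<in> carrier G \<Longrightarrow> mat_trace (\<rho> g) = mat_trace (\<rho>1 g) + mat_trace (\<rho>2 g)"
      by (rule reducible_rep_blocks[OF assms(1) less.prems 3]) (rule that)
    obtain xs where "set xs \<subseteq> irr_characters G" "\<forall>g\<in>carrier G. mat_trace (\<rho>1 g) = (\<Sum>\<chi>\<leftarrow>xs. \<chi> g)"
      using less.IH[OF b(1,3)] by blast
    moreover obtain ys where "set ys \<subseteq> irr_characters G" "\<forall>g\<in>carrier G. mat_trace (\<rho>2 g) = (\<Sum>\<chi>\<leftarrow>ys. \<chi> g)"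
      using less.IH[OF b(2,4)] by blast
    ultimately show ?thesis using b(5) by (intro exI[of _ "xs @ ys"]) auto
  qed
qed

section \<open>Integral multiplicities and recognition of character tables\<close>

lemma complex_rep_subgroup:
  assumes G: "group G" and H: "subgroup H G" and \<rho>: "complex_rep G n \<rho>"
  shows "complex_rep (G\<lparr>carrier := H\<rparr>) n \<rho>"
proof (rule complex_repI)
  show "group (G\<lparr>carrier := H\<rparr>)" using subgroup.subgroup_is_group[OF H G] .
  have HG: "h \<in> carrier G" if "h \<in> H" for h using subgroup.mem_carrier[OF H that] .
  show "\<rho> g \<in> carrier_mat n n" if "g \<in> carrier (G\<lparr>carrier := H\<rparr>)" for g
    using complex_repD(1)[OF G \<rho>] HG that by simp
  show "\<rho> (g \<otimes>\<^bsub>G\<lparr>carrier := H\<rparr>\<^esub> h) = \<rho> g * \<rho> h"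
    if "g \<in> carrier (G\<lparr>carrier := H\<rparr>)" "h \<in> carrier (G\<lparr>carrier := H\<rparr>)" for g h
    using complex_repD(2)[OF G \<rho>] HG that by simp
  show "\<rho> \<one>\<^bsub>G\<lparr>carrier := H\<rparr>\<^esub> = 1\<^sub>m n" using complex_repD(3)[OF G \<rho>] by simp
qed

lemma linear_character_irreducible:
  assumes G: "group G" and m: "\<And>g h. g \<in> carrier G \<Longrightarrow> h \<in> carrier G \<Longrightarrow> lam (g \<otimes>\<^bsub>G\<^esub> h) = lam g * lam h"
    and o: "lam \<one>\<^bsub>G\<^esub> = (1 :: complex)"
  shows "irreducible_rep G 1 (\<lambda>g. mat 1 1 (\<lambda>_. lam g))"
  unfolding irreducible_rep_def
proof (intro conjI allI impI)
  show "complex_rep G 1 (\<lambda>g. mat 1 1 (\<lambda>_. lam g))"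
    by (rule complex_repI[OF G]) (auto intro!: eq_matI simp: m o scalar_prod_def)
  fix W assume W: "VectorSpace.subspace class_ring W (module_vec TYPE(complex) 1) \<and>
    (\<forall>g\<in>carrier G. \<forall>w\<in>W. mat 1 1 (\<lambda>_. lam g) *\<^sub>v w \<in> W)"
  have Wc: "W \<subseteq> carrier_vec 1" and W0: "0\<^sub>v 1 \<in> W"
    and Ws: "\<And>c v. v \<in> W \<Longrightarrow> c \<cdot>\<^sub>v v \<in> W"
    using W by (auto simp: VectorSpace.subspace_def submodule_def module_vec_simps)
  show "W = {0\<^sub>v 1} \<or> W = carrier_vec 1"
  proof (cases "W = {0\<^sub>v 1}")
    case False
    then obtain w where w: "w \<in> W" "w \<noteq> 0\<^sub>v 1" using W0 by blast
    have w1: "w \<in> carrier_vec 1" using w Wc by blast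
    have "w $ 0 \<noteq> 0" using w(2) w1 by (auto simp: vec_eq_iff)
    then have e: "(v $ 0 / w $ 0) \<cdot>\<^sub>v w = v" if "v \<in> carrier_vec 1" for v
      using that w1 by (intro eq_vecI) auto
    have "carrier_vec 1 \<subseteq> W"
    proof
      fix v :: "complex vec" assume "v \<in> carrier_vec 1"
      then show "v \<in> W" using Ws[OF w(1), of "v $ 0 / w $ 0"] by (simp only: e)
    qed
    then show ?thesis using Wc by blast
  qed simp
qed simp

text \<open>Permutation matrices after a numbering of \<open>X\<close>; the diagonal entry at a
  point is 1 exactly when the point is fixed.\<close>

lemma perm_char_rep:
  assumes G: "group G" and X: "finite X"
    and c: "\<And>g x. g \<in> carrier G \<Longrightarrow> x \<in> X \<Longrightarrow> act g x \<in> X"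
    and m: "\<And>g h x. g \<in> carrier G \<Longrightarrow> h \<in> carrier G \<Longrightarrow> x \<in> X \<Longrightarrow> act (g \<otimes>\<^bsub>G\<^esub> h) x = act g (act h x)"
    and o: "\<And>x. x \<in> X \<Longrightarrow> act \<one>\<^bsub>G\<^esub> x = x"
  shows "\<exists>n \<rho>. complex_rep G n \<rho> \<and> (\<forall>g\<in>carrier G. mat_trace (\<rho> g) = of_nat (card {x \<in> X. act g x = x}))"
proof -
  define N where "N = card X"
  obtain e where e: "bij_betw e {..<N} X"
    using ex_bij_betw_nat_finite[OF X] by (auto simp: N_def atLeast0LessThan)
  have eX: "e i \<in> X" if "i < N" for i using e that by (auto simp: bij_betw_def)
  define \<rho> where "\<rho> g = mat N N (\<lambda>(i, j). if e i = act g (e j) then 1 else 0 :: complex)" for g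
  have "complex_rep G N \<rho>"
  proof (rule complex_repI[OF G])
    fix g h assume g: "g \<in> carrier G" and h: "h \<in> carrier G"
    show "\<rho> (g \<otimes>\<^bsub>G\<^esub> h) = \<rho> g * \<rho> h"
    proof (rule eq_matI)
      fix i j assume "i < dim_row (\<rho> g * \<rho> h)" "j < dim_col (\<rho> g * \<rho> h)"
      then have ij: "i < N" "j < N" by (auto simp: \<rho>_def)
      have "act h (e j) \<in> X" using c[OF h] eX ij by blast
      then obtain l0 where l0: "l0 < N" "e l0 = act h (e j)"
        using e unfolding bij_betw_def by (metis (mono_tags, lifting) imageE lessThan_iff)
      have l0': "e l = act h (e j) \<longleftrightarrow> l = l0" if "l < N" for l
        using e l0 that unfolding bij_betw_def by (metis inj_onD lessThan_iff)
      have "(\<rho> g * \<rho> h) $$ (i, j) = (\<Sum>l<N. \<rho> g $$ (i, l) * \<rho> h $$ (l, j))"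
        using ij by (intro mult_mat_index) (auto simp: \<rho>_def)
      also have "\<dots> = (\<Sum>l<N. if l = l0 then \<rho> g $$ (i, l0) else 0)"
        using ij l0' by (intro sum.cong) (auto simp: \<rho>_def)
      also have "\<dots> = (if e i = act g (act h (e j)) then 1 else 0)" using ij l0 by (simp add: \<rho>_def)
      also have "\<dots> = \<rho> (g \<otimes>\<^bsub>G\<^esub> h) $$ (i, j)" using ij m[OF g h eX] by (simp add: \<rho>_def)
      finally show "\<rho> (g \<otimes>\<^bsub>G\<^esub> h) $$ (i, j) = (\<rho> g * \<rho> h) $$ (i, j)" by simp
    qed (auto simp: \<rho>_def)
  next
    have "e i = e j \<longleftrightarrow> i = j" if "i < N" "j < N" for i j
      using e that unfolding bij_betw_def by (metis inj_onD lessThan_iff)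
    then show "\<rho> \<one>\<^bsub>G\<^esub> = 1\<^sub>m N" using o eX by (intro eq_matI) (auto simp: \<rho>_def)
  qed (simp add: \<rho>_def)
  moreover have "mat_trace (\<rho> g) = of_nat (card {x \<in> X. act g x = x})" for g
  proof -
    have "mat_trace (\<rho> g) = (\<Sum>i<N. if act g (e i) = e i then 1 else 0)"
      unfolding mat_trace_def \<rho>_def by (auto intro!: sum.cong)
    also have "\<dots> = (\<Sum>x\<in>X. if act g x = x then 1 else 0)"
      using e by (rule sum.reindex_bij_betw)
    also have "\<dots> = of_nat (card {x \<in> X. act g x = x})"
      using X by (simp add: sum.If_cases Int_def)
    finally show ?thesis .
  qed
  ultimately show ?thesis by blast
qed

context group
begin

lemma cip_cong:
  assumes "\<And>g. g \<in> carrier G \<Longrightarrow> f g = f' g"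
  shows "cip f h = cip f' h"
  unfolding cip_def using assms by simp

lemma cip_sum_list: "cip (\<lambda>g. \<Sum>\<chi>\<leftarrow>\<chi>s. \<chi> g) h = (\<Sum>\<chi>\<leftarrow>\<chi>s. cip \<chi> h)"
  by (induction \<chi>s) (simp_all add: cip_def sum.distrib distrib_right add_divide_distrib)

lemma rep_char_cip_Nats:
  assumes fin: "finite (carrier G)" and \<rho>: "complex_rep G n \<rho>" and \<psi>: "\<psi> \<in> irr_characters G"
  shows "cip (\<lambda>g. mat_trace (\<rho> g)) \<psi> \<in> \<nat>"
proof -
  obtain \<chi>s where \<chi>s: "set \<chi>s \<subseteq> irr_characters G" "\<forall>g\<in>carrier G. mat_trace (\<rho> g) = (\<Sum>\<chi>\<leftarrow>\<chi>s. \<chi> g)"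
    using rep_char_decomposition[OF group_axioms \<rho>] by blast
  have "cip (\<lambda>g. mat_trace (\<rho> g)) \<psi> = (\<Sum>\<chi>\<leftarrow>\<chi>s. cip \<chi> \<psi>)"
    using cip_cong[of "\<lambda>g. mat_trace (\<rho> g)" "\<lambda>g. \<Sum>\<chi>\<leftarrow>\<chi>s. \<chi> g"] \<chi>s(2) by (simp add: cip_sum_list)
  also have "\<dots> \<in> \<nat>"
    using \<chi>s(1) by (induction \<chi>s) (auto simp: irr_characters_orthonormal[OF fin _ \<psi>])
  finally show ?thesis .
qed

lemma perm_char_cip_Nats:
  assumes fin: "finite (carrier G)" and \<psi>: "\<psi> \<in> irr_characters G" and "finite X"
    and "\<And>g x. g \<in> carrier G \<Longrightarrow> x \<in> X \<Longrightarrow> act g x \<in> X"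
    and "\<And>g h x. g \<in> carrier G \<Longrightarrow> h \<in> carrier G \<Longrightarrow> x \<in> X \<Longrightarrow> act (g \<otimes> h) x = act g (act h x)"
    and "\<And>x. x \<in> X \<Longrightarrow> act \<one> x = x"
  shows "cip (\<lambda>g. of_nat (card {x \<in> X. act g x = x})) \<psi> \<in> \<nat>"
proof -
  obtain n \<rho> where \<rho>: "complex_rep G n \<rho>"
    "\<forall>g\<in>carrier G. mat_trace (\<rho> g) = of_nat (card {x \<in> X. act g x = x})"
    using perm_char_rep[OF group_axioms assms(3-6)] by blast
  have "cip (\<lambda>g. of_nat (card {x \<in> X. act g x = x})) \<psi> = cip (\<lambda>g. mat_trace (\<rho> g)) \<psi>"
    using \<rho>(2) by (intro cip_cong) simp
  then show ?thesis using rep_char_cip_Nats[OF fin \<rho>(1) \<psi>] by simp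
qed

text \<open>By Frobenius reciprocity this is the multiplicity of \<open>\<psi>\<close> in the
  character induced from \<open>lam\<close>. It is computed inside \<open>H\<close>, as the
  multiplicity of \<open>lam\<close> in the restriction of \<open>\<psi>\<close>.\<close>

lemma linear_char_restrict_Nats:
  assumes fin: "finite (carrier G)" and \<psi>: "\<psi> \<in> irr_characters G" and H: "subgroup H G"
    and lam: "\<And>g h. g \<in> H \<Longrightarrow> h \<in> H \<Longrightarrow> lam (g \<otimes> h) = lam g * lam h" "lam \<one> = 1"
  shows "(\<Sum>h\<in>H. \<psi> h * cnj (lam h)) / of_nat (card H) \<in> \<nat>"
proof -
  interpret H: group "G\<lparr>carrier := H\<rparr>" using subgroup.subgroup_is_group[OF H group_axioms] .
  have HG: "H \<subseteq> carrier G" using H by (rule subgroup.subset)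
  obtain n \<rho> where \<rho>: "irreducible_rep G n \<rho>" "\<psi> = (\<lambda>g\<in>carrier G. mat_trace (\<rho> g))"
    using \<psi> by (rule irr_charactersE)
  let ?\<phi> = "\<lambda>g\<in>H. mat_trace (mat 1 1 (\<lambda>_. lam g))"
  have "irreducible_rep (G\<lparr>carrier := H\<rparr>) 1 (\<lambda>g. mat 1 1 (\<lambda>_. lam g))"
    using lam by (intro linear_character_irreducible[OF H.group_axioms]) auto
  then have "?\<phi> \<in> irr_characters (G\<lparr>carrier := H\<rparr>)" unfolding irr_characters_def by auto
  then have "H.cip (\<lambda>g. mat_trace (\<rho> g)) ?\<phi> \<in> \<nat>"
    using complex_rep_subgroup[OF group_axioms H irreducible_repD(1)[OF \<rho>(1)]] finite_subset[OF HG fin]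
    by (intro H.rep_char_cip_Nats) auto
  moreover have "H.cip (\<lambda>g. mat_trace (\<rho> g)) ?\<phi> = (\<Sum>h\<in>H. \<psi> h * cnj (lam h)) / of_nat (card H)"
    unfolding H.cip_def \<rho>(2) using HG by (auto simp: mat_trace_def subset_iff intro!: sum.cong arg_cong2[of _ _ _ _ "(/)"])
  ultimately show ?thesis by simp
qed

text \<open>The regular character is \<open>card (carrier G)\<close> at the identity and 0
  elsewhere, so pairing it with \<open>f\<close> returns the conjugate of \<open>f \<one>\<close>.
  As a sum of irreducible characters it also pairs to 0.\<close>

lemma orthogonal_irr_characters_one:
  assumes fin: "finite (carrier G)" and orth: "\<And>\<psi>. \<psi> \<in> irr_characters G \<Longrightarrow> cip \<psi> f = 0"
  shows "f \<one> = 0"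
proof -
  obtain n \<rho> where \<rho>: "complex_rep G n \<rho>"
    "\<forall>g\<in>carrier G. mat_trace (\<rho> g) = of_nat (card {x \<in> carrier G. g \<otimes> x = x})"
    using perm_char_rep[OF group_axioms fin, of "\<lambda>g x. g \<otimes> x"] by (auto simp: m_assoc)
  obtain \<chi>s where \<chi>s: "set \<chi>s \<subseteq> irr_characters G" "\<forall>g\<in>carrier G. mat_trace (\<rho> g) = (\<Sum>\<chi>\<leftarrow>\<chi>s. \<chi> g)"
    using rep_char_decomposition[OF group_axioms \<rho>(1)] by blast
  have reg: "mat_trace (\<rho> g) = (if g = \<one> then of_nat (card (carrier G)) else 0)" if g: "g \<in> carrier G" for g
  proof -
    have "{x \<in> carrier G. g \<otimes> x = x} = (if g = \<one> then carrier G else {})" using g by auto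
    then show ?thesis using \<rho>(2) g by simp
  qed
  have "cip (\<lambda>g. mat_trace (\<rho> g)) f = (\<Sum>\<chi>\<leftarrow>\<chi>s. cip \<chi> f)"
    using cip_cong[of "\<lambda>g. mat_trace (\<rho> g)" "\<lambda>g. \<Sum>\<chi>\<leftarrow>\<chi>s. \<chi> g"] \<chi>s(2) by (simp add: cip_sum_list)
  also have "\<dots> = 0" using \<chi>s(1) orth by (induction \<chi>s) auto
  also have "cip (\<lambda>g. mat_trace (\<rho> g)) f
      = (\<Sum>g\<in>carrier G. if g = \<one> then of_nat (card (carrier G)) * cnj (f \<one>) else 0) / of_nat (card (carrier G))"
    unfolding cip_def by (intro arg_cong2[of _ _ _ _ "(/)"] sum.cong) (auto simp: reg)
  also have "\<dots> = cnj (f \<one>)" using fin by (auto simp: card_eq_0_iff)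
  finally show ?thesis by simp
qed

end

lemma int_squares_sum_one:
  fixes z :: "'i \<Rightarrow> int"
  assumes "finite I" "(\<Sum>i\<in>I. (z i)\<^sup>2) = 1"
  obtains i where "i \<in> I" "z i = 1 \<or> z i = -1" "\<And>k. k \<in> I \<Longrightarrow> k \<noteq> i \<Longrightarrow> z k = 0"
proof -
  have "\<exists>i\<in>I. z i \<noteq> 0"
  proof (rule ccontr)
    assume "\<not> (\<exists>i\<in>I. z i \<noteq> 0)"
    then have "(\<Sum>i\<in>I. (z i)\<^sup>2) = 0" by (intro sum.neutral) auto
    then show False using assms(2) by simp
  qed
  then obtain i where i: "i \<in> I" "z i \<noteq> 0" by blast
  have s: "(\<Sum>i\<in>I. (z i)\<^sup>2) = (z i)\<^sup>2 + (\<Sum>k\<in>I - {i}. (z k)\<^sup>2)"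
    using assms(1) i(1) by (rule sum.remove)
  have nn: "(\<Sum>k\<in>I - {i}. (z k)\<^sup>2) \<ge> 0" by (intro sum_nonneg) auto
  have "(z i)\<^sup>2 \<ge> 1" using i(2) by (simp add: int_one_le_iff_zero_less)
  then have z: "(z i)\<^sup>2 = 1" "(\<Sum>k\<in>I - {i}. (z k)\<^sup>2) = 0" using s nn assms(2) by linarith+
  have "z k = 0" if "k \<in> I" "k \<noteq> i" for k
    using z(2) that assms(1) by (subst (asm) sum_nonneg_eq_0_iff) auto
  moreover have "z i = 1 \<or> z i = -1" using z(1) by (simp add: power2_eq_1_iff)
  ultimately show ?thesis using that i(1) by blast
qed

context group
begin

text \<open>The restriction to the carrier matches the extensional functions in
  \<open>irr_characters\<close>.\<close>

definition table_char :: "'a set list \<Rightarrow> complex list \<Rightarrow> 'a \<Rightarrow> complex" where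
  "table_char Cs r = (\<lambda>g\<in>carrier G. r ! (THE j. j < length Cs \<and> g \<in> Cs ! j))"

text \<open>Orthogonality of columns inverts the passage from class values \<open>v\<close> to
  coefficients, so each irreducible character is a combination of rows and Parseval's identity
  holds. The premise \<open>int\<close> may assume that identity, because integrality of an
  irrational pair is deduced from it. The identity column \<open>j0\<close> fixes the signs and
  gives the final contradiction.\<close>

lemma character_table_recognition:
  assumes fin: "finite (carrier G)"
    and dist: "distinct Cs" and Cs: "set Cs = conj_classes G"
    and one: "j0 < length Cs" "Cs ! j0 = {\<one>}"
    and len: "length X = length Cs" "\<And>r. r \<in> set X \<Longrightarrow> length r = length Cs"
    and Xd: "distinct X" and Xpos: "\<And>i. i < length Cs \<Longrightarrow> \<exists>d>0. X ! i ! j0 = of_nat d"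
    and orth: "\<And>j k. j < length Cs \<Longrightarrow> k < length Cs \<Longrightarrow>
      (\<Sum>i<length Cs. X ! i ! j * cnj (X ! i ! k)) * of_nat (card (Cs ! j))
        = (if j = k then of_nat (card (carrier G)) else 0)"
    and int: "\<And>\<psi> v i. \<psi> \<in> irr_characters G \<Longrightarrow>
      (\<And>j g. j < length Cs \<Longrightarrow> g \<in> Cs ! j \<Longrightarrow> \<psi> g = v j) \<Longrightarrow>
      (\<Sum>i<length Cs. (cmod ((\<Sum>j<length Cs. of_nat (card (Cs ! j)) * X ! i ! j * cnj (v j)) / of_nat (card (carrier G))))\<^sup>2) = 1 \<Longrightarrow>
      i < length Cs \<Longrightarrow>
      (\<Sum>j<length Cs. of_nat (card (Cs ! j)) * X ! i ! j * cnj (v j)) / of_nat (card (carrier G)) \<in> \<int>"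
  shows "is_character_table G Cs (map (table_char Cs) X) X"
proof -
  define r where "r = length Cs"
  define N :: complex where "N = of_nat (card (carrier G))"
  have N0: "N \<noteq> 0" using fin by (auto simp: N_def card_eq_0_iff)
  define c where "c j = (of_nat (card (Cs ! j)) :: complex)" for j
  define \<chi> where "\<chi> i = table_char Cs (X ! i)" for i
  have Cne: "Cs ! j \<noteq> {}" "Cs ! j \<subseteq> carrier G" if j: "j < r" for j
  proof -
    have "Cs ! j \<in> conj_classes G" using j Cs nth_mem r_def by blast
    then obtain x where x: "x \<in> carrier G" "Cs ! j = conj_class G x" by (auto simp: conj_classes_def)
    then show "Cs ! j \<subseteq> carrier G" by (auto simp: conj_class_def)
    have "\<one> \<otimes> x \<otimes> inv \<one> \<in> conj_class G x" using one_closed unfolding conj_class_def by blast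
    then show "Cs ! j \<noteq> {}" using x by auto
  qed
  have conj_eq: "conj_class G x = conj_class G y" if x: "x \<in> carrier G" and y: "y \<in> carrier G" and z: "z \<in> conj_class G x" "z \<in> conj_class G y" for x y z
  proof -
    have sub: "conj_class G x \<subseteq> conj_class G y"
      if x: "x \<in> carrier G" and y: "y \<in> carrier G" and z: "z \<in> conj_class G x" "z \<in> conj_class G y" for x y z
    proof
      fix u assume "u \<in> conj_class G x"
      then obtain k where k: "k \<in> carrier G" "u = k \<otimes> x \<otimes> inv k" by (auto simp: conj_class_def)
      obtain g where g: "g \<in> carrier G" "z = g \<otimes> x \<otimes> inv g" using z by (auto simp: conj_class_def)
      obtain h where h: "h \<in> carrier G" "z = h \<otimes> y \<otimes> inv h" using z by (auto simp: conj_class_def)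
      have "x = inv g \<otimes> z \<otimes> g"
        unfolding g(2) using g(1) x by (simp add: m_assoc) (simp add: m_assoc[symmetric])
      also have "\<dots> = inv g \<otimes> h \<otimes> y \<otimes> inv (inv g \<otimes> h)"
        unfolding h(2) using g(1) h(1) y by (simp add: m_assoc inv_mult_group)
      finally have x': "x = inv g \<otimes> h \<otimes> y \<otimes> inv (inv g \<otimes> h)" .
      have "u = (k \<otimes> (inv g \<otimes> h)) \<otimes> y \<otimes> inv (k \<otimes> (inv g \<otimes> h))"
        unfolding k(2) using k(1) g(1) h(1) y by (subst x') (simp add: m_assoc inv_mult_group)
      then show "u \<in> conj_class G y"
        unfolding conj_class_def using k(1) g(1) h(1) by blast
    qed
    show ?thesis using sub[OF x y z] sub[OF y x z(2,1)] by blast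
  qed
  have disj: "j = k" if jk: "j < r" "k < r" "g \<in> Cs ! j" "g \<in> Cs ! k" for j k g
  proof -
    obtain x y where "x \<in> carrier G" "Cs ! j = conj_class G x" "y \<in> carrier G" "Cs ! k = conj_class G y"
      using jk Cs nth_mem[of j Cs] nth_mem[of k Cs] by (auto simp: conj_classes_def r_def)
    then have "Cs ! j = Cs ! k" using conj_eq jk by metis
    then show ?thesis using dist jk by (simp add: nth_eq_iff_index_eq r_def)
  qed
  have cover: "\<exists>j<r. g \<in> Cs ! j" if g: "g \<in> carrier G" for g
  proof -
    have "\<one> \<otimes> g \<otimes> inv \<one> \<in> conj_class G g" using one_closed unfolding conj_class_def by blast
    then have "g \<in> conj_class G g" using g by simp
    moreover have "conj_class G g \<in> set Cs" using g Cs by (auto simp: conj_classes_def)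
    ultimately show ?thesis by (metis in_set_conv_nth r_def)
  qed
  have \<chi>v: "\<chi> i g = X ! i ! j" if "j < r" "g \<in> Cs ! j" for i j g
  proof -
    have "(THE j. j < length Cs \<and> g \<in> Cs ! j) = j" using that disj by (intro the_equality) (auto simp: r_def)
    then show ?thesis using that Cne by (auto simp: \<chi>_def table_char_def)
  qed
  have finC: "finite (Cs ! j)" if "j < r" for j using finite_subset[OF Cne(2)[OF that] fin] .
  have G_un: "carrier G = (\<Union>j<r. Cs ! j)" using cover Cne by blast
  have sumG: "(\<Sum>g\<in>carrier G. f g) = (\<Sum>j<r. c j * v j)"
    if "\<And>j g. j < r \<Longrightarrow> g \<in> Cs ! j \<Longrightarrow> f g = v j" for f v
  proof -
    have "(\<Sum>g\<in>carrier G. f g) = (\<Sum>j<r. \<Sum>g\<in>Cs ! j. f g)"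
      unfolding G_un using finC disj by (intro sum.UNION_disjoint) auto
    also have "\<dots> = (\<Sum>j<r. c j * v j)" using that by (intro sum.cong) (auto simp: c_def)
    finally show ?thesis .
  qed
  have \<psi>_class: "\<exists>v. \<forall>j<r. \<forall>g\<in>Cs ! j. \<psi> g = v j" if \<psi>: "\<psi> \<in> irr_characters G" for \<psi>
  proof (intro exI allI impI ballI)
    fix j g assume j: "j < r" and g: "g \<in> Cs ! j"
    obtain x where x: "x \<in> carrier G" "Cs ! j = conj_class G x"
      using j Cs nth_mem[of j Cs] by (auto simp: conj_classes_def r_def)
    have "\<psi> h = \<psi> x" if "h \<in> Cs ! j" for h
      using that irr_character_conj[OF \<psi> x(1)] x(2) by (auto simp: conj_class_def)
    then show "\<psi> g = \<psi> (SOME h. h \<in> Cs ! j)" using g someI_ex[of "\<lambda>h. h \<in> Cs ! j"] by metis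
  qed
  \<comment> \<open>The vanishing of the other coefficients is recorded too: it makes a row outside
    \<open>irr_characters\<close> orthogonal to all irreducible characters.\<close>
  have expand: "\<exists>i<r. \<psi> = \<chi> i \<and> (\<forall>k<r. k \<noteq> i \<longrightarrow> cip (\<chi> k) \<psi> = 0)" if \<psi>: "\<psi> \<in> irr_characters G" for \<psi>
  proof -
    obtain v where v: "\<And>j g. j < r \<Longrightarrow> g \<in> Cs ! j \<Longrightarrow> \<psi> g = v j" using \<psi>_class[OF \<psi>] by metis
    define b where "b i = (\<Sum>j<r. c j * X ! i ! j * cnj (v j)) / N" for i
    have b: "b i = cip (\<chi> i) \<psi>" for i
      unfolding b_def cip_def N_def
      by (subst sumG[of _ "\<lambda>j. X ! i ! j * cnj (v j)"]) (auto simp: \<chi>v v mult.assoc)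
    \<comment> \<open>Orthogonality of columns \<open>j\<close> and \<open>k\<close>, weighted by
      the class size, collapses the double sum to the term \<open>j = k\<close>.\<close>
    have vb: "v k = (\<Sum>i<r. cnj (b i) * X ! i ! k)" if k: "k < r" for k
    proof -
      have "(\<Sum>i<r. cnj (b i) * X ! i ! k) = (\<Sum>i<r. \<Sum>j<r. v j * (X ! i ! k * cnj (X ! i ! j) * c j) / N)"
        by (simp add: b_def sum_divide_distrib sum_distrib_left sum_distrib_right N_def c_def mult_ac)
      also have "\<dots> = (\<Sum>j<r. v j * ((\<Sum>i<r. X ! i ! k * cnj (X ! i ! j)) * c j) / N)"
        by (subst sum.swap) (simp add: sum_distrib_left sum_distrib_right sum_divide_distrib mult_ac)
      also have "\<dots> = (\<Sum>j<r. if j = k then v k else 0)"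
      proof (intro sum.cong refl)
        fix j assume "j \<in> {..<r}"
        then have j: "j < r" by simp
        have "(\<Sum>i<r. X ! i ! k * cnj (X ! i ! j)) = cnj (\<Sum>i<r. X ! i ! j * cnj (X ! i ! k))"
          by (simp add: mult.commute)
        then have "(\<Sum>i<r. X ! i ! k * cnj (X ! i ! j)) * c j = cnj ((\<Sum>i<r. X ! i ! j * cnj (X ! i ! k)) * c j)"
          by (simp add: c_def)
        also have "\<dots> = (if j = k then N else 0)" using orth[of j k] j k by (simp add: c_def r_def N_def)
        finally show "v j * ((\<Sum>i<r. X ! i ! k * cnj (X ! i ! j)) * c j) / N = (if j = k then v k else 0)"
          using N0 by simp
      qed
      finally show ?thesis using k by simp
    qed
    \<comment> \<open>Parseval: one factor \<open>v j\<close> is expanded in the rows, and its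
      conjugate is absorbed into \<open>b i\<close>.\<close>
    have "1 = cip \<psi> \<psi>" using irr_characters_orthonormal[OF fin \<psi> \<psi>] by simp
    also have "\<dots> = (\<Sum>j<r. c j * (v j * cnj (v j))) / N"
      unfolding cip_def N_def by (subst sumG[of _ "\<lambda>j. v j * cnj (v j)"]) (auto simp: v)
    also have "\<dots> = (\<Sum>j<r. c j * ((\<Sum>i<r. cnj (b i) * X ! i ! j) * cnj (v j))) / N"
      using vb by (intro arg_cong2[of _ _ _ _ "(/)"] sum.cong) auto
    also have "\<dots> = (\<Sum>i<r. cnj (b i) * ((\<Sum>j<r. c j * X ! i ! j * cnj (v j)) / N))"
      by (simp add: sum_divide_distrib sum_distrib_left sum_distrib_right mult_ac) (rule sum.swap)
    also have "\<dots> = (\<Sum>i<r. cnj (b i) * b i)" by (simp only: b_def[symmetric])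
    also have "\<dots> = (\<Sum>i<r. of_real ((cmod (b i))\<^sup>2))"
      by (intro sum.cong refl) (simp add: complex_norm_square[symmetric] mult.commute)
    finally have "complex_of_real (\<Sum>i<r. (cmod (b i))\<^sup>2) = 1" by simp
    then have norm1: "(\<Sum>i<r. (cmod (b i))\<^sup>2) = 1" by (simp only: of_real_eq_1_iff)
    have "b i \<in> \<int>" if "i < r" for i
      using int[OF \<psi>, of v i] v norm1 that by (simp add: b_def c_def r_def N_def)
    then have "\<forall>i. \<exists>z. i < r \<longrightarrow> b i = of_int z" by (metis Ints_cases)
    then obtain z where z: "\<And>i. i < r \<Longrightarrow> b i = of_int (z i)" by metis
    have "real_of_int (\<Sum>i<r. (z i)\<^sup>2) = (\<Sum>i<r. (cmod (b i))\<^sup>2)"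
      using z by (auto simp: of_int_power intro!: sum.cong)
    then have "(\<Sum>i<r. (z i)\<^sup>2) = 1" using norm1 by (simp only: of_int_eq_1_iff)
    then obtain i where i: "i < r" "z i = 1 \<or> z i = -1" "\<And>k. k < r \<Longrightarrow> k \<noteq> i \<Longrightarrow> z k = 0"
      by (rule int_squares_sum_one[rotated]) auto
    have b0: "b k = 0" if "k < r" "k \<noteq> i" for k using z i that by simp
    have vi: "v k = of_int (z i) * X ! i ! k" if k: "k < r" for k
    proof -
      have "v k = (\<Sum>j<r. if j = i then of_int (z i) * X ! i ! k else 0)"
        unfolding vb[OF k] using b0 z i(1) by (intro sum.cong) auto
      then show ?thesis using i(1) by simp
    qed
    \<comment> \<open>Both degrees are positive integers, which rules out the sign -1.\<close>
    obtain d where d: "d > 0" "X ! i ! j0 = of_nat d" using Xpos[of i] i(1) r_def by blast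
    obtain n where n: "n > 0" "\<psi> \<one> = of_nat n" using irr_character_one[OF \<psi>] .
    have "of_nat n = of_int (z i) * (of_nat d :: complex)"
      using v[of j0 \<one>] vi[of j0] one d n by (simp add: r_def)
    then have "of_int (int n) = (of_int (z i * int d) :: complex)" by simp
    then have "int n = z i * int d" by (simp only: of_int_eq_iff)
    then have zi: "z i = 1" using i(2) n d by auto
    have "\<psi> = \<chi> i"
    proof
      fix g
      show "\<psi> g = \<chi> i g"
      proof (cases "g \<in> carrier G")
        case True
        then obtain j where "j < r" "g \<in> Cs ! j" using cover by blast
        then show ?thesis using v vi zi \<chi>v by simp
      next
        case False
        then show ?thesis using irr_character_undefined[OF \<psi>] by (simp add: \<chi>_def table_char_def)
      qed
    qed
    then show ?thesis using i(1) b0 b by metis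
  qed
  have mem: "\<chi> i \<in> irr_characters G" if i: "i < r" for i
  proof (rule ccontr)
    assume n: "\<chi> i \<notin> irr_characters G"
    have "cip \<psi> (\<chi> i) = 0" if \<psi>: "\<psi> \<in> irr_characters G" for \<psi>
    proof -
      obtain k where k: "k < r" "\<psi> = \<chi> k" "\<forall>l<r. l \<noteq> k \<longrightarrow> cip (\<chi> l) \<psi> = 0" using expand[OF \<psi>] by blast
      then have "cip (\<chi> i) \<psi> = 0" using n \<psi> i by metis
      moreover have "cip \<psi> (\<chi> i) = cnj (cip (\<chi> i) \<psi>)" by (simp add: cip_def mult.commute)
      ultimately show ?thesis by simp
    qed
    then have "\<chi> i \<one> = 0" by (rule orthogonal_irr_characters_one[OF fin])
    then show False using \<chi>v[of j0 \<one> i] one Xpos[of i] i by (auto simp: r_def)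
  qed
  have lenX: "length X = r" using len(1) by (simp add: r_def)
  have \<chi>X: "map (table_char Cs) X = map \<chi> [0..<r]"
    using lenX by (intro nth_equalityI) (auto simp: \<chi>_def)
  have inj: "i = k" if ik: "i < r" "k < r" "\<chi> i = \<chi> k" for i k
  proof -
    have "X ! i ! j = X ! k ! j" if j: "j < r" for j
    proof -
      obtain g where "g \<in> Cs ! j" using Cne(1)[OF j] by blast
      then show ?thesis using \<chi>v[OF j] ik(3) by metis
    qed
    moreover have "length (X ! i) = r" "length (X ! k) = r" using len(2) ik lenX by (auto simp: r_def)
    ultimately have "X ! i = X ! k" by (intro nth_equalityI) auto
    then show ?thesis using Xd ik lenX by (simp add: nth_eq_iff_index_eq)
  qed
  have "distinct (map \<chi> [0..<r])" using inj by (auto simp: distinct_map inj_on_def)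
  moreover have "set (map \<chi> [0..<r]) = irr_characters G" 
  proof (intro equalityI subsetI)
    fix \<psi> assume "\<psi> \<in> irr_characters G"
    then obtain i where "i < r" "\<psi> = \<chi> i" using expand by blast
    then show "\<psi> \<in> set (map \<chi> [0..<r])" by simp
  qed (use mem in auto)
  moreover have "(map \<chi> [0..<r] ! i) g = X ! i ! j" if "i < r" "j < r" "g \<in> Cs ! j" for i j g
    using that \<chi>v by simp
  ultimately show ?thesis
    unfolding is_character_table_def \<chi>X using dist Cs len lenX by (auto simp: r_def)
qed

end

section \<open>Cycles of permutations\<close>

text \<open>Unlike \<open>cycle_type\<close> this keeps the cycles of length 1, so the lengths sum
  to \<open>card S\<close> and the fixed points of all powers can be read off.\<close>

definition full_cycle_type :: "'a set \<Rightarrow> ('a \<Rightarrow> 'a) \<Rightarrow> nat multiset" where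
  "full_cycle_type S p = image_mset card (mset_set (orbit p ` S))"

lemma permutes_orbit_facts:
  assumes p: "p permutes S" and S: "finite S"
  shows "x \<in> orbit p x" "y \<in> orbit p x \<Longrightarrow> orbit p y = orbit p x"
    "x \<in> S \<Longrightarrow> orbit p x \<subseteq> S" "finite (orbit p x)" "card (orbit p x) > 0"
    "(p ^^ d) x = x \<longleftrightarrow> card (orbit p x) dvd d" "set (support p x) = orbit p x"
    "card (orbit p x) = least_power p x"
proof -
  have perm: "permutation p" using p S by (auto simp: permutation_permutes)
  show self: "x \<in> orbit p x" using perm by (rule permutation_self_in_orbit)
  show "orbit p y = orbit p x" if "y \<in> orbit p x" using orbit_cyclic_eq3[OF cyclic_on_orbit'[OF perm] that] .
  show "orbit p x \<subseteq> S" if "x \<in> S" using permutes_orbit_subset[OF p that] .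
  show fin: "finite (orbit p x)" using finite_orbit[OF self] .
  show "card (orbit p x) > 0" using self fin by (auto simp: card_gt_0_iff)
  show s: "set (support p x) = orbit p x"
    unfolding support_set[OF perm] orbit_altdef_permutation[OF perm] by auto
  show lp: "card (orbit p x) = least_power p x"
    using distinct_card[OF cycle_of_permutation[OF perm, of x]] s by simp
  show "(p ^^ d) x = x \<longleftrightarrow> card (orbit p x) dvd d" using least_power_dvd[OF perm] lp by simp
qed

lemma orbits_disjoint:
  assumes "p permutes S" "finite S"
  shows "pairwise disjnt (orbit p ` S)"
  using permutes_orbit_facts(2)[OF assms] unfolding pairwise_def disjnt_def by blast

text \<open>The points in question form a disjoint union of orbits. The predicate is taken to be
  equality with \<open>l\<close>, for points of period \<open>l\<close>, and divisibility of
  \<open>d\<close>, for fixed points of the power \<open>d\<close>.\<close>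

lemma card_Union_orbits:
  assumes p: "p permutes S" and S: "finite S"
  shows "card {x \<in> S. P (card (orbit p x))} = \<Sum>\<^sub># (filter_mset P (full_cycle_type S p))"
proof -
  define A where "A = {B \<in> orbit p ` S. P (card B)}"
  have "{x \<in> S. P (card (orbit p x))} = \<Union>A"
  proof (intro equalityI subsetI)
    fix x assume "x \<in> \<Union>A"
    then obtain y where y: "y \<in> S" "x \<in> orbit p y" "P (card (orbit p y))" by (auto simp: A_def)
    then have "orbit p x = orbit p y" "x \<in> S" using permutes_orbit_facts(2,3)[OF p S] by blast+
    then show "x \<in> {x \<in> S. P (card (orbit p x))}" using y(3) by simp
  qed (use permutes_orbit_facts(1)[OF p S] in \<open>auto simp: A_def\<close>)
  also have "card (\<Union>A) = (\<Sum>B\<in>A. card B)"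
    using orbits_disjoint[OF p S] permutes_orbit_facts(4)[OF p S]
    by (intro card_Union_disjoint) (auto simp: A_def pairwise_def)
  also have "\<dots> = \<Sum>\<^sub># (image_mset card (mset_set A))" by (simp add: sum_unfold_sum_mset)
  also have "image_mset card (mset_set A) = filter_mset P (full_cycle_type S p)"
    using S by (simp add: A_def full_cycle_type_def filter_mset_image_mset)
  finally show ?thesis .
qed

lemma card_period_points:
  assumes "p permutes S" "finite S"
  shows "card {x \<in> S. card (orbit p x) = l} = l * count (full_cycle_type S p) l"
  using card_Union_orbits[OF assms, of "\<lambda>c. c = l"] by (simp add: filter_eq_replicate_mset)

lemma card_fixed_points_funpow:
  assumes "p permutes S" "finite S"
  shows "card {x \<in> S. (p ^^ d) x = x} = \<Sum>\<^sub># (filter_mset (\<lambda>c. c dvd d) (full_cycle_type S p))"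
  using card_Union_orbits[OF assms, of "\<lambda>c. c dvd d"] by (simp add: permutes_orbit_facts(6)[OF assms])

lemma sum_full_cycle_type:
  assumes "p permutes S" "finite S"
  shows "\<Sum>\<^sub># (full_cycle_type S p) = card S"
  using card_fixed_points_funpow[OF assms, of 0] by simp

lemma full_cycle_type_pos:
  assumes "p permutes S" "finite S" "c \<in># full_cycle_type S p"
  shows "c > 0"
  using assms(3) permutes_orbit_facts(5)[OF assms(1,2)] assms(2) by (auto simp: full_cycle_type_def)

lemma cycle_type_eq_filter:
  assumes p: "p permutes S" and S: "finite S"
  shows "cycle_type p = filter_mset (\<lambda>c. c \<noteq> 1) (full_cycle_type S p)"
proof -
  have "{orbit p x |x. p x \<noteq> x} = {B \<in> orbit p ` S. card B \<noteq> 1}"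
  proof -
    have "card (orbit p x) \<noteq> 1 \<longleftrightarrow> p x \<noteq> x" for x
      using permutes_orbit_facts(6)[OF p S, of 1 x] by simp
    moreover have "x \<in> S" if "p x \<noteq> x" for x using that p by (meson permutes_not_in)
    ultimately show ?thesis by auto
  qed
  then show ?thesis
    using S by (simp add: cycle_type_def full_cycle_type_def filter_mset_image_mset)
qed

lemma orbit_conjugate:
  assumes h: "bij h"
  shows "orbit (h \<circ> p \<circ> inv' h) (h x) = h ` orbit p x"
proof -
  have "((h \<circ> p \<circ> inv' h) ^^ n) (h x) = h ((p ^^ n) x)" for n
    using h by (induction n) (auto simp: bij_is_inj inv_f_f)
  then show ?thesis unfolding orbit_altdef by auto
qed

lemma full_cycle_type_conjugate:
  assumes h: "h permutes S" and S: "finite S"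
  shows "full_cycle_type S (h \<circ> p \<circ> inv' h) = full_cycle_type S p"
proof -
  have bh: "bij h" using h by (rule permutes_bij)
  have "orbit (h \<circ> p \<circ> inv' h) ` S = orbit (h \<circ> p \<circ> inv' h) ` h ` S" using h by (simp add: permutes_image)
  also have "\<dots> = (\<lambda>B. h ` B) ` orbit p ` S" unfolding image_image by (simp add: orbit_conjugate[OF bh])
  finally have e: "orbit (h \<circ> p \<circ> inv' h) ` S = (\<lambda>B. h ` B) ` orbit p ` S" .
  have inj: "inj_on (\<lambda>B. h ` B) (orbit p ` S)" by (intro inj_onI) (simp add: inj_image_eq_iff[OF bij_is_inj[OF bh]])
  have "card (h ` B) = card B" for B using bh by (simp add: card_image inj_on_subset[OF bij_is_inj])
  then show ?thesis
    unfolding full_cycle_type_def e image_mset_mset_set[OF inj, symmetric] by (simp add: image_mset.compositionality o_def)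
qed

section \<open>Parity from the number of cycles\<close>

lemma evenperm_cycle_of_list:
  "distinct cs \<Longrightarrow> cs \<noteq> [] \<Longrightarrow> evenperm (cycle_of_list cs) \<longleftrightarrow> odd (length cs)"
proof (induction cs rule: cycle_of_list.induct)
  case (1 i j cs)
  have "evenperm (cycle_of_list (i # j # cs)) \<longleftrightarrow> evenperm (transpose i j) = evenperm (cycle_of_list (j # cs))"
    by (simp only: cycle_of_list.simps evenperm_comp[OF permutation_swap_id permutation_of_cycle])
  then show ?case using 1 by (auto simp: evenperm_swap simp del: cycle_of_list.simps)
qed simp_all

lemma orbit_cycle_of_list:
  assumes cs: "distinct cs" and x: "x \<in> set cs"
  shows "orbit (cycle_of_list cs) x = set cs"
proof -
  let ?c = "cycle_of_list cs"
  have ne: "cs \<noteq> []" using x by auto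
  have "(?c ^^ n) (cs ! 0) = cs ! (n mod length cs)" for n
  proof -
    have "(?c ^^ n) (cs ! 0) = map (?c ^^ n) cs ! 0" using ne by simp
    also have "\<dots> = rotate n cs ! 0" by (simp only: cyclic_rotation[OF cs])
    also have "\<dots> = cs ! (n mod length cs)" using ne by (simp add: nth_rotate)
    finally show ?thesis .
  qed
  moreover have "set cs = {cs ! (n mod length cs) |n. True}"
    unfolding set_conv_nth using ne by (auto; metis mod_less mod_less_divisor length_greater_0_conv)
  ultimately have e: "orbit ?c (cs ! 0) = set cs"
    unfolding orbit_altdef_permutation[OF permutation_of_cycle] by simp
  show ?thesis
    using orbit_cyclic_eq3[OF cyclic_on_orbit'[OF permutation_of_cycle, of cs "cs ! 0"]] x e by simp
qed

text \<open>A further disjoint cycle of length \<open>l\<close> changes the parity by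
  \<open>l - 1\<close>, while it adds \<open>l\<close> points and one orbit.\<close>

lemma evenperm_cycle_decomp:
  "cycle_decomp I p \<Longrightarrow> p permutes I \<and> finite I \<and> (evenperm p \<longleftrightarrow> even (card I + card (orbit p ` I)))"
proof (induction rule: cycle_decomp.induct)
  case empty
  show ?case by (auto simp: permutes_id id_def)
next
  case (comp I p cs)
  let ?c = "cycle_of_list cs" and ?q = "cycle_of_list cs \<circ> p"
  from comp have p: "p permutes I" "finite I" by auto
  have permp: "permutation p" using p by (auto simp: permutation_permutes)
  have q: "?q permutes (set cs \<union> I)"
    by (intro permutes_compose permutes_subset[OF p(1)] permutes_subset[OF cycle_permutes]) auto
  show ?case
  proof (cases "cs = []")
    \<comment> \<open>The decomposition rule admits an empty cycle, which contributes neither a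
      point nor an orbit.\<close>
    case True
    then have "?q = p" by (simp add: fun_eq_iff)
    then show ?thesis using comp.IH True by simp
  next
    case False
    have o1: "orbit ?q x = orbit p x" if "x \<in> I" for x
    proof (rule sym, rule orbit_cong0[OF that])
      show "p \<in> I \<rightarrow> I" using p by (auto simp: permutes_in_image)
      fix y assume "y \<in> I"
      then have "p y \<in> I" using p by (simp add: permutes_in_image)
      then have "p y \<notin> set cs" using comp by blast
      then show "p y = ?q y" by (simp add: id_outside_supp)
    qed
    have o2: "orbit ?q x = set cs" if "x \<in> set cs" for x
    proof -
      have "orbit ?c x = orbit ?q x"
      proof (rule orbit_cong0[OF that])
        show "?c \<in> set cs \<rightarrow> set cs" using cycle_permutes[of cs] by (auto simp: permutes_in_image)
        fix y assume "y \<in> set cs"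
        then have "y \<notin> I" using comp by blast
        then show "?c y = ?q y" using p by (simp add: permutes_not_in)
      qed
      then show ?thesis using orbit_cycle_of_list[OF comp.hyps(2) that] by simp
    qed
    have "orbit ?q ` (set cs \<union> I) = insert (set cs) (orbit p ` I)"
      using o1 o2 False by (auto simp: image_Un image_iff)
    moreover have "set cs \<notin> orbit p ` I"
      using permutes_orbit_facts(1,3)[OF p] comp.hyps(3) by auto
    ultimately have co: "card (orbit ?q ` (set cs \<union> I)) = Suc (card (orbit p ` I))" using p(2) by simp
    have ci: "card (set cs \<union> I) = length cs + card I"
      using comp.hyps(2,3) p(2) by (simp add: card_Un_disjoint distinct_card)
    have "evenperm ?q \<longleftrightarrow> evenperm ?c = evenperm p"
      by (rule evenperm_comp[OF permutation_of_cycle permp])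
    then have "evenperm ?q \<longleftrightarrow> even (card (set cs \<union> I) + card (orbit ?q ` (set cs \<union> I)))"
      unfolding co ci using conjunct2[OF conjunct2[OF comp.IH]] evenperm_cycle_of_list[OF comp.hyps(2) False]
      by (simp only: even_add even_Suc add_Suc_right) blast
    moreover have "finite (set cs \<union> I)" using p(2) by simp
    ultimately show ?thesis using q by (intro conjI)
  qed
qed

lemma evenperm_full_cycle_type:
  assumes "p permutes S" "finite S"
  shows "evenperm p \<longleftrightarrow> even (card S + size (full_cycle_type S p))"
  using evenperm_cycle_decomp[OF cycle_decomposition[OF assms]] by (simp add: full_cycle_type_def)

text \<open>Rotation says that \<open>p\<close> moves each entry of a block to the next one, so a
  block is a cycle of \<open>p\<close> together with a starting point. An \<open>l\<close>-cycle
  thus yields \<open>l\<close> blocks, and the blocks of a system are disjoint and ordered.\<close>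

definition cyc_blocks :: "'a set \<Rightarrow> ('a \<Rightarrow> 'a) \<Rightarrow> nat list \<Rightarrow> 'a list list set" where
  "cyc_blocks S p ls = {bss. map length bss = ls \<and> distinct (concat bss) \<and> set (concat bss) \<subseteq> S \<and>
     map (map p) bss = map rotate1 bss}"

text \<open>The truncated subtraction is intended: it gives \<open>0\<close> once the cycles of length \<open>l\<close> are used up.\<close>

fun cyc_count :: "nat multiset \<Rightarrow> nat list \<Rightarrow> nat" where
  "cyc_count M [] = 1"
| "cyc_count M (l # ls) = cyc_count M ls * (l * count M l - l * count_list ls l)"

lemma rotated_block:
  assumes p: "p permutes S" and S: "finite S" and b: "b \<noteq> []" "distinct b" "map p b = rotate1 b"
  shows "b = support p (hd b)" "x \<in> set b \<Longrightarrow> orbit p x = set b" "card (set b) = length b"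
proof -
  show c: "card (set b) = length b" using b by (simp add: distinct_card)
  have "(p ^^ n) (hd b) = b ! (n mod length b)" for n
  proof (induction n)
    case 0
    then show ?case using b by (simp add: hd_conv_nth)
  next
    case (Suc n)
    have "p (b ! (n mod length b)) = map p b ! (n mod length b)"
      by (rule nth_map[symmetric]) (use b(1) in simp)
    also have "\<dots> = b ! (Suc n mod length b)" unfolding b(3) using b(1) by (simp add: nth_rotate1 mod_Suc_eq)
    finally show ?case using Suc by simp
  qed
  note pw = this
  have "set b = {b ! (n mod length b) |n. True}"
    unfolding set_conv_nth using b(1) by (auto; metis mod_less mod_less_divisor length_greater_0_conv)
  moreover have perm: "permutation p" using p S by (auto simp: permutation_permutes)
  ultimately have o: "orbit p (hd b) = set b" unfolding orbit_altdef_permutation[OF perm] pw by simp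
  show "orbit p x = set b" if "x \<in> set b" using permutes_orbit_facts(2)[OF p S, of x "hd b"] o that by simp
  have "least_power p (hd b) = length b" using permutes_orbit_facts(8)[OF p S, of "hd b"] o c by simp
  then show "b = support p (hd b)" using pw by (intro nth_equalityI) auto
qed

lemma support_rotates:
  assumes p: "permutation p"
  shows "map p (support p x) = rotate1 (support p x)"
proof (rule nth_equalityI)
  fix i assume "i < length (map p (support p x))"
  then have i: "i < least_power p x" by simp
  have "(p ^^ (Suc i mod least_power p x)) x = (p ^^ Suc i) x"
  proof (cases "Suc i = least_power p x")
    case True
    have "(p ^^ least_power p x) x = x" by (rule least_power_of_permutation(1)[OF p])
    then show ?thesis unfolding True by simp
  next
    case False
    then show ?thesis using i by simp
  qed
  then show "map p (support p x) ! i = rotate1 (support p x) ! i"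
    using i by (simp add: nth_rotate1)
qed simp

text \<open>The head block is determined by its first point, which may be any point of period
  \<open>l\<close> outside the remaining blocks; these already occupy \<open>l\<close> such points
  for each occurrence of \<open>l\<close> in \<open>ls\<close>.\<close>

lemma card_cyc_blocks:
  assumes p: "p permutes S" and S: "finite S" and ls: "\<forall>l\<in>set ls. l > 0"
  shows "finite (cyc_blocks S p ls) \<and> card (cyc_blocks S p ls) = cyc_count (full_cycle_type S p) ls"
  using ls
proof (induction ls)
  case Nil
  have "cyc_blocks S p [] = {[]}" by (auto simp: cyc_blocks_def)
  then show ?case by simp
next
  case (Cons l ls)
  have l: "l > 0" using Cons.prems by simp
  have perm: "permutation p" using p S by (auto simp: permutation_permutes)
  define H where "H bss = {x \<in> S. card (orbit p x) = l} - set (concat bss)" for bss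
  have eq: "cyc_blocks S p (l # ls) = (\<Union>bss\<in>cyc_blocks S p ls. (\<lambda>x. support p x # bss) ` H bss)"
  proof (intro equalityI subsetI)
    fix z assume "z \<in> cyc_blocks S p (l # ls)"
    then obtain b bss where z: "z = b # bss" "length b = l" "distinct b" "set b \<subseteq> S" "map p b = rotate1 b"
      "set b \<inter> set (concat bss) = {}" and bss: "bss \<in> cyc_blocks S p ls"
      unfolding cyc_blocks_def by (cases z) auto
    have ne: "b \<noteq> []" using z(2) l by auto
    note rb = rotated_block[OF p S ne z(3,5)]
    have hb: "hd b \<in> set b" using ne by simp
    then have "hd b \<in> S" "hd b \<notin> set (concat bss)" using z(4,6) by blast+
    moreover have "card (orbit p (hd b)) = l" using rb(2)[OF hb] rb(3) z(2) by simp
    ultimately have "hd b \<in> H bss" unfolding H_def by blast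
    moreover have "z = support p (hd b) # bss" using z(1) rb(1) by simp
    ultimately show "z \<in> (\<Union>bss\<in>cyc_blocks S p ls. (\<lambda>x. support p x # bss) ` H bss)" using bss by blast
  next
    fix z assume "z \<in> (\<Union>bss\<in>cyc_blocks S p ls. (\<lambda>x. support p x # bss) ` H bss)"
    then obtain bss x where bss: "bss \<in> cyc_blocks S p ls" and x: "x \<in> H bss" "z = support p x # bss" by blast
    have xS: "x \<in> S" "card (orbit p x) = l" "x \<notin> set (concat bss)" using x(1) by (auto simp: H_def)
    \<comment> \<open>A chosen block that meets the orbit of \<open>x\<close> is that whole orbit,
      so it would contain \<open>x\<close>.\<close>
    have "set (support p x) \<inter> set (concat bss) = {}"
    proof (rule ccontr)
      assume "set (support p x) \<inter> set (concat bss) \<noteq> {}"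
      then obtain y b where y: "y \<in> orbit p x" "b \<in> set bss" "y \<in> set b"
        using permutes_orbit_facts(7)[OF p S, of x] by auto
      have bb: "distinct b" "map p b = rotate1 b"
        using bss y(2) unfolding cyc_blocks_def by (auto simp: distinct_concat_iff)
      have "b \<noteq> []" using y(3) by auto
      from rotated_block(2)[OF p S this bb y(3)] have "orbit p y = set b" .
      then have "x \<in> set b" using permutes_orbit_facts(1,2)[OF p S] y(1) by metis
      then show False using xS(3) y(2) by auto
    qed
    then show "z \<in> cyc_blocks S p (l # ls)"
      using bss xS cycle_of_permutation[OF perm, of x] support_rotates[OF perm, of x]
        permutes_orbit_facts(3,7,8)[OF p S, of x]
      unfolding cyc_blocks_def x(2) by auto
  qed
  have cH: "card (H bss) = l * count (full_cycle_type S p) l - l * count_list ls l" if bss: "bss \<in> cyc_blocks S p ls" for bss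
  proof -
    have d: "map length bss = ls" "distinct (concat bss)" "set (concat bss) \<subseteq> S" "map (map p) bss = map rotate1 bss"
      using bss by (auto simp: cyc_blocks_def)
    have "card {x \<in> set (concat bss). card (orbit p x) = l} = l * count_list (map length bss) l"
      using d(2,4)
    proof (induction bss)
      case (Cons b bss)
      have IH: "card {x \<in> set (concat bss). card (orbit p x) = l} = l * count_list (map length bss) l"
        using Cons by simp
      have "{x \<in> set b. card (orbit p x) = l} = (if length b = l then set b else {})"
      proof (cases "b = []")
        case False
        then show ?thesis using rotated_block(2,3)[OF p S False] Cons.prems by auto
      qed simp
      then have "card {x \<in> set b. card (orbit p x) = l} = (if length b = l then l else 0)"
        using Cons.prems by (simp add: distinct_card)
      moreover have "{x \<in> set (concat (b # bss)). card (orbit p x) = l}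
          = {x \<in> set b. card (orbit p x) = l} \<union> {x \<in> set (concat bss). card (orbit p x) = l}" by auto
      moreover have "{x \<in> set b. card (orbit p x) = l} \<inter> {x \<in> set (concat bss). card (orbit p x) = l} = {}"
        using Cons.prems by auto
      ultimately show ?case using IH by (simp add: card_Un_disjoint)
    qed simp
    moreover have "H bss = {x \<in> S. card (orbit p x) = l} - {x \<in> set (concat bss). card (orbit p x) = l}"
      by (auto simp: H_def)
    moreover have "{x \<in> set (concat bss). card (orbit p x) = l} \<subseteq> {x \<in> S. card (orbit p x) = l}"
      using d(3) by auto
    ultimately show ?thesis using S d(1) card_period_points[OF p S, of l]
      by (simp add: card_Diff_subset del: set_concat)
  qed
  have inj: "inj_on (\<lambda>x. support p x # bss) (H bss)" for bss
  proof (rule inj_onI)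
    fix x y assume "x \<in> H bss" "y \<in> H bss" and e: "support p x # bss = support p y # bss"
    have "support p x ! 0 = x" for x using least_power_of_permutation(2)[OF perm, of x] by simp
    then show "x = y" using e by (metis list.inject)
  qed
  have IH: "finite (cyc_blocks S p ls)" "card (cyc_blocks S p ls) = cyc_count (full_cycle_type S p) ls"
    using Cons by auto
  have finH: "finite (H bss)" for bss using S by (simp add: H_def)
  have "card (cyc_blocks S p (l # ls)) = (\<Sum>bss\<in>cyc_blocks S p ls. card ((\<lambda>x. support p x # bss) ` H bss))"
    unfolding eq using IH(1) finH by (intro card_UN_disjoint) auto
  also have "\<dots> = (\<Sum>bss\<in>cyc_blocks S p ls. l * count (full_cycle_type S p) l - l * count_list ls l)"
    using cH by (intro sum.cong) (auto simp: card_image[OF inj])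
  also have "\<dots> = cyc_count (full_cycle_type S p) (l # ls)" using IH(2) by simp
  finally show ?case using IH(1) finH unfolding eq by auto
qed

text \<open>\<open>Y\<close> splits into orbits, each in bijection with \<open>C\<close>.
  Composition and inverses are demanded only through their effect on \<open>Y\<close>, which fits
  centralizers acting on systems of cycles.\<close>

lemma free_action_dvd:
  assumes Y: "finite Y" and C: "finite C" and e: "e \<in> C" "\<And>y. y \<in> Y \<Longrightarrow> act e y = y"
    and act: "\<And>c y. c \<in> C \<Longrightarrow> y \<in> Y \<Longrightarrow> act c y \<in> Y"
    and comp: "\<And>c d. c \<in> C \<Longrightarrow> d \<in> C \<Longrightarrow> \<exists>b\<in>C. \<forall>y\<in>Y. act b y = act c (act d y)"
    and inv: "\<And>c. c \<in> C \<Longrightarrow> \<exists>b\<in>C. \<forall>y\<in>Y. act b (act c y) = y"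
    and free: "\<And>c d y. c \<in> C \<Longrightarrow> d \<in> C \<Longrightarrow> y \<in> Y \<Longrightarrow> act c y = act d y \<Longrightarrow> c = d"
  shows "card C dvd card Y"
proof -
  define R where "R = {(y, z). y \<in> Y \<and> (\<exists>c\<in>C. z = act c y)}"
  have "equiv Y R"
  proof (rule equivI)
    show "R \<subseteq> Y \<times> Y" using act by (auto simp: R_def)
    show "refl_on Y R" using e by (force simp: R_def refl_on_def)
    show "sym R"
    proof (rule symI)
      fix y z assume "(y, z) \<in> R"
      then obtain c where c: "y \<in> Y" "c \<in> C" "z = act c y" by (auto simp: R_def)
      obtain b where "b \<in> C" "act b z = y" using inv[OF c(2)] c by auto
      then show "(z, y) \<in> R" using c act by (force simp: R_def)
    qed
    show "trans R"
    proof (rule transI)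
      fix x y z assume "(x, y) \<in> R" "(y, z) \<in> R"
      then obtain c d where c: "x \<in> Y" "c \<in> C" "y = act c x" "d \<in> C" "z = act d y" by (auto simp: R_def)
      obtain b where "b \<in> C" "act b x = z" using comp[OF c(4,2)] c by auto
      then show "(x, z) \<in> R" using c by (force simp: R_def)
    qed
  qed
  moreover have "card C dvd card B" if "B \<in> Y // R" for B
  proof -
    obtain y where y: "y \<in> Y" "B = R `` {y}" using \<open>B \<in> Y // R\<close> by (auto simp: quotient_def)
    have "B = (\<lambda>c. act c y) ` C" using y by (auto simp: R_def)
    moreover have "inj_on (\<lambda>c. act c y) C" using free y(1) by (auto simp: inj_on_def)
    ultimately show ?thesis by (simp add: card_image)
  qed
  ultimately show ?thesis by (rule equiv_imp_dvd_card[OF Y])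
qed

section \<open>Sharply transitive groups\<close>

text \<open>The group is a bare set of functions, so that counting works directly with composition;
  the record \<open>M\<close> supplies the algebraic structure when representations enter.\<close>

locale perm_group =
  fixes S :: "'a set" and G :: "('a \<Rightarrow> 'a) set"
  assumes finS: "finite S" and perm: "g \<in> G \<Longrightarrow> g permutes S"
    and id_mem: "id \<in> G" and comp_mem: "g \<in> G \<Longrightarrow> h \<in> G \<Longrightarrow> g \<circ> h \<in> G"
    and inv_mem: "g \<in> G \<Longrightarrow> inv' g \<in> G"
begin

lemma finG: "finite G"
  by (rule finite_subset[OF _ finite_permutations[OF finS]]) (use perm in auto)

lemma inv_simps:
  assumes "g \<in> G"
  shows "inv' g (g x) = x" "g (inv' g x) = x" "g \<circ> inv' g = id" "inv' g \<circ> g = id"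
  using permutes_inverses[OF perm[OF assms]] permutes_inv_o[OF perm[OF assms]] by auto

lemma pow_mem: "g \<in> G \<Longrightarrow> g ^^ n \<in> G"
  by (induction n) (auto simp: id_mem comp_mem)

definition cent :: "('a \<Rightarrow> 'a) \<Rightarrow> ('a \<Rightarrow> 'a) set" where
  "cent g = {h \<in> G. h \<circ> g = g \<circ> h}"

definition cl :: "('a \<Rightarrow> 'a) \<Rightarrow> ('a \<Rightarrow> 'a) set" where
  "cl g = {h \<circ> g \<circ> inv' h |h. h \<in> G}"

abbreviation ct :: "('a \<Rightarrow> 'a) \<Rightarrow> nat multiset" where
  "ct \<equiv> full_cycle_type S"

lemma conj_mem: "g \<in> G \<Longrightarrow> h \<in> G \<Longrightarrow> h \<circ> g \<circ> inv' h \<in> G"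
  by (simp add: comp_mem inv_mem)

lemma cl_subset: "g \<in> G \<Longrightarrow> cl g \<subseteq> {h \<in> G. ct h = ct g}"
  using conj_mem full_cycle_type_conjugate[OF perm finS] by (auto simp: cl_def)

lemma self_cl: "g \<in> cl g"
  unfolding cl_def using id_mem by (auto intro!: exI[of _ id])

lemma cl_eq:
  assumes g: "g \<in> G" and x: "x \<in> cl g"
  shows "cl x = cl g"
proof -
  have sub: "cl x \<subseteq> cl g" if g: "g \<in> G" and x: "x \<in> cl g" for g x
  proof
    fix u assume "u \<in> cl x"
    then obtain k where k: "k \<in> G" "u = k \<circ> x \<circ> inv' k" by (auto simp: cl_def)
    obtain h where h: "h \<in> G" "x = h \<circ> g \<circ> inv' h" using x by (auto simp: cl_def)
    have "inv' (k \<circ> h) = inv' h \<circ> inv' k"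
      using k h perm by (intro o_inv_distrib permutes_bij)
    then have "u = (k \<circ> h) \<circ> g \<circ> inv' (k \<circ> h)" unfolding k(2) h(2) by (simp add: fun_eq_iff)
    then show "u \<in> cl g" using comp_mem[OF k(1) h(1)] unfolding cl_def by blast
  qed
  obtain h where h: "h \<in> G" "x = h \<circ> g \<circ> inv' h" using x by (auto simp: cl_def)
  have xG: "x \<in> G" using h g conj_mem by simp
  have "g = inv' h \<circ> x \<circ> inv' (inv' h)"
    unfolding h(2) using inv_simps[OF h(1)] permutes_inv_inv[OF perm[OF h(1)]] by (simp add: fun_eq_iff)
  then have "g \<in> cl x" using inv_mem[OF h(1)] unfolding cl_def by blast
  then show ?thesis using sub[OF g x] sub[OF xG] by blast
qed

lemma cent_props:
  assumes "g \<in> G"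
  shows "cent g \<subseteq> G" "id \<in> cent g" "h \<in> cent g \<Longrightarrow> k \<in> cent g \<Longrightarrow> h \<circ> k \<in> cent g"
    "h \<in> cent g \<Longrightarrow> inv' h \<in> cent g" "finite (cent g)"
proof -
  show "cent g \<subseteq> G" by (auto simp: cent_def)
  then show "finite (cent g)" using finG finite_subset by blast
  show "id \<in> cent g" by (simp add: cent_def id_mem)
  show "h \<circ> k \<in> cent g" if h: "h \<in> cent g" and k: "k \<in> cent g"
  proof -
    have "h (g x) = g (h x)" "k (g x) = g (k x)" for x
      using h k by (simp_all add: cent_def fun_eq_iff)
    then have "h \<circ> k \<circ> g = g \<circ> (h \<circ> k)" by (simp add: fun_eq_iff)
    moreover have "h \<circ> k \<in> G" using h k by (intro comp_mem) (auto simp: cent_def)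
    ultimately show ?thesis unfolding cent_def by blast
  qed
  show "inv' h \<in> cent g" if h: "h \<in> cent g"
  proof -
    have hG: "h \<in> G" using h by (simp add: cent_def)
    have "inv' h \<circ> g = inv' h \<circ> (g \<circ> h) \<circ> inv' h" using inv_simps[OF hG] by (simp add: fun_eq_iff)
    also have "g \<circ> h = h \<circ> g" using h by (simp add: cent_def)
    also have "inv' h \<circ> (h \<circ> g) \<circ> inv' h = g \<circ> inv' h" using inv_simps[OF hG] by (simp add: fun_eq_iff)
    finally show ?thesis using inv_mem[OF hG] unfolding cent_def by blast
  qed
qed

text \<open>Orbit-stabilizer: the fibres of conjugation, as a map from \<open>G\<close> onto the
  class, are the left cosets of the centralizer.\<close>

lemma card_cl_cent:
  assumes g: "g \<in> G"
  shows "card (cl g) * card (cent g) = card G"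
proof -
  define f :: "('a \<Rightarrow> 'a) \<Rightarrow> 'a \<Rightarrow> 'a" where "f h = h \<circ> g \<circ> inv' h" for h
  have "card G = (\<Sum>h\<in>G. 1)" by simp
  also have "\<dots> = (\<Sum>y\<in>f ` G. \<Sum>h\<in>{h \<in> G. f h = y}. 1)" by (rule sum.image_gen[OF finG])
  also have "\<dots> = (\<Sum>y\<in>f ` G. card (cent g))"
  proof (intro sum.cong refl)
    fix y assume "y \<in> f ` G"
    then obtain h where h: "h \<in> G" "y = f h" by blast
    have "bij_betw (\<lambda>k. h \<circ> k) (cent g) {k \<in> G. f k = y}"
    proof (rule bij_betw_byWitness[where f' = "\<lambda>k. inv' h \<circ> k"])
      show "\<forall>a\<in>cent g. inv' h \<circ> (h \<circ> a) = a" "\<forall>a'\<in>{k \<in> G. f k = y}. h \<circ> (inv' h \<circ> a') = a'"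
        using inv_simps[OF h(1)] by (auto simp: fun_eq_iff)
      show "(\<lambda>k. h \<circ> k) ` cent g \<subseteq> {k \<in> G. f k = y}"
      proof
        fix x assume "x \<in> (\<lambda>k. h \<circ> k) ` cent g"
        then obtain k where k: "k \<in> G" "k \<circ> g = g \<circ> k" "x = h \<circ> k" by (auto simp: cent_def)
        have "inv' x = inv' k \<circ> inv' h"
          unfolding k(3) using k h perm by (intro o_inv_distrib permutes_bij)
        then have "f x = h \<circ> (k \<circ> g) \<circ> inv' k \<circ> inv' h" by (simp add: f_def k(3) fun_eq_iff)
        also have "\<dots> = y" unfolding k(2) h(2) f_def using inv_simps[OF k(1)] by (simp add: fun_eq_iff)
        finally show "x \<in> {k \<in> G. f k = y}" using k h comp_mem by simp
      qed
      show "(\<lambda>k. inv' h \<circ> k) ` {k \<in> G. f k = y} \<subseteq> cent g"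
      proof
        fix x assume "x \<in> (\<lambda>k. inv' h \<circ> k) ` {k \<in> G. f k = y}"
        then obtain k where k: "k \<in> G" "k \<circ> g \<circ> inv' k = h \<circ> g \<circ> inv' h" "x = inv' h \<circ> k"
          by (auto simp: f_def h(2))
        have "x \<circ> g = inv' h \<circ> (k \<circ> g \<circ> inv' k) \<circ> k" using inv_simps[OF k(1)] by (simp add: k(3) fun_eq_iff)
        also have "\<dots> = g \<circ> x" unfolding k(2) using inv_simps[OF h(1)] by (simp add: k(3) fun_eq_iff)
        finally show "x \<in> cent g" using k h comp_mem inv_mem by (simp add: cent_def)
      qed
    qed
    then show "(\<Sum>h\<in>{h \<in> G. f h = y}. 1) = card (cent g)" using bij_betw_same_card by fastforce
  qed
  also have "\<dots> = card (cl g) * card (cent g)"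
    by (simp add: f_def cl_def setcompr_eq_image)
  finally show ?thesis ..
qed

text \<open>Such a set is a disjoint union of conjugacy classes. Applied to all elements of one
  cycle type, it turns a divisor common to the class sizes into a divisor of the count.\<close>

lemma conj_closed_dvd:
  assumes X: "X \<subseteq> G" "\<And>g. g \<in> X \<Longrightarrow> cl g \<subseteq> X" and d: "\<And>g. g \<in> X \<Longrightarrow> d dvd card (cl g)"
  shows "d dvd card X"
proof -
  define R where "R = {(x, y). x \<in> X \<and> y \<in> cl x}"
  have "equiv X R"
  proof (rule equivI)
    show "R \<subseteq> X \<times> X" using X by (auto simp: R_def)
    show "refl_on X R" using self_cl by (auto simp: R_def refl_on_def)
    show "sym R"
    proof (rule symI)
      fix x y assume "(x, y) \<in> R"
      then have xy: "x \<in> X" "y \<in> cl x" by (simp_all add: R_def)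
      have "x \<in> G" using xy(1) X(1) by blast
      then have "x \<in> cl y" using cl_eq[OF _ xy(2)] self_cl[of x] by simp
      then show "(y, x) \<in> R" using xy X(2)[OF xy(1)] by (auto simp: R_def)
    qed
    show "trans R"
    proof (rule transI)
      fix x y z assume "(x, y) \<in> R" "(y, z) \<in> R"
      then have xy: "x \<in> X" "y \<in> cl x" "z \<in> cl y" by (simp_all add: R_def)
      have "x \<in> G" using xy(1) X(1) by blast
      then have "z \<in> cl x" using cl_eq[OF _ xy(2)] xy(3) by simp
      then show "(x, z) \<in> R" using xy(1) by (simp add: R_def)
    qed
  qed
  moreover have "d dvd card B" if "B \<in> X // R" for B
  proof -
    obtain x where x: "x \<in> X" "B = R `` {x}" using \<open>B \<in> X // R\<close> by (auto simp: quotient_def)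
    then have "B = cl x" by (auto simp: R_def)
    then show ?thesis using d x by simp
  qed
  ultimately show ?thesis by (rule equiv_imp_dvd_card[OF finite_subset[OF X(1) finG]])
qed

end

section \<open>Sharply transitive groups: tuples, moments and centralizers\<close>

locale sharp_group = perm_group S G for S :: "'a set" and G +
  fixes k :: nat
  assumes sharp: "sharply_transitive k S G" and kS: "k \<le> card S"
begin

definition tuples :: "nat \<Rightarrow> 'a list set" where
  "tuples j = {xs. length xs = j \<and> distinct xs \<and> set xs \<subseteq> S}"

lemma tuples_finite: "finite (tuples j)"
  by (rule finite_subset[OF _ finite_lists_length_eq[OF finS, of j]]) (auto simp: tuples_def)

lemma card_tuples: "j \<le> card S \<Longrightarrow> card (tuples j) = \<Prod>{card S - j + 1..card S}"
  unfolding tuples_def using card_lists_distinct_length_eq[OF finS] by (simp add: conj_assoc)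

lemma card_tuples_pos: "j \<le> card S \<Longrightarrow> card (tuples j) > 0"
  by (subst card_tuples) (auto intro!: prod_pos)

lemma sharp_ex1: "xs \<in> tuples k \<Longrightarrow> ys \<in> tuples k \<Longrightarrow> \<exists>!g. g \<in> G \<and> map g xs = ys"
  using sharp unfolding sharply_transitive_def tuples_def by blast

lemma map_tuples: "g \<in> G \<Longrightarrow> xs \<in> tuples j \<Longrightarrow> map g xs \<in> tuples j"
  using perm[of g] by (auto simp: tuples_def distinct_map permutes_inj_on permutes_in_image)

lemma card_G: "card G = card (tuples k)"
proof -
  obtain xs where xs: "xs \<in> tuples k" using card_tuples_pos[OF kS] by (force simp: card_gt_0_iff)
  have "bij_betw (\<lambda>g. map g xs) G (tuples k)"
    unfolding bij_betw_def
  proof (intro conjI equalityI subsetI inj_onI)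
    fix g h assume gh: "g \<in> G" "h \<in> G" "map g xs = map h xs"
    from sharp_ex1[OF xs map_tuples[OF gh(1) xs]] show "g = h" using gh by metis
  next
    fix ys assume "ys \<in> tuples k"
    from ex1_implies_ex[OF sharp_ex1[OF xs this]] show "ys \<in> (\<lambda>g. map g xs) ` G" by blast
  qed (use map_tuples[OF _ xs] in blast)
  then show ?thesis by (rule bij_betw_same_card)
qed

lemma eq_if_agree:
  assumes "g \<in> G" "h \<in> G" "A \<subseteq> S" "card A \<ge> k" "\<And>x. x \<in> A \<Longrightarrow> g x = h x"
  shows "g = h"
proof -
  obtain B where B: "B \<subseteq> A" "card B = k" using obtain_subset_with_card_n[OF assms(4)] by metis
  then have "finite B" using finS assms(3) by (meson finite_subset)
  then obtain xs where xs: "set xs = B" "distinct xs" using finite_distinct_list by blast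
  then have "xs \<in> tuples k" using B assms(3) distinct_card[of xs] by (auto simp: tuples_def)
  moreover have "map g xs = map h xs" using xs B assms(5) by auto
  ultimately show ?thesis using sharp_ex1[OF _ map_tuples[OF assms(1)]] assms(1,2) by metis
qed

lemma extend_tuple:
  assumes xs: "xs \<in> tuples j" and j: "j \<le> k"
  obtains zs where "xs @ zs \<in> tuples k"
proof -
  have c: "card (S - set xs) = card S - j"
    using xs finS by (auto simp: tuples_def card_Diff_subset distinct_card)
  then have "k - j \<le> card (S - set xs)" using kS by simp
  then obtain B where B: "B \<subseteq> S - set xs" "card B = k - j" using obtain_subset_with_card_n by metis
  then obtain zs where zs: "set zs = B" "distinct zs"
    using finite_distinct_list[of B] finS by (meson finite_Diff finite_subset)
  then have "xs @ zs \<in> tuples k" using xs B j distinct_card[of zs] by (auto simp: tuples_def)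
  then show ?thesis by (rule that)
qed

lemma transitive_tuples:
  assumes "xs \<in> tuples j" "ys \<in> tuples j" "j \<le> k"
  obtains g where "g \<in> G" "map g xs = ys"
proof -
  obtain zs ws where "xs @ zs \<in> tuples k" "ys @ ws \<in> tuples k"
    using extend_tuple[OF assms(1,3)] extend_tuple[OF assms(2,3)] by metis
  then obtain g where "g \<in> G" "map g (xs @ zs) = ys @ ws" using sharp_ex1 by blast
  moreover from this have "map g xs = ys" using assms by (auto simp: tuples_def)
  ultimately show ?thesis using that by blast
qed

text \<open>Composing with an element that takes one target tuple to another identifies the fibres,
  so all of them have the same size. Here \<open>j \<le> k\<close> is what makes the group
  transitive on \<open>j\<close>-tuples.\<close>

lemma card_fiber:
  assumes xs: "xs \<in> tuples j" and ys: "ys \<in> tuples j" and j: "j \<le> k"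
  shows "card {g \<in> G. map g xs = ys} * card (tuples j) = card G"
proof -
  have eq: "card {g \<in> G. map g xs = zs} = card {g \<in> G. map g xs = ys}" if zs: "zs \<in> tuples j" for zs
  proof -
    obtain h where h: "h \<in> G" "map h zs = ys" using transitive_tuples[OF zs ys j] .
    have "bij_betw (\<lambda>g. h \<circ> g) {g \<in> G. map g xs = zs} {g \<in> G. map g xs = ys}"
    proof (rule bij_betw_byWitness[where f' = "\<lambda>g. inv' h \<circ> g"])
      have "map (inv' h) ys = zs" using inv_simps[OF h(1)] unfolding h(2)[symmetric] by (simp add: map_idI)
      then show "(\<lambda>g. inv' h \<circ> g) ` {g \<in> G. map g xs = ys} \<subseteq> {g \<in> G. map g xs = zs}"
        using h comp_mem inv_mem by auto
    qed (use h comp_mem inv_simps[OF h(1)] in \<open>auto simp: fun_eq_iff\<close>)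
    then show ?thesis by (rule bij_betw_same_card)
  qed
  have "card G = (\<Sum>g\<in>G. 1)" by simp
  also have "\<dots> = (\<Sum>zs\<in>tuples j. \<Sum>g\<in>{g \<in> G. map g xs = zs}. 1)"
    using map_tuples[OF _ xs] by (intro sum.group[symmetric] finG tuples_finite) auto
  also have "\<dots> = (\<Sum>zs\<in>tuples j. card {g \<in> G. map g xs = ys})" using eq by simp
  finally show ?thesis by simp
qed

definition block_lists :: "nat list \<Rightarrow> 'a list list set" where
  "block_lists ls = {bss. map length bss = ls \<and> distinct (concat bss) \<and> set (concat bss) \<subseteq> S}"

lemma unconcat: "length xs = sum_list ls \<Longrightarrow> \<exists>bss. map length bss = ls \<and> concat bss = xs"
proof (induction ls arbitrary: xs)
  case (Cons l ls)
  have "length (drop l xs) = sum_list ls" using Cons.prems by simp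
  from Cons.IH[OF this] obtain bss where "map length bss = ls" "concat bss = drop l xs" by blast
  then show ?case using Cons.prems by (intro exI[of _ "take l xs # bss"]) auto
qed auto

lemma concat_inj_length: "map length xss = map length yss \<Longrightarrow> concat xss = concat yss \<Longrightarrow> xss = yss"
proof (induction xss arbitrary: yss)
  case (Cons a xss)
  then show ?case by (cases yss) auto
qed auto

lemma card_block_lists: "finite (block_lists ls) \<and> card (block_lists ls) = card (tuples (sum_list ls))"
proof -
  have "bij_betw concat (block_lists ls) (tuples (sum_list ls))"
    unfolding bij_betw_def
  proof (intro conjI equalityI subsetI)
    show "inj_on concat (block_lists ls)"
      by (auto simp: inj_on_def block_lists_def intro: concat_inj_length)
    fix xs assume xs: "xs \<in> tuples (sum_list ls)"
    then obtain bss where "map length bss = ls" "concat bss = xs"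
      using unconcat[of xs ls] unfolding tuples_def by blast
    then show "xs \<in> concat ` block_lists ls" using xs by (force simp: block_lists_def tuples_def)
  next
  qed (auto simp: block_lists_def tuples_def length_concat simp del: set_concat)
  then show ?thesis using bij_betw_finite tuples_finite bij_betw_same_card by blast
qed

lemma cyc_blocks_subset: "cyc_blocks S g ls = {bss \<in> block_lists ls. map (map g) bss = map rotate1 bss}"
  by (auto simp: cyc_blocks_def block_lists_def)

text \<open>Pairs of an element and a block list are counted in two ways. A block list of total
  length \<open>j\<close> prescribes the image of a \<open>j\<close>-tuple, so it consists of cycles
  of \<open>card G / card (tuples j)\<close> elements, and there are \<open>card (tuples j)\<close>
  block lists.\<close>

lemma cycle_moment:
  assumes j: "sum_list ls \<le> k"
  shows "(\<Sum>g\<in>G. card (cyc_blocks S g ls)) = card G"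
proof -
  define j where "j = sum_list ls"
  define B where "B = block_lists ls"
  have B: "finite B" "card B = card (tuples j)" using card_block_lists by (auto simp: B_def j_def)
  have jS: "j \<le> card S" using assms kS by (simp add: j_def)
  have fib: "card {g \<in> G. map (map g) bss = map rotate1 bss} * card (tuples j) = card G" if b: "bss \<in> B" for bss
  proof -
    have c: "concat bss \<in> tuples j"
      using b by (auto simp: B_def block_lists_def tuples_def length_concat j_def)
    have "set (concat (map rotate1 bss)) = set (concat bss)" by simp
    moreover have "length (concat (map rotate1 bss)) = length (concat bss)" by (simp add: length_concat o_def)
    ultimately have r: "concat (map rotate1 bss) \<in> tuples j"
      using c by (simp add: tuples_def card_distinct distinct_card del: set_concat)
    \<comment> \<open>Since the block lengths agree on both sides, flattening the lists loses
      nothing.\<close>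
    have "map (map g) bss = map rotate1 bss \<longleftrightarrow> map g (concat bss) = concat (map rotate1 bss)" for g
    proof
      assume "map (map g) bss = map rotate1 bss"
      then have "concat (map (map g) bss) = concat (map rotate1 bss)" by (rule arg_cong)
      then show "map g (concat bss) = concat (map rotate1 bss)" by (simp only: map_concat)
    next
      assume "map g (concat bss) = concat (map rotate1 bss)"
      then show "map (map g) bss = map rotate1 bss"
        by (intro concat_inj_length) (simp_all only: map_concat, simp add: o_def)
    qed
    then show ?thesis using card_fiber[OF c r] assms by (simp add: j_def)
  qed
  have "(\<Sum>g\<in>G. card (cyc_blocks S g ls)) = (\<Sum>g\<in>G. \<Sum>bss\<in>B. if map (map g) bss = map rotate1 bss then 1 else 0)"
    using B(1) by (simp add: cyc_blocks_subset B_def sum.If_cases Int_def)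
  also have "\<dots> = (\<Sum>bss\<in>B. card {g \<in> G. map (map g) bss = map rotate1 bss})"
    using finG by (subst sum.swap) (simp add: sum.If_cases Int_def)
  finally have "(\<Sum>g\<in>G. card (cyc_blocks S g ls)) * card (tuples j)
      = (\<Sum>bss\<in>B. card {g \<in> G. map (map g) bss = map rotate1 bss} * card (tuples j))"
    by (simp add: sum_distrib_right)
  also have "\<dots> = card G * card (tuples j)" using fib B(2) by simp
  finally show ?thesis using card_tuples_pos[OF jS] by simp
qed

text \<open>An element commuting with \<open>g\<close> carries cycles of \<open>g\<close> to cycles
  of \<open>g\<close>. If two of them agree on a system with at least \<open>k\<close> points they
  are equal, so the action is free. A zero count would say nothing; the lists \<open>ls\<close> are
  therefore taken from cycles that \<open>g\<close> has.\<close>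

lemma card_cent_dvd:
  assumes g: "g \<in> G" and ls: "\<forall>l\<in>set ls. l > 0" "sum_list ls \<ge> k"
  shows "card (cent g) dvd cyc_count (ct g) ls"
proof -
  have "card (cent g) dvd card (cyc_blocks S g ls)"
  proof (rule free_action_dvd[where act = "\<lambda>h. map (map h)" and e = id])
    show "finite (cyc_blocks S g ls)" using card_cyc_blocks[OF perm[OF g] finS ls(1)] by simp
    show "finite (cent g)" "id \<in> cent g" using cent_props[OF g] by auto
    show "map (map h) y \<in> cyc_blocks S g ls" if h: "h \<in> cent g" and y: "y \<in> cyc_blocks S g ls" for h y
    proof -
      have hG: "h \<in> G" using h by (simp add: cent_def)
      have "map (map g) (map (map h) y) = map (map h) (map (map g) y)"
        using h by (simp add: cent_def comp_def fun_eq_iff)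
      also have "map (map g) y = map rotate1 y" using y unfolding cyc_blocks_def by blast
      also have "map (map h) (map rotate1 y) = map rotate1 (map (map h) y)" by (simp add: rotate1_map)
      finally have "map (map g) (map (map h) y) = map rotate1 (map (map h) y)" .
      moreover have "concat (map (map h) y) = map h (concat y)" by (simp add: map_concat)
      moreover have "map h (concat y) \<in> tuples (sum_list ls)"
        by (rule map_tuples[OF hG]) (use y in \<open>auto simp: tuples_def cyc_blocks_def length_concat\<close>)
      moreover have "map length (map (map h) y) = ls" using y by (simp add: cyc_blocks_def o_def)
      ultimately show ?thesis unfolding cyc_blocks_def tuples_def by (simp del: set_concat map_map set_map)
    qed
    show "\<exists>b\<in>cent g. \<forall>y\<in>cyc_blocks S g ls. map (map b) y = map (map c) (map (map d) y)"
      if "c \<in> cent g" "d \<in> cent g" for c d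
      using cent_props(3)[OF g that] by (intro bexI[of _ "c \<circ> d"]) auto
    show "\<exists>b\<in>cent g. \<forall>y\<in>cyc_blocks S g ls. map (map b) (map (map c) y) = y" if c: "c \<in> cent g" for c
    proof -
      have "c \<in> G" using c by (simp add: cent_def)
      then show ?thesis using cent_props(4)[OF g c] inv_simps by (intro bexI[of _ "inv' c"]) (auto simp: map_idI)
    qed
    show "c = d" if c: "c \<in> cent g" and d: "d \<in> cent g" and y: "y \<in> cyc_blocks S g ls"
      and e: "map (map c) y = map (map d) y" for c d y
    proof (rule eq_if_agree)
      show "c \<in> G" "d \<in> G" using c d by (auto simp: cent_def)
      show "set (concat y) \<subseteq> S" using y by (simp add: cyc_blocks_def)
      have "card (set (concat y)) = sum_list ls" using y by (auto simp: cyc_blocks_def distinct_card length_concat simp del: set_concat)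
      then show "k \<le> card (set (concat y))" using ls(2) by simp
      have "map c (concat y) = map d (concat y)" using e by (metis map_concat)
      then show "\<And>x. x \<in> set (concat y) \<Longrightarrow> c x = d x" by (metis map_eq_conv)
    qed
  qed auto
  then show ?thesis using card_cyc_blocks[OF perm[OF g] finS ls(1)] by simp
qed

lemma cycle_count_moment:
  assumes "\<forall>l\<in>set ls. l > 0" "sum_list ls \<le> k"
  shows "(\<Sum>g\<in>G. cyc_count (ct g) ls) = card G"
  using cycle_moment[OF assms(2)] card_cyc_blocks[OF perm finS assms(1)] by simp

lemma few_fixed_points:
  assumes g: "g \<in> G"
  shows "\<Sum>\<^sub># (filter_mset (\<lambda>c. c dvd d) (ct g)) < k \<or> g ^^ d = id"
proof (rule disjCI)
  assume "g ^^ d \<noteq> id"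
  moreover have "g ^^ d = id" if "k \<le> card {x \<in> S. (g ^^ d) x = x}"
    by (rule eq_if_agree[OF pow_mem[OF g] id_mem _ that]) auto
  ultimately have "card {x \<in> S. (g ^^ d) x = x} < k" by (metis not_le)
  then show "\<Sum>\<^sub># (filter_mset (\<lambda>c. c dvd d) (ct g)) < k"
    using card_fixed_points_funpow[OF perm[OF g] finS] by simp
qed

end

text \<open>Larger parts come first, which is the normal form that \<open>cyc_list\<close>
  produces.\<close>

fun partitions :: "nat \<Rightarrow> nat \<Rightarrow> nat list list" where
  "partitions m 0 = (if m = 0 then [[]] else [])"
| "partitions m (Suc l) = concat (map (\<lambda>c. map (\<lambda>xs. replicate c (Suc l) @ xs) (partitions (m - c * Suc l) l))
     [0..<Suc (m div Suc l)])"

lemma partitions_complete: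
  "\<Sum>\<^sub># M = m \<Longrightarrow> (\<And>c. c \<in># M \<Longrightarrow> 0 < c \<and> c \<le> l) \<Longrightarrow> \<exists>xs\<in>set (partitions m l). mset xs = M"
proof (induction l arbitrary: m M)
  case 0
  then have "M = {#}" by (metis gr_implies_not0 le_0_eq multiset_nonemptyE not_gr0)
  then show ?case using 0 by simp
next
  case (Suc l)
  define c where "c = count M (Suc l)"
  define M' where "M' = filter_mset (\<lambda>x. x \<noteq> Suc l) M"
  have M: "M = replicate_mset c (Suc l) + M'"
    using multiset_partition[of M "\<lambda>x. x = Suc l"] by (simp add: c_def M'_def filter_eq_replicate_mset)
  have m: "m = c * Suc l + \<Sum>\<^sub># M'" using Suc.prems(1) M by simp
  have "0 < x \<and> x \<le> l" if "x \<in># M'" for x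
    using Suc.prems(2)[of x] that by (auto simp: M'_def)
  then obtain xs where xs: "xs \<in> set (partitions (m - c * Suc l) l)" "mset xs = M'"
    using Suc.IH[of M' "m - c * Suc l"] m by auto
  have "c * Suc l \<le> m" using m by simp
  then have "c \<le> m div Suc l" by (simp add: less_eq_div_iff_mult_less_eq)
  then have "replicate c (Suc l) @ xs \<in> set (partitions m (Suc l))"
    using xs(1) by (auto simp del: mult_Suc_right intro!: bexI[of _ c])
  moreover have "mset (replicate c (Suc l) @ xs) = M" using M xs(2) by simp
  ultimately show ?case by blast
qed

text \<open>The number of fixed points of the \<open>d\<close>-th power of a permutation with cycle lengths \<open>xs\<close>.\<close>

definition fx :: "nat list \<Rightarrow> nat \<Rightarrow> nat" where
  "fx xs d = sum_list (filter (\<lambda>c. c dvd d) xs)"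

text \<open>The number of cycles of an even permutation of \<open>n\<close> points has the parity of \<open>n\<close>; a nontrivial power fixes fewer than \<open>k\<close> points.\<close>

definition sharp_cycle_list :: "nat \<Rightarrow> nat \<Rightarrow> nat list \<Rightarrow> bool" where
  "sharp_cycle_list n k xs \<longleftrightarrow> even (n + length xs) \<and> list_all (\<lambda>d. fx xs d < k \<or> fx xs d = n) [1..<Suc n]"

locale sharp_alt_group = sharp_group S G k for S :: "'a set" and G and k :: nat +
  assumes even: "g \<in> G \<Longrightarrow> evenperm g"
begin

text \<open>A canonical list in place of a multiset, so that the candidate types can be enumerated
  and tested by evaluation.\<close>

definition cyc_list :: "('a \<Rightarrow> 'a) \<Rightarrow> nat list" where
  "cyc_list g = rev (sorted_list_of_multiset (ct g))"

lemma mset_cyc_list: "mset (cyc_list g) = ct g"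
  by (simp add: cyc_list_def)

lemma cyc_list_eq_iff: "cyc_list g = cyc_list h \<longleftrightarrow> ct g = ct h"
  by (metis mset_cyc_list cyc_list_def)

lemma card_fix_pow: "g \<in> G \<Longrightarrow> card {x \<in> S. (g ^^ d) x = x} = fx (cyc_list g) d"
  using card_fixed_points_funpow[OF perm finS, of g d]
  by (simp add: fx_def mset_cyc_list[symmetric] sum_mset_sum_list[symmetric] del: sum_mset_sum_list)

text \<open>The type of a power is never computed from its cycles: its numbers of fixed points are
  read off the original element, and they single out one candidate.\<close>

lemma fx_pow:
  assumes "g \<in> G"
  shows "fx (cyc_list (g ^^ e)) d = fx (cyc_list g) (e * d)"
  using card_fix_pow[OF pow_mem[OF assms, of e], of d] card_fix_pow[OF assms, of "e * d"]
  by (simp add: funpow_mult)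

lemma fx_full_iff:
  assumes g: "g \<in> G"
  shows "fx (cyc_list g) d = card S \<longleftrightarrow> g ^^ d = id"
proof
  assume "fx (cyc_list g) d = card S"
  then have "{x \<in> S. (g ^^ d) x = x} = S" using finS card_fix_pow[OF g, of d] by (intro card_subset_eq) auto
  then show "g ^^ d = id" using perm[OF pow_mem[OF g, of d]] by (auto simp: fun_eq_iff permutes_def)
next
  assume "g ^^ d = id"
  then show "fx (cyc_list g) d = card S" using card_fix_pow[OF g, of d] by simp
qed

lemma fx_small_or_full: "g \<in> G \<Longrightarrow> fx (cyc_list g) d < k \<or> fx (cyc_list g) d = card S"
  using few_fixed_points[of g d] card_fix_pow[of g d] card_fixed_points_funpow[OF perm finS, of g d]
    fx_full_iff[of g d] by auto

text \<open>The premise \<open>L\<close> says that the sieve returns decreasing lists only. It is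
  settled by evaluation once the degree is fixed, and turns equality of multisets into equality of
  lists.\<close>

lemma cyc_list_mem:
  assumes g: "g \<in> G"
    and L: "list_all (\<lambda>xs. rev (sort xs) = xs) (filter (sharp_cycle_list (card S) k) (partitions (card S) (card S)))"
  shows "cyc_list g \<in> set (filter (sharp_cycle_list (card S) k) (partitions (card S) (card S)))"
proof -
  note p = perm[OF g] finS
  have "c \<le> card S" if c: "c \<in># ct g" for c
  proof -
    obtain M where "ct g = add_mset c M" using multi_member_split[OF c] by blast
    then show ?thesis using sum_full_cycle_type[OF p] by simp
  qed
  then obtain xs where xs: "xs \<in> set (partitions (card S) (card S))" "mset xs = ct g"
    using partitions_complete[OF sum_full_cycle_type[OF p]] full_cycle_type_pos[OF p] by metis
  have "fx xs d = fx (cyc_list g) d" for d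
    using xs(2) unfolding fx_def by (metis mset_cyc_list mset_filter sum_mset_sum_list)
  moreover have "even (card S + length xs)"
    using even[OF g] evenperm_full_cycle_type[OF p] xs(2) by (metis size_mset)
  ultimately have ok: "sharp_cycle_list (card S) k xs"
    unfolding sharp_cycle_list_def using fx_small_or_full[OF g] by (simp add: list_all_iff)
  then have mem: "xs \<in> set (filter (sharp_cycle_list (card S) k) (partitions (card S) (card S)))" using xs(1) by simp
  then have "rev (sort xs) = xs" using L unfolding list_all_iff by blast
  moreover have "cyc_list g = rev (sort xs)"
    unfolding cyc_list_def xs(2)[symmetric] by (simp add: sorted_list_of_multiset_mset)
  ultimately show ?thesis using mem by simp
qed

definition of_type :: "nat list \<Rightarrow> ('a \<Rightarrow> 'a) set" where
  "of_type xs = {g \<in> G. cyc_list g = xs}"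

definition N :: "nat list \<Rightarrow> nat" where
  "N xs = card (of_type xs)"

lemma of_type_finite: "finite (of_type xs)"
  using finG by (simp add: of_type_def)

lemma sum_by_type:
  fixes f :: "nat list \<Rightarrow> nat"
  assumes L: "distinct L" "\<And>g. g \<in> G \<Longrightarrow> cyc_list g \<in> set L"
  shows "(\<Sum>g\<in>G. f (cyc_list g)) = (\<Sum>xs\<leftarrow>L. N xs * f xs)"
proof -
  have "(\<Sum>g\<in>G. f (cyc_list g)) = (\<Sum>xs\<in>set L. \<Sum>g\<in>{g \<in> G. cyc_list g = xs}. f (cyc_list g))"
    using L(2) finG by (intro sum.group[symmetric]) auto
  also have "\<dots> = (\<Sum>xs\<in>set L. N xs * f xs)"
    by (intro sum.cong refl) (simp add: N_def of_type_def)
  also have "\<dots> = (\<Sum>xs\<leftarrow>L. N xs * f xs)" using L(1) by (simp add: sum_list_distinct_conv_sum_set)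
  finally show ?thesis .
qed

lemma type_moment:
  assumes L: "distinct L" "\<And>g. g \<in> G \<Longrightarrow> cyc_list g \<in> set L"
    and ls: "\<forall>l\<in>set ls. l > 0" "sum_list ls \<le> k"
  shows "(\<Sum>xs\<leftarrow>L. N xs * cyc_count (mset xs) ls) = card G"
  using cycle_count_moment[OF ls] sum_by_type[OF L, of "\<lambda>xs. cyc_count (mset xs) ls"]
  by (simp add: mset_cyc_list)

lemma cl_subset_type: "g \<in> of_type xs \<Longrightarrow> cl g \<subseteq> of_type xs"
  using cl_subset[of g] by (auto simp: of_type_def cyc_list_eq_iff)

lemma card_cl_le_N: "g \<in> of_type xs \<Longrightarrow> card (cl g) \<le> N xs"
  unfolding N_def by (intro card_mono cl_subset_type of_type_finite)

lemma cent_dvd: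
  assumes "g \<in> of_type xs" "\<forall>l\<in>set ls. l > 0" "sum_list ls \<ge> k"
  shows "card (cent g) dvd cyc_count (mset xs) ls"
  using card_cent_dvd[of g ls] assms by (simp add: of_type_def mset_cyc_list[symmetric])

lemma class_equation: "g \<in> of_type xs \<Longrightarrow> card (cl g) * card (cent g) = card G"
  by (rule card_cl_cent) (simp add: of_type_def)

lemma cl_eq_type:
  assumes "g \<in> of_type xs" "card (cl g) \<ge> N xs"
  shows "cl g = of_type xs"
  using assms cl_subset_type[OF assms(1)] of_type_finite[of xs] unfolding N_def
  by (intro card_seteq) auto

text \<open>The order of the centralizer divides the count \<open>c\<close> of cycle systems, so a
  class has at least \<open>card G / c\<close> elements. If the type has no more than that, the
  class fills it.\<close>

lemma single_class:
  assumes g: "g \<in> of_type xs" and ls: "\<forall>l\<in>set ls. l > 0" "sum_list ls \<ge> k"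
    and N: "N xs * cyc_count (mset xs) ls = card G"
  shows "cl g = of_type xs \<and> card (cent g) = cyc_count (mset xs) ls"
proof -
  have G0: "card G > 0" using finG id_mem by (auto simp: card_gt_0_iff)
  have c0: "cyc_count (mset xs) ls > 0" using N G0 by (metis mult_0_right not_gr0)
  have N0: "N xs > 0" using N G0 by (metis mult_0 not_gr0)
  have le: "card (cent g) \<le> cyc_count (mset xs) ls" using cent_dvd[OF g ls] c0 by (rule dvd_imp_le)
  have eq: "card (cl g) * card (cent g) = N xs * cyc_count (mset xs) ls" using class_equation[OF g] N by simp
  have "card (cl g) \<ge> N xs"
  proof (rule ccontr)
    assume "\<not> card (cl g) \<ge> N xs"
    then have "card (cl g) * card (cent g) < N xs * cyc_count (mset xs) ls"
      using le c0 cent_props(2,5)[of g] g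
      by (intro mult_less_le_imp_less) (auto simp: card_gt_0_iff of_type_def)
    then show False using eq by simp
  qed
  then have "card (cl g) = N xs" using card_cl_le_N[OF g] by simp
  then show ?thesis using cl_eq_type[OF g] eq N0 by simp
qed

lemma type_dvd:
  assumes "\<And>g. g \<in> of_type xs \<Longrightarrow> d dvd card (cl g)"
  shows "d dvd N xs"
  unfolding N_def
proof (rule conj_closed_dvd)
  show "cl g \<subseteq> of_type xs" "d dvd card (cl g)" if "g \<in> of_type xs" for g
    using that cl_subset_type assms by auto
qed (simp add: of_type_def)

lemma N_zero_iff: "N xs = 0 \<longleftrightarrow> of_type xs = {}"
  using of_type_finite[of xs] by (simp add: N_def)

end

section \<open>Conjugacy classes in degree 12\<close>

text \<open>The candidates with a 9-cycle (indices 12 and 13) are ruled out only later, by counting.\<close>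

definition types12 :: "nat list list" where
  "types12 = [[1,1,1,1,1,1,1,1,1,1,1,1], [2,2,2,2,1,1,1,1], [2,2,2,2,2,2], [3,3,3,1,1,1], [3,3,3,3],
     [4,4,1,1,1,1], [4,4,2,2], [5,5,1,1], [6,3,2,1], [6,6], [8,2,1,1], [8,4], [9,1,1,1], [9,3], [10,2], [11,1]]"

text \<open>Parity and the fixed points of powers leave 16 of the 77 partitions of 12.\<close>

lemma types12_eq: "filter (sharp_cycle_list 12 5) (partitions 12 12) = types12"
  unfolding types12_def by code_simp

locale sharp5_12 = sharp_alt_group S G 5 for S :: "'a set" and G +
  assumes card_S: "card S = 12"
begin

lemma card_G_12: "card G = 95040"
proof -
  have "{12 - 5 + 1..12} = {8, 9, 10, 11, 12 :: nat}" by auto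
  then show ?thesis unfolding card_G card_tuples[OF kS] card_S by simp
qed

lemma cyc_list_types12: "g \<in> G \<Longrightarrow> cyc_list g \<in> set types12"
  using cyc_list_mem[of g] unfolding card_S types12_eq by (simp add: types12_def)

text \<open>Coefficients and unknowns enter as explicit lists, so that each instance becomes a
  linear equation with numerals.\<close>

lemma moment12:
  assumes "\<forall>l\<in>set ls. l > 0" "sum_list ls \<le> 5"
    and cs: "map (\<lambda>xs. cyc_count (mset xs) ls) types12 = cs" and ns: "map N types12 = ns"
  shows "sum_list (map2 (*) ns cs) = 95040"
proof -
  have "(\<Sum>xs\<leftarrow>types12. N xs * cyc_count (mset xs) ls) = 95040"
    using type_moment[OF _ cyc_list_types12 assms(1,2)] card_G_12 by (simp add: types12_def)
  moreover have "map (\<lambda>xs. N xs * cyc_count (mset xs) ls) types12 = map2 (*) ns cs"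
    unfolding cs[symmetric] ns[symmetric] by (simp add: map2_map_map)
  ultimately show ?thesis by simp
qed

text \<open>This is all that the moments give: nine counts are determined, and the other seven
  depend on \<open>v\<close> and \<open>a\<close>, the numbers of elements of types 2^6 and
  3^4.\<close>

lemma cycle_equations12:
  obtains v a b c d where
    "map N types12 = [1, 495, v, 1760, a, 2970, b, 9504, 15840, c, 11880, 30 * v, 0, d, 24 * v, 17280]"
    "b + 15 * v = 8910" "40 * v + a + c + d = 26400" "4 * a + d = 10560"
proof -
  obtain n0 n1 n2 n3 n4 n5 n6 n7 n8 n9 n10 n11 n12 n13 n14 n15 where
    ns: "map N types12 = [n0, n1, n2, n3, n4, n5, n6, n7, n8, n9, n10, n11, n12, n13, n14, n15]"
    by (simp add: types12_def)
  note m = moment12[OF _ _ _ ns]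
  \<comment> \<open>The coefficients are the values of \<open>cyc_count\<close> on the sixteen
    candidates. Here 192 = 8 * 4 * 3 * 2, since 2^4 is the only type with a 2-cycle and three fixed
    points. Each of the first five systems occurs in a single type and gives its count at
    once.\<close>
  have e0: "sum_list (map2 (*) [n0, n1, n2, n3, n4, n5, n6, n7, n8, n9, n10, n11, n12, n13, n14, n15] [0, 192, 0, 0, 0, 0, 0, 0, 0, 0, 0, 0, 0, 0, 0, 0]) = 95040"
    by (rule m[of "[1, 1, 1, 2]"]) (simp, simp, simp add: types12_def)
  have e1: "sum_list (map2 (*) [n0, n1, n2, n3, n4, n5, n6, n7, n8, n9, n10, n11, n12, n13, n14, n15] [0, 0, 0, 0, 0, 32, 0, 0, 0, 0, 0, 0, 0, 0, 0, 0]) = 95040"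
    by (rule m[of "[1, 4]"]) (simp, simp, simp add: types12_def)
  have e2: "sum_list (map2 (*) [n0, n1, n2, n3, n4, n5, n6, n7, n8, n9, n10, n11, n12, n13, n14, n15] [0, 0, 0, 0, 0, 0, 0, 10, 0, 0, 0, 0, 0, 0, 0, 0]) = 95040"
    by (rule m[of "[5]"]) (simp, simp, simp add: types12_def)
  have e3: "sum_list (map2 (*) [n0, n1, n2, n3, n4, n5, n6, n7, n8, n9, n10, n11, n12, n13, n14, n15] [0, 0, 0, 54, 0, 0, 0, 0, 0, 0, 0, 0, 0, 0, 0, 0]) = 95040"
    by (rule m[of "[1, 1, 3]"]) (simp, simp, simp add: types12_def)
  have e4: "sum_list (map2 (*) [n0, n1, n2, n3, n4, n5, n6, n7, n8, n9, n10, n11, n12, n13, n14, n15] [0, 0, 0, 0, 0, 0, 0, 0, 6, 0, 0, 0, 0, 0, 0, 0]) = 95040"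
    by (rule m[of "[3, 2]"]) (simp, simp, simp add: types12_def)
  have e5: "n0 = 1"
  proof -
    have "g = id" if "g \<in> of_type (types12 ! 0)" for g
      using fx_full_iff[of g 1] that by (simp add: of_type_def types12_def fx_def card_S)
    moreover have "id \<in> of_type (types12 ! 0)"
    proof -
      have "fx (cyc_list id) 1 = 12" using fx_full_iff[OF id_mem, of 1] by (simp add: card_S)
      moreover have "list_all (\<lambda>xs. fx xs 1 = 12 \<longrightarrow> xs = types12 ! 0) types12" by code_simp
      ultimately show ?thesis
        using cyc_list_types12[OF id_mem] id_mem unfolding of_type_def list_all_iff by blast
    qed
    ultimately have "of_type (types12 ! 0) = {id}" by blast
    moreover have "N (types12 ! 0) = n0" using arg_cong[OF ns, of "\<lambda>xs. xs ! 0"] by (simp add: types12_def)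
    ultimately show ?thesis by (simp add: N_def)
  qed
  have e6: "sum_list (map2 (*) [n0, n1, n2, n3, n4, n5, n6, n7, n8, n9, n10, n11, n12, n13, n14, n15] [0, 32, 0, 0, 0, 0, 0, 0, 2, 0, 4, 0, 0, 0, 0, 0]) = 95040"
    by (rule m[of "[2, 1]"]) (simp, simp, simp add: types12_def)
  have e7: "sum_list (map2 (*) [n0, n1, n2, n3, n4, n5, n6, n7, n8, n9, n10, n11, n12, n13, n14, n15] [1320, 24, 0, 6, 0, 24, 0, 0, 0, 0, 0, 0, 6, 0, 0, 0]) = 95040"
    by (rule m[of "[1, 1, 1]"]) (simp, simp, simp add: types12_def)
  have e8: "sum_list (map2 (*) [n0, n1, n2, n3, n4, n5, n6, n7, n8, n9, n10, n11, n12, n13, n14, n15] [12, 4, 0, 3, 0, 4, 0, 2, 1, 0, 2, 0, 3, 0, 0, 1]) = 95040"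
    by (rule m[of "[1]"]) (simp, simp, simp add: types12_def)
  have e9: "sum_list (map2 (*) [n0, n1, n2, n3, n4, n5, n6, n7, n8, n9, n10, n11, n12, n13, n14, n15] [0, 0, 0, 0, 0, 8, 8, 0, 0, 0, 0, 4, 0, 0, 0, 0]) = 95040"
    by (rule m[of "[4]"]) (simp, simp, simp add: types12_def)
  have e10: "sum_list (map2 (*) [n0, n1, n2, n3, n4, n5, n6, n7, n8, n9, n10, n11, n12, n13, n14, n15] [0, 48, 120, 0, 0, 0, 8, 0, 0, 0, 0, 0, 0, 0, 0, 0]) = 95040"
    by (rule m[of "[2, 2]"]) (simp, simp, simp add: types12_def)
  have e11: "sum_list (map2 (*) [n0, n1, n2, n3, n4, n5, n6, n7, n8, n9, n10, n11, n12, n13, n14, n15] [0, 8, 12, 0, 0, 0, 4, 0, 2, 0, 2, 0, 0, 0, 2, 0]) = 95040"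
    by (rule m[of "[2]"]) (simp, simp, simp add: types12_def)
  have e12: "sum_list (map2 (*) [n0, n1, n2, n3, n4, n5, n6, n7, n8, n9, n10, n11, n12, n13, n14, n15] [0, 0, 0, 9, 12, 0, 0, 0, 3, 0, 0, 0, 0, 3, 0, 0]) = 95040"
    by (rule m[of "[3]"]) (simp, simp, simp add: types12_def)
  have e13: "sum_list (map2 (*) [n0, n1, n2, n3, n4, n5, n6, n7, n8, n9, n10, n11, n12, n13, n14, n15] [1, 1, 1, 1, 1, 1, 1, 1, 1, 1, 1, 1, 1, 1, 1, 1]) = 95040"
    by (rule m[of "[]"]) (simp, simp, simp add: types12_def)
  note e = e0 e1 e2 e3 e4 e5 e6 e7 e8 e9 e10 e11 e12 e13
  note f = e[simplified]
  have "n0 = 1" "n1 = 495" "n5 = 2970" "n7 = 9504" "n3 = 1760" "n8 = 15840" using f by linarith+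
  moreover from this have "n10 = 11880" "n12 = 0" using f by linarith+
  moreover from calculation have "n15 = 17280" using f by linarith
  moreover from calculation have "n11 = 30 * n2" "n14 = 24 * n2" "n6 + 15 * n2 = 8910" using f by linarith+
  moreover from calculation have "40 * n2 + n4 + n9 + n13 = 26400" "4 * n4 + n13 = 10560" using f by linarith+
  ultimately show ?thesis using that[of n2 n4 n6 n9 n13] ns by simp
qed

end

section \<open>Powers, roots and the splitting of a type into classes\<close>

lemma funpow_comp_commute:
  assumes "t \<circ> f = f \<circ> t"
  shows "(t \<circ> f) ^^ n = t ^^ n \<circ> f ^^ n"
proof -
  have c: "f ((t ^^ n) x) = (t ^^ n) (f x)" for n x
  proof (induction n)
    case (Suc n)
    have "f (t y) = t (f y)" for y using fun_cong[OF assms, of y] by simp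
    then show ?case using Suc by simp
  qed simp
  show ?thesis
    by (induction n) (simp_all add: fun_eq_iff c)
qed

lemma funpow_conjugate:
  assumes "bij h"
  shows "(h \<circ> g \<circ> inv' h) ^^ n = h \<circ> (g ^^ n) \<circ> inv' h"
proof (induction n)
  case 0
  then show ?case using assms by (simp add: fun_eq_iff bij_is_surj surj_f_inv_f)
next
  case (Suc n)
  then show ?case using assms by (simp add: fun_eq_iff bij_is_inj inv_f_f)
qed

context perm_group
begin

text \<open>Cauchy's theorem for the centralizer, taken from Sylow's theorem with exponent 1: a
  nontrivial element of a subgroup of order \<open>p\<close>.\<close>

lemma cauchy_cent:
  assumes g: "g \<in> G" and p: "Factorial_Ring.prime (p :: nat)" "p dvd card (cent g)"
  obtains f where "f \<in> cent g" "f \<noteq> id" "f ^^ p = id"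
proof -
  define C :: "('a \<Rightarrow> 'a) monoid" where "C = \<lparr>carrier = cent g, mult = (\<circ>), one = id\<rparr>"
  have C: "group C"
  proof (rule groupI)
    fix x assume "x \<in> carrier C"
    then show "\<exists>y\<in>carrier C. y \<otimes>\<^bsub>C\<^esub> x = \<one>\<^bsub>C\<^esub>"
      using cent_props(4)[OF g, of x] inv_simps(4)[of x] by (auto simp: C_def cent_def)
  qed (use cent_props[OF g] in \<open>auto simp: C_def comp_assoc\<close>)
  interpret C: group C by (rule C)
  obtain m where "card (cent g) = p * m" using p(2) by (auto elim: dvdE)
  then have "\<exists>H. subgroup H C \<and> card H = p ^ 1"
    using cent_props(5)[OF g] p(1) by (intro sylow_thm[where m = m] C) (auto simp: C_def Coset.order_def)
  then obtain H where H: "subgroup H C" "card H = p" by auto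
  have p2: "p \<ge> 2" using p(1) by (rule prime_ge_2_nat)
  have "\<exists>f\<in>H. f \<noteq> id"
  proof (rule ccontr)
    assume "\<not> (\<exists>f\<in>H. f \<noteq> id)"
    then have "H \<subseteq> {id}" by blast
    then have "card H \<le> 1" using card_mono[of "{id}" H] by simp
    then show False using H(2) p2 by simp
  qed
  then obtain f where f: "f \<in> H" "f \<noteq> id" by blast
  interpret H: group "C\<lparr>carrier := H\<rparr>" using subgroup.subgroup_is_group[OF H(1) C] .
  have pw: "f [^]\<^bsub>C\<lparr>carrier := H\<rparr>\<^esub> n = f ^^ n" for n :: nat
    by (induction n) (simp_all add: C_def funpow_swap1 fun_eq_iff)
  have "f [^]\<^bsub>C\<lparr>carrier := H\<rparr>\<^esub> p = id"
    using H.pow_order_eq_1[of f] f(1) H(2) by (simp add: Coset.order_def C_def)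
  then show ?thesis using that[of f] f subgroup.mem_carrier[OF H(1) f(1)] pw by (simp add: C_def)
qed

lemma centD:
  assumes "h \<in> cent g"
  shows "h \<in> G" "h \<circ> g = g \<circ> h" "h (g x) = g (h x)"
  using assms by (auto simp: cent_def fun_eq_iff)

lemma cl_funpow: "x \<in> cl g \<Longrightarrow> x ^^ n \<in> cl (g ^^ n)"
  using funpow_conjugate[OF permutes_bij[OF perm]] unfolding cl_def by blast

end

context sharp_alt_group
begin

text \<open>If the order of the centralizer divides \<open>card G / s\<close>, then \<open>s\<close>
  divides its index, which is the class size.\<close>

lemma of_type_dvd:
  assumes ls: "\<forall>l\<in>set ls. l > 0" "sum_list ls \<ge> k" and s: "s * cyc_count (mset xs) ls = card G"
  shows "g \<in> of_type xs \<Longrightarrow> s dvd card (cl g)" "s dvd N xs"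
proof -
  show *: "s dvd card (cl g)" if g: "g \<in> of_type xs" for g
  proof -
    obtain q where q: "cyc_count (mset xs) ls = card (cent g) * q" using cent_dvd[OF g ls] by (elim dvdE)
    have "card (cent g) > 0" using cent_props(2,5)[of g] g by (auto simp: card_gt_0_iff of_type_def)
    moreover have "card (cl g) * card (cent g) = s * q * card (cent g)"
      using class_equation[OF g] s q by (simp add: mult_ac)
    ultimately have "card (cl g) = s * q" by simp
    then show ?thesis by simp
  qed
  show "s dvd N xs" by (rule type_dvd[OF *])
qed

text \<open>Conjugating the roots conjugates their powers. This settles the types whose centralizer
  bound is too coarse for \<open>single_class\<close>.\<close>

lemma root_class:
  assumes r: "\<And>t. t \<in> of_type xs \<Longrightarrow> \<exists>u\<in>of_type ys. t = u ^^ e"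
    and c: "\<And>u. u \<in> of_type ys \<Longrightarrow> cl u = of_type ys" and t: "t \<in> of_type xs"
  shows "cl t = of_type xs"
proof
  show "cl t \<subseteq> of_type xs" by (rule cl_subset_type[OF t])
  obtain u where u: "u \<in> of_type ys" "t = u ^^ e" using r[OF t] by blast
  show "of_type xs \<subseteq> cl t"
  proof
    fix x assume "x \<in> of_type xs"
    then obtain v where v: "v \<in> of_type ys" "x = v ^^ e" using r by blast
    then show "x \<in> cl t" using cl_funpow[of v u e] c[OF u(1)] u(2) by simp
  qed
qed

text \<open>Each class of this type has at least \<open>s\<close> elements, so \<open>2 * s\<close>
  elements leave room for two classes only, and two non-conjugate elements exhibit them.\<close>

lemma two_classes:
  assumes g: "g \<in> of_type xs" and g': "g' \<in> of_type xs" and n: "g' \<notin> cl g"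
    and ls: "\<forall>l\<in>set ls. l > 0" "sum_list ls \<ge> k" and s: "s * cyc_count (mset xs) ls = card G"
    and N: "N xs = 2 * s"
  shows "card (cl g) = s \<and> card (cl g') = s \<and> cl g \<inter> cl g' = {} \<and> of_type xs = cl g \<union> cl g'"
proof -
  have fin: "finite (cl x)" if "x \<in> of_type xs" for x
    using finite_subset[OF cl_subset_type[OF that] of_type_finite] .
  have pos: "card (cl x) > 0" if "x \<in> of_type xs" for x
    using self_cl[of x] fin[OF that] by (auto simp: card_gt_0_iff)
  have ge: "card (cl x) \<ge> s" if "x \<in> of_type xs" for x
    using of_type_dvd(1)[OF ls s that] pos[OF that] by (rule dvd_imp_le)
  have disj: "cl g \<inter> cl g' = {}"
  proof (rule ccontr)
    assume "cl g \<inter> cl g' \<noteq> {}"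
    then obtain x where x: "x \<in> cl g" "x \<in> cl g'" by blast
    have "cl g = cl g'" using cl_eq[OF _ x(1)] cl_eq[OF _ x(2)] g g' by (simp add: of_type_def)
    then show False using n self_cl by blast
  qed
  have sub: "cl g \<union> cl g' \<subseteq> of_type xs" using cl_subset_type g g' by blast
  have un: "card (cl g \<union> cl g') = card (cl g) + card (cl g')"
    using disj fin g g' by (intro card_Un_disjoint) auto
  have "card (cl g) + card (cl g') \<le> 2 * s"
    using card_mono[OF of_type_finite sub] un N by (simp add: N_def)
  then have c: "card (cl g) = s" "card (cl g') = s" using ge[OF g] ge[OF g'] by simp_all
  then have "cl g \<union> cl g' = of_type xs"
    using sub un N by (intro card_seteq of_type_finite) (auto simp: N_def)
  then show ?thesis using c disj by simp
qed

text \<open>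
  An element inverting an 11-cycle can be chosen to fix a point of it; its square is then the identity,
  and it moves the ten other points of the cycle.
\<close>

lemma inverse_not_conjugate_11:
  assumes g: "g \<in> G" and c: "count (ct g) 11 = 1" and S: "card S \<le> 12"
    and T: "\<And>u. u \<in> G \<Longrightarrow> fx (cyc_list u) 2 = card S \<Longrightarrow> u \<noteq> id \<Longrightarrow> fx (cyc_list u) 1 > card S - 10 \<or> fx (cyc_list u) 1 = 0"
  shows "inv' g \<notin> cl g"
proof
  assume "inv' g \<in> cl g"
  then obtain h where h: "h \<in> G" "inv' g = h \<circ> g \<circ> inv' h" by (auto simp: cl_def)
  note p = perm[OF g] finS
  have "permutation g" using p by (auto simp: permutation_permutes)
  note orb = orbit_altdef_permutation[OF this]
  have hg: "h (g x) = inv' g (h x)" for x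
    unfolding h(2) using inv_simps(1)[OF h(1)] by simp
  have bg: "bij g" "bij h" using perm[OF g] perm[OF h(1)] permutes_bij by auto
  define P where "P = {x \<in> S. card (orbit g x) = 11}"
  have cP: "card P = 11" using card_period_points[OF p, of 11] c by (simp add: P_def)
  then obtain y where y: "y \<in> P" by (metis card.empty ex_in_conv zero_neq_numeral)
  have oP: "orbit g y = P"
  proof (rule card_subset_eq)
    show "finite P" using finS by (simp add: P_def)
    show "orbit g y \<subseteq> P"
    proof
      fix z assume z: "z \<in> orbit g y"
      have "orbit g z = orbit g y" by (rule permutes_orbit_facts(2)[OF p z])
      moreover have "z \<in> S" using permutes_orbit_facts(3)[OF p, of y] y z by (auto simp: P_def)
      ultimately show "z \<in> P" using y by (simp add: P_def)
    qed
    show "card (orbit g y) = card P" using y cP by (simp add: P_def)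
  qed
  have "orbit (inv' g) (h y) = h ` orbit g y" unfolding h(2) by (rule orbit_conjugate[OF bg(2)])
  moreover have "orbit (inv' g) (h y) = orbit g (h y)"
    using orbit_inv_eq[of g "h y"] p by (auto simp: permutation_permutes)
  ultimately have "card (orbit g (h y)) = 11"
    using y card_image[OF inj_on_subset[OF bij_is_inj[OF bg(2)] subset_UNIV], of "orbit g y"] by (simp add: P_def)
  then have "h y \<in> P" using y perm[OF h(1)] by (simp add: P_def permutes_in_image)
  then have "orbit g (h y) = P" using oP permutes_orbit_facts(2)[OF p, of "h y" y] by simp
  then obtain m where m: "y = (g ^^ m) (h y)"
    using y unfolding orb by blast
  \<comment> \<open>A factor that is a power of \<open>g\<close> does not disturb the inversion of
    \<open>g\<close>, and with the right exponent it makes \<open>y\<close> a fixed point.\<close>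
  define r where "r = g ^^ m \<circ> h"
  have rG: "r \<in> G" unfolding r_def by (intro comp_mem pow_mem g h(1))
  have ry: "r y = y" using m by (simp add: r_def)
  have rg: "r (g x) = inv' g (r x)" for x
  proof -
    have "(g ^^ m) (inv' g z) = inv' g ((g ^^ m) z)" for z
    proof -
      have "(g ^^ m) (g (inv' g z)) = g ((g ^^ m) (inv' g z))" by (simp add: funpow_swap1)
      then show ?thesis using inv_simps(1,2)[OF g] by metis
    qed
    then show ?thesis by (simp add: r_def hg)
  qed
  have rgi: "g (r ((g ^^ i) y)) = r (inv' g ((g ^^ i) y))" for i
    using rg[of "inv' g ((g ^^ i) y)"] inv_simps(2)[OF g] by metis
  \<comment> \<open>\<open>r\<close> reflects the cycle, taking the point \<open>i\<close> steps
    after \<open>y\<close> to the point \<open>i\<close> steps before it; the equation avoids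
    inverse powers.\<close>
  have rp: "(g ^^ i) (r ((g ^^ i) y)) = y" for i
  proof (induction i)
    case 0
    then show ?case using ry by simp
  next
    case (Suc i)
    have "(g ^^ Suc i) w = (g ^^ i) (g w)" for w by (simp add: funpow_swap1)
    then have "(g ^^ Suc i) (r ((g ^^ Suc i) y)) = (g ^^ i) (g (r (g ((g ^^ i) y))))" by simp
    also have "\<dots> = (g ^^ i) (g (inv' g (r ((g ^^ i) y))))" by (simp only: rg)
    finally have "(g ^^ Suc i) (r ((g ^^ Suc i) y)) = (g ^^ i) (g (inv' g (r ((g ^^ i) y))))" .
    then show ?case using Suc inv_simps(2)[OF g] by simp
  qed
  have gi: "inj (g ^^ i)" for i using permutes_inj[OF perm[OF pow_mem[OF g]]] .
  have "r \<noteq> id"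
  proof
    assume "r = id"
    then have "(g ^^ 2) y = y" using rp[of 1] by (simp add: numeral_2_eq_2)
    then show False using permutes_orbit_facts(6)[OF p, of 2 y] y by (simp add: P_def)
  qed
  have rr: "r (r x) = x" if x: "x \<in> P" for x
  proof -
    obtain i where i: "x = (g ^^ i) y"
      using x oP unfolding orb by blast
    have rgp: "r ((g ^^ j) z) = (inv' g ^^ j) (r z)" for j z by (induction j) (simp_all add: rg)
    have irgp: "r ((inv' g ^^ j) z) = (g ^^ j) (r z)" for j z
    proof (induction j)
      case (Suc j)
      have "r (inv' g w) = g (r w)" for w using rg[of "inv' g w"] inv_simps(2)[OF g] by metis
      then show ?case using Suc by simp
    qed simp
    have "r (r x) = r ((inv' g ^^ i) (r y))" by (simp only: i rgp)
    also have "\<dots> = x" by (simp only: irgp ry i)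
    finally show ?thesis .
  qed
  \<comment> \<open>At most one point lies off the 11-cycle. As \<open>r\<close> preserves the
    cycle, it fixes that point.\<close>
  have cSP: "card (S - P) \<le> 1"
    using cP S card_Diff_subset[of P S] finS by (simp add: P_def)
  have "r (r x) = x" if x: "x \<in> S" for x
  proof (cases "x \<in> P")
    case False
    have rP: "r z \<in> P" if z: "z \<in> P" for z
    proof -
      obtain i where i: "z = (g ^^ i) y"
        using z oP unfolding orb by blast
      have "(g ^^ i) (r z) \<in> P" using rp[of i] y by (simp add: i)
      moreover have "r z \<in> S" using perm[OF rG] z by (simp add: P_def permutes_in_image)
      ultimately show ?thesis
        using permutes_orbit_facts(2)[OF p] funpow_in_orbit[OF permutes_orbit_facts(1)[OF p], of i "r z"]
        by (simp add: P_def)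
    qed
    have "r ` P = P" using rP finS permutes_inj_on[OF perm[OF rG], of P]
      by (intro card_subset_eq) (auto simp: P_def card_image)
    have "r x \<notin> P"
    proof
      assume "r x \<in> P"
      then have "r x \<in> r ` P" using \<open>r ` P = P\<close> by simp
      then have "x \<in> P" using permutes_inj[OF perm[OF rG]] by (auto dest: injD)
      then show False using False by simp
    qed
    moreover have "r x \<in> S" using perm[OF rG] x by (simp add: permutes_in_image)
    ultimately have "r x = x" using cSP False x finS by (metis DiffI card_le_Suc0_iff_eq finite_Diff One_nat_def)
    then show ?thesis by simp
  qed (rule rr)
  then have "r (r x) = x" for x using permutes_not_in[OF perm[OF rG], of x] by (cases "x \<in> S") simp_all
  then have "r ^^ 2 = id" by (simp add: numeral_2_eq_2 fun_eq_iff)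
  then have f2: "fx (cyc_list r) 2 = card S" using fx_full_iff[OF rG] by simp
  \<comment> \<open>A fixed point \<open>i\<close> steps after \<open>y\<close> gives 11 dvd 2 i,
    hence 11 dvd i. So \<open>r\<close> has between 1 and \<open>card S - 10\<close> fixed points,
    which the premise \<open>T\<close> forbids for an involution.\<close>
  have fixP: "x = y" if x: "x \<in> P" "r x = x" for x
  proof -
    obtain i where i: "x = (g ^^ i) y"
      using x(1) oP unfolding orb by blast
    have "(g ^^ (i + i)) y = y" using rp[of i] x(2) by (simp add: i funpow_add)
    then have "11 dvd i + i" using permutes_orbit_facts(6)[OF p, of "i + i" y] y by (simp add: P_def)
    then have "11 dvd i" by presburger
    then show ?thesis using permutes_orbit_facts(6)[OF p, of i y] y by (simp add: P_def i)
  qed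
  have f1: "fx (cyc_list r) 1 = card {x \<in> S. r x = x}" using card_fix_pow[OF rG, of 1] by simp
  have sub: "{x \<in> S. r x = x} \<subseteq> insert y (S - P)" using fixP by blast
  have "card {x \<in> S. r x = x} \<le> Suc (card (S - P))"
  proof -
    have "card {x \<in> S. r x = x} \<le> card (insert y (S - P))" using finS by (intro card_mono sub) simp
    then show ?thesis using finS by (simp add: card_insert_if split: if_splits)
  qed
  moreover have "card (S - P) = card S - 11" using cP card_Diff_subset[of P S] finS by (simp add: P_def)
  moreover have "card S \<ge> 11" using cP card_mono[OF finS, of P] by (simp add: P_def)
  ultimately have "fx (cyc_list r) 1 \<le> card S - 10" using f1 by simp
  moreover have "y \<in> {x \<in> S. r x = x}" using ry y by (simp add: P_def)
  then have "fx (cyc_list r) 1 \<noteq> 0" using f1 finS by auto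
  ultimately show False using T[OF rG f2 \<open>r \<noteq> id\<close>] by simp
qed

end

lemma funpow_mod_id: "g ^^ m = id \<Longrightarrow> g ^^ n = g ^^ (n mod m)"
  using funpow_mod_eq[of m g] by (auto simp: fun_eq_iff)

text \<open>Divisibility together with a lower bound leaves only \<open>m\<close>,
  \<open>m / 2\<close>, ..., \<open>m / s\<close> as possible orders.\<close>

lemma cofactor_cases:
  fixes c m s :: nat
  assumes "c dvd m" "s * c \<ge> m" "m > 0"
  obtains q where "0 < q" "q \<le> s" "m = c * q"
proof -
  obtain q where q: "m = c * q" using assms(1) by (elim dvdE)
  have "c > 0" "q > 0" using q assms(3) by (auto intro: Nat.gr0I)
  moreover have "c * q \<le> c * s" using assms(2) q by (simp add: mult.commute)
  ultimately show ?thesis using that[of q] q by simp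
qed

section \<open>Remaining counts and single classes in degree 12\<close>

context sharp5_12
begin

text \<open>A few fixed-point numbers of powers suffice to recognize a type; that \<open>P\<close>
  isolates one candidate is checked by evaluation.\<close>

lemma of_type12I:
  assumes "u \<in> G" "P (cyc_list u)" "list_all (\<lambda>xs. P xs \<longrightarrow> xs = types12 ! i) types12"
  shows "u \<in> of_type (types12 ! i)"
  using assms cyc_list_types12[of u] unfolding of_type_def list_all_iff by blast

lemma of_type12D:
  assumes "u \<in> of_type (types12 ! i)"
  shows "u \<in> G" "fx (cyc_list u) d = fx (types12 ! i) d" "fx (types12 ! i) d = 12 \<longleftrightarrow> u ^^ d = id"
  using assms fx_full_iff[of u d] by (auto simp: of_type_def card_S)

lemma commuting_product:
  assumes "t \<in> G" "f \<in> cent t"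
  shows "t \<circ> f \<in> G" "(t \<circ> f) ^^ n = t ^^ n \<circ> f ^^ n"
  using centD[OF assms(2)] comp_mem assms(1) funpow_comp_commute[of t f n] by auto

text \<open>The product of commuting elements of orders 2 and 3 has order 6, and its cube is
  \<open>t\<close>, which is free of fixed points. Only type 6^2 fits. The next two lemmas are
  analogous and in addition recover the given element as a power of the product.\<close>

lemma product_2_3:
  assumes t: "t \<in> of_type (types12 ! 2)" and f: "f \<in> cent t" "f \<noteq> id" "f ^^ 3 = id"
  shows "t \<circ> f \<in> of_type (types12 ! 9)"
proof -
  note u = commuting_product[OF of_type12D(1)[OF t] f(1)]
  have t2: "t ^^ 2 = id" using of_type12D(3)[OF t, of 2] by (simp add: types12_def fx_def)
  have "(t \<circ> f) ^^ 3 = t" using u(2)[of 3] funpow_mod_id[OF t2, of 3] f(3) by simp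
  then have "fx (cyc_list (t \<circ> f)) 3 = fx (types12 ! 2) 1" using fx_pow[OF u(1), of 3 1] of_type12D(2)[OF t, of 1] by simp
  then have 3: "fx (cyc_list (t \<circ> f)) 3 = 0" by (simp add: types12_def fx_def)
  have "(t \<circ> f) ^^ 6 = id" using u(2)[of 6] funpow_mod_id[OF t2, of 6] funpow_mod_id[OF f(3), of 6] by simp
  then have 6: "fx (cyc_list (t \<circ> f)) 6 = 12" using fx_full_iff[OF u(1), of 6] card_S by simp
  have "(t \<circ> f) ^^ 2 \<noteq> id"
  proof
    assume "(t \<circ> f) ^^ 2 = id"
    then have "f ^^ 2 = id" using u(2)[of 2] t2 by simp
    then show False using funpow_mod_id[where g = f and m = 2 and n = 3] f by simp
  qed
  then have 2: "fx (cyc_list (t \<circ> f)) 2 \<noteq> 12" using fx_full_iff[OF u(1), of 2] card_S by simp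
  show ?thesis
    by (rule of_type12I[where P = "\<lambda>xs. fx xs 3 = 0 \<and> fx xs 6 = 12 \<and> fx xs 2 \<noteq> 12", OF u(1)])
      (use 2 3 6 in simp, code_simp)
qed

lemma product_2_5:
  assumes t: "t \<in> of_type (types12 ! 2)" and f: "f \<in> cent t" "f \<noteq> id" "f ^^ 5 = id"
  shows "t \<circ> f \<in> of_type (types12 ! 14)" "t = (t \<circ> f) ^^ 5"
proof -
  note u = commuting_product[OF of_type12D(1)[OF t] f(1)]
  have t2: "t ^^ 2 = id" using of_type12D(3)[OF t, of 2] by (simp add: types12_def fx_def)
  show p5: "t = (t \<circ> f) ^^ 5" using u(2)[of 5] funpow_mod_id[OF t2, of 5] f(3) by simp
  then have "fx (cyc_list (t \<circ> f)) 5 = fx (types12 ! 2) 1" using fx_pow[OF u(1), of 5 1] of_type12D(2)[OF t, of 1] by simp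
  then have 5: "fx (cyc_list (t \<circ> f)) 5 = 0" by (simp add: types12_def fx_def)
  have "(t \<circ> f) ^^ 10 = id" using u(2)[of 10] funpow_mod_id[OF t2, of 10] funpow_mod_id[OF f(3), of 10] by simp
  then have 10: "fx (cyc_list (t \<circ> f)) 10 = 12" using fx_full_iff[OF u(1), of 10] card_S by simp
  have "(t \<circ> f) ^^ 2 \<noteq> id"
  proof
    assume "(t \<circ> f) ^^ 2 = id"
    then have "f ^^ 2 = id" using u(2)[of 2] t2 by simp
    then show False using funpow_mod_id[where g = f and m = 2 and n = 5] f by simp
  qed
  then have 2: "fx (cyc_list (t \<circ> f)) 2 \<noteq> 12" using fx_full_iff[OF u(1), of 2] card_S by simp
  show "t \<circ> f \<in> of_type (types12 ! 14)"
    by (rule of_type12I[where P = "\<lambda>xs. fx xs 5 = 0 \<and> fx xs 10 = 12 \<and> fx xs 2 \<noteq> 12", OF u(1)])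
      (use 2 5 10 in simp, code_simp)
qed

lemma product_3_2:
  assumes z: "z \<in> of_type (types12 ! 4)" and f: "f \<in> cent z" "f \<noteq> id" "f ^^ 2 = id"
  shows "z \<circ> f \<in> of_type (types12 ! 9)" "z = (z \<circ> f) ^^ 4"
proof -
  note u = commuting_product[OF of_type12D(1)[OF z] f(1)]
  have z3: "z ^^ 3 = id" using of_type12D(3)[OF z, of 3] by (simp add: types12_def fx_def)
  show "z = (z \<circ> f) ^^ 4" using u(2)[of 4] funpow_mod_id[OF z3, of 4] funpow_mod_id[OF f(3), of 4] by simp
  have "(z \<circ> f) ^^ 2 = z ^^ 2" using u(2)[of 2] f(3) by simp
  then have "fx (cyc_list (z \<circ> f)) 2 = fx (types12 ! 4) 2"
    using fx_pow[OF u(1), of 2 1] fx_pow[OF of_type12D(1)[OF z], of 2 1] of_type12D(2)[OF z, of 2] by simp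
  then have 2: "fx (cyc_list (z \<circ> f)) 2 = 0" by (simp add: types12_def fx_def)
  have "(z \<circ> f) ^^ 6 = id" using u(2)[of 6] funpow_mod_id[OF z3, of 6] funpow_mod_id[OF f(3), of 6] by simp
  then have 6: "fx (cyc_list (z \<circ> f)) 6 = 12" using fx_full_iff[OF u(1), of 6] card_S by simp
  have "(z \<circ> f) ^^ 3 \<noteq> id" using u(2)[of 3] z3 funpow_mod_id[OF f(3), of 3] f(2) by simp
  then have 3: "fx (cyc_list (z \<circ> f)) 3 \<noteq> 12" using fx_full_iff[OF u(1), of 3] card_S by simp
  show "z \<circ> f \<in> of_type (types12 ! 9)"
    by (rule of_type12I[where P = "\<lambda>xs. fx xs 2 = 0 \<and> fx xs 6 = 12 \<and> fx xs 3 \<noteq> 12", OF u(1)])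
      (use 2 3 6 in simp, code_simp)
qed

lemma cube_6_6:
  assumes g: "g \<in> of_type (types12 ! 9)"
  shows "g ^^ 3 \<in> of_type (types12 ! 2)"
proof (rule of_type12I[where P = "\<lambda>xs. fx xs 1 = 0 \<and> fx xs 2 = 12"])
  note gG = of_type12D(1)[OF g]
  show "g ^^ 3 \<in> G" by (rule pow_mem[OF gG])
  show "fx (cyc_list (g ^^ 3)) 1 = 0 \<and> fx (cyc_list (g ^^ 3)) 2 = 12"
    using fx_pow[OF gG, of 3 1] fx_pow[OF gG, of 3 2] of_type12D(2)[OF g, of 3] of_type12D(2)[OF g, of 6]
    by (simp add: types12_def fx_def)
qed code_simp

text \<open>960 = 12 * 10 * 8 counts ordered triples of 2-cycles, and 95040 / 396 = 240 is a quarter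
  of it.\<close>

lemma centralizer_card_2_6:
  assumes t: "t \<in> of_type (types12 ! 2)" and N: "N (types12 ! 2) = 396"
  obtains q where "0 < q" "q \<le> 4" "960 = card (cent t) * q"
proof (rule cofactor_cases[of "card (cent t)" 960 4])
  show "card (cent t) dvd 960" using cent_dvd[OF t, of "[2,2,2]"] by (simp add: types12_def)
  have "card (cl t) * card (cent t) = 95040" using class_equation[OF t] card_G_12 by simp
  moreover have "card (cl t) * card (cent t) \<le> 396 * card (cent t)" using card_cl_le_N[OF t] N by simp
  ultimately show "960 \<le> 4 * card (cent t)" by simp
qed (use that in auto)

lemma type_counts12:
  "map N types12 = [1, 495, 396, 1760, 2640, 2970, 2970, 9504, 15840, 7920, 11880, 11880, 0, 0, 9504, 17280]"
proof -
  obtain v a b c d where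
    eq: "map N types12 = [1, 495, v, 1760, a, 2970, b, 9504, 15840, c, 11880, 30 * v, 0, d, 24 * v, 17280]"
    and e: "b + 15 * v = 8910" "40 * v + a + c + d = 26400" "4 * a + d = 10560"
    by (rule cycle_equations12)
  have N: "N (types12 ! i) = [1, 495, v, 1760, a, 2970, b, 9504, 15840, c, 11880, 30 * v, 0, d, 24 * v, 17280] ! i"
    if "i < 16" for i
    using nth_map[of i types12 N] that unfolding eq by (simp add: types12_def)
  \<comment> \<open>With \<open>v = 0\<close> the equations force \<open>c > 0\<close>, because
    \<open>a\<close> is at most 2640 and \<open>d\<close> at most 10560. Then an element of type 6^2
    exists, and its cube has type 2^6.\<close>
  have "v \<noteq> 0"
  proof
    assume v: "v = 0"
    then have "N (types12 ! 9) \<noteq> 0" using N[of 9] e by simp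
    then obtain g where "g \<in> of_type (types12 ! 9)" unfolding N_zero_iff by blast
    then have "N (types12 ! 2) \<noteq> 0" unfolding N_zero_iff using cube_6_6 by blast
    then show False using N[of 2] v by simp
  qed
  \<comment> \<open>\<open>24 * v\<close> is a positive multiple of 9504 and, because
    \<open>v \<le> 594\<close>, less than twice that number.\<close>
  have "9504 dvd N (types12 ! 14)"
    by (rule of_type_dvd(2)[of "[10]"]) (simp_all add: types12_def card_G_12)
  then obtain q where q: "24 * v = 9504 * q" using N[of 14] by (auto elim: dvdE)
  have "v \<le> 594" using e(1) by simp
  then have "q = 1" using q \<open>v \<noteq> 0\<close> by (cases q) auto
  then have v: "v = 396" using q by simp
  \<comment> \<open>An element of type 3.9 has at least 95040 / 9 = 10560 conjugates, which uses up
    everything and leaves \<open>c = 0\<close>. Without type 6^2 no element of order 3 centralizes a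
    \<open>t\<close> of type 2^6, so its centralizer has order 320. Then 297 divides all these class
    sizes, but it does not divide 396.\<close>
  have "d = 0"
  proof (rule ccontr)
    assume d0: "d \<noteq> 0"
    have "10560 dvd N (types12 ! 13)"
      by (rule of_type_dvd(2)[of "[9]"]) (simp_all add: types12_def card_G_12)
    then have "10560 \<le> d" using N[of 13] d0 by (auto dest: dvd_imp_le)
    then have c0: "c = 0" using e v by simp
    have "297 dvd N (types12 ! 2)"
    proof (rule type_dvd)
      fix t assume t: "t \<in> of_type (types12 ! 2)"
      obtain q where q: "0 < q" "q \<le> 4" "960 = card (cent t) * q"
        by (rule centralizer_card_2_6[OF t]) (use N[of 2] v in auto)
      have n3: "\<not> 3 dvd card (cent t)"
      proof
        assume d3: "3 dvd card (cent t)"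
        have p3: "Factorial_Ring.prime (3 :: nat)" by simp
        obtain f where f: "f \<in> cent t" "f \<noteq> id" "f ^^ 3 = id"
          by (rule cauchy_cent[OF of_type12D(1)[OF t] p3 d3])
        then have "N (types12 ! 9) \<noteq> 0" unfolding N_zero_iff using product_2_3[OF t f] by blast
        then show False using N[of 9] c0 by simp
      qed
      consider "q = 1" | "q = 2" | "q = 3" | "q = 4" using q by linarith
      then have "card (cent t) = 960 \<or> card (cent t) = 480 \<or> card (cent t) = 320 \<or> card (cent t) = 240"
        using q(3) by cases simp_all
      then have "card (cent t) = 320" using n3 by (elim disjE) simp_all
      then show "297 dvd card (cl t)" using class_equation[OF t] card_G_12 by simp
    qed
    then show False using N[of 2] v by simp
  qed
  then show ?thesis using eq e v by simp
qed

lemma N12: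
  "i < 16 \<Longrightarrow> N (types12 ! i) = [1, 495, 396, 1760, 2640, 2970, 2970, 9504, 15840, 7920, 11880, 11880, 0, 0, 9504, 17280] ! i"
  using nth_map[of i types12 N] unfolding type_counts12 by (simp add: types12_def)

lemma single_class12:
  assumes "g \<in> of_type (types12 ! i)" "i < 16" "\<forall>l\<in>set ls. l > 0" "sum_list ls \<ge> 5"
    "N (types12 ! i) * cyc_count (mset (types12 ! i)) ls = 95040"
  shows "cl g = of_type (types12 ! i)"
  using single_class[of g "types12 ! i" ls] assms card_G_12 by simp

lemma classes12:
  assumes g: "g \<in> of_type (types12 ! i)" and i: "i \<in> {0..<12} \<union> {14}"
  shows "cl g = of_type (types12 ! i)"
proof -
  have r10: "cl g = of_type (types12 ! 14)" if "g \<in> of_type (types12 ! 14)" for g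
    by (rule single_class12[OF that, of "[10]"]) (simp_all add: N12, simp add: types12_def)
  have r66: "cl g = of_type (types12 ! 9)" if "g \<in> of_type (types12 ! 9)" for g
    by (rule single_class12[OF that, of "[6]"]) (simp_all add: N12, simp add: types12_def)
  \<comment> \<open>All four possible orders are multiples of 5, so each involution of this type is
    the fifth power of an element of type 2.10.\<close>
  have r26: "cl t = of_type (types12 ! 2)" if t: "t \<in> of_type (types12 ! 2)" for t
  proof (rule root_class[OF _ r10 t, where e = 5])
    fix t assume t: "t \<in> of_type (types12 ! 2)"
    obtain q where q: "0 < q" "q \<le> 4" "960 = card (cent t) * q"
      by (rule centralizer_card_2_6[OF t]) (auto simp: N12)
    consider "q = 1" | "q = 2" | "q = 3" | "q = 4" using q by linarith
    then have "card (cent t) = 960 \<or> card (cent t) = 480 \<or> card (cent t) = 320 \<or> card (cent t) = 240"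
      using q(3) by cases simp_all
    then have d5: "5 dvd card (cent t)" by (elim disjE) simp_all
    have p5: "Factorial_Ring.prime (5 :: nat)" by simp
    obtain f where f: "f \<in> cent t" "f \<noteq> id" "f ^^ 5 = id"
      by (rule cauchy_cent[OF of_type12D(1)[OF t] p5 d5])
    then show "\<exists>u\<in>of_type (types12 ! 14). t = u ^^ 5" using product_2_5[OF t f] by blast
  qed
  \<comment> \<open>108 = 12 * 9 counts ordered pairs of 3-cycles. The possible orders 108, 54 and
    36 are even, so each element is the fourth power of one of type 6^2.\<close>
  have r34: "cl z = of_type (types12 ! 4)" if z: "z \<in> of_type (types12 ! 4)" for z
  proof (rule root_class[OF _ r66 z, where e = 4])
    fix z assume z: "z \<in> of_type (types12 ! 4)"
    obtain q where q: "0 < q" "q \<le> 3" "108 = card (cent z) * q"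
    proof (rule cofactor_cases[of "card (cent z)" 108 3])
      show "card (cent z) dvd 108" using cent_dvd[OF z, of "[3,3]"] by (simp add: types12_def)
      have "card (cl z) * card (cent z) = 95040" using class_equation[OF z] card_G_12 by simp
      moreover have "card (cl z) * card (cent z) \<le> 2640 * card (cent z)" using card_cl_le_N[OF z] by (simp add: N12)
      ultimately show "108 \<le> 3 * card (cent z)" by simp
    qed auto
    consider "q = 1" | "q = 2" | "q = 3" using q by linarith
    then have "card (cent z) = 108 \<or> card (cent z) = 54 \<or> card (cent z) = 36"
      using q(3) by cases simp_all
    then have d2: "2 dvd card (cent z)" by (elim disjE) simp_all
    have p2: "Factorial_Ring.prime (2 :: nat)" by (rule two_is_prime_nat)
    obtain f where f: "f \<in> cent z" "f \<noteq> id" "f ^^ 2 = id"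
      by (rule cauchy_cent[OF of_type12D(1)[OF z] p2 d2])
    then show "\<exists>u\<in>of_type (types12 ! 9). z = u ^^ 4" using product_3_2[OF z f] by blast
  qed
  have r1: "cl g = of_type (types12 ! 0)" if g: "g \<in> of_type (types12 ! 0)" for g
  proof (rule cl_eq_type[OF g])
    have "finite (cl g)" using finite_subset[OF cl_subset_type[OF g] of_type_finite] .
    then have "card (cl g) > 0" using self_cl[of g] by (auto simp: card_gt_0_iff)
    then show "N (types12 ! 0) \<le> card (cl g)" by (simp add: N12)
  qed
  have disj: "i = 0 \<or> i = 1 \<or> i = 2 \<or> i = 3 \<or> i = 4 \<or> i = 5 \<or> i = 6 \<or> i = 7 \<or> i = 8 \<or> i = 9 \<or> i = 10 \<or> i = 11 \<or> i = 14"
  proof -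
    have "i < 12 \<or> i = 14" using i by auto
    then show ?thesis by presburger
  qed
  have s1: "cl g = of_type (types12 ! 1)" if "g \<in> of_type (types12 ! 1)" for g
    by (rule single_class12[OF that, of "[1,1,1,2]"]) (simp_all add: N12, simp add: types12_def)
  have s3: "cl g = of_type (types12 ! 3)" if "g \<in> of_type (types12 ! 3)" for g
    by (rule single_class12[OF that, of "[1,1,3]"]) (simp_all add: N12, simp add: types12_def)
  have s5: "cl g = of_type (types12 ! 5)" if "g \<in> of_type (types12 ! 5)" for g
    by (rule single_class12[OF that, of "[1,4]"]) (simp_all add: N12, simp add: types12_def)
  have s6: "cl g = of_type (types12 ! 6)" if "g \<in> of_type (types12 ! 6)" for g
    by (rule single_class12[OF that, of "[4,2]"]) (simp_all add: N12, simp add: types12_def)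
  have s7: "cl g = of_type (types12 ! 7)" if "g \<in> of_type (types12 ! 7)" for g
    by (rule single_class12[OF that, of "[5]"]) (simp_all add: N12, simp add: types12_def)
  have s8: "cl g = of_type (types12 ! 8)" if "g \<in> of_type (types12 ! 8)" for g
    by (rule single_class12[OF that, of "[3,2]"]) (simp_all add: N12, simp add: types12_def)
  have s10: "cl g = of_type (types12 ! 10)" if "g \<in> of_type (types12 ! 10)" for g
    by (rule single_class12[OF that, of "[8]"]) (simp_all add: N12, simp add: types12_def)
  have s11: "cl g = of_type (types12 ! 11)" if "g \<in> of_type (types12 ! 11)" for g
    by (rule single_class12[OF that, of "[8]"]) (simp_all add: N12, simp add: types12_def)
  show ?thesis using disj g
    by (elim disjE) (simp_all only: r1 s1 r26 s3 r34 s5 s6 s7 s8 r66 s10 s11 r10)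
qed

text \<open>The centralizer bound is 11, so classes have at least 95040 / 11 = 8640 elements, half
  of the type. The inverse of \<open>g\<close> supplies the second class, and as a power of
  \<open>g\<close> it has the same type.\<close>

lemma classes12_11:
  assumes g: "g \<in> of_type (types12 ! 15)"
  shows "inv' g \<in> of_type (types12 ! 15)" "card (cl g) = 8640" "card (cl (inv' g)) = 8640"
    "cl g \<inter> cl (inv' g) = {}" "of_type (types12 ! 15) = cl g \<union> cl (inv' g)"
proof -
  have gG: "g \<in> G" using g by (rule of_type12D)
  have "inv' g = g ^^ 10"
  proof -
    have "g ^^ 11 = id" using of_type12D(3)[OF g, of 11] by (simp add: types12_def fx_def)
    then have "g ((g ^^ 10) x) = x" for x by (simp add: fun_eq_iff numeral_eq_Suc)
    then show ?thesis using inv_simps(1)[OF gG] by (metis ext)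
  qed
  show ig: "inv' g \<in> of_type (types12 ! 15)"
  proof (rule of_type12I[where P = "\<lambda>xs. fx xs 1 = 1 \<and> fx xs 11 = 12"])
    show "inv' g \<in> G" by (rule inv_mem[OF gG])
    show "fx (cyc_list (inv' g)) 1 = 1 \<and> fx (cyc_list (inv' g)) 11 = 12"
      unfolding \<open>inv' g = g ^^ 10\<close>
      using fx_pow[OF gG, of 10 1] fx_pow[OF gG, of 10 11] of_type12D(2)[OF g, of 10] of_type12D(2)[OF g, of 110]
      by (simp add: types12_def fx_def)
  qed code_simp
  have "inv' g \<notin> cl g"
  proof (rule inverse_not_conjugate_11[OF gG])
    show "count (ct g) 11 = 1" using g by (simp add: of_type_def mset_cyc_list[symmetric] types12_def)
    fix u assume u: "u \<in> G" "fx (cyc_list u) 2 = card S" "u \<noteq> id"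
    have "fx (cyc_list u) 1 \<noteq> 12" using fx_full_iff[OF u(1), of 1] u(3) card_S by simp
    moreover have "list_all (\<lambda>xs. fx xs 2 = 12 \<and> fx xs 1 \<noteq> 12 \<longrightarrow> fx xs 1 = 4 \<or> fx xs 1 = 0) types12"
      by code_simp
    ultimately have "fx (cyc_list u) 1 = 4 \<or> fx (cyc_list u) 1 = 0"
      using cyc_list_types12[OF u(1)] u(2) card_S unfolding list_all_iff by metis
    then show "fx (cyc_list u) 1 > card S - 10 \<or> fx (cyc_list u) 1 = 0" using card_S by auto
  qed (simp add: card_S)
  moreover have "8640 * cyc_count (mset (types12 ! 15)) [11] = card G" by (simp add: card_G_12 types12_def)
  moreover have "N (types12 ! 15) = 2 * 8640" by (simp add: N12)
  ultimately have "card (cl g) = 8640 \<and> card (cl (inv' g)) = 8640 \<and> cl g \<inter> cl (inv' g) = {} \<and>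
    of_type (types12 ! 15) = cl g \<union> cl (inv' g)"
    by (intro two_classes[OF g ig, where ls = "[11]"]) simp_all
  then show "card (cl g) = 8640" "card (cl (inv' g)) = 8640" "cl g \<inter> cl (inv' g) = {}"
    "of_type (types12 ! 15) = cl g \<union> cl (inv' g)"
    by blast+
qed

text \<open>
  An element commuting with \<open>g\<close> and fixing a point fixes a 6-cycle of \<open>g\<close> pointwise, so the centralizer
  of \<open>g\<close> acts regularly on the twelve points.
\<close>

lemma sum_cent_6_6:
  fixes F :: "nat list \<Rightarrow> complex"
  assumes g: "g \<in> of_type (types12 ! 9)"
  shows "card (cent g) = 12"
    "(\<Sum>h\<in>cent g. F (cyc_list h)) = F (types12 ! 0) + 3 * F (types12 ! 2) + 2 * F (types12 ! 4) + 6 * F (types12 ! 9)"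
proof -
  have gG: "g \<in> G" by (rule of_type12D(1)[OF g])
  note C = cent_props[OF gG]
  have "card (cl g) = 7920" using classes12[OF g] N12[of 9] by (simp add: N_def)
  then show card12: "card (cent g) = 12" using class_equation[OF g] card_G_12 by simp
  have gn: "g ^^ n = id \<longleftrightarrow> 6 dvd n" for n
    using of_type12D(3)[OF g, of n] by (cases "6 dvd n") (simp_all add: types12_def fx_def)
  have gC: "g ^^ n \<in> cent g" for n
    using pow_mem[OF gG, of n] by (simp add: cent_def fun_eq_iff funpow_swap1)
  have o6: "card (orbit g y) = 6" if y: "y \<in> S" for y
  proof -
    have d: "card (orbit g y) dvd n \<longleftrightarrow> (g ^^ n) y = y" for n
      using permutes_orbit_facts(6)[OF perm[OF gG] finS] by simp
    have nf: "(g ^^ n) y \<noteq> y" if "n = 2 \<or> n = 3" for n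
    proof -
      have "card {x \<in> S. (g ^^ n) x = x} = 0"
        using card_fix_pow[OF gG, of n] of_type12D(2)[OF g, of n] that by (auto simp: types12_def fx_def)
      then show ?thesis using y finS by auto
    qed
    have "card (orbit g y) dvd 6" using d[of 6] gn[of 6] by simp
    moreover have "\<not> card (orbit g y) dvd 2" "\<not> card (orbit g y) dvd 3" using d nf by auto
    moreover have "c = 6" if "c dvd 6" "\<not> c dvd 2" "\<not> c dvd 3" for c :: nat
    proof -
      have "c \<le> 6" using that(1) by (auto dest: dvd_imp_le)
      then have "c = 0 \<or> c = 1 \<or> c = 2 \<or> c = 3 \<or> c = 4 \<or> c = 5 \<or> c = 6" by presburger
      then show ?thesis using that by (elim disjE) simp_all
    qed
    ultimately show ?thesis by blast
  qed
  have free: "x = id" if x: "x \<in> cent g" and y: "y \<in> S" "x y = y" for x y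
  proof (rule eq_if_agree)
    show "x \<in> G" "id \<in> G" using centD(1)[OF x] id_mem .
    show "orbit g y \<subseteq> S" by (rule permutes_orbit_facts(3)[OF perm[OF gG] finS y(1)])
    show "5 \<le> card (orbit g y)" using o6[OF y(1)] by simp
    fix z assume "z \<in> orbit g y"
    then obtain i where i: "z = (g ^^ i) y" by (auto simp: orbit_altdef)
    have "x ((g ^^ j) y) = (g ^^ j) y" for j
      using y(2) centD(3)[OF x] by (induction j) simp_all
    then show "x z = id z" by (simp add: i)
  qed
  have powC: "x ^^ n \<in> cent g" if "x \<in> cent g" for x n
    using C(2,3) that by (induction n) auto
  have fx0: "fx (cyc_list x) d = 0 \<or> fx (cyc_list x) d = 12" if x: "x \<in> cent g" for x d
  proof (cases "x ^^ d = id")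
    case True
    then show ?thesis using fx_full_iff[OF centD(1)[OF x], of d] card_S by simp
  next
    case False
    then have e: "{y \<in> S. (x ^^ d) y = y} = {}" using free[OF powC[OF x]] by blast
    show ?thesis using card_fix_pow[OF centD(1)[OF x], of d] unfolding e by simp
  qed
  have full: "fx (cyc_list x) d = 12 \<longleftrightarrow> x ^^ d = id" if "x \<in> cent g" for x d
    using fx_full_iff[OF centD(1)[OF that], of d] card_S by simp
  \<comment> \<open>Among the candidates only four types have powers that are each trivial or free
    of fixed points; the exponent 4 serves to exclude 4.8.\<close>
  have l6: "list_all (\<lambda>xs. (\<forall>d\<in>set [1,2,3,4]. fx xs d = 0 \<or> fx xs d = 12) \<longrightarrow> fx xs 6 = 12 \<and>
      xs = (if fx xs 1 = 12 then types12 ! 0 else if fx xs 2 = 12 then types12 ! 2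
        else if fx xs 3 = 12 then types12 ! 4 else types12 ! 9)) types12" by code_simp
  have t: "fx (cyc_list x) 6 = 12 \<and> cyc_list x = (if fx (cyc_list x) 1 = 12 then types12 ! 0
      else if fx (cyc_list x) 2 = 12 then types12 ! 2
        else if fx (cyc_list x) 3 = 12 then types12 ! 4 else types12 ! 9)" if x: "x \<in> cent g" for x
    using l6 cyc_list_types12[OF centD(1)[OF x]] fx0[OF x] unfolding list_all_iff by blast
  have x6: "x ^^ 6 = id" if "x \<in> cent g" for x using t[OF that] full[OF that] by blast
  have ty: "cyc_list x = (if x = id then types12 ! 0 else if x ^^ 2 = id then types12 ! 2
      else if x ^^ 3 = id then types12 ! 4 else types12 ! 9)" if x: "x \<in> cent g" for x
    using t[OF x] unfolding full[OF x] by simp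
  \<comment> \<open>The cyclic group generated by \<open>g\<close>, of index 2 in the
    centralizer.\<close>
  define P where "P = (\<lambda>i. g ^^ i) ` {..<6}"
  have injg: "inj (g ^^ i)" for i by (rule permutes_inj[OF perm[OF pow_mem[OF gG]]])
  have lt: "g ^^ i \<noteq> g ^^ j" if "i < j" "j < 6" for i j
  proof
    assume e: "g ^^ i = g ^^ j"
    have "g ^^ j = g ^^ i \<circ> g ^^ (j - i)" using that(1) by (simp add: funpow_add[symmetric])
    then have "(g ^^ i) (id x) = (g ^^ i) ((g ^^ (j - i)) x)" for x using e by (metis comp_apply id_apply)
    then have "g ^^ (j - i) = id" using injg[of i] by (auto simp: fun_eq_iff inj_eq)
    then show False using gn[of "j - i"] that by (auto dest: dvd_imp_le)
  qed
  have injP: "inj_on (\<lambda>i. g ^^ i) {..<6}"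
    using lt by (intro linorder_inj_onI) auto
  have P: "P \<subseteq> cent g" "card P = 6" using gC card_image[OF injP] by (auto simp: P_def)
  have gP: "g ^^ n \<in> P" for n
    using funpow_mod_id[of 6 g n] gn[of 6] by (auto simp: P_def)
  have PP: "x \<circ> y \<in> P" if "x \<in> P" "y \<in> P" for x y
    using that gP by (auto simp: P_def funpow_add[symmetric])
  have Pinv: "\<exists>y\<in>P. y \<circ> x = id" if x: "x \<in> P" for x
  proof -
    obtain i where i: "i < 6" "x = g ^^ i" using x by (auto simp: P_def)
    have "g ^^ (6 - i) \<circ> x = id" using gn[of 6] i by (simp add: funpow_add[symmetric])
    then show ?thesis using gP by blast
  qed
  have coset: "cent g = P \<union> (\<lambda>x. x \<circ> k) ` P \<and> P \<inter> (\<lambda>x. x \<circ> k) ` P = {} \<and> inj_on (\<lambda>x. x \<circ> k) P"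
    if k: "k \<in> cent g" "k \<notin> P" for k
  proof -
    have kG: "k \<in> G" by (rule centD(1)[OF k(1)])
    have inj: "inj_on (\<lambda>x. x \<circ> k) P"
    proof (rule inj_onI)
      fix x y assume "x \<circ> k = y \<circ> k"
      then have "x \<circ> k \<circ> inv' k = y \<circ> k \<circ> inv' k" by simp
      then show "x = y" using inv_simps(3)[OF kG] by (simp add: comp_assoc)
    qed
    have disj: "P \<inter> (\<lambda>x. x \<circ> k) ` P = {}"
    proof (rule ccontr)
      assume "P \<inter> (\<lambda>x. x \<circ> k) ` P \<noteq> {}"
      then obtain x where x: "x \<in> P" "x \<circ> k \<in> P" by blast
      obtain y where y: "y \<in> P" "y \<circ> x = id" using Pinv[OF x(1)] by blast
      have "k = y \<circ> (x \<circ> k)" using y(2) by (simp add: comp_assoc[symmetric])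
      then show False using PP[OF y(1) x(2)] k(2) by simp
    qed
    have "card (P \<union> (\<lambda>x. x \<circ> k) ` P) = 12"
      using disj P(2) card_image[OF inj] finite_subset[OF P(1) C(5)] by (simp add: card_Un_disjoint)
    moreover have "P \<union> (\<lambda>x. x \<circ> k) ` P \<subseteq> cent g" using P(1) C(3)[OF _ k(1)] by blast
    ultimately have "P \<union> (\<lambda>x. x \<circ> k) ` P = cent g"
      using card12 C(5) by (intro card_subset_eq) auto
    then show ?thesis using disj inj by blast
  qed
  have "P \<noteq> cent g" using P(2) card12 by auto
  then obtain h where h: "h \<in> cent g" "h \<notin> P" using P(1) by blast
  have hhP: "h \<circ> h \<in> P"
  proof (rule ccontr)
    assume "h \<circ> h \<notin> P"
    then have "h \<circ> h \<in> (\<lambda>x. x \<circ> h) ` P" using coset[OF h] C(3)[OF h(1) h(1)] by blast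
    then obtain x where x: "x \<in> P" "h \<circ> h = x \<circ> h" by blast
    then have "h \<circ> h \<circ> inv' h = x \<circ> h \<circ> inv' h" by simp
    then show False using inv_simps(3)[OF centD(1)[OF h(1)]] x(1) h(2) by (simp add: comp_assoc)
  qed
  \<comment> \<open>The square of \<open>h\<close> lies in \<open>P\<close> while \<open>h\<close>
    does not, so neither does the cube; and the cube has order 2 because all sixth powers are
    trivial. Hence the centralizer is \<open>P\<close> together with the coset of an
    involution.\<close>
  define k where "k = h ^^ 3"
  have kC: "k \<in> cent g" unfolding k_def by (rule powC[OF h(1)])
  have "k = h \<circ> h \<circ> h" by (simp add: k_def numeral_3_eq_3 comp_assoc)
  then have kP: "k \<notin> P" using coset[OF h] hhP by blast
  have k2: "k ^^ 2 = id" using x6[OF h(1)] by (simp add: k_def funpow_mult)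
  have kg: "(g ^^ i \<circ> k) ^^ n = g ^^ (i * n) \<circ> k ^^ n" for i n
  proof -
    have "(g ^^ i) (k y) = k ((g ^^ i) y)" for y
      by (induction i) (simp_all add: centD(3)[OF kC])
    then have "g ^^ i \<circ> k = k \<circ> g ^^ i" by (simp add: fun_eq_iff)
    from funpow_comp_commute[OF this, of n] show ?thesis by (simp only: funpow_mult)
  qed
  have nid: "g ^^ i \<circ> k \<noteq> id" for i
  proof -
    have "id \<in> P" using gP[of 0] by (simp add: id_def)
    moreover have "g ^^ i \<circ> k \<in> (\<lambda>x. x \<circ> k) ` P" using gP by blast
    ultimately show ?thesis using coset[OF kC kP] by (metis disjoint_iff)
  qed
  have gkC: "g ^^ i \<circ> k \<in> cent g" for i by (rule C(3)[OF gC kC])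
  have t1: "cyc_list (g ^^ i) = (if 6 dvd i then types12 ! 0 else if 6 dvd i * 2 then types12 ! 2
      else if 6 dvd i * 3 then types12 ! 4 else types12 ! 9)" for i
    unfolding ty[OF gC] by (simp only: funpow_mult mult.commute[of _ i] gn)
  \<comment> \<open>The square of \<open>g ^^ i \<circ> k\<close> is the power \<open>2 * i\<close>
    of \<open>g\<close>. So \<open>i = 0\<close> and \<open>i = 3\<close> give involutions, and the
    other four exponents give type 6^2.\<close>
  have t2: "cyc_list (g ^^ i \<circ> k) = (if 6 dvd i * 2 then types12 ! 2 else types12 ! 9)" for i
  proof -
    have "(g ^^ i \<circ> k) ^^ 2 = id \<longleftrightarrow> 6 dvd i * 2" unfolding kg k2 using gn by simp
    moreover have "k ^^ 3 = k" using funpow_mod_id[OF k2, of 3] by simp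
    then have "(g ^^ i \<circ> k) ^^ 3 \<noteq> id" unfolding kg using nid by simp
    ultimately show ?thesis unfolding ty[OF gkC] using nid by simp
  qed
  have d2: "\<not> 6 dvd Suc (Suc 0)" by presburger
  have s6: "{..<6} = {0, 1, 2, 3, 4, 5 :: nat}" by auto
  have "(\<Sum>h\<in>cent g. F (cyc_list h)) = (\<Sum>h\<in>P. F (cyc_list h)) + (\<Sum>h\<in>(\<lambda>x. x \<circ> k) ` P. F (cyc_list h))"
    using coset[OF kC kP] finite_subset[OF P(1) C(5)]
    by (subst coset[OF kC kP, THEN conjunct1], intro sum.union_disjoint) auto
  also have "(\<Sum>h\<in>P. F (cyc_list h)) = (\<Sum>i<6. F (cyc_list (g ^^ i)))"
    unfolding P_def by (rule sum.reindex_cong[OF injP]) auto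
  also have "(\<Sum>h\<in>(\<lambda>x. x \<circ> k) ` P. F (cyc_list h)) = (\<Sum>x\<in>P. F (cyc_list (x \<circ> k)))"
    using coset[OF kC kP] by (subst sum.reindex) auto
  also have "\<dots> = (\<Sum>i<6. F (cyc_list (g ^^ i \<circ> k)))"
    unfolding P_def by (rule sum.reindex_cong[OF injP]) auto
  also have "(\<Sum>i<6. F (cyc_list (g ^^ i))) = F (types12 ! 0) + F (types12 ! 2) + 2 * F (types12 ! 4) + 2 * F (types12 ! 9)"
    unfolding t1 s6 by (simp add: d2)
  also have "(\<Sum>i<6. F (cyc_list (g ^^ i \<circ> k))) = 2 * F (types12 ! 2) + 4 * F (types12 ! 9)"
    unfolding t2 s6 by (simp add: d2)
  finally show "(\<Sum>h\<in>cent g. F (cyc_list h)) = F (types12 ! 0) + 3 * F (types12 ! 2) + 2 * F (types12 ! 4) + 6 * F (types12 ! 9)"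
    by (simp add: algebra_simps)
qed

end

section \<open>Conjugacy classes in degree 11\<close>

text \<open>The candidate with a 9-cycle (index 7) is ruled out only later, by counting.\<close>

definition types11 :: "nat list list" where
  "types11 = [[1,1,1,1,1,1,1,1,1,1,1], [2,2,2,2,1,1,1], [3,3,3,1,1], [4,4,1,1,1], [5,5,1], [6,3,2],
     [8,2,1], [9,1,1], [11]]"

lemma types11_eq: "filter (sharp_cycle_list 11 4) (partitions 11 11) = types11"
  unfolding types11_def by code_simp

locale sharp4_11 = sharp_alt_group S G 4 for S :: "'a set" and G +
  assumes card_S: "card S = 11"
begin

lemma card_G_11: "card G = 7920"
proof -
  have "{11 - 4 + 1..11} = {8, 9, 10, 11 :: nat}" by auto
  then show ?thesis unfolding card_G card_tuples[OF kS] card_S by simp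
qed

lemma cyc_list_types11: "g \<in> G \<Longrightarrow> cyc_list g \<in> set types11"
  using cyc_list_mem[of g] unfolding card_S types11_eq by (simp add: types11_def)

lemma moment11:
  assumes "\<forall>l\<in>set ls. l > 0" "sum_list ls \<le> 4"
    and cs: "map (\<lambda>xs. cyc_count (mset xs) ls) types11 = cs" and ns: "map N types11 = ns"
  shows "sum_list (map2 (*) ns cs) = 7920"
proof -
  have "(\<Sum>xs\<leftarrow>types11. N xs * cyc_count (mset xs) ls) = 7920"
    using type_moment[OF _ cyc_list_types11 assms(1,2)] card_G_11 by (simp add: types11_def)
  moreover have "map (\<lambda>xs. N xs * cyc_count (mset xs) ls) types11 = map2 (*) ns cs"
    unfolding cs[symmetric] ns[symmetric] by (simp add: map2_map_map)
  ultimately show ?thesis by simp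
qed

lemma of_type11I:
  assumes "u \<in> G" "P (cyc_list u)" "list_all (\<lambda>xs. P xs \<longrightarrow> xs = types11 ! i) types11"
  shows "u \<in> of_type (types11 ! i)"
  using assms cyc_list_types11[of u] unfolding of_type_def list_all_iff by blast

lemma of_type11D:
  assumes "u \<in> of_type (types11 ! i)"
  shows "u \<in> G" "fx (cyc_list u) d = fx (types11 ! i) d" "fx (types11 ! i) d = 11 \<longleftrightarrow> u ^^ d = id"
  using assms fx_full_iff[of u d] by (auto simp: of_type_def card_S)

text \<open>In degree 11 the moments and the uniqueness of the identity already determine every
  count, including the absence of 9-cycles.\<close>

lemma type_counts11: "map N types11 = [1, 165, 440, 990, 1584, 1320, 1980, 0, 1440]"
proof -
  obtain n0 n1 n2 n3 n4 n5 n6 n7 n8 where ns: "map N types11 = [n0, n1, n2, n3, n4, n5, n6, n7, n8]"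
    by (simp add: types11_def)
  note m = moment11[OF _ _ _ ns]
  have id0: "n0 = 1"
  proof -
    have "g = id" if "g \<in> of_type (types11 ! 0)" for g
      using fx_full_iff[of g 1] that by (simp add: of_type_def types11_def fx_def card_S)
    moreover have "id \<in> of_type (types11 ! 0)"
    proof (rule of_type11I[where P = "\<lambda>xs. fx xs 1 = 11"])
      show "fx (cyc_list id) 1 = 11" using fx_full_iff[OF id_mem, of 1] by (simp add: card_S)
    qed (rule id_mem, code_simp)
    ultimately have "of_type (types11 ! 0) = {id}" by blast
    moreover have "N (types11 ! 0) = n0" using arg_cong[OF ns, of "\<lambda>xs. xs ! 0"] by (simp add: types11_def)
    ultimately show ?thesis by (simp add: N_def)
  qed
  have e0: "sum_list (map2 (*) [n0, n1, n2, n3, n4, n5, n6, n7, n8] [0, 48, 0, 0, 0, 0, 0, 0, 0]) = 7920"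
    by (rule m[of "[1, 1, 2]"]) (simp, simp, simp add: types11_def)
  have e1: "sum_list (map2 (*) [n0, n1, n2, n3, n4, n5, n6, n7, n8] [0, 0, 18, 0, 0, 0, 0, 0, 0]) = 7920"
    by (rule m[of "[1, 3]"]) (simp, simp, simp add: types11_def)
  have e2: "sum_list (map2 (*) [n0, n1, n2, n3, n4, n5, n6, n7, n8] [0, 0, 0, 8, 0, 0, 0, 0, 0]) = 7920"
    by (rule m[of "[4]"]) (simp, simp, simp add: types11_def)
  have e3: "sum_list (map2 (*) [n0, n1, n2, n3, n4, n5, n6, n7, n8] [0, 24, 0, 0, 0, 0, 2, 0, 0]) = 7920"
    by (rule m[of "[2, 1]"]) (simp, simp, simp add: types11_def)
  have e4: "sum_list (map2 (*) [n0, n1, n2, n3, n4, n5, n6, n7, n8] [0, 8, 0, 0, 0, 2, 2, 0, 0]) = 7920"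
    by (rule m[of "[2]"]) (simp, simp, simp add: types11_def)
  have e5: "sum_list (map2 (*) [n0, n1, n2, n3, n4, n5, n6, n7, n8] [110, 6, 2, 6, 0, 0, 0, 2, 0]) = 7920"
    by (rule m[of "[1, 1]"]) (simp, simp, simp add: types11_def)
  have e6: "sum_list (map2 (*) [n0, n1, n2, n3, n4, n5, n6, n7, n8] [11, 3, 2, 3, 1, 0, 1, 2, 0]) = 7920"
    by (rule m[of "[1]"]) (simp, simp, simp add: types11_def)
  have e7: "sum_list (map2 (*) [n0, n1, n2, n3, n4, n5, n6, n7, n8] [1, 1, 1, 1, 1, 1, 1, 1, 1]) = 7920"
    by (rule m[of "[]"]) (simp, simp, simp add: types11_def)
  note f = e0[simplified] e1[simplified] e2[simplified] e3[simplified] e4[simplified] e5[simplified]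
    e6[simplified] e7[simplified]
  have "n1 = 165" "n2 = 440" "n3 = 990" using f by linarith+
  moreover from this have "n6 = 1980" "n7 = 0" using f id0 by linarith+
  moreover from calculation have "n5 = 1320" "n4 = 1584" using f id0 by linarith+
  moreover from calculation have "n8 = 1440" using f id0 by linarith
  ultimately show ?thesis using ns id0 by simp
qed

lemma N11: "i < 9 \<Longrightarrow> N (types11 ! i) = [1, 165, 440, 990, 1584, 1320, 1980, 0, 1440] ! i"
  using nth_map[of i types11 N] unfolding type_counts11 by (simp add: types11_def)

lemma single_class11:
  assumes "g \<in> of_type (types11 ! i)" "i < 9" "\<forall>l\<in>set ls. l > 0" "sum_list ls \<ge> 4"
    "N (types11 ! i) * cyc_count (mset (types11 ! i)) ls = 7920"
  shows "cl g = of_type (types11 ! i)"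
  using single_class[of g "types11 ! i" ls] assms card_G_11 by simp

text \<open>One 5-cycle bounds the order of the centralizer by 10, twice the true value. An order of
  10 would give a commuting involution, and the product would have fixed-point numbers that no
  candidate shows.\<close>

lemma class11_5_5:
  assumes g: "g \<in> of_type (types11 ! 4)"
  shows "cl g = of_type (types11 ! 4)"
proof -
  note gG = of_type11D(1)[OF g]
  have ceq: "card (cl g) * card (cent g) = 7920" using class_equation[OF g] card_G_11 by simp
  have le: "card (cl g) \<le> 1584" using card_cl_le_N[OF g] by (simp add: N11)
  have "card (cent g) dvd 10" using cent_dvd[OF g, of "[5]"] by (simp add: types11_def)
  moreover have "2 * card (cent g) \<ge> 10"
    using ceq mult_le_mono1[OF le, of "card (cent g)"] by simp
  ultimately obtain q where q: "0 < q" "q \<le> 2" "10 = card (cent g) * q" by (rule cofactor_cases) auto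
  have "\<not> 2 dvd card (cent g)"
  proof
    assume d2: "2 dvd card (cent g)"
    have p2: "Factorial_Ring.prime (2 :: nat)" by (rule two_is_prime_nat)
    obtain f where f: "f \<in> cent g" "f \<noteq> id" "f ^^ 2 = id" by (rule cauchy_cent[OF gG p2 d2])
    have fg: "g \<circ> f = f \<circ> g" using centD(2)[OF f(1)] by simp
    have u: "g \<circ> f \<in> G" by (rule comp_mem[OF gG centD(1)[OF f(1)]])
    have g5: "g ^^ 5 = id" using of_type11D(3)[OF g, of 5] by (simp add: types11_def fx_def)
    have "(g \<circ> f) ^^ 5 = f" using funpow_comp_commute[OF fg, of 5] g5 funpow_mod_id[OF f(3), of 5] by simp
    then have 5: "fx (cyc_list (g \<circ> f)) 5 \<noteq> 11" using fx_full_iff[OF u, of 5] f(2) card_S by simp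
    have "(g \<circ> f) ^^ 10 = id"
      using funpow_comp_commute[OF fg, of 10] funpow_mod_id[OF g5, of 10] funpow_mod_id[OF f(3), of 10] by simp
    then have 10: "fx (cyc_list (g \<circ> f)) 10 = 11" using fx_full_iff[OF u, of 10] card_S by simp
    have "(g \<circ> f) ^^ 2 = g ^^ 2" using funpow_comp_commute[OF fg, of 2] f(3) by simp
    then have "fx (cyc_list (g \<circ> f)) 2 = fx (types11 ! 4) 2"
      using fx_pow[OF u, of 2 1] fx_pow[OF gG, of 2 1] of_type11D(2)[OF g, of 2] by simp
    then have 2: "fx (cyc_list (g \<circ> f)) 2 = 1" by (simp add: types11_def fx_def)
    have "list_all (\<lambda>xs. \<not> (fx xs 5 \<noteq> 11 \<and> fx xs 10 = 11 \<and> fx xs 2 = 1)) types11" by code_simp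
    then show False using cyc_list_types11[OF u] 2 5 10 unfolding list_all_iff by blast
  qed
  moreover have "q = 1 \<or> q = 2" using q by linarith
  ultimately have "card (cent g) = 5" using q(3) by auto
  then show ?thesis using ceq by (intro cl_eq_type[OF g]) (simp add: N11)
qed

lemma classes11:
  assumes g: "g \<in> of_type (types11 ! i)" and i: "i < 6"
  shows "cl g = of_type (types11 ! i)"
proof -
  have r1: "cl g = of_type (types11 ! 0)" if g: "g \<in> of_type (types11 ! 0)" for g
  proof (rule cl_eq_type[OF g])
    have "finite (cl g)" using finite_subset[OF cl_subset_type[OF g] of_type_finite] .
    then have "card (cl g) > 0" using self_cl[of g] by (auto simp: card_gt_0_iff)
    then show "N (types11 ! 0) \<le> card (cl g)" by (simp add: N11)
  qed
  have s1: "cl g = of_type (types11 ! 1)" if "g \<in> of_type (types11 ! 1)" for g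
    by (rule single_class11[OF that, of "[1,1,2]"]) (simp_all add: N11, simp add: types11_def)
  have s2: "cl g = of_type (types11 ! 2)" if "g \<in> of_type (types11 ! 2)" for g
    by (rule single_class11[OF that, of "[1,3]"]) (simp_all add: N11, simp add: types11_def)
  have s3: "cl g = of_type (types11 ! 3)" if "g \<in> of_type (types11 ! 3)" for g
    by (rule single_class11[OF that, of "[4]"]) (simp_all add: N11, simp add: types11_def)
  have s5: "cl g = of_type (types11 ! 5)" if "g \<in> of_type (types11 ! 5)" for g
    by (rule single_class11[OF that, of "[6]"]) (simp_all add: N11, simp add: types11_def)
  have "i = 0 \<or> i = 1 \<or> i = 2 \<or> i = 3 \<or> i = 4 \<or> i = 5" using i by presburger
  then show ?thesis using g
    by (elim disjE) (simp_all only: r1 s1 s2 s3 class11_5_5 s5)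
qed

lemma classes11_11:
  assumes g: "g \<in> of_type (types11 ! 8)"
  shows "inv' g \<in> of_type (types11 ! 8)" "card (cl g) = 720" "card (cl (inv' g)) = 720"
    "cl g \<inter> cl (inv' g) = {}" "of_type (types11 ! 8) = cl g \<union> cl (inv' g)"
proof -
  have gG: "g \<in> G" using g by (rule of_type11D)
  have "inv' g = g ^^ 10"
  proof -
    have "g ^^ 11 = id" using of_type11D(3)[OF g, of 11] by (simp add: types11_def fx_def)
    then have "g ((g ^^ 10) x) = x" for x by (simp add: fun_eq_iff numeral_eq_Suc)
    then show ?thesis using inv_simps(1)[OF gG] by (metis ext)
  qed
  show ig: "inv' g \<in> of_type (types11 ! 8)"
  proof (rule of_type11I[where P = "\<lambda>xs. fx xs 1 = 0 \<and> fx xs 11 = 11"])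
    show "inv' g \<in> G" by (rule inv_mem[OF gG])
    show "fx (cyc_list (inv' g)) 1 = 0 \<and> fx (cyc_list (inv' g)) 11 = 11"
      unfolding \<open>inv' g = g ^^ 10\<close>
      using fx_pow[OF gG, of 10 1] fx_pow[OF gG, of 10 11] of_type11D(2)[OF g, of 10] of_type11D(2)[OF g, of 110]
      by (simp add: types11_def fx_def)
  qed code_simp
  have "inv' g \<notin> cl g"
  proof (rule inverse_not_conjugate_11[OF gG])
    show "count (ct g) 11 = 1" using g by (simp add: of_type_def mset_cyc_list[symmetric] types11_def)
    fix u assume u: "u \<in> G" "fx (cyc_list u) 2 = card S" "u \<noteq> id"
    have "fx (cyc_list u) 1 \<noteq> 11" using fx_full_iff[OF u(1), of 1] u(3) card_S by simp
    moreover have "list_all (\<lambda>xs. fx xs 2 = 11 \<and> fx xs 1 \<noteq> 11 \<longrightarrow> fx xs 1 = 3) types11"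
      by code_simp
    ultimately have "fx (cyc_list u) 1 = 3"
      using cyc_list_types11[OF u(1)] u(2) card_S unfolding list_all_iff by metis
    then show "fx (cyc_list u) 1 > card S - 10 \<or> fx (cyc_list u) 1 = 0" using card_S by auto
  qed (simp add: card_S)
  moreover have "720 * cyc_count (mset (types11 ! 8)) [11] = card G" by (simp add: card_G_11 types11_def)
  moreover have "N (types11 ! 8) = 2 * 720" by (simp add: N11)
  ultimately have "card (cl g) = 720 \<and> card (cl (inv' g)) = 720 \<and> cl g \<inter> cl (inv' g) = {} \<and>
    of_type (types11 ! 8) = cl g \<union> cl (inv' g)"
    by (intro two_classes[OF g ig, where ls = "[11]"]) simp_all
  then show "card (cl g) = 720" "card (cl (inv' g)) = 720" "cl g \<inter> cl (inv' g) = {}"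
    "of_type (types11 ! 8) = cl g \<union> cl (inv' g)"
    by blast+
qed

text \<open>Transitivity on triples makes every 3-subset the fixed set of some element of type 2^4.
  There are 165 such elements and 165 three-element subsets of 11 points, so this surjection is
  injective.\<close>

lemma involution_determined_by_fixed_points:
  assumes s: "s \<in> of_type (types11 ! 1)" and t: "t \<in> of_type (types11 ! 1)"
    and A: "card A = 3" "\<And>x. x \<in> A \<Longrightarrow> x \<in> S \<and> s x = x \<and> t x = x"
  shows "s = t"
proof -
  define Fix where "Fix g = {x \<in> S. g x = x}" for g :: "'a \<Rightarrow> 'a"
  have cF: "card (Fix g) = 3" if g: "g \<in> of_type (types11 ! 1)" for g
    using card_fix_pow[OF of_type11D(1)[OF g], of 1] of_type11D(2)[OF g, of 1]
    by (simp add: Fix_def types11_def fx_def)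
  have fF: "finite (Fix g)" for g using finS by (simp add: Fix_def)
  have "Fix ` of_type (types11 ! 1) = {B. B \<subseteq> S \<and> card B = 3}"
  proof (intro equalityI subsetI)
    fix B assume "B \<in> {B. B \<subseteq> S \<and> card B = 3}"
    then have B: "B \<subseteq> S" "card B = 3" by auto
    obtain xs where xs: "set xs = Fix s" "distinct xs" using finite_distinct_list[OF fF] by blast
    obtain ys where ys: "set ys = B" "distinct ys" using finite_distinct_list[of B] B finS finite_subset by blast
    have "xs \<in> tuples 3" using xs cF[OF s] distinct_card[of xs] by (auto simp: tuples_def Fix_def)
    moreover have "ys \<in> tuples 3" using ys B distinct_card[of ys] by (auto simp: tuples_def)
    ultimately obtain h where h: "h \<in> G" "map h xs = ys" by (rule transitive_tuples) auto
    have hB: "h ` Fix s = B" using h(2) xs ys by (metis list.set_map)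
    have u: "h \<circ> s \<circ> inv' h \<in> of_type (types11 ! 1)"
      using cl_subset_type[OF s] h(1) unfolding cl_def by blast
    have "B \<subseteq> Fix (h \<circ> s \<circ> inv' h)"
      using hB B(1) inv_simps(1)[OF h(1)] by (auto simp: Fix_def)
    then have "B = Fix (h \<circ> s \<circ> inv' h)" using cF[OF u] B(2) fF by (intro card_subset_eq) auto
    then show "B \<in> Fix ` of_type (types11 ! 1)" using u by blast
  qed (use cF in \<open>auto simp: Fix_def\<close>)
  then have "card (Fix ` of_type (types11 ! 1)) = 11 choose 3"
    using n_subsets[OF finS, of 3] card_S by simp
  also have "\<dots> = 165" by (simp add: binomial_fact_lemma eval_nat_numeral choose_reduce_nat)
  also have "\<dots> = card (of_type (types11 ! 1))" using N11[of 1] by (simp add: N_def)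
  finally have inj: "inj_on Fix (of_type (types11 ! 1))" by (intro eq_card_imp_inj_on of_type_finite)
  have "A = Fix s" using A cF[OF s] fF by (intro card_subset_eq) (auto simp: Fix_def)
  moreover have "A = Fix t" using A cF[OF t] fF by (intro card_subset_eq) (auto simp: Fix_def)
  ultimately show ?thesis using inj s t by (auto dest: inj_onD)
qed

text \<open>
  An element conjugating \<open>g\<close> to \<open>g^5\<close> and fixing a point of the 8-cycle fixes four points of it. If one
  fixing a point of the 8-cycle inverts \<open>g\<close>, then its product with \<open>g\<close> and \<open>g^4\<close> are involutions with the
  same three fixed points, hence equal.
\<close>

lemma powers_not_conjugate_8_2:
  assumes g: "g \<in> of_type (types11 ! 6)"
  shows "g ^^ 5 \<notin> cl g" "g ^^ 7 \<notin> cl g"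
proof -
  have gG: "g \<in> G" using g by (rule of_type11D)
  note p = perm[OF gG] finS
  have "permutation g" using p by (auto simp: permutation_permutes)
  note pg = this and orb = orbit_altdef_permutation[OF this]
  have g8: "g ^^ 8 = id" using of_type11D(3)[OF g, of 8] by (simp add: types11_def fx_def)
  have gn8: "(g ^^ n) x = (g ^^ (n mod 8)) x" for n x using funpow_mod_id[OF g8, of n] by simp
  have cf: "card {x \<in> S. (g ^^ d) x = x} = fx (types11 ! 6) d" for d
    using card_fix_pow[OF gG, of d] of_type11D(2)[OF g, of d] by simp
  \<comment> \<open>The points on the 8-cycle: the fourth power of \<open>g\<close> fixes exactly
    the other three.\<close>
  define P where "P = {x \<in> S. (g ^^ 4) x \<noteq> x}"
  have cP: "card P = 8"
  proof -
    have "P = S - {x \<in> S. (g ^^ 4) x = x}" by (auto simp: P_def)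
    then show ?thesis using cf[of 4] finS card_S by (simp add: card_Diff_subset types11_def fx_def)
  qed
  then obtain y where y: "y \<in> P" by (metis card.empty ex_in_conv zero_neq_numeral)
  have o8: "card (orbit g y) = 8"
  proof -
    have d: "card (orbit g y) dvd n \<longleftrightarrow> (g ^^ n) y = y" for n using permutes_orbit_facts(6)[OF p] by simp
    have "card (orbit g y) dvd 8" "\<not> card (orbit g y) dvd 4" using d g8 y by (auto simp: P_def)
    moreover have "c = 8" if "c dvd 8" "\<not> c dvd 4" for c :: nat
    proof -
      have "c \<le> 8" using that(1) by (auto dest: dvd_imp_le)
      then have "c = 0 \<or> c = 1 \<or> c = 2 \<or> c = 3 \<or> c = 4 \<or> c = 5 \<or> c = 6 \<or> c = 7 \<or> c = 8" by presburger
      then show ?thesis using that by (elim disjE) simp_all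
    qed
    ultimately show ?thesis by blast
  qed
  have oP: "orbit g y = P"
  proof (rule card_subset_eq)
    show "finite P" using finS by (simp add: P_def)
    show "orbit g y \<subseteq> P"
    proof
      fix z assume z: "z \<in> orbit g y"
      have "orbit g z = orbit g y" by (rule permutes_orbit_facts(2)[OF p z])
      then have "\<not> card (orbit g z) dvd 4" using o8 by simp
      then have "(g ^^ 4) z \<noteq> z" using permutes_orbit_facts(6)[OF p] by simp
      moreover have "z \<in> S" using permutes_orbit_facts(3)[OF p, of y] y z by (auto simp: P_def)
      ultimately show "z \<in> P" by (simp add: P_def)
    qed
    show "card (orbit g y) = card P" using o8 cP by simp
  qed
  have inj: "i = j" if "(g ^^ i) y = (g ^^ j) y" "i < 8" "j < 8" for i j
  proof -
    have "least_power g y = 8" using permutes_orbit_facts(8)[OF p, of y] o8 by simp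
    then have "distinct (map (\<lambda>i. (g ^^ i) y) [0..<8])" using cycle_of_permutation[OF pg, of y] by simp
    then have "inj_on (\<lambda>i. (g ^^ i) y) {0..<8}" by (simp add: distinct_map)
    then show ?thesis using that by (auto dest: inj_onD)
  qed
  \<comment> \<open>A conjugator of \<open>g\<close> to a power of \<open>g\<close> preserves the
    8-cycle, and a factor that is a power of \<open>g\<close> makes it fix \<open>y\<close>.\<close>
  have norm: "\<exists>r\<in>G. r y = y \<and> (\<forall>x. r (g x) = (g ^^ e) (r x))" if c: "g ^^ e \<in> cl g" for e
  proof -
    obtain h where h: "h \<in> G" "g ^^ e = h \<circ> g \<circ> inv' h" using c by (auto simp: cl_def)
    have hg: "h (g x) = (g ^^ e) (h x)" for x unfolding h(2) using inv_simps(1)[OF h(1)] by simp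
    have hgn: "h ((g ^^ n) x) = (g ^^ (e * n)) (h x)" for n x
      by (induction n) (simp_all add: hg funpow_add)
    have "(g ^^ 4) (h y) \<noteq> h y"
    proof
      assume f: "(g ^^ 4) (h y) = h y"
      have "((g ^^ 4) ^^ e) (h y) = h y" using f by (induction e) simp_all
      then have "h ((g ^^ 4) y) = h y" using hgn[of 4 y] by (simp add: funpow_mult mult.commute)
      then have "(g ^^ 4) y = y" using permutes_inj[OF perm[OF h(1)]] by (simp add: inj_eq)
      then show False using y by (simp add: P_def)
    qed
    moreover have "h y \<in> S" using perm[OF h(1)] y by (simp add: P_def permutes_in_image)
    ultimately have "h y \<in> orbit g y" using oP by (simp add: P_def)
    then have "y \<in> orbit g (h y)" using permutes_orbit_facts(1,2)[OF p] by metis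
    then obtain m where m: "y = (g ^^ m) (h y)" unfolding orb by blast
    show ?thesis
    proof (intro bexI conjI allI)
      show "g ^^ m \<circ> h \<in> G" by (intro comp_mem pow_mem gG h(1))
      show "(g ^^ m \<circ> h) y = y" using m by simp
      show "(g ^^ m \<circ> h) (g x) = (g ^^ e) ((g ^^ m \<circ> h) x)" for x
        by (simp add: hg funpow_add[symmetric, unfolded comp_def, THEN fun_cong] add.commute)
    qed
  qed
  have rpow: "r ((g ^^ n) x) = (g ^^ (e * n)) (r x)" if "\<forall>x. r (g x) = (g ^^ e) (r x)" for r e n x
    using that by (induction n) (simp_all add: funpow_add)
  have ge: "g ^^ i \<noteq> g ^^ j" if "i < 8" "j < 8" "i \<noteq> j" for i j using inj[of i j] that by metis
  show "g ^^ 5 \<notin> cl g"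
  proof
    assume "g ^^ 5 \<in> cl g"
    then obtain r where r: "r \<in> G" "r y = y" "\<forall>x. r (g x) = (g ^^ 5) (r x)" using norm by blast
    have f: "r ((g ^^ n) y) = (g ^^ (5 * n)) y" for n using rpow[OF r(3), of n y] r(2) by simp
    have "r = id"
    proof (rule eq_if_agree[OF r(1) id_mem])
      \<comment> \<open>The power \<open>n\<close> of \<open>g\<close> applied to \<open>y\<close>
        is fixed when \<open>5 * n\<close> and \<open>n\<close> agree modulo 8, that is for even
        \<open>n\<close>.\<close>
      let ?A = "{y, (g ^^ 2) y, (g ^^ 4) y, (g ^^ 6) y}"
      show "?A \<subseteq> S" using y perm[OF pow_mem[OF gG]] by (auto simp: P_def permutes_in_image)
      have "(g ^^ 0) y \<noteq> (g ^^ 2) y" "(g ^^ 0) y \<noteq> (g ^^ 4) y" "(g ^^ 0) y \<noteq> (g ^^ 6) y"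
        "(g ^^ 2) y \<noteq> (g ^^ 4) y" "(g ^^ 2) y \<noteq> (g ^^ 6) y" "(g ^^ 4) y \<noteq> (g ^^ 6) y"
        using inj[of 0 2] inj[of 0 4] inj[of 0 6] inj[of 2 4] inj[of 2 6] inj[of 4 6] by auto
      then show "4 \<le> card ?A" by simp
      have "r ((g ^^ 2) y) = (g ^^ 2) y" "r ((g ^^ 4) y) = (g ^^ 4) y" "r ((g ^^ 6) y) = (g ^^ 6) y"
        using f[of 2] f[of 4] f[of 6] gn8[of 10 y] gn8[of 20 y] gn8[of 30 y] by simp_all
      then show "r x = id x" if "x \<in> ?A" for x using that r(2) by auto
    qed
    then have "g = g ^^ 5" using r(3) by (simp add: fun_eq_iff)
    then show False using ge[of 1 5] by simp
  qed
  show "g ^^ 7 \<notin> cl g"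
  proof
    assume "g ^^ 7 \<in> cl g"
    then obtain r where r: "r \<in> G" "r y = y" "\<forall>x. r (g x) = (g ^^ 7) (r x)" using norm by blast
    have rinj: "r u = r v \<longleftrightarrow> u = v" for u v using permutes_inj[OF perm[OF r(1)]] by (simp add: inj_eq)
    have rS: "r u \<in> S \<longleftrightarrow> u \<in> S" for u using perm[OF r(1)] by (simp add: permutes_in_image)
    have gS: "(g ^^ n) u \<in> S \<longleftrightarrow> u \<in> S" for n u using perm[OF pow_mem[OF gG]] by (simp add: permutes_in_image)
    \<comment> \<open>Inversion of the cycle fixes the point opposite to \<open>y\<close>, since 28
      is 4 modulo 8.\<close>
    have r4: "r ((g ^^ 4) y) = (g ^^ 4) y" using rpow[OF r(3), of 4 y] r(2) gn8[of 28 y] by simp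
    have gg: "g ((g ^^ 7) x) = x" for x using g8 by (simp add: fun_eq_iff eval_nat_numeral)
    have y4: "(g ^^ 4) y \<noteq> y" using y by (simp add: P_def)
    have "card {x \<in> S. (g ^^ 1) x = x} = 1" unfolding cf by (simp add: types11_def fx_def)
    \<comment> \<open>\<open>q\<close> is the fixed point of \<open>g\<close>, and \<open>a\<close>
      below is one end of its 2-cycle.\<close>
    then obtain q where q: "{x \<in> S. g x = x} = {q}" by (auto simp: card_Suc_eq eval_nat_numeral)
    then have qS: "q \<in> S" "g q = q" by auto
    have cA: "card {x \<in> S. (g ^^ 2) x = x} = 3" unfolding cf by (simp add: types11_def fx_def)
    have "{x \<in> S. (g ^^ 2) x = x} \<noteq> {q}" using cA by auto
    moreover have "q \<in> {x \<in> S. (g ^^ 2) x = x}" using qS by (simp add: numeral_2_eq_2)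
    ultimately obtain a where a: "a \<in> S" "g (g a) = a" "a \<noteq> q" by (auto simp: numeral_2_eq_2)
    have ga: "g a \<noteq> a" using a q by auto
    have gaq: "g a \<noteq> q" using a qS by (metis)
    have A: "{x \<in> S. (g ^^ 2) x = x} = {q, a, g a}"
      using cA qS a ga gaq gS[of 1 a] finS
      by (intro sym[OF card_subset_eq]) (auto simp: numeral_2_eq_2)
    have fixy: "z \<noteq> y" "z \<noteq> (g ^^ 4) y" if "g (g z) = z" for z
    proof -
      have "(g ^^ 4) z = z" using that by (simp add: eval_nat_numeral)
      moreover have "(g ^^ 4) ((g ^^ 4) y) = y" using g8 by (simp add: fun_eq_iff eval_nat_numeral)
      ultimately show "z \<noteq> y" "z \<noteq> (g ^^ 4) y" using y4 by auto
    qed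
    \<comment> \<open>Two points of the 8-cycle and two off it make four, and sharp 4-transitivity
      applies.\<close>
    have four: "u = id" if u: "u \<in> G" "u y = y" "u ((g ^^ 4) y) = (g ^^ 4) y" "u q = q" "u a = a" for u
    proof (rule eq_if_agree[OF u(1) id_mem])
      show "{y, (g ^^ 4) y, q, a} \<subseteq> S" using y qS a gS[of 4 y] by (auto simp: P_def)
      show "4 \<le> card {y, (g ^^ 4) y, q, a}"
        using y4 a fixy[of q] fixy[of a] qS by (auto simp: card_insert_if)
      show "u x = id x" if "x \<in> {y, (g ^^ 4) y, q, a}" for x using that u by auto
    qed
    have rq: "r q = q"
    proof -
      have "r q = (g ^^ 7) (r q)" using r(3) qS by metis
      then have "g (r q) = r q" using gg[of "r q"] by metis
      then show ?thesis using q rS qS by blast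
    qed
    have r2: "g (g (r x)) = r x" if "g (g x) = x" for x
    proof -
      have "r x = (g ^^ 7) ((g ^^ 7) (r x))" using r(3) that by metis
      then show ?thesis using gg[of "r x"] gg by metis
    qed
    have "r a \<in> {q, a, g a}" using r2[OF a(2)] a(1) rS unfolding A[symmetric] by (simp add: numeral_2_eq_2)
    moreover have "r a \<noteq> q" using rinj[of a q] rq a by simp
    \<comment> \<open>Otherwise \<open>r\<close> would fix four points, hence be trivial, and
      \<open>g\<close> would equal its inverse. So \<open>r\<close> interchanges the ends of the
      2-cycle.\<close>
    moreover have "r a \<noteq> a"
    proof
      assume "r a = a"
      then have "r = id" using four[OF r(1) r(2) r4 rq] by simp
      then have "g = g ^^ 7" using r(3) by (simp add: fun_eq_iff)
      then show False using ge[of 1 7] by simp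
    qed
    ultimately have ra: "r a = g a" by simp
    have rga: "r (g a) = a" 
    proof -
      have "r (g a) \<in> {q, a, g a}" using r2[of "g a"] a(1,2) rS gS[of 1 a] unfolding A[symmetric] by (simp add: numeral_2_eq_2)
      moreover have "r (g a) \<noteq> q" using rinj[of "g a" q] rq gaq by simp
      moreover have "r (g a) \<noteq> g a" using rinj[of "g a" a] ra ga by simp
      ultimately show ?thesis by simp
    qed
    \<comment> \<open>\<open>g\<close> and \<open>r\<close> both interchange \<open>a\<close> and
      \<open>g a\<close>, so \<open>s\<close> fixes these points and \<open>q\<close>, as the fourth
      power of \<open>g\<close> does. But \<open>s\<close> takes \<open>y\<close> to
      \<open>g y\<close>, not to the opposite point.\<close>
    define s where "s = g \<circ> r"
    have sG: "s \<in> G" unfolding s_def by (rule comp_mem[OF gG r(1)])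
    have rr: "r \<circ> r = id" by (rule four[OF comp_mem[OF r(1) r(1)]]) (simp_all add: r(2) r4 rq ra rga)
    have "s (s x) = x" for x
    proof -
      have "s (s x) = g ((g ^^ 7) (r (r x)))" using r(3) by (simp add: s_def)
      then show ?thesis using gg rr by (simp add: fun_eq_iff)
    qed
    then have s2: "s ^^ 2 = id" by (simp add: numeral_2_eq_2 fun_eq_iff)
    have sy: "s y = g y" using r(2) by (simp add: s_def)
    then have "s \<noteq> id" using inj[of 0 1] by auto
    have st: "s \<in> of_type (types11 ! 1)"
    proof (rule of_type11I[where P = "\<lambda>xs. fx xs 2 = 11 \<and> fx xs 1 \<noteq> 11", OF sG])
      show "fx (cyc_list s) 2 = 11 \<and> fx (cyc_list s) 1 \<noteq> 11"
        using fx_full_iff[OF sG, of 2] fx_full_iff[OF sG, of 1] s2 \<open>s \<noteq> id\<close> card_S by simp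
    qed code_simp
    have gt: "g ^^ 4 \<in> of_type (types11 ! 1)"
    proof (rule of_type11I[where P = "\<lambda>xs. fx xs 2 = 11 \<and> fx xs 1 \<noteq> 11", OF pow_mem[OF gG]])
      show "fx (cyc_list (g ^^ 4)) 2 = 11 \<and> fx (cyc_list (g ^^ 4)) 1 \<noteq> 11"
      proof -
        have "fx (cyc_list (g ^^ 4)) d = fx (types11 ! 6) (4 * d)" for d
          using fx_pow[OF gG, of 4 d] of_type11D(2)[OF g, of "4 * d"] by simp
        then show ?thesis by (simp add: types11_def) (simp add: fx_def)
      qed
    qed code_simp
    have "s = g ^^ 4"
    proof (rule involution_determined_by_fixed_points[OF st gt, of "{q, a, g a}"])
      show "card {q, a, g a} = 3" using A cA by simp
      have e: "(g ^^ 4) x = x" if "g (g x) = x" for x using that by (simp add: eval_nat_numeral)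
      show "x \<in> S \<and> s x = x \<and> (g ^^ 4) x = x" if "x \<in> {q, a, g a}" for x
        using that e[of q] e[of a] e[of "g a"] qS a rq ra rga gS[of 1 a] by (auto simp: s_def)
    qed
    then show False using sy inj[of 4 1] by simp
  qed
qed

text \<open>The odd powers split as 1, 3 and 5, 7. This is why the table involves
  \<open>alpha\<close>, the sum of the first and third powers of a primitive eighth root of
  unity.\<close>

lemma classes11_8:
  assumes g: "g \<in> of_type (types11 ! 6)"
  shows "g ^^ 5 \<in> of_type (types11 ! 6)" "card (cl g) = 990" "card (cl (g ^^ 5)) = 990"
    "cl g \<inter> cl (g ^^ 5) = {}" "of_type (types11 ! 6) = cl g \<union> cl (g ^^ 5)"
    "g ^^ 3 \<in> cl g" "g ^^ 7 \<in> cl (g ^^ 5)"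
    "g ^^ 4 \<in> of_type (types11 ! 1)" "g ^^ 2 \<in> of_type (types11 ! 3)" "g ^^ 6 \<in> of_type (types11 ! 3)"
proof -
  have gG: "g \<in> G" using g by (rule of_type11D)
  have f: "fx (cyc_list (g ^^ e)) d = fx (types11 ! 6) (e * d)" for e d
    using fx_pow[OF gG, of e d] of_type11D(2)[OF g, of "e * d"] by simp
  have odd: "g ^^ e \<in> of_type (types11 ! 6)" if "e = 3 \<or> e = 5 \<or> e = 7" for e
  proof (rule of_type11I[where P = "\<lambda>xs. fx xs 1 = 1 \<and> fx xs 2 = 3 \<and> fx xs 4 = 3 \<and> fx xs 8 = 11", OF pow_mem[OF gG]])
    show "fx (cyc_list (g ^^ e)) 1 = 1 \<and> fx (cyc_list (g ^^ e)) 2 = 3 \<and> fx (cyc_list (g ^^ e)) 4 = 3 \<and>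
        fx (cyc_list (g ^^ e)) 8 = 11"
      unfolding f using that by (elim disjE) (simp_all add: types11_def fx_def)
  qed code_simp
  show g5: "g ^^ 5 \<in> of_type (types11 ! 6)" by (rule odd) simp
  show "g ^^ 4 \<in> of_type (types11 ! 1)"
  proof (rule of_type11I[where P = "\<lambda>xs. fx xs 2 = 11 \<and> fx xs 1 = 3", OF pow_mem[OF gG]])
    show "fx (cyc_list (g ^^ 4)) 2 = 11 \<and> fx (cyc_list (g ^^ 4)) 1 = 3"
      unfolding f by (simp add: types11_def fx_def)
  qed code_simp
  have even: "g ^^ e \<in> of_type (types11 ! 3)" if "e = 2 \<or> e = 6" for e
  proof (rule of_type11I[where P = "\<lambda>xs. fx xs 1 = 3 \<and> fx xs 2 = 3 \<and> fx xs 4 = 11", OF pow_mem[OF gG]])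
    show "fx (cyc_list (g ^^ e)) 1 = 3 \<and> fx (cyc_list (g ^^ e)) 2 = 3 \<and> fx (cyc_list (g ^^ e)) 4 = 11"
      unfolding f using that by (elim disjE) (simp_all add: types11_def fx_def)
  qed code_simp
  show "g ^^ 2 \<in> of_type (types11 ! 3)" "g ^^ 6 \<in> of_type (types11 ! 3)" by (rule even, simp)+
  have "990 * cyc_count (mset (types11 ! 6)) [8] = card G" by (simp add: card_G_11 types11_def)
  moreover have "N (types11 ! 6) = 2 * 990" by (simp add: N11)
  ultimately have t: "card (cl g) = 990 \<and> card (cl (g ^^ 5)) = 990 \<and> cl g \<inter> cl (g ^^ 5) = {} \<and>
    of_type (types11 ! 6) = cl g \<union> cl (g ^^ 5)"
    by (intro two_classes[OF g g5 powers_not_conjugate_8_2(1)[OF g], where ls = "[8]"]) simp_all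
  then show "card (cl g) = 990" "card (cl (g ^^ 5)) = 990" "cl g \<inter> cl (g ^^ 5) = {}"
    "of_type (types11 ! 6) = cl g \<union> cl (g ^^ 5)"
    by blast+
  have g8: "g ^^ 8 = id" using of_type11D(3)[OF g, of 8] by (simp add: types11_def fx_def)
  \<comment> \<open>If the cube were conjugate to the fifth power, cubing once more would make
    \<open>g\<close> conjugate to its seventh power, as 9 and 15 are 1 and 7 modulo 8.\<close>
  show "g ^^ 3 \<in> cl g"
  proof (rule ccontr)
    assume "g ^^ 3 \<notin> cl g"
    then have "g ^^ 3 \<in> cl (g ^^ 5)" using t odd[of 3] by blast
    then have "(g ^^ 3) ^^ 3 \<in> cl ((g ^^ 5) ^^ 3)" by (rule cl_funpow)
    then have "g \<in> cl (g ^^ 7)"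
      using funpow_mod_id[OF g8, of 9] funpow_mod_id[OF g8, of 15] by (simp add: funpow_mult)
    then have "cl g = cl (g ^^ 7)" using cl_eq[OF pow_mem[OF gG]] by blast
    then show False using self_cl[of "g ^^ 7"] powers_not_conjugate_8_2(2)[OF g] by simp
  qed
  show "g ^^ 7 \<in> cl (g ^^ 5)" using t odd[of 7] powers_not_conjugate_8_2(2)[OF g] by blast
qed

end

section \<open>Permutation characters on lists of subsets\<close>

text \<open>The number of invariant \<open>k\<close>-subsets of a permutation with the given cycle lengths.\<close>

fun subset_count :: "nat list \<Rightarrow> nat \<Rightarrow> nat" where
  "subset_count [] k = (if k = 0 then 1 else 0)"
| "subset_count (c # cs) k = subset_count cs k + (if c \<le> k then subset_count cs (k - c) else 0)"

lemma card_subfamilies: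
  assumes "finite A" "image_mset f (mset_set A) = mset xs"
  shows "card {Q. Q \<subseteq> A \<and> sum f Q = k} = subset_count xs k"
  using assms
proof (induction xs arbitrary: A k)
  case Nil
  then have "A = {}" by (metis image_mset_is_empty_iff mset.simps(1) mset_set_empty_iff)
  then have "{Q. Q \<subseteq> A \<and> sum f Q = k} = (if k = 0 then {{}} else {})" by auto
  then show ?case by simp
next
  case (Cons c cs)
  have "c \<in># image_mset f (mset_set A)" using Cons.prems by simp
  then obtain B where B: "B \<in> A" "f B = c" using Cons.prems(1) by auto
  define A' where "A' = A - {B}"
  have A: "A = insert B A'" "B \<notin> A'" "finite A'" using B Cons.prems(1) by (auto simp: A'_def)
  have img: "image_mset f (mset_set A') = mset cs" using Cons.prems(2) A B by simp
  note IH = Cons.IH[OF A(3) img]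
  have eq: "{Q. Q \<subseteq> A \<and> sum f Q = k} = {Q. Q \<subseteq> A' \<and> sum f Q = k} \<union>
      (if c \<le> k then insert B ` {Q. Q \<subseteq> A' \<and> sum f Q = k - c} else {})" (is "_ = ?L \<union> ?R")
  proof (intro equalityI subsetI)
    fix Q assume "Q \<in> {Q. Q \<subseteq> A \<and> sum f Q = k}"
    then have Q: "Q \<subseteq> A" "sum f Q = k" by auto
    show "Q \<in> ?L \<union> ?R"
    proof (cases "B \<in> Q")
      case True
      have "finite Q" using Q(1) Cons.prems(1) finite_subset by blast
      then have s: "sum f Q = c + sum f (Q - {B})" using True B by (simp add: sum.remove)
      have "Q = insert B (Q - {B})" "Q - {B} \<subseteq> A'" using True Q A by auto
      then show ?thesis using s Q(2) by (auto intro!: image_eqI[of _ _ "Q - {B}"])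
    next
      case False
      then show ?thesis using Q A by auto
    qed
  next
    fix Q assume "Q \<in> ?L \<union> ?R"
    then consider "Q \<in> ?L" | Q' where "c \<le> k" "Q = insert B Q'" "Q' \<subseteq> A'" "sum f Q' = k - c"
      by (auto split: if_splits)
    then show "Q \<in> {Q. Q \<subseteq> A \<and> sum f Q = k}"
    proof cases
      case 2
      have "finite Q'" "B \<notin> Q'" using 2(3) A finite_subset by auto
      then show ?thesis using 2 A B by auto
    qed (use A in auto)
  qed
  have inj: "inj_on (insert B) {Q. Q \<subseteq> A' \<and> sum f Q = k - c}"
    using A(2) by (auto simp: inj_on_def dest!: insert_ident[THEN iffD1, rotated 2])
  have "card (?L \<union> ?R) = card ?L + card ?R"
    using A by (intro card_Un_disjoint) auto
  then show ?case unfolding eq by (simp add: IH card_image[OF inj])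
qed

text \<open>An invariant subset is a union of cycles, so it corresponds to a subfamily of the orbits
  whose sizes sum to \<open>k\<close>.\<close>

lemma card_invariant_subsets:
  assumes p: "p permutes S" and S: "finite S" and xs: "mset xs = full_cycle_type S p"
  shows "card {B. B \<subseteq> S \<and> card B = k \<and> p ` B = B} = subset_count xs k"
proof -
  note f = permutes_orbit_facts[OF p S]
  define A where "A = orbit p ` S"
  have "bij_betw Union {Q. Q \<subseteq> A \<and> sum card Q = k} {B. B \<subseteq> S \<and> card B = k \<and> p ` B = B}"
  proof (rule bij_betw_byWitness[where f' = "\<lambda>B. orbit p ` B"])
    show "\<forall>Q\<in>{Q. Q \<subseteq> A \<and> sum card Q = k}. orbit p ` \<Union>Q = Q"
    proof
      fix Q assume "Q \<in> {Q. Q \<subseteq> A \<and> sum card Q = k}"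
      then have Q: "Q \<subseteq> orbit p ` S" by (simp add: A_def)
      have "orbit p x = B" if "B \<in> Q" "x \<in> B" for x B
      proof -
        obtain y where "B = orbit p y" using Q \<open>B \<in> Q\<close> by blast
        then show ?thesis using f(2) \<open>x \<in> B\<close> by simp
      qed
      moreover have "\<exists>x. x \<in> B" if "B \<in> Q" for B using Q that f(1) by blast
      ultimately show "orbit p ` \<Union>Q = Q" by (auto simp: image_iff; metis)
    qed
    have closed: "(p ^^ n) x \<in> B" if "p ` B = B" "x \<in> B" for B n x
      using that by (induction n) auto
    have U: "\<Union> (orbit p ` B) = B" if "p ` B = B" for B
      using closed[OF that] f(1) by (auto simp: orbit_altdef)
    then show "\<forall>B\<in>{B. B \<subseteq> S \<and> card B = k \<and> p ` B = B}. \<Union> (orbit p ` B) = B" by blast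
    have cU: "card (\<Union>Q) = sum card Q" if "Q \<subseteq> A" for Q
      using that pairwise_subset[OF orbits_disjoint[OF p S], of Q] f(4)
      by (intro card_Union_disjoint) (auto simp: A_def)
    have pU: "p ` \<Union>Q = \<Union>Q" if "Q \<subseteq> A" for Q
    proof -
      have "p ` orbit p x = orbit p x" for x
      proof (rule card_subset_eq[OF f(4)])
        show "p ` orbit p x \<subseteq> orbit p x" by (auto intro: orbit.intros)
        show "card (p ` orbit p x) = card (orbit p x)" by (rule card_image[OF permutes_inj_on[OF p]])
      qed
      then have "p ` B = B" if "B \<in> Q" for B
      proof -
        assume e: "\<And>x. p ` orbit p x = orbit p x"
        obtain x where "B = orbit p x" using \<open>Q \<subseteq> A\<close> \<open>B \<in> Q\<close> unfolding A_def by blast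
        then show ?thesis using e by simp
      qed
      then have "(image p) ` Q = Q" by (simp add: image_def)
      then show ?thesis by (metis image_Union)
    qed
    show "Union ` {Q. Q \<subseteq> A \<and> sum card Q = k} \<subseteq> {B. B \<subseteq> S \<and> card B = k \<and> p ` B = B}"
    proof
      fix B assume "B \<in> Union ` {Q. Q \<subseteq> A \<and> sum card Q = k}"
      then obtain Q where Q: "Q \<subseteq> A" "sum card Q = k" "B = \<Union>Q" by blast
      have "B \<subseteq> S" using Q(1,3) f(3) unfolding A_def by blast
      then show "B \<in> {B. B \<subseteq> S \<and> card B = k \<and> p ` B = B}" using cU[OF Q(1)] pU[OF Q(1)] Q(2,3) by simp
    qed
    show "(\<lambda>B. orbit p ` B) ` {B. B \<subseteq> S \<and> card B = k \<and> p ` B = B} \<subseteq> {Q. Q \<subseteq> A \<and> sum card Q = k}"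
    proof
      fix Q assume "Q \<in> (\<lambda>B. orbit p ` B) ` {B. B \<subseteq> S \<and> card B = k \<and> p ` B = B}"
      then obtain B where B: "B \<subseteq> S" "card B = k" "p ` B = B" "Q = orbit p ` B" by blast
      have "Q \<subseteq> A" using B by (auto simp: A_def)
      then show "Q \<in> {Q. Q \<subseteq> A \<and> sum card Q = k}" using cU[of Q] U[OF B(3)] B by simp
    qed
  qed
  then have "card {B. B \<subseteq> S \<and> card B = k \<and> p ` B = B} = card {Q. Q \<subseteq> A \<and> sum card Q = k}"
    by (simp add: bij_betw_same_card)
  also have "\<dots> = subset_count xs k"
    using S xs by (intro card_subfamilies) (auto simp: A_def full_cycle_type_def)
  finally show ?thesis .
qed

text \<open>Lists of subsets realize products of permutation characters: the fixed points of the
  componentwise action multiply.\<close>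

definition subset_lists :: "'a set \<Rightarrow> nat list \<Rightarrow> 'a set list set" where
  "subset_lists S ks = {Bs. map card Bs = ks \<and> (\<forall>B\<in>set Bs. B \<subseteq> S)}"

lemma subset_lists_Cons:
  "subset_lists S (k # ks) = (\<lambda>(B, Bs). B # Bs) ` ({B. B \<subseteq> S \<and> card B = k} \<times> subset_lists S ks)"
proof (intro equalityI subsetI)
  fix Bs assume "Bs \<in> subset_lists S (k # ks)"
  then obtain B Bs' where "Bs = B # Bs'" "card B = k" "B \<subseteq> S" "Bs' \<in> subset_lists S ks"
    by (cases Bs) (auto simp: subset_lists_def)
  then show "Bs \<in> (\<lambda>(B, Bs). B # Bs) ` ({B. B \<subseteq> S \<and> card B = k} \<times> subset_lists S ks)" by force
next
  fix Bs assume "Bs \<in> (\<lambda>(B, Bs). B # Bs) ` ({B. B \<subseteq> S \<and> card B = k} \<times> subset_lists S ks)"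
  then obtain B Bs' where "Bs = B # Bs'" "card B = k" "B \<subseteq> S" "Bs' \<in> subset_lists S ks" by auto
  then show "Bs \<in> subset_lists S (k # ks)" by (simp add: subset_lists_def)
qed

lemma finite_subset_lists: "finite S \<Longrightarrow> finite (subset_lists S ks)"
proof (induction ks)
  case Nil
  have "subset_lists S [] = {[]}" by (auto simp: subset_lists_def)
  then show ?case by simp
next
  case (Cons k ks)
  then show ?case unfolding subset_lists_Cons by (intro finite_imageI finite_cartesian_product) auto
qed

lemma card_fixed_subset_lists:
  assumes p: "p permutes S" and S: "finite S" and xs: "mset xs = full_cycle_type S p"
  shows "card {Bs \<in> subset_lists S ks. map (image p) Bs = Bs} = (\<Prod>k\<leftarrow>ks. subset_count xs k)"
proof (induction ks)
  case Nil
  have "{Bs \<in> subset_lists S []. map (image p) Bs = Bs} = {[]}" by (auto simp: subset_lists_def)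
  then show ?case by simp
next
  case (Cons k ks)
  have "{Bs \<in> subset_lists S (k # ks). map (image p) Bs = Bs} = (\<lambda>(B, Bs). B # Bs) `
      ({B. B \<subseteq> S \<and> card B = k \<and> p ` B = B} \<times> {Bs \<in> subset_lists S ks. map (image p) Bs = Bs})"
    unfolding subset_lists_Cons by auto
  moreover have "inj_on (\<lambda>(B, Bs). B # Bs) X" for X :: "('a set \<times> 'a set list) set" by (auto simp: inj_on_def)
  ultimately show ?case using Cons by (simp add: card_image card_cartesian_product card_invariant_subsets[OF assms])
qed

text \<open>The row length \<open>n\<close> is carried along so that the empty combination is a zero
  row of the right size.\<close>

fun int_comb :: "nat \<Rightarrow> int list \<Rightarrow> int list list \<Rightarrow> int list" where
  "int_comb n (a # as) (g # gs) = map2 (\<lambda>x y. a * x + y) g (int_comb n as gs)"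
| "int_comb n _ _ = replicate n 0"

lemma int_comb_Ints:
  fixes w :: "nat \<Rightarrow> complex"
  assumes "\<And>g. g \<in> set gs \<Longrightarrow> length g = n \<and> (\<Sum>j<n. of_int (g ! j) * w j) \<in> \<int>"
  shows "length (int_comb n as gs) = n \<and> (\<Sum>j<n. of_int (int_comb n as gs ! j) * w j) \<in> \<int>"
  using assms
proof (induction n as gs rule: int_comb.induct)
  case (1 n a as g gs)
  then have IH: "length (int_comb n as gs) = n" "(\<Sum>j<n. of_int (int_comb n as gs ! j) * w j) \<in> \<int>"
    and g: "length g = n" "(\<Sum>j<n. of_int (g ! j) * w j) \<in> \<int>" by auto
  have "(\<Sum>j<n. of_int (int_comb n (a # as) (g # gs) ! j) * w j)
      = of_int a * (\<Sum>j<n. of_int (g ! j) * w j) + (\<Sum>j<n. of_int (int_comb n as gs ! j) * w j)"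
    unfolding sum_distrib_left sum.distrib[symmetric]
    by (intro sum.cong refl) (simp add: IH(1) g(1) distrib_right mult.assoc)
  also have "\<dots> \<in> \<int>" using IH(2) g(2) by (intro Ints_add Ints_mult) auto
  finally show ?case using IH(1) g(1) by simp
qed auto

text \<open>If another coefficient is nonzero it takes up the whole norm, and the pair vanishes. If
  not, the only obstruction is a pair with sum 0, such as the real numbers with
  \<open>p = - q\<close> and \<open>2 * p\<^sup>2 = 1\<close>; the equal degrees
  \<open>d a = d b\<close> turn a nonzero total degree into a nonzero sum.\<close>

lemma pair_Ints:
  fixes c :: "nat \<Rightarrow> complex"
  assumes norm: "(\<Sum>i<n. (cmod (c i))\<^sup>2) = 1" and ab: "a < n" "b < n" "a \<noteq> b"
    and int: "\<And>i. i < n \<Longrightarrow> i \<noteq> a \<Longrightarrow> i \<noteq> b \<Longrightarrow> c i \<in> \<int>"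
    and real: "c a \<in> \<real>" "c b \<in> \<real>" and sum: "c a + c b \<in> \<int>"
    and deg: "(\<Sum>i<n. d i * c i) \<noteq> 0" "d a = d b" and i: "i < n"
  shows "c i \<in> \<int>"
proof -
  have split: "(\<Sum>i<n. f i) = f a + f b + (\<Sum>i\<in>{..<n} - {a, b}. f i)" for f :: "nat \<Rightarrow> 'b :: ab_group_add"
  proof -
    have "(\<Sum>i<n. f i) = (\<Sum>i\<in>{..<n} - {a, b}. f i) + sum f {a, b}"
      by (rule sum.subset_diff) (use ab in auto)
    then show ?thesis using ab by (simp add: algebra_simps)
  qed
  have "c a \<in> \<int> \<and> c b \<in> \<int>"
  proof (cases "\<exists>k<n. k \<noteq> a \<and> k \<noteq> b \<and> c k \<noteq> 0")
    case True
    then obtain k where k: "k < n" "k \<noteq> a" "k \<noteq> b" "c k \<noteq> 0" by blast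
    obtain m where m: "c k = of_int m" using int[OF k(1-3)] by (auto elim: Ints_cases)
    have "1 \<le> \<bar>m\<bar>" using k(4) m by auto
    then have "1 \<le> cmod (c k)" using m by simp
    then have "1 \<le> (cmod (c k))\<^sup>2" by simp
    also have "\<dots> \<le> (\<Sum>i\<in>{..<n} - {a, b}. (cmod (c i))\<^sup>2)"
      using k by (intro member_le_sum) auto
    finally have "(cmod (c a))\<^sup>2 + (cmod (c b))\<^sup>2 \<le> 0" using norm unfolding split[of "\<lambda>i. (cmod (c i))\<^sup>2"] by simp
    then have "c a = 0 \<and> c b = 0" by (simp add: sum_power2_le_zero_iff)
    then show ?thesis by simp
  next
    case False
    obtain p q where p: "c a = of_real p" and q: "c b = of_real q" using real by (auto elim!: Reals_cases)
    obtain s where s: "c a + c b = of_int s" using sum by (auto elim: Ints_cases)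
    then have "complex_of_real (p + q) = complex_of_real (real_of_int s)" using p q by simp
    then have ps: "p + q = of_int s" by (simp only: of_real_eq_iff)
    have "(\<Sum>i\<in>{..<n} - {a, b}. (cmod (c i))\<^sup>2) = 0" "(\<Sum>i\<in>{..<n} - {a, b}. d i * c i) = 0"
      using False by (auto intro!: sum.neutral)
    then have e: "p\<^sup>2 + q\<^sup>2 = 1" and "d a * (c a + c b) \<noteq> 0"
      using norm deg unfolding split[of "\<lambda>i. (cmod (c i))\<^sup>2"] split[of "\<lambda>i. d i * c i"]
      by (simp_all add: p q algebra_simps)
    then have s0: "s \<noteq> 0" using s by auto
    \<comment> \<open>The parallelogram identity bounds the integer \<open>p + q\<close> by 1 in
      absolute value; then its square is 1 and \<open>p * q = 0\<close>.\<close>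
    have "(p + q)\<^sup>2 + (p - q)\<^sup>2 = 2" using e by (simp add: power2_eq_square algebra_simps)
    then have "(p + q)\<^sup>2 \<le> 2" using zero_le_power2[of "p - q"] by linarith
    then have "real_of_int (s\<^sup>2) \<le> 2" unfolding ps by simp
    then have s2: "s\<^sup>2 \<le> 2" by linarith
    have "\<bar>s\<bar> \<le> 1"
    proof (rule ccontr)
      assume "\<not> \<bar>s\<bar> \<le> 1"
      then have "2\<^sup>2 \<le> \<bar>s\<bar>\<^sup>2" by (intro power_mono) auto
      then show False using s2 by simp
    qed
    then have "s = 1 \<or> s = - 1" using s0 by linarith
    then have "s\<^sup>2 = 1" by auto
    then have "(p + q)\<^sup>2 = 1" unfolding ps by (metis of_int_1 of_int_power)
    then have "p * q = 0" using e by (simp add: power2_sum)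
    then have "p = 0 \<or> q = 0" by simp
    then show ?thesis
    proof
      assume "p = 0"
      then show ?thesis using p s by simp
    next
      assume "q = 0"
      then show ?thesis using q s by simp
    qed
  qed
  then show ?thesis using int[OF i] by blast
qed

section \<open>The permutation group as an abstract group\<close>

context perm_group
begin

definition M :: "('a \<Rightarrow> 'a) monoid" where
  "M = \<lparr>carrier = G, mult = (\<circ>), one = id\<rparr>"

lemma M_simps: "carrier M = G" "f \<otimes>\<^bsub>M\<^esub> h = f \<circ> h" "\<one>\<^bsub>M\<^esub> = id"
  by (simp_all add: M_def)

sublocale M: group M
proof (rule groupI)
  fix g assume "g \<in> carrier M"
  then show "\<exists>h\<in>carrier M. h \<otimes>\<^bsub>M\<^esub> g = \<one>\<^bsub>M\<^esub>" using inv_mem inv_simps(4) by (auto simp: M_simps)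
qed (auto simp: M_simps id_mem comp_mem)

lemma m_inv_M: "g \<in> G \<Longrightarrow> inv\<^bsub>M\<^esub> g = inv' g"
  by (rule M.inv_equality) (simp_all add: M_simps inv_mem inv_simps)

lemma conj_class_M: "g \<in> G \<Longrightarrow> conj_class M g = cl g"
  unfolding conj_class_def cl_def by (intro Collect_cong ex_cong1) (auto simp: M_simps m_inv_M)

lemma conj_classes_M: "conj_classes M = cl ` G"
  unfolding conj_classes_def by (auto simp: M_simps conj_class_M)

lemma subgroup_M:
  assumes "H \<subseteq> G" "H \<noteq> {}" "\<And>h k. h \<in> H \<Longrightarrow> k \<in> H \<Longrightarrow> h \<circ> k \<in> H" "\<And>h. h \<in> H \<Longrightarrow> inv' h \<in> H"
  shows "subgroup H M"
  by (rule M.subgroupI) (use assms in \<open>auto simp: M_simps m_inv_M subset_iff\<close>)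

lemma sum_over_classes:
  fixes f :: "('a \<Rightarrow> 'a) \<Rightarrow> complex"
  assumes d: "distinct Cs" and Cs: "set Cs = conj_classes M"
    and v: "\<And>j g. j < length Cs \<Longrightarrow> g \<in> Cs ! j \<Longrightarrow> f g = v j"
  shows "(\<Sum>g\<in>G. f g) = (\<Sum>j<length Cs. of_nat (card (Cs ! j)) * v j)"
proof -
  have U: "G = \<Union>(set Cs)"
    using self_cl cl_subset unfolding Cs conj_classes_M by fastforce
  have "(\<Sum>g\<in>G. f g) = (\<Sum>C\<in>set Cs. \<Sum>g\<in>C. f g)"
  proof (subst U, rule sum.Union_disjoint[unfolded comp_def])
    show "\<forall>A\<in>set Cs. finite A" using finite_subset[OF _ finG] U by blast
    show "\<forall>A\<in>set Cs. \<forall>B\<in>set Cs. A \<noteq> B \<longrightarrow> A \<inter> B = {}"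
      unfolding Cs conj_classes_M
    proof clarify
      fix g h assume gh: "g \<in> G" "h \<in> G" "cl g \<noteq> cl h"
      have "False" if "x \<in> cl g" "x \<in> cl h" for x
        using cl_eq[OF gh(1) that(1)] cl_eq[OF gh(2) that(2)] gh(3) by simp
      then show "cl g \<inter> cl h = {}" by blast
    qed
  qed
  also have "\<dots> = (\<Sum>j<length Cs. \<Sum>g\<in>Cs ! j. f g)"
    using sum.reindex_bij_betw[OF bij_betw_nth[OF d refl refl], of "\<lambda>C. \<Sum>g\<in>C. f g"] by simp
  also have "\<dots> = (\<Sum>j<length Cs. of_nat (card (Cs ! j)) * v j)"
    by (intro sum.cong refl) (simp add: v)
  finally show ?thesis .
qed

end

definition subset_list_count :: "nat list \<Rightarrow> nat list \<Rightarrow> int" where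
  "subset_list_count ks xs = int (\<Prod>k\<leftarrow>ks. subset_count xs k)"

context sharp_alt_group
begin

text \<open>The multiplicity of \<open>\<psi>\<close> in a permutation character, rewritten as a sum
  over classes. The character contributes only through the types \<open>ts\<close>, so the statement
  is about numerical rows.\<close>

lemma subset_list_char_Ints:
  assumes d: "distinct Cs" and Cs: "set Cs = conj_classes M" and len: "length ts = length Cs"
    and ts: "\<And>j. j < length Cs \<Longrightarrow> Cs ! j \<subseteq> of_type (ts ! j)"
    and \<psi>: "\<psi> \<in> irr_characters M" and v: "\<And>j g. j < length Cs \<Longrightarrow> g \<in> Cs ! j \<Longrightarrow> \<psi> g = v j"
  shows "(\<Sum>j<length Cs. of_int (map (subset_list_count ks) ts ! j) *
    (of_nat (card (Cs ! j)) * cnj (v j) / of_nat (card G))) \<in> \<int>"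
proof -
  have "M.cip (\<lambda>g. of_nat (card {Bs \<in> subset_lists S ks. map (image g) Bs = Bs})) \<psi> \<in> \<nat>"
  proof (rule M.perm_char_cip_Nats)
    show "finite (carrier M)" by (simp add: M_simps finG)
    show "finite (subset_lists S ks)" by (rule finite_subset_lists[OF finS])
    show "map (image g) Bs \<in> subset_lists S ks" if "g \<in> carrier M" "Bs \<in> subset_lists S ks" for g Bs
    proof -
      have "g permutes S" using that(1) perm by (simp add: M_simps)
      then have "card (g ` B) = card B" "B \<subseteq> S \<Longrightarrow> g ` B \<subseteq> S" for B
        using permutes_inj_on permutes_image by (auto intro!: card_image) blast
      then show ?thesis using that(2) by (auto simp: subset_lists_def)
    qed
  qed (auto simp: M_simps \<psi> image_comp)
  also have "M.cip (\<lambda>g. of_nat (card {Bs \<in> subset_lists S ks. map (image g) Bs = Bs})) \<psi>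
      = (\<Sum>g\<in>G. of_int (subset_list_count ks (cyc_list g)) * cnj (\<psi> g)) / of_nat (card G)"
    unfolding M.cip_def M_simps
    by (intro arg_cong2[where f = "(/)"] sum.cong refl)
      (simp add: card_fixed_subset_lists[OF perm finS mset_cyc_list] subset_list_count_def)
  also have "(\<Sum>g\<in>G. of_int (subset_list_count ks (cyc_list g)) * cnj (\<psi> g))
      = (\<Sum>j<length Cs. of_nat (card (Cs ! j)) * (of_int (subset_list_count ks (ts ! j)) * cnj (v j)))"
  proof (rule sum_over_classes[OF d Cs])
    fix j g assume "j < length Cs" "g \<in> Cs ! j"
    then have "cyc_list g = ts ! j" "\<psi> g = v j" using ts v by (auto simp: of_type_def)
    then show "of_int (subset_list_count ks (cyc_list g)) * cnj (\<psi> g)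
      = of_int (subset_list_count ks (ts ! j)) * cnj (v j)" by simp
  qed
  also have "\<dots> / of_nat (card G) = (\<Sum>j<length Cs. of_int (map (subset_list_count ks) ts ! j) *
    (of_nat (card (Cs ! j)) * cnj (v j) / of_nat (card G)))"
    unfolding sum_divide_distrib by (intro sum.cong refl) (simp add: len mult_ac)
  finally show ?thesis using Nats_subset_Ints by blast
qed

lemma restrict_one_Ints:
  assumes \<psi>: "\<psi> \<in> irr_characters M" and H: "subgroup H M"
    and lam: "\<And>h k. h \<in> H \<Longrightarrow> k \<in> H \<Longrightarrow> lam (h \<circ> k) = lam h * lam k" "lam id = 1"
  shows "(\<Sum>h\<in>H. \<psi> h * cnj (lam h)) / of_nat (card H) \<in> \<int>"
proof -
  have "(\<Sum>h\<in>H. \<psi> h * cnj (lam h)) / of_nat (card H) \<in> \<nat>"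
    by (rule M.linear_char_restrict_Nats) (use assms finG in \<open>simp_all add: M_simps\<close>)
  then show ?thesis using Nats_subset_Ints by blast
qed

end

section \<open>The two tables as integral combinations\<close>

text \<open>The empty types 9.1^3 and 9.3 at indices 12 and 13 are dropped, and the 11-cycles appear
  twice because they form two classes.\<close>

definition class_types12 :: "nat list list" where
  "class_types12 = map ((!) types12) ([0..<12] @ [14, 15, 15])"

definition class_sizes12 :: "nat list" where
  "class_sizes12 = [1, 495, 396, 1760, 2640, 2970, 2970, 9504, 15840, 7920, 11880, 11880, 9504, 8640, 8640]"

text \<open>
  Values of the permutation characters of \<open>subset_types12\<close> and, in the last row, of the trivial character
  induced from the centralizer of an element of type \<open>6\<^sup>2\<close>. The coefficients were found by integer row
  reduction.
\<close>

definition gens12 :: "int list list" where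
  "gens12 =
   [[1, 1, 1, 1, 1, 1, 1, 1, 1, 1, 1, 1, 1, 1, 1],
    [12, 4, 0, 3, 0, 4, 0, 2, 1, 0, 2, 0, 0, 1, 1],
    [144, 16, 0, 9, 0, 16, 0, 4, 1, 0, 4, 0, 0, 1, 1],
    [66, 10, 6, 3, 0, 6, 2, 1, 1, 0, 2, 0, 1, 0, 0],
    [1728, 64, 0, 27, 0, 64, 0, 8, 1, 0, 8, 0, 0, 1, 1],
    [792, 40, 0, 9, 0, 24, 0, 2, 1, 0, 4, 0, 0, 0, 0],
    [220, 20, 0, 4, 4, 4, 0, 0, 2, 0, 2, 0, 0, 0, 0],
    [20736, 256, 0, 81, 0, 256, 0, 16, 1, 0, 16, 0, 0, 1, 1],
    [9504, 160, 0, 27, 0, 96, 0, 4, 1, 0, 8, 0, 0, 0, 0],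
    [4356, 100, 36, 9, 0, 36, 4, 1, 1, 0, 4, 0, 1, 0, 0],
    [2640, 80, 0, 12, 0, 16, 0, 0, 2, 0, 4, 0, 0, 0, 0],
    [495, 31, 15, 9, 0, 3, 3, 0, 1, 0, 1, 1, 0, 0, 0],
    [14520, 200, 0, 12, 0, 24, 0, 0, 2, 0, 4, 0, 0, 0, 0],
    [287496, 1000, 216, 27, 0, 216, 8, 1, 1, 0, 8, 0, 1, 0, 0],
    [7920, 0, 60, 0, 6, 0, 0, 0, 0, 6, 0, 0, 0, 0, 0]]"

definition coeffs12 :: "int list list" where
  "coeffs12 =
   [[1, 0, 0, 0, 0, 0, 0, 0, 0, 0, 0, 0, 0, 0, 0],
    [-1, 1, 0, 0, 0, 0, 0, 0, 0, 0, 0, 0, 0, 0, 0],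
    [11, -598, 971, -41, -461, -45, 0, 77, -35, 32, 47, -10, 4, -3, -2],
    [14, -790, 1283, -54, -610, -56, 0, 102, -47, 42, 61, -14, 6, -4, -2],
    [11, -602, 977, -41, -462, -52, 1, 77, -34, 33, 50, -12, 3, -3, -2],
    [0, -1, 0, 1, 0, 0, 0, 0, 0, 0, 0, 0, 0, 0, 0],
    [7, -392, 637, -26, -303, -30, 0, 51, -24, 21, 32, -8, 3, -2, -1],
    [1, -2, 1, -1, 0, 0, 0, 0, 0, 0, 0, 0, 0, 0, 0],
    [37, -2003, 3248, -134, -1538, -163, 0, 256, -113, 107, 164, -38, 11, -10, -6],
    [-18, 995, -1617, 67, 768, 77, 0, -128, 57, -53, -80, 18, -6, 5, 3],
    [-7, 392, -637, 25, 303, 30, 1, -51, 24, -21, -32, 8, -3, 2, 1],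
    [-12, 604, -979, 42, 463, 50, 0, -77, 34, -33, -50, 12, -3, 3, 2],
    [7, -396, 646, -27, -307, -32, -1, 51, -22, 21, 33, -7, 2, -2, -1],
    [-7, 399, -648, 27, 307, 33, 0, -51, 22, -21, -33, 7, -2, 2, 1]]"

text \<open>The fourth row is the sum of the two rows of the table that involve \<open>omega\<close>.\<close>

definition rows12 :: "int list list" where
  "rows12 =
   [[  1,  1,  1,  1,  1,  1,  1,  1,  1,  1,  1,  1,  1,  1,  1],
     [ 11,  3, -1,  2, -1,  3, -1,  1,  0, -1,  1, -1, -1,  0,  0],
     [ 11,  3, -1,  2, -1, -1,  3,  1,  0, -1, -1,  1, -1,  0,  0],
     [ 32,  0,  8, -4,  2,  0,  0,  2,  0,  2,  0,  0, -2, -1, -1],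
     [ 45, -3,  5,  0,  3,  1,  1,  0,  0, -1, -1, -1,  0,  1,  1],
     [ 54,  6,  6,  0,  0,  2,  2, -1,  0,  0,  0,  0,  1, -1, -1],
     [ 55,  7, -5,  1,  1, -1, -1,  0,  1,  1, -1, -1,  0,  0,  0],
     [ 55, -1, -5,  1,  1,  3, -1,  0, -1,  1, -1,  1,  0,  0,  0],
     [ 55, -1, -5,  1,  1, -1,  3,  0, -1,  1,  1, -1,  0,  0,  0],
     [ 66,  2,  6,  3,  0, -2, -2,  1, -1,  0,  0,  0,  1,  0,  0],
     [ 99,  3, -1,  0,  3, -1, -1, -1,  0, -1,  1,  1, -1,  0,  0],
     [120, -8,  0,  3,  0,  0,  0,  0,  1,  0,  0,  0,  0, -1, -1],
     [144,  0,  4,  0, -3,  0,  0, -1,  0,  1,  0,  0, -1,  1,  1],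
     [176,  0, -4, -4, -1,  0,  0,  1,  0, -1,  0,  0,  1,  0,  0]]"

definition subset_types12 :: "nat list list" where
  "subset_types12 = [[], [1], [1,1], [2], [1,1,1], [2,1], [3], [1,1,1,1], [2,1,1], [2,2], [3,1], [4], [3,2], [2,2,2]]"

text \<open>Index 7, the empty type with a 9-cycle, is dropped; the types 2.8 and 11 appear twice
  because each splits into two classes.\<close>

definition class_types11 :: "nat list list" where
  "class_types11 = map ((!) types11) ([0..<6] @ [6, 6, 8, 8])"

definition class_sizes11 :: "nat list" where
  "class_sizes11 = [1, 165, 440, 990, 1584, 1320, 990, 990, 720, 720]"

definition gens11 :: "int list list" where
  "gens11 =
   [[1, 1, 1, 1, 1, 1, 1, 1, 1, 1],
    [11, 3, 2, 3, 1, 0, 1, 1, 0, 0],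
    [121, 9, 4, 9, 1, 0, 1, 1, 0, 0],
    [55, 7, 1, 3, 0, 1, 1, 1, 0, 0],
    [1331, 27, 8, 27, 1, 0, 1, 1, 0, 0],
    [605, 21, 2, 9, 0, 0, 1, 1, 0, 0],
    [165, 13, 3, 1, 0, 1, 1, 1, 0, 0],
    [3025, 49, 1, 9, 0, 1, 1, 1, 0, 0]]"

definition subset_types11 :: "nat list list" where
  "subset_types11 = [[], [1], [1,1], [2], [1,1,1], [2,1], [3], [2,2]]"

lemma distinct_types12: "distinct types12" unfolding types12_def by code_simp
lemma distinct_types11: "distinct types11" unfolding types11_def by code_simp

lemma types12_length: "length types12 = 16" by (simp add: types12_def)
lemma types11_length: "length types11 = 9" by (simp add: types11_def)

section \<open>The list of classes in degree 12\<close>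

context sharp5_12
begin

text \<open>Any 11-cycle \<open>g\<close> serves. With its inverse in its place the last two columns
  are exchanged, which the table compensates by exchanging the two rows with
  \<open>omega\<close>.\<close>

definition classes_12 :: "('a \<Rightarrow> 'a) \<Rightarrow> ('a \<Rightarrow> 'a) set list" where
  "classes_12 g = map (\<lambda>i. of_type (types12 ! i)) ([0..<12] @ [14]) @ [cl g, cl (inv' g)]"

lemma of_type12_nonempty: "i < 16 \<Longrightarrow> i \<noteq> 12 \<Longrightarrow> i \<noteq> 13 \<Longrightarrow> of_type (types12 ! i) \<noteq> {}"
proof -
  assume i: "i < 16" "i \<noteq> 12" "i \<noteq> 13"
  have "list_all (\<lambda>i. i = 12 \<or> i = 13 \<or> [1, 495, 396, 1760, 2640, 2970, 2970, 9504, 15840, 7920, 11880, 11880, 0, 0, 9504, 17280 :: nat] ! i \<noteq> 0) [0..<16]"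
    by (simp add: upt_rec)
  moreover have "i \<in> set [0..<16]" using i(1) by simp
  ultimately have "[1, 495, 396, 1760, 2640, 2970, 2970, 9504, 15840, 7920, 11880, 11880, 0, 0, 9504, 17280 :: nat] ! i \<noteq> 0"
    using i(2,3) unfolding list_all_iff by blast
  then have "N (types12 ! i) \<noteq> 0" using i N12[OF i(1)] by metis
  then show ?thesis unfolding N_zero_iff .
qed

lemma of_type12_disjoint:
  "i < 16 \<Longrightarrow> j < 16 \<Longrightarrow> i \<noteq> j \<Longrightarrow> of_type (types12 ! i) \<inter> of_type (types12 ! j) = {}"
  using nth_eq_iff_index_eq[OF distinct_types12] by (auto simp: of_type_def types12_length)

lemma classes_12_facts:
  assumes g: "g \<in> of_type (types12 ! 15)"
  shows "length (classes_12 g) = 15" "distinct (classes_12 g)" "set (classes_12 g) = conj_classes M"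
    "\<And>j. j < 13 \<Longrightarrow> classes_12 g ! j = of_type (class_types12 ! j)"
    "\<And>j. j < 15 \<Longrightarrow> classes_12 g ! j \<subseteq> of_type (class_types12 ! j)"
    "\<And>j. j < 15 \<Longrightarrow> card (classes_12 g ! j) = class_sizes12 ! j"
    "classes_12 g ! 13 = cl g" "classes_12 g ! 14 = cl (inv' g)"
proof -
  note c = classes12_11[OF g]
  show len: "length (classes_12 g) = 15" by (simp add: classes_12_def)
  show n13: "classes_12 g ! 13 = cl g" and n14: "classes_12 g ! 14 = cl (inv' g)"
    by (simp_all add: classes_12_def nth_append)
  have idx: "(([0..<12] @ [14]) :: nat list) ! j = ([0..<12] @ [14, 15, 15]) ! j" if "j < 13" for j
    using that by (auto simp: nth_append less_Suc_eq)
  show eq: "classes_12 g ! j = of_type (class_types12 ! j)" if "j < 13" for j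
    using that idx[OF that] by (simp add: classes_12_def class_types12_def nth_append)
  have t15: "class_types12 ! 13 = types12 ! 15" "class_types12 ! 14 = types12 ! 15"
    by (simp_all add: class_types12_def nth_append)
  show sub: "classes_12 g ! j \<subseteq> of_type (class_types12 ! j)" if "j < 15" for j
  proof -
    consider "j < 13" | "j = 13" | "j = 14" using \<open>j < 15\<close> by linarith
    then show ?thesis using eq n13 n14 t15 c(5) by cases auto
  qed
  show "card (classes_12 g ! j) = class_sizes12 ! j" if "j < 15" for j
  proof -
    have s: "list_all (\<lambda>j. [1, 495, 396, 1760, 2640, 2970, 2970, 9504, 15840, 7920, 11880, 11880, 0, 0, 9504, 17280 :: nat]
        ! (([0..<12] @ [14]) ! j) = class_sizes12 ! j) [0..<13]"
      unfolding class_sizes12_def by (simp add: upt_rec)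
    consider "j < 13" | "j = 13" | "j = 14" using \<open>j < 15\<close> by linarith
    then show ?thesis
    proof cases
      case 1
      then have "([0..<12] @ [14]) ! j < (16::nat)" by (auto simp: nth_append less_Suc_eq)
      then have "N (class_types12 ! j) = class_sizes12 ! j"
      proof -
        assume a: "([0..<12] @ [14]) ! j < (16::nat)"
        have "class_types12 ! j = types12 ! (([0..<12] @ [14]) ! j)"
          unfolding class_types12_def idx[OF 1] by (rule nth_map) (use 1 in simp)
        moreover have "j \<in> set [0..<13]" using 1 by simp
        ultimately show ?thesis using N12[OF a] s unfolding list_all_iff by metis
      qed
      then show ?thesis unfolding eq[OF 1] by (simp add: N_def)
    qed (simp_all add: n13 n14 c class_sizes12_def)
  qed
  have ne: "of_type (types12 ! i) \<noteq> cl h" if "i \<in> set ([0..<12] @ [14])" "h = g \<or> h = inv' g" for i h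
  proof -
    have "cl h \<subseteq> of_type (types12 ! 15)" "h \<in> cl h" using that(2) c self_cl by auto
    then show ?thesis using of_type12_disjoint[of i 15] that(1) by (cases "i = 14") fastforce+
  qed
  have "inj_on (\<lambda>i. of_type (types12 ! i)) (set ([0..<12] @ [14]))"
  proof (rule inj_onI, rule ccontr)
    fix i j assume ij: "i \<in> set ([0..<12] @ [14])" "j \<in> set ([0..<12] @ [14])"
      "of_type (types12 ! i) = of_type (types12 ! j)" "i \<noteq> j"
    then have "i < 16" "j < 16" "i \<noteq> 12" "i \<noteq> 13" by auto
    then show False using of_type12_disjoint[of i j] of_type12_nonempty[of i] ij by simp
  qed
  then have "distinct (map (\<lambda>i. of_type (types12 ! i)) ([0..<12] @ [14]))"
    unfolding distinct_map by simp
  moreover have "cl g \<noteq> cl (inv' g)" using c(4) self_cl by blast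
  moreover have "C \<noteq> cl g \<and> C \<noteq> cl (inv' g)" if "C \<in> set (map (\<lambda>i. of_type (types12 ! i)) ([0..<12] @ [14]))" for C
  proof -
    obtain i where "i \<in> set ([0..<12] @ [14])" "C = of_type (types12 ! i)" using \<open>C \<in> _\<close> unfolding set_map by blast
    then show ?thesis using ne[of i g] ne[of i "inv' g"] by simp
  qed
  ultimately show "distinct (classes_12 g)"
    unfolding classes_12_def distinct_append by (auto simp del: set_map map_append)
  have set: "set (classes_12 g) = (\<lambda>i. of_type (types12 ! i)) ` ({0..<12} \<union> {14}) \<union> {cl g, cl (inv' g)}"
    by (simp add: classes_12_def insert_commute image_Un)
  show "set (classes_12 g) = conj_classes M" unfolding conj_classes_M
  proof (intro equalityI subsetI)
    fix C assume "C \<in> set (classes_12 g)"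
    then consider i where "i \<in> {0..<12} \<union> {14}" "C = of_type (types12 ! i)" | "C = cl g" | "C = cl (inv' g)"
      unfolding set by blast
    then show "C \<in> cl ` G"
    proof cases
      case 1
      then have "C \<noteq> {}" using of_type12_nonempty[of i] by auto
      then obtain h where "h \<in> C" by blast
      then have "h \<in> G" "C = cl h" using classes12[of h i] 1 by (auto simp: of_type_def)
      then show ?thesis by blast
    qed (use g c(1) in \<open>auto simp: of_type_def\<close>)
  next
    fix C assume "C \<in> cl ` G"
    then obtain h where h: "h \<in> G" "C = cl h" by blast
    have "cyc_list h \<in> set types12" by (rule cyc_list_types12[OF h(1)])
    then obtain i where i: "i < 16" "cyc_list h = types12 ! i"
      by (metis (no_types) in_set_conv_nth types12_length)
    then have hi: "h \<in> of_type (types12 ! i)" using h by (simp add: of_type_def)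
    then have "N (types12 ! i) \<noteq> 0" unfolding N_zero_iff by blast
    then have "i \<noteq> 12" "i \<noteq> 13" using N12[of 12] N12[of 13] by auto
    then consider "i \<in> {0..<12} \<union> {14}" | "i = 15" using i(1) by force
    then show "C \<in> set (classes_12 g)"
    proof cases
      case 1
      then show ?thesis unfolding set using classes12[OF hi 1] h by blast
    next
      case 2
      then have "h \<in> cl g \<or> h \<in> cl (inv' g)" using hi c(5) by blast
      moreover have "g \<in> G" "inv' g \<in> G" using g c(1) by (auto simp: of_type_def)
      ultimately have "C = cl g \<or> C = cl (inv' g)" using cl_eq h(2) by blast
      then show ?thesis unfolding set by blast
    qed
  qed
qed

end

lemma rows12_eq: "map (\<lambda>as. int_comb 15 as gens12) coeffs12 = rows12"
  unfolding gens12_def coeffs12_def rows12_def by code_simp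

text \<open>Products of integers rather than naturals, since \<open>code_simp\<close> multiplies naturals in unary.\<close>

lemma subset_list_count_int: "subset_list_count = (\<lambda>ks xs. \<Prod>k\<leftarrow>ks. int (subset_count xs k))"
proof (intro ext)
  show "subset_list_count ks xs = (\<Prod>k\<leftarrow>ks. int (subset_count xs k))" for ks xs
    by (induction ks) (simp_all add: subset_list_count_def)
qed

text \<open>The extra row has degree 95040 / 12 = 7920. At the types 2^6, 3^4 and 6^2 the
  centralizer orders are 240, 36 and 12, and the subgroup contains 3, 2 and 6 elements; hence 60, 6
  and 6.\<close>

lemma gens12_eq:
  "gens12 = map (\<lambda>ks. map (subset_list_count ks) class_types12) subset_types12 @
    [[7920, 0, 60, 0, 6, 0, 0, 0, 0, 6, 0, 0, 0, 0, 0]]"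
  unfolding gens12_def class_types12_def types12_def subset_types12_def subset_list_count_int by code_simp

lemma gens11_eq: "gens11 = map (\<lambda>ks. map (subset_list_count ks) class_types11) subset_types11"
  unfolding gens11_def class_types11_def types11_def subset_types11_def subset_list_count_int by code_simp

text \<open>Trace -1 and norm 3 of \<open>omega\<close>: these rules bring every product of table
  entries to the form a + b \<open>omega\<close>, which lets simplification decide
  orthogonality.\<close>

lemma cnj_omega: "cnj omega = - 1 - omega" and omega_square: "omega * omega = - 3 - omega"
proof -
  have c: "csqrt (- 11) = \<i> * of_real (sqrt 11)" using csqrt_of_real'[of "-11"] by simp
  have s: "complex_of_real (sqrt 11) * complex_of_real (sqrt 11) = 11"
    unfolding of_real_mult[symmetric] by simp
  have o: "omega = (- 1 + \<i> * of_real (sqrt 11)) / 2" by (simp add: omega_def c)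
  show "cnj omega = - 1 - omega" unfolding o by (simp add: field_simps)
  have w: "2 * omega = \<i> * of_real (sqrt 11) - 1" unfolding o by simp
  have "4 * (omega * omega) = (2 * omega) * (2 * omega)" by simp
  also have "\<dots> = - 12 - 2 * (2 * omega)" unfolding w by (simp add: algebra_simps s)
  also have "\<dots> = 4 * (- 3 - omega)" by simp
  finally show "omega * omega = - 3 - omega" by (simp only: mult_left_cancel[of "4 :: complex"] simp_thms zero_neq_numeral[symmetric] not_False_eq_True)
qed

lemma alpha_simps: "cnj alpha = - alpha" "alpha * alpha = - 2"
proof -
  have c: "alpha = \<i> * of_real (sqrt 2)" using csqrt_of_real'[of "-2"] by (simp add: alpha_def)
  have s: "complex_of_real (sqrt 2) * complex_of_real (sqrt 2) = 2"
    unfolding of_real_mult[symmetric] by simp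
  show "cnj alpha = - alpha" "alpha * alpha = - 2" unfolding c by (simp_all add: algebra_simps s)
qed

lemma omega_neq: "omega \<noteq> cnj omega"
proof
  assume "omega = cnj omega"
  then have o: "2 * omega = - 1" using cnj_omega by (simp add: algebra_simps)
  have "(2 * omega) * (2 * omega) = 4 * (omega * omega)" by simp
  also have "\<dots> = - 12 - 2 * (2 * omega)" unfolding omega_square by simp
  finally show False unfolding o by simp
qed

lemma alpha_neq: "alpha \<noteq> - alpha"
  using alpha_simps(2) by auto

lemma table_12_shape: "length table_12 = 15" "\<And>r. r \<in> set table_12 \<Longrightarrow> length r = 15" "distinct table_12"
  using omega_neq by (auto simp: table_12_def)

lemma table_11_shape: "length table_11 = 10" "\<And>r. r \<in> set table_11 \<Longrightarrow> length r = 10" "distinct table_11"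
  using omega_neq alpha_neq by (auto simp: table_11_def alpha_simps)

lemma table_12_orthogonality:
  assumes "j < 15" "k < 15"
  shows "(\<Sum>i<15. table_12 ! i ! j * cnj (table_12 ! i ! k)) * of_nat (class_sizes12 ! j) = (if j = k then 95040 else 0)"
proof -
  \<comment> \<open>The check is stated for the transposed table by zipping columns, a form that
    unfolds completely; it is translated back to indexed sums afterwards.\<close>
  have L: "list_all (\<lambda>(j, m, c). list_all (\<lambda>(k, d). (\<Sum>(x, y)\<leftarrow>zip c d. x * cnj y) * of_nat m = (if j = k then 95040 else 0))
      (zip [0..<15] (List.transpose table_12))) (zip [0..<15] (zip class_sizes12 (List.transpose table_12)))"
    unfolding table_12_def class_sizes12_def
    by (simp add: upt_rec cnj_omega omega_square algebra_simps)
  have len: "length (List.transpose table_12) = 15" "length class_sizes12 = 15"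
    by (simp_all add: table_12_def class_sizes12_def)
  have eq: "(\<Sum>(x, y)\<leftarrow>zip (List.transpose table_12 ! j) (List.transpose table_12 ! k). x * cnj y) = (\<Sum>i<15. table_12 ! i ! j * cnj (table_12 ! i ! k))"
  proof -
    have t: "List.transpose table_12 ! l = map (\<lambda>r. r ! l) table_12" if "l < 15" for l
    proof -
      have "filter (\<lambda>r. l < length r) table_12 = table_12"
        using table_12_shape(2) \<open>l < 15\<close> by (intro filter_True) auto
      then show ?thesis using nth_transpose[of l table_12] len \<open>l < 15\<close> by simp
    qed
    show ?thesis unfolding t[OF assms(1)] t[OF assms(2)]
      by (simp add: sum_list_sum_nth table_12_shape(1) atLeast0LessThan)
  qed
  have all: "\<forall>p<15. \<forall>q<15. (\<Sum>(x, y)\<leftarrow>zip (List.transpose table_12 ! p) (List.transpose table_12 ! q). x * cnj y) *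
      of_nat (class_sizes12 ! p) = (if p = q then 95040 else 0)"
    using L len by (simp add: list_all_length)
  show ?thesis using all[rule_format, OF assms] unfolding eq .
qed

lemma table_11_orthogonality:
  assumes "j < 10" "k < 10"
  shows "(\<Sum>i<10. table_11 ! i ! j * cnj (table_11 ! i ! k)) * of_nat (class_sizes11 ! j) = (if j = k then 7920 else 0)"
proof -
  have L: "list_all (\<lambda>(j, m, c). list_all (\<lambda>(k, d). (\<Sum>(x, y)\<leftarrow>zip c d. x * cnj y) * of_nat m = (if j = k then 7920 else 0))
      (zip [0..<10] (List.transpose table_11))) (zip [0..<10] (zip class_sizes11 (List.transpose table_11)))"
    unfolding table_11_def class_sizes11_def
    by (simp add: upt_rec cnj_omega omega_square algebra_simps alpha_simps)
  have len: "length (List.transpose table_11) = 10" "length class_sizes11 = 10"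
    by (simp_all add: table_11_def class_sizes11_def)
  have eq: "(\<Sum>(x, y)\<leftarrow>zip (List.transpose table_11 ! j) (List.transpose table_11 ! k). x * cnj y) = (\<Sum>i<10. table_11 ! i ! j * cnj (table_11 ! i ! k))"
  proof -
    have t: "List.transpose table_11 ! l = map (\<lambda>r. r ! l) table_11" if "l < 10" for l
    proof -
      have "filter (\<lambda>r. l < length r) table_11 = table_11"
        using table_11_shape(2) \<open>l < 10\<close> by (intro filter_True) auto
      then show ?thesis using nth_transpose[of l table_11] len \<open>l < 10\<close> by simp
    qed
    show ?thesis unfolding t[OF assms(1)] t[OF assms(2)]
      by (simp add: sum_list_sum_nth table_11_shape(1) atLeast0LessThan)
  qed
  have all: "\<forall>p<10. \<forall>q<10. (\<Sum>(x, y)\<leftarrow>zip (List.transpose table_11 ! p) (List.transpose table_11 ! q). x * cnj y) *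
      of_nat (class_sizes11 ! p) = (if p = q then 7920 else 0)"
    using L len by (simp add: list_all_length)
  show ?thesis using all[rule_format, OF assms] unfolding eq .
qed

section \<open>Values at inverses and restriction to cyclic subgroups\<close>

context sharp_alt_group
begin

text \<open>A permutation and its inverse have the same orbits. Hence irreducible characters are
  real on every type that is a single class.\<close>

lemma of_type_inv:
  assumes "g \<in> of_type xs"
  shows "inv' g \<in> of_type xs"
proof -
  have g: "g \<in> G" using assms by (simp add: of_type_def)
  have "permutation g" using perm[OF g] finS by (auto simp: permutation_permutes)
  then have "orbit (inv' g) = orbit g" by (intro ext) (simp add: orbit_inv_eq)
  then have "ct (inv' g) = ct g" by (simp add: full_cycle_type_def)
  then have "cyc_list (inv' g) = cyc_list g" unfolding cyc_list_eq_iff .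
  then show ?thesis using assms inv_mem[OF g] by (simp add: of_type_def)
qed

lemma character_inv: "\<psi> \<in> irr_characters M \<Longrightarrow> g \<in> G \<Longrightarrow> \<psi> (inv' g) = cnj (\<psi> g)"
  using M.irr_character_inv[of \<psi> g] finG by (simp add: M_simps m_inv_M)

text \<open>The integer is the multiplicity, in the restriction of \<open>\<psi>\<close> to the
  group generated by \<open>g\<close>, of the linear character that sends \<open>g\<close> to
  \<open>\<zeta>\<close>.\<close>

lemma cyclic_restrict_Ints:
  assumes \<psi>: "\<psi> \<in> irr_characters M" and g: "g \<in> G" "g ^^ n = id" "n > 0"
    and inj: "inj_on (\<lambda>i. g ^^ i) {..<n}" and \<zeta>: "\<zeta> ^ n = (1 :: complex)"
  shows "(\<Sum>i<n. \<psi> (g ^^ i) * cnj (\<zeta> ^ i)) / of_nat n \<in> \<int>"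
proof -
  define H where "H = (\<lambda>i. g ^^ i) ` {..<n}"
  \<comment> \<open>The exponent is read off as the one below \<open>n\<close>; this is
    multiplicative because both \<open>g\<close> and \<open>\<zeta>\<close> have order dividing
    \<open>n\<close>.\<close>
  define lam where "lam h = \<zeta> ^ the_inv_into {..<n} (\<lambda>i. g ^^ i) h" for h
  have red: "g ^^ i = g ^^ (i mod n)" for i by (rule funpow_mod_id[OF g(2)])
  have \<zeta>red: "\<zeta> ^ i = \<zeta> ^ (i mod n)" for i
  proof -
    have "\<zeta> ^ (n * (i div n) + i mod n) = \<zeta> ^ (i mod n)" by (simp only: power_add power_mult \<zeta> power_one mult_1_left)
    then show ?thesis by simp
  qed
  have lam: "lam (g ^^ i) = \<zeta> ^ i" for i
  proof -
    have "the_inv_into {..<n} (\<lambda>i. g ^^ i) (g ^^ (i mod n)) = i mod n"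
      using g(3) by (intro the_inv_into_f_f[OF inj]) simp
    then show ?thesis unfolding lam_def using red[of i] \<zeta>red[of i] by simp
  qed
  have mem: "g ^^ i \<in> H" for i using red[of i] g(3) by (auto simp: H_def)
  have "subgroup H M"
  proof (rule subgroup_M)
    show "H \<subseteq> G" using pow_mem[OF g(1)] by (auto simp: H_def)
    show "H \<noteq> {}" using mem by blast
    show "h \<circ> k \<in> H" if "h \<in> H" "k \<in> H" for h k
    proof -
      obtain i j where "h = g ^^ i" "k = g ^^ j" using \<open>h \<in> H\<close> \<open>k \<in> H\<close> by (auto simp: H_def)
      then show ?thesis using mem[of "i + j"] by (simp add: funpow_add)
    qed
    show "inv' h \<in> H" if "h \<in> H" for h
    proof -
      obtain i where i: "h = g ^^ i" "i < n" using \<open>h \<in> H\<close> by (auto simp: H_def)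
      have "g ^^ (n - i) \<circ> g ^^ i = id" "g ^^ i \<circ> g ^^ (n - i) = id" using i(2) g(2) by (simp_all add: funpow_add[symmetric])
      then have "inv' (g ^^ i) = g ^^ (n - i)" by (rule inv_unique_comp[rotated])
      then show ?thesis using mem i by simp
    qed
  qed
  moreover have "lam (h \<circ> k) = lam h * lam k" if "h \<in> H" "k \<in> H" for h k
  proof -
    obtain i j where "h = g ^^ i" "k = g ^^ j" using \<open>h \<in> H\<close> \<open>k \<in> H\<close> by (auto simp: H_def)
    then show ?thesis using lam[of "i + j"] lam by (simp add: funpow_add power_add)
  qed
  moreover have "lam id = 1" using lam[of 0] by simp
  ultimately have "(\<Sum>h\<in>H. \<psi> h * cnj (lam h)) / of_nat (card H) \<in> \<int>"
    by (intro restrict_one_Ints[OF \<psi>])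
  moreover have "(\<Sum>h\<in>H. \<psi> h * cnj (lam h)) = (\<Sum>i<n. \<psi> (g ^^ i) * cnj (\<zeta> ^ i))"
    unfolding H_def by (simp add: sum.reindex[OF inj] lam)
  moreover have "card H = n" unfolding H_def by (simp add: card_image[OF inj])
  ultimately show ?thesis by simp
qed

end

lemma table_12_rows:
  "table_12 = map (map of_int) (take 3 rows12) @ [table_12 ! 3, table_12 ! 4] @ map (map of_int) (drop 4 rows12)"
  unfolding table_12_def rows12_def by simp

lemma table_12_rational:
  assumes "i < 15" "i \<noteq> 3" "i \<noteq> 4"
  obtains r where "r \<in> set rows12" "table_12 ! i = map of_int r"
proof -
  have l: "length rows12 = 14" by (simp add: rows12_def)
  show thesis
  proof (cases "i < 3")
    case True
    then have "table_12 ! i = map of_int (rows12 ! i)"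
      by (subst table_12_rows) (simp add: nth_append l)
    then show thesis using that[of "rows12 ! i"] True l by simp
  next
    case False
    then have i: "i \<ge> 5" using assms by simp
    \<comment> \<open>The pair of rows 3 and 4 is merged in \<open>rows12\<close>, so later rows sit
      one place earlier.\<close>
    then have "table_12 ! i = map of_int (rows12 ! (i - 1))"
      using assms(1) by (subst table_12_rows) (simp add: nth_append l nth_Cons' Suc_diff_le)
    then show thesis using that[of "rows12 ! (i - 1)"] assms(1) l by simp
  qed
qed

lemma pair_row12: "j < 15 \<Longrightarrow> table_12 ! 3 ! j + table_12 ! 4 ! j = of_int (rows12 ! 3 ! j)"
proof -
  have "map2 (+) (table_12 ! 3) (table_12 ! 4) = map of_int (rows12 ! 3)"
    by (simp add: table_12_def rows12_def cnj_omega)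
  moreover have "length (table_12 ! 3) = 15" "length (table_12 ! 4) = 15" "length (rows12 ! 3) = 15"
    by (simp_all add: table_12_def rows12_def)
  moreover assume "j < 15"
  ultimately show ?thesis by (metis (no_types, lifting) length_map length_zip min.idem nth_map nth_zip case_prod_conv)
qed

section \<open>The character table in degree 12\<close>

context sharp5_12
begin

text \<open>The multiplicity of the trivial character in the restriction of \<open>\<psi>\<close> to
  the centralizer; the weights 1, 3, 2, 6 come from \<open>sum_cent_6_6\<close>. An integer equals
  its conjugate, so the conjugated form needed for the coefficients follows.\<close>

lemma centralizer_6_6_Ints:
  assumes \<psi>: "\<psi> \<in> irr_characters M" and z: "z \<in> of_type (types12 ! 9)"
    and v: "\<And>i g. i \<in> {0, 2, 4, 9} \<Longrightarrow> g \<in> of_type (types12 ! i) \<Longrightarrow> \<psi> g = v i"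
  shows "(cnj (v 0) + 3 * cnj (v 2) + 2 * cnj (v 4) + 6 * cnj (v 9)) / 12 \<in> \<int>"
proof -
  have zG: "z \<in> G" using z by (simp add: of_type_def)
  note C = cent_props[OF zG]
  have t: "types12 ! i = types12 ! j \<longleftrightarrow> i = j" if "i < 16" "j < 16" for i j
    using nth_eq_iff_index_eq[OF distinct_types12] that by (simp add: types12_length)
  \<comment> \<open>Applied to the indicator function of four types, \<open>sum_cent_6_6\<close>
    gives 12, the order of the centralizer. So no other type occurs in it.\<close>
  define T where "T = (!) types12 ` {0, 2, 4, 9}"
  have "types12 ! 0 \<in> T" "types12 ! 2 \<in> T" "types12 ! 4 \<in> T" "types12 ! 9 \<in> T"
    unfolding T_def by (rule imageI, simp)+
  then have "(\<Sum>h\<in>cent z. if cyc_list h \<in> T then 1 else 0 :: complex) = 12"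
    unfolding sum_cent_6_6(2)[OF z, of "\<lambda>xs. if xs \<in> T then 1 else 0"] by simp
  moreover have "(\<Sum>h\<in>cent z. if cyc_list h \<in> T then 1 else 0 :: complex) = of_nat (card {h \<in> cent z. cyc_list h \<in> T})"
    by (simp add: sum.inter_filter[OF C(5), symmetric])
  ultimately have "complex_of_nat (card {h \<in> cent z. cyc_list h \<in> T}) = of_nat 12"
    by simp
  then have "card {h \<in> cent z. cyc_list h \<in> T} = card (cent z)"
    using sum_cent_6_6(1)[OF z] by (simp only: of_nat_eq_iff)
  then have all: "{h \<in> cent z. cyc_list h \<in> T} = cent z"
    by (intro card_subset_eq[OF C(5)]) auto
  define F where "F xs = (if xs = types12 ! 0 then v 0 else if xs = types12 ! 2 then v 2 else
    if xs = types12 ! 4 then v 4 else v 9)" for xs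
  have F: "\<psi> h = F (cyc_list h)" if "h \<in> cent z" for h
  proof -
    obtain i where i: "i \<in> {0, 2, 4, 9}" "cyc_list h = types12 ! i" 
    proof -
      have "cyc_list h \<in> T" using \<open>h \<in> cent z\<close> all by blast
      then show ?thesis using that unfolding T_def by (elim imageE) blast
    qed
    then have "h \<in> of_type (types12 ! i)" using C(1) that by (auto simp: of_type_def)
    then show ?thesis using v[OF i(1)] i by (auto simp: F_def t)
  qed
  have "subgroup (cent z) M" by (rule subgroup_M) (use C in blast)+
  then have "(\<Sum>h\<in>cent z. \<psi> h * cnj 1) / of_nat (card (cent z)) \<in> \<int>"
    by (rule restrict_one_Ints[OF \<psi>]) simp_all
  also have "(\<Sum>h\<in>cent z. \<psi> h * cnj 1) = (\<Sum>h\<in>cent z. F (cyc_list h))" using F by simp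
  also have "\<dots> = v 0 + 3 * v 2 + 2 * v 4 + 6 * v 9"
    unfolding sum_cent_6_6(2)[OF z] by (simp add: F_def t)
  finally have "(v 0 + 3 * v 2 + 2 * v 4 + 6 * v 9) / 12 \<in> \<int>"
    using sum_cent_6_6(1)[OF z] by simp
  then obtain m where m: "(v 0 + 3 * v 2 + 2 * v 4 + 6 * v 9) / 12 = of_int m" by (auto elim: Ints_cases)
  have "(cnj (v 0) + 3 * cnj (v 2) + 2 * cnj (v 4) + 6 * cnj (v 9)) / 12
      = cnj ((v 0 + 3 * v 2 + 2 * v 4 + 6 * v 9) / 12)" by simp
  then show ?thesis unfolding m by simp
qed

lemma character_table_12:
  assumes g: "g \<in> of_type (types12 ! 15)"
  shows "is_character_table M (classes_12 g) (map (M.table_char (classes_12 g)) table_12) table_12"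
proof -
  define Cs where "Cs = classes_12 g"
  note F = classes_12_facts[OF g, folded Cs_def]
  have sizes: "card (Cs ! j) = class_sizes12 ! j" if "j < 15" for j using F(6)[OF that] .
  have size0: "class_sizes12 ! 0 = 1" by (simp add: class_sizes12_def)
  have idC: "id \<in> Cs ! 0"
  proof -
    have "id \<in> of_type (types12 ! 0)"
      by (rule of_type12I[where P = "\<lambda>xs. fx xs 1 = 12", OF id_mem])
        (use fx_full_iff[OF id_mem, of 1] card_S in simp, code_simp)
    then show ?thesis using F(4)[of 0] by (simp add: class_types12_def nth_append)
  qed
  have "Cs ! 0 = {\<one>\<^bsub>M\<^esub>}"
  proof -
    have "card (Cs ! 0) = 1" using sizes[of 0] size0 by simp
    then show ?thesis using idC by (auto simp: card_1_singleton_iff M_simps)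
  qed
  moreover have "(\<Sum>j<15. of_nat (card (Cs ! j)) * table_12 ! i ! j * cnj (v j)) / of_nat (card G) \<in> \<int>"
    if \<psi>: "\<psi> \<in> irr_characters M" and v: "\<And>j g. j < 15 \<Longrightarrow> g \<in> Cs ! j \<Longrightarrow> \<psi> g = v j"
      and norm: "(\<Sum>i<15. (cmod ((\<Sum>j<15. of_nat (card (Cs ! j)) * table_12 ! i ! j * cnj (v j)) / of_nat (card G)))\<^sup>2) = 1"
      and i: "i < 15" for \<psi> v i
  proof -
    \<comment> \<open>Class size, value and group order are collected in \<open>w\<close>, so that
      each coefficient is linear in a row of the table with the same weights.\<close>
    define w where "w j = of_nat (card (Cs ! j)) * cnj (v j) / of_nat (card G)" for j
    define c where "c i = (\<Sum>j<15. table_12 ! i ! j * w j)" for i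
    have c: "(\<Sum>j<15. of_nat (card (Cs ! j)) * table_12 ! i ! j * cnj (v j)) / of_nat (card G) = c i" for i
      unfolding c_def w_def sum_divide_distrib by (intro sum.cong refl) simp
    have w: "w j = of_nat (class_sizes12 ! j) * cnj (v j) / 95040" if "j < 15" for j
      using sizes[OF that] by (simp add: w_def card_G_12)
    have gens: "length r = 15 \<and> (\<Sum>j<15. of_int (r ! j) * w j) \<in> \<int>" if "r \<in> set gens12" for r
    proof -
      consider ks where "r = map (subset_list_count ks) class_types12"
        | "r = [7920, 0, 60, 0, 6, 0, 0, 0, 0, 6, 0, 0, 0, 0, 0]"
        using \<open>r \<in> set gens12\<close> unfolding gens12_eq by auto
      then show ?thesis
      proof cases
        case 1
        have l: "length class_types12 = 15" by (simp add: class_types12_def)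
        then show ?thesis
          using subset_list_char_Ints[OF F(2,3), of class_types12 \<psi> v ks] F(1,5) \<psi> v by (simp add: 1 w_def)
      next
        case 2
        have "of_type (types12 ! 9) \<noteq> {}" by (rule of_type12_nonempty) auto
        then obtain z where z: "z \<in> of_type (types12 ! 9)" by blast
        have "(cnj (v 0) + 3 * cnj (v 2) + 2 * cnj (v 4) + 6 * cnj (v 9)) / 12 \<in> \<int>"
        proof (rule centralizer_6_6_Ints[OF \<psi> z])
          fix i h assume i: "i \<in> {0, 2, 4, 9 :: nat}" and h: "h \<in> of_type (types12 ! i)"
          have "class_types12 ! i = types12 ! i" using i by (auto simp: class_types12_def nth_append)
          then show "\<psi> h = v i" using F(4)[of i] v[of i h] i h by auto
        qed
        \<comment> \<open>Degree times class size over group order: 7920 / 95040 = 1 / 12, and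
          likewise 60 * 396, 6 * 2640 and 6 * 7920 give 3, 2 and 6 twelfths.\<close>
        also have "(cnj (v 0) + 3 * cnj (v 2) + 2 * cnj (v 4) + 6 * cnj (v 9)) / 12 = (\<Sum>j<15. of_int (r ! j) * w j)"
          by (simp add: 2 w lessThan_nat_numeral lessThan_Suc class_sizes12_def field_simps)
        finally show ?thesis by (simp add: 2)
      qed
    qed
    have rows: "(\<Sum>j<15. of_int (r ! j) * w j) \<in> \<int>" "length r = 15" if r: "r \<in> set rows12" for r
    proof -
      obtain as where "r = int_comb 15 as gens12" using r unfolding rows12_eq[symmetric] by auto
      then show "(\<Sum>j<15. of_int (r ! j) * w j) \<in> \<int>" "length r = 15"
        using int_comb_Ints[of gens12 15 w as] gens by auto
    qed
    have rational: "c i \<in> \<int>" if "i < 15" "i \<noteq> 3" "i \<noteq> 4" for i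
    proof -
      obtain r where r: "r \<in> set rows12" "table_12 ! i = map of_int r" using \<open>i < 15\<close> \<open>i \<noteq> 3\<close> \<open>i \<noteq> 4\<close> by (rule table_12_rational)
      then show ?thesis using rows[OF r(1)] by (simp add: c_def)
    qed
    have pair: "c 3 + c 4 \<in> \<int>"
    proof -
      have "c 3 + c 4 = (\<Sum>j<15. of_int (rows12 ! 3 ! j) * w j)"
        unfolding c_def sum.distrib[symmetric] by (intro sum.cong refl) (simp add: pair_row12[symmetric] distrib_right)
      then show ?thesis using rows(1)[of "rows12 ! 3"] by (simp add: rows12_def)
    qed
    have CG: "Cs ! j \<subseteq> G" "Cs ! j \<noteq> {}" if "j < 15" for j
    proof -
      have "Cs ! j \<in> cl ` G" using that F(1,3) nth_mem[of j Cs] unfolding conj_classes_M by simp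
      then show "Cs ! j \<subseteq> G" "Cs ! j \<noteq> {}" using cl_subset self_cl by blast+
    qed
    have real: "cnj (v j) = v j" if "j < 13" for j
    proof -
      obtain h where h: "h \<in> Cs ! j" using CG(2)[of j] \<open>j < 13\<close> by fastforce
      then have "inv' h \<in> Cs ! j" using of_type_inv F(4)[OF \<open>j < 13\<close>] by simp
      moreover have "h \<in> G" using h CG(1)[of j] \<open>j < 13\<close> by auto
      ultimately show ?thesis using v[of j h] v[of j "inv' h"] h character_inv[OF \<psi>, of h] \<open>j < 13\<close> by simp
    qed
    have conj: "v 14 = cnj (v 13)"
    proof -
      have "g \<in> G" using g by (simp add: of_type_def)
      then show ?thesis using v[of 13 g] v[of 14 "inv' g"] character_inv[OF \<psi>, of g] self_cl by (simp add: F(7,8))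
    qed
    \<comment> \<open>Conjugation exchanges the last two class values and at the same time
      \<open>omega\<close> with its conjugate, and all other terms are real.\<close>
    have "cnj (c 3) = c 3" "cnj (c 4) = c 4"
      unfolding c_def
      by (simp_all add: w real conj lessThan_nat_numeral lessThan_Suc class_sizes12_def table_12_def)
    then have reals: "c 3 \<in> \<real>" "c 4 \<in> \<real>" unfolding Reals_cnj_iff by simp_all
    \<comment> \<open>The orthogonality relations with the identity column recover the degree of
      \<open>\<psi>\<close> from its coefficients; \<open>pair_Ints\<close> needs that it is
      nonzero.\<close>
    have deg: "(\<Sum>i<15. table_12 ! i ! 0 * c i) = cnj (v 0)"
    proof -
      have col0: "cnj (table_12 ! i ! 0) = table_12 ! i ! 0" if "i < 15" for i
      proof -
        have "list_all (\<lambda>r. cnj (r ! 0) = r ! 0) table_12" by (simp add: table_12_def)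
        then show ?thesis using \<open>i < 15\<close> table_12_shape(1) by (simp add: list_all_length)
      qed
      have "(\<Sum>i<15. table_12 ! i ! 0 * c i) = (\<Sum>j<15. (\<Sum>i<15. table_12 ! i ! j * cnj (table_12 ! i ! 0)) * w j)"
        unfolding c_def sum_distrib_left sum_distrib_right
        by (subst sum.swap) (intro sum.cong refl, simp add: col0)
      also have "\<dots> = (\<Sum>j<15::nat. if j = 0 then cnj (v 0) else 0)"
      proof (rule sum.cong[OF refl])
        fix j :: nat assume "j \<in> {..<15}"
        then have j: "j < 15" by simp
        have o: "(\<Sum>i<15. table_12 ! i ! j * cnj (table_12 ! i ! 0)) * of_nat (class_sizes12 ! j) = (if j = 0 then 95040 else 0)"
          by (rule table_12_orthogonality[OF j]) simp
        have "(\<Sum>i<15. table_12 ! i ! j * cnj (table_12 ! i ! 0)) * w j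
          = ((\<Sum>i<15. table_12 ! i ! j * cnj (table_12 ! i ! 0)) * of_nat (class_sizes12 ! j)) * cnj (v j) / 95040"
          by (simp add: w[OF j])
        also have "\<dots> = (if j = 0 then cnj (v 0) else 0)" unfolding o by simp
        finally show "(\<Sum>i<15. table_12 ! i ! j * cnj (table_12 ! i ! 0)) * w j = (if j = 0 then cnj (v 0) else 0)" .
      qed
      also have "\<dots> = cnj (v 0)" by simp
      finally show ?thesis .
    qed
    obtain n :: nat where "n > 0" "\<psi> \<one>\<^bsub>M\<^esub> = of_nat n" using \<psi> by (rule M.irr_character_one)
    then have "v 0 \<noteq> 0" using v[of 0 id] idC by (simp add: M_simps)
    then have nz: "(\<Sum>i<15. table_12 ! i ! 0 * c i) \<noteq> 0" unfolding deg by simp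
    have "table_12 ! 3 ! 0 = table_12 ! 4 ! 0" by (simp add: table_12_def)
    show ?thesis unfolding c
      by (rule pair_Ints[where n = 15 and a = 3 and b = 4 and d = "\<lambda>i. table_12 ! i ! 0"])
        (use norm[unfolded c] rational reals pair nz \<open>table_12 ! 3 ! 0 = table_12 ! 4 ! 0\<close> i in simp_all)
  qed
  moreover have "\<exists>d>0. table_12 ! i ! 0 = of_nat d" if "i < 15" for i
  proof -
    let ?ds = "[1, 11, 11, 16, 16, 45, 54, 55, 55, 55, 66, 99, 120, 144, 176] :: nat list"
    have m: "map (\<lambda>r. r ! 0) table_12 = map of_nat ?ds" by (simp add: table_12_def)
    have "table_12 ! i ! 0 = map (\<lambda>r. r ! 0) table_12 ! i"
      by (rule nth_map[symmetric]) (use that table_12_shape(1) in simp)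
    also have "\<dots> = of_nat (?ds ! i)" unfolding m by (rule nth_map) (use that in simp)
    finally have "table_12 ! i ! 0 = of_nat (?ds ! i)" .
    moreover have "list_all (\<lambda>d. d > 0) ?ds" by simp
    then have "?ds ! i > 0" using that unfolding list_all_length by simp
    ultimately show ?thesis by blast
  qed
  ultimately show ?thesis unfolding Cs_def[symmetric]
    using F(1) table_12_shape finG
    by (intro M.character_table_recognition[where ?j0.0 = 0])
      (simp_all add: M_simps F(2,3) card_G_12 sizes table_12_orthogonality)
qed

end

text \<open>
  The third and fifth rows are the sums of the pairs of rows with entries in \<open>alpha\<close> and \<open>omega\<close>. The last
  row is \<open>table_11 ! 2\<close> minus the character induced from a faithful linear character of a cyclic
  subgroup of order 8.
\<close>

definition rows11 :: "int list list" where
  "rows11 =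
   [[ 1,  1,  1,  1,  1,  1,  1,  1,  1,  1],
    [10,  2,  1,  2,  0, -1,  0,  0, -1, -1],
    [20, -4,  2,  0,  0,  2,  0,  0, -2, -2],
    [11,  3,  2, -1,  1,  0, -1, -1,  0,  0],
    [32,  0, -4,  0,  2,  0,  0,  0, -1, -1],
    [44,  4, -1,  0, -1,  1,  0,  0,  0,  0],
    [45, -3,  0,  1,  0,  0, -1, -1,  1,  1],
    [55, -1,  1, -1,  0, -1,  1,  1,  0,  0],
    [-980, 4, 1, 0, 0, 1, 0, 0, -1, -1]]"

definition coeffs11 :: "int list list" where
  "coeffs11 =
   [[1, 0, 0, 0, 0, 0, 0, 0],
    [-1, 1, 0, 0, 0, 0, 0, 0],
    [-2, -3, 6, 4, -1, -4, -1, 1],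
    [0, -6, 9, 0, -2, -2, -1, 1],
    [-1, -8, 15, 4, -4, -3, -5, 2],
    [0, -1, 0, 1, 0, 0, 0, 0],
    [1, -2, 1, -1, 0, 0, 0, 0],
    [0, 7, -9, -2, 2, 2, 2, -1],
    [-1, -8, 12, 3, -3, -2, -2, 1]]"

lemma rows11_eq: "mset (map (\<lambda>as. int_comb 10 as gens11) coeffs11) = mset rows11"
  unfolding gens11_def coeffs11_def rows11_def by code_simp

lemma table_11_rows:
  "table_11 = map (map of_int) (take 2 rows11) @ [table_11 ! 2, table_11 ! 3] @
    [map of_int (rows11 ! 3), table_11 ! 5, table_11 ! 6] @ map (map of_int) (take 3 (drop 5 rows11))"
  unfolding table_11_def rows11_def by simp

lemma table_11_rational:
  assumes "i < 10" "i \<notin> {2, 3, 5, 6}"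
  obtains r where "r \<in> set rows11" "table_11 ! i = map of_int r"
proof -
  have l: "length rows11 = 9" by (simp add: rows11_def)
  \<comment> \<open>Each merged pair before row \<open>i\<close> lowers its position in
    \<open>rows11\<close> by one.\<close>
  consider "i < 2" | "i = 4" | "i \<ge> 7" using assms by force
  then show thesis
  proof cases
    case 1
    then have "table_11 ! i = map of_int (rows11 ! i)"
      by (subst table_11_rows) (simp add: nth_append l)
    then show thesis using that[of "rows11 ! i"] 1 l by simp
  next
    case 2
    then have "table_11 ! i = map of_int (rows11 ! 3)"
      by (subst table_11_rows) (simp add: nth_append l)
    then show thesis using that[of "rows11 ! 3"] l by simp
  next
    case 3
    then have "table_11 ! i = map of_int (rows11 ! (i - 2))"
      using assms(1) by (subst table_11_rows) (simp add: nth_append l nth_Cons' Suc_diff_le)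
    then show thesis using that[of "rows11 ! (i - 2)"] assms(1) l by simp
  qed
qed

lemma pair_rows11:
  assumes "j < 10"
  shows "table_11 ! 2 ! j + table_11 ! 3 ! j = of_int (rows11 ! 2 ! j)"
    "table_11 ! 5 ! j + table_11 ! 6 ! j = of_int (rows11 ! 4 ! j)"
proof -
  have add: "p ! j + q ! j = of_int (r ! j)" if "map2 (+) p q = map of_int r" "length p = 10" "length q = 10" "length r = 10"
    for p q :: "complex list" and r
    using arg_cong[OF that(1), of "\<lambda>xs. xs ! j"] that(2-) assms by simp
  show "table_11 ! 2 ! j + table_11 ! 3 ! j = of_int (rows11 ! 2 ! j)"
    by (rule add) (simp_all add: table_11_def rows11_def alpha_simps)
  show "table_11 ! 5 ! j + table_11 ! 6 ! j = of_int (rows11 ! 4 ! j)"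
    by (rule add) (simp_all add: table_11_def rows11_def cnj_omega)
qed

section \<open>Classes and character table in degree 11\<close>

context sharp4_11
begin

text \<open>The representatives \<open>u\<close> and \<open>g\<close> are independent choices:
  passing to the other class of either type exchanges two columns, and this only exchanges two
  conjugate rows.\<close>

definition classes_11 :: "('a \<Rightarrow> 'a) \<Rightarrow> ('a \<Rightarrow> 'a) \<Rightarrow> ('a \<Rightarrow> 'a) set list" where
  "classes_11 u g = map (\<lambda>i. of_type (types11 ! i)) [0..<6] @ [cl u, cl (u ^^ 5), cl g, cl (inv' g)]"

lemma of_type11_nonempty: "i < 9 \<Longrightarrow> i \<noteq> 7 \<Longrightarrow> of_type (types11 ! i) \<noteq> {}"
proof -
  assume i: "i < 9" "i \<noteq> 7"
  have "list_all (\<lambda>i. i = 7 \<or> [1, 165, 440, 990, 1584, 1320, 1980, 0, 1440 :: nat] ! i \<noteq> 0) [0..<9]"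
    by (simp add: upt_rec)
  moreover have "i \<in> set [0..<9]" using i(1) by simp
  ultimately have "[1, 165, 440, 990, 1584, 1320, 1980, 0, 1440 :: nat] ! i \<noteq> 0"
    using i(2) unfolding list_all_iff by blast
  then have "N (types11 ! i) \<noteq> 0" using N11[OF i(1)] by metis
  then show ?thesis unfolding N_zero_iff .
qed

lemma of_type11_disjoint:
  "i < 9 \<Longrightarrow> j < 9 \<Longrightarrow> i \<noteq> j \<Longrightarrow> of_type (types11 ! i) \<inter> of_type (types11 ! j) = {}"
  using nth_eq_iff_index_eq[OF distinct_types11] by (auto simp: of_type_def types11_length)

lemma classes_11_facts:
  assumes u: "u \<in> of_type (types11 ! 6)" and g: "g \<in> of_type (types11 ! 8)"
  shows "length (classes_11 u g) = 10" "distinct (classes_11 u g)" "set (classes_11 u g) = conj_classes M"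
    "\<And>j. j < 6 \<Longrightarrow> classes_11 u g ! j = of_type (class_types11 ! j)"
    "\<And>j. j < 10 \<Longrightarrow> classes_11 u g ! j \<subseteq> of_type (class_types11 ! j)"
    "\<And>j. j < 10 \<Longrightarrow> card (classes_11 u g ! j) = class_sizes11 ! j"
    "classes_11 u g ! 6 = cl u" "classes_11 u g ! 7 = cl (u ^^ 5)"
    "classes_11 u g ! 8 = cl g" "classes_11 u g ! 9 = cl (inv' g)"
proof -
  note c = classes11_11[OF g] and d = classes11_8[OF u]
  show len: "length (classes_11 u g) = 10" by (simp add: classes_11_def)
  show n6: "classes_11 u g ! 6 = cl u" and n7: "classes_11 u g ! 7 = cl (u ^^ 5)"
    and n8: "classes_11 u g ! 8 = cl g" and n9: "classes_11 u g ! 9 = cl (inv' g)"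
    by (simp_all add: classes_11_def nth_append)
  have ty: "class_types11 ! j = types11 ! j" if "j < 6" for j
    using that by (simp add: class_types11_def nth_append)
  show eq: "classes_11 u g ! j = of_type (class_types11 ! j)" if "j < 6" for j
    using that by (simp add: classes_11_def ty nth_append)
  have t: "class_types11 ! 6 = types11 ! 6" "class_types11 ! 7 = types11 ! 6"
    "class_types11 ! 8 = types11 ! 8" "class_types11 ! 9 = types11 ! 8"
    by (simp_all add: class_types11_def nth_append)
  show sub: "classes_11 u g ! j \<subseteq> of_type (class_types11 ! j)" if "j < 10" for j
  proof -
    consider "j < 6" | "j = 6" | "j = 7" | "j = 8" | "j = 9" using \<open>j < 10\<close> by linarith
    then show ?thesis using eq n6 n7 n8 n9 t c(5) d(5) by cases auto
  qed
  show "card (classes_11 u g ! j) = class_sizes11 ! j" if "j < 10" for j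
  proof -
    have s: "list_all (\<lambda>j. [1, 165, 440, 990, 1584, 1320, 1980, 0, 1440 :: nat] ! j = class_sizes11 ! j) [0..<6]"
      unfolding class_sizes11_def by (simp add: upt_rec)
    consider "j < 6" | "j = 6" | "j = 7" | "j = 8" | "j = 9" using \<open>j < 10\<close> by linarith
    then show ?thesis
    proof cases
      case 1
      have "j \<in> set [0..<6]" using 1 by simp
      then have "N (types11 ! j) = class_sizes11 ! j" using N11[of j] s 1 unfolding list_all_iff by simp
      then show ?thesis unfolding eq[OF 1] ty[OF 1] by (simp add: N_def)
    qed (simp_all add: n6 n7 n8 n9 c d class_sizes11_def)
  qed
  have reps: "u \<in> G" "u ^^ 5 \<in> G" "g \<in> G" "inv' g \<in> G" using u g c(1) d(1) by (auto simp: of_type_def)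
  have cls: "cl u \<subseteq> of_type (types11 ! 6)" "cl (u ^^ 5) \<subseteq> of_type (types11 ! 6)"
    "cl g \<subseteq> of_type (types11 ! 8)" "cl (inv' g) \<subseteq> of_type (types11 ! 8)" using c(5) d(5) by blast+
  have dis: "of_type (types11 ! i) \<inter> of_type (types11 ! j) = {}" if "i < 9" "j < 9" "i \<noteq> j" for i j
    using of_type11_disjoint that .
  have ne: "of_type (types11 ! i) \<noteq> cl h" if "i < 6" "h \<in> {u, u ^^ 5, g, inv' g}" for i h
  proof -
    have "h \<in> cl h" by (rule self_cl)
    moreover have "cl h \<subseteq> of_type (types11 ! 6) \<or> cl h \<subseteq> of_type (types11 ! 8)" using that(2) cls by auto
    ultimately show ?thesis using dis[of i 6] dis[of i 8] that(1) by fastforce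
  qed
  have "inj_on (\<lambda>i. of_type (types11 ! i)) (set [0..<6])"
  proof (rule inj_onI, rule ccontr)
    fix i j assume "i \<in> set [0..<6]" "j \<in> set [0..<6]"
      "of_type (types11 ! i) = of_type (types11 ! j)" "i \<noteq> j"
    then show False using dis[of i j] of_type11_nonempty[of i] by simp
  qed
  then have "distinct (map (\<lambda>i. of_type (types11 ! i)) [0..<6])"
    unfolding distinct_map by simp
  moreover have "distinct [cl u, cl (u ^^ 5), cl g, cl (inv' g)]"
  proof -
    have "cl x \<noteq> cl y" if "cl x \<subseteq> of_type (types11 ! 6)" "cl y \<subseteq> of_type (types11 ! 8)" for x y
      using dis[of 6 8] self_cl[of x] that by auto
    moreover have "cl g \<noteq> cl (inv' g)" "cl u \<noteq> cl (u ^^ 5)" using c(4) d(4) self_cl by blast+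
    ultimately show ?thesis using cls by simp
  qed
  moreover have "C \<notin> set [cl u, cl (u ^^ 5), cl g, cl (inv' g)]"
    if "C \<in> set (map (\<lambda>i. of_type (types11 ! i)) [0..<6])" for C
  proof -
    obtain i where "i \<in> set [0..<6]" "C = of_type (types11 ! i)" using \<open>C \<in> _\<close> unfolding set_map by blast
    then show ?thesis using ne[of i] by simp
  qed
  ultimately show "distinct (classes_11 u g)"
    unfolding classes_11_def distinct_append by blast
  have set: "set (classes_11 u g) = (\<lambda>i. of_type (types11 ! i)) ` {0..<6} \<union> {cl u, cl (u ^^ 5), cl g, cl (inv' g)}"
    by (simp add: classes_11_def)
  show "set (classes_11 u g) = conj_classes M" unfolding conj_classes_M
  proof (intro equalityI subsetI)
    fix C assume "C \<in> set (classes_11 u g)"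
    then consider i where "i < 6" "C = of_type (types11 ! i)" | h where "h \<in> G" "C = cl h"
      unfolding set using reps by fastforce
    then show "C \<in> cl ` G"
    proof cases
      case 1
      then have "C \<noteq> {}" using of_type11_nonempty[of i] by auto
      then obtain h where "h \<in> C" by blast
      then have "h \<in> G" "C = cl h" using classes11[of h i] 1 by (auto simp: of_type_def)
      then show ?thesis by blast
    qed simp
  next
    fix C assume "C \<in> cl ` G"
    then obtain h where h: "h \<in> G" "C = cl h" by blast
    have "cyc_list h \<in> set types11" by (rule cyc_list_types11[OF h(1)])
    then obtain i where i: "i < 9" "cyc_list h = types11 ! i"
      by (metis (no_types) in_set_conv_nth types11_length)
    then have hi: "h \<in> of_type (types11 ! i)" using h by (simp add: of_type_def)
    then have "N (types11 ! i) \<noteq> 0" unfolding N_zero_iff by blast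
    then have "i \<noteq> 7" using N11[of 7] by auto
    then consider "i < 6" | "i = 6" | "i = 8" using i(1) by linarith
    then show "C \<in> set (classes_11 u g)"
    proof cases
      case 1
      then have "C = of_type (types11 ! i)" using classes11[OF hi 1] h by simp
      moreover have "i \<in> {0..<6}" using 1 by simp
      ultimately show ?thesis unfolding set by blast
    next
      case 2
      then have "h \<in> cl u \<or> h \<in> cl (u ^^ 5)" using hi d(5) by blast
      then have "C = cl u \<or> C = cl (u ^^ 5)" using cl_eq reps h(2) by blast
      then show ?thesis unfolding set by blast
    next
      case 3
      then have "h \<in> cl g \<or> h \<in> cl (inv' g)" using hi c(5) by blast
      then have "C = cl g \<or> C = cl (inv' g)" using cl_eq reps h(2) by blast
      then show ?thesis unfolding set by blast
    qed
  qed
qed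

text \<open>The powers with exponents 1, 3 and 5, 7 lie in the two classes of type 2.8, where the
  root of unity adds up to \<open>alpha\<close> and its negative. The exponents 2 and 6 give the
  same value with opposite coefficients, so type 4^2 drops out.\<close>

lemma cyclic_8_Ints:
  assumes \<psi>: "\<psi> \<in> irr_characters M" and u: "u \<in> of_type (types11 ! 6)"
    and v: "\<psi> id = v 0" "\<And>h. h \<in> of_type (types11 ! 1) \<Longrightarrow> \<psi> h = v 1" "\<And>h. h \<in> of_type (types11 ! 3) \<Longrightarrow> \<psi> h = v 3"
      "\<And>h. h \<in> cl u \<Longrightarrow> \<psi> h = v 6" "\<And>h. h \<in> cl (u ^^ 5) \<Longrightarrow> \<psi> h = v 7"
  shows "(cnj (v 0) - cnj (v 1) + cnj (v 6) * alpha + cnj (v 7) * cnj alpha) / 8 \<in> \<int>"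
proof -
  have uG: "u \<in> G" using u by (rule of_type11D)
  note d = classes11_8[OF u]
  have u8: "u ^^ 8 = id" using of_type11D(3)[OF u, of 8] by (simp add: types11_def fx_def)
  have "list_all (\<lambda>d. fx (types11 ! 6) d \<noteq> 11) [1..<8]" unfolding types11_def by code_simp
  then have small: "u ^^ d \<noteq> id" if "0 < d" "d < 8" for d
    using of_type11D(3)[OF u, of d] that by (simp add: list_all_iff)
  have inj: "inj_on (\<lambda>i. u ^^ i) {..<8}"
  proof (rule linorder_inj_onI)
    fix i j :: nat assume ij: "i < j" "j \<in> {..<8}"
    show "u ^^ i \<noteq> u ^^ j"
    proof
      assume e: "u ^^ i = u ^^ j"
      have "u ^^ (j - i) = id"
      proof
        fix x
        have "(u ^^ i) ((u ^^ (j - i)) x) = (u ^^ i) x"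
          using fun_cong[OF funpow_add[of i "j - i" u], of x] e ij(1) by simp
        moreover have "inj (u ^^ i)" using permutes_inj[OF perm[OF pow_mem[OF uG]]] .
        ultimately show "(u ^^ (j - i)) x = id x" by (simp add: inj_eq)
      qed
      moreover have "j - i < 8" "0 < j - i" using ij less_imp_diff_less by auto
      ultimately show False using small by blast
    qed
  qed auto
  \<comment> \<open>A primitive eighth root of unity with square \<i>, written through
    \<open>alpha\<close> so that the rules for \<open>alpha\<close> evaluate it.\<close>
  define \<zeta> where "\<zeta> = (1 - \<i>) * alpha / 2"
  have \<zeta>2: "\<zeta> ^ 2 = \<i>"
  proof -
    have "\<zeta> ^ 2 = (1 - \<i>) * (1 - \<i>) * (alpha * alpha) / 4" by (simp add: \<zeta>_def power2_eq_square)
    then show ?thesis by (simp add: alpha_simps algebra_simps)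
  qed
  have \<zeta>e: "\<zeta> ^ (2 * m) = \<i> ^ m" "\<zeta> ^ Suc (2 * m) = \<zeta> * \<i> ^ m" for m
    by (simp_all add: power_mult \<zeta>2)
  have \<zeta>: "\<zeta> ^ 3 = \<zeta> * \<i>" "\<zeta> ^ 4 = - 1" "\<zeta> ^ 5 = - \<zeta>" "\<zeta> ^ 6 = - \<i>" "\<zeta> ^ 7 = - \<zeta> * \<i>" "\<zeta> ^ 8 = 1"
    using \<zeta>e(2)[of 1] \<zeta>e(1)[of 2] \<zeta>e(2)[of 2] \<zeta>e(1)[of 3] \<zeta>e(2)[of 3] \<zeta>e(1)[of 4]
    by (simp_all add: eval_nat_numeral)
  have s: "\<zeta> + \<zeta> * \<i> = alpha" by (simp add: \<zeta>_def field_simps)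
  have int: "(\<Sum>i<8. \<psi> (u ^^ i) * cnj (\<zeta> ^ i)) / of_nat 8 \<in> \<int>"
    by (rule cyclic_restrict_Ints[OF \<psi> uG u8 _ inj \<zeta>(6)]) simp
  have vals: "\<psi> (u ^^ 0) = v 0" "\<psi> (u ^^ 1) = v 6" "\<psi> (u ^^ 2) = v 3" "\<psi> (u ^^ 3) = v 6"
    "\<psi> (u ^^ 4) = v 1" "\<psi> (u ^^ 5) = v 7" "\<psi> (u ^^ 6) = v 3" "\<psi> (u ^^ 7) = v 7"
    using v d self_cl by simp_all
  have "(\<Sum>i<8. \<psi> (u ^^ i) * cnj (\<zeta> ^ i)) = \<psi> (u ^^ 0) * cnj (\<zeta> ^ 0) + \<psi> (u ^^ 1) * cnj (\<zeta> ^ 1) + \<psi> (u ^^ 2) * cnj (\<zeta> ^ 2)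
      + \<psi> (u ^^ 3) * cnj (\<zeta> ^ 3) + \<psi> (u ^^ 4) * cnj (\<zeta> ^ 4) + \<psi> (u ^^ 5) * cnj (\<zeta> ^ 5)
      + \<psi> (u ^^ 6) * cnj (\<zeta> ^ 6) + \<psi> (u ^^ 7) * cnj (\<zeta> ^ 7)"
    by (simp only: lessThan_nat_numeral lessThan_Suc sum.insert numeral_nat) (simp add: numeral_nat add_ac)
  also have "\<dots> = v 0 - v 1 + v 6 * cnj (\<zeta> + \<zeta> * \<i>) - v 7 * cnj (\<zeta> + \<zeta> * \<i>)"
    unfolding vals \<zeta> \<zeta>2 by (simp add: algebra_simps)
  finally have "(\<Sum>i<8. \<psi> (u ^^ i) * cnj (\<zeta> ^ i)) = v 0 - v 1 + v 6 * cnj alpha - v 7 * cnj alpha" unfolding s .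
  then have "(v 0 - v 1 + v 6 * cnj alpha - v 7 * cnj alpha) / 8 \<in> \<int>" using int by simp
  then obtain m where m: "(v 0 - v 1 + v 6 * cnj alpha - v 7 * cnj alpha) / 8 = of_int m" by (auto elim: Ints_cases)
  have "(cnj (v 0) - cnj (v 1) + cnj (v 6) * alpha + cnj (v 7) * cnj alpha) / 8
      = cnj ((v 0 - v 1 + v 6 * cnj alpha - v 7 * cnj alpha) / 8)" by (simp add: alpha_simps)
  then show ?thesis unfolding m by simp
qed

lemma character_table_11:
  assumes u: "u \<in> of_type (types11 ! 6)" and g: "g \<in> of_type (types11 ! 8)"
  shows "is_character_table M (classes_11 u g) (map (M.table_char (classes_11 u g)) table_11) table_11"
proof -
  define Cs where "Cs = classes_11 u g"
  note F = classes_11_facts[OF u g, folded Cs_def]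
  have sizes: "card (Cs ! j) = class_sizes11 ! j" if "j < 10" for j using F(6)[OF that] .
  have size0: "class_sizes11 ! 0 = 1" by (simp add: class_sizes11_def)
  have idC: "id \<in> Cs ! 0"
  proof -
    have "id \<in> of_type (types11 ! 0)"
      by (rule of_type11I[where P = "\<lambda>xs. fx xs 1 = 11", OF id_mem])
        (use fx_full_iff[OF id_mem, of 1] card_S in simp, code_simp)
    then show ?thesis using F(4)[of 0] by (simp add: class_types11_def nth_append)
  qed
  have "Cs ! 0 = {\<one>\<^bsub>M\<^esub>}"
  proof -
    have "card (Cs ! 0) = 1" using sizes[of 0] size0 by simp
    then show ?thesis using idC by (auto simp: card_1_singleton_iff M_simps)
  qed
  moreover have "(\<Sum>j<10. of_nat (card (Cs ! j)) * table_11 ! i ! j * cnj (v j)) / of_nat (card G) \<in> \<int>"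
    if \<psi>: "\<psi> \<in> irr_characters M" and v: "\<And>j g. j < 10 \<Longrightarrow> g \<in> Cs ! j \<Longrightarrow> \<psi> g = v j"
      and norm: "(\<Sum>i<10. (cmod ((\<Sum>j<10. of_nat (card (Cs ! j)) * table_11 ! i ! j * cnj (v j)) / of_nat (card G)))\<^sup>2) = 1"
      and i: "i < 10" for \<psi> v i
  proof -
    define w where "w j = of_nat (card (Cs ! j)) * cnj (v j) / of_nat (card G)" for j
    define c where "c i = (\<Sum>j<10. table_11 ! i ! j * w j)" for i
    have c: "(\<Sum>j<10. of_nat (card (Cs ! j)) * table_11 ! i ! j * cnj (v j)) / of_nat (card G) = c i" for i
      unfolding c_def w_def sum_divide_distrib by (intro sum.cong refl) simp
    have w: "w j = of_nat (class_sizes11 ! j) * cnj (v j) / 7920" if "j < 10" for j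
      using sizes[OF that] by (simp add: w_def card_G_11)
    have gens: "length r = 10 \<and> (\<Sum>j<10. of_int (r ! j) * w j) \<in> \<int>" if "r \<in> set gens11" for r
    proof -
      obtain ks where r: "r = map (subset_list_count ks) class_types11"
        using \<open>r \<in> set gens11\<close> unfolding gens11_eq by auto
      have l: "length class_types11 = 10" by (simp add: class_types11_def)
      then show ?thesis
        using subset_list_char_Ints[OF F(2,3), of class_types11 \<psi> v ks] F(1,5) \<psi> v by (simp add: r w_def)
    qed
    have rows: "(\<Sum>j<10. of_int (r ! j) * w j) \<in> \<int>" "length r = 10" if r: "r \<in> set rows11" for r
    proof -
      have "r \<in> set (map (\<lambda>as. int_comb 10 as gens11) coeffs11)"
        using r mset_eq_setD[OF rows11_eq] by simp
      then obtain as where "r = int_comb 10 as gens11" by auto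
      then show "(\<Sum>j<10. of_int (r ! j) * w j) \<in> \<int>" "length r = 10"
        using int_comb_Ints[of gens11 10 w as] gens by auto
    qed
    have pairs: "c 2 + c 3 \<in> \<int>" "c 5 + c 6 \<in> \<int>"
    proof -
      have "c 2 + c 3 = (\<Sum>j<10. of_int (rows11 ! 2 ! j) * w j)" "c 5 + c 6 = (\<Sum>j<10. of_int (rows11 ! 4 ! j) * w j)"
        unfolding c_def sum.distrib[symmetric]
        by (intro sum.cong refl; simp add: pair_rows11[symmetric] distrib_right)+
      then show "c 2 + c 3 \<in> \<int>" "c 5 + c 6 \<in> \<int>"
        using rows(1)[of "rows11 ! 2"] rows(1)[of "rows11 ! 4"] by (simp_all add: rows11_def)
    qed
    \<comment> \<open>Row 2 is the last row of \<open>rows11\<close> plus the character induced from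
      the cyclic group of order 8, so its coefficient is a sum of two integers. Row 3 then follows
      from the sum of the pair, and only the pair with \<open>omega\<close> is left for
      \<open>pair_Ints\<close>.\<close>
    have c2: "c 2 \<in> \<int>"
    proof -
      have "(cnj (v 0) - cnj (v 1) + cnj (v 6) * alpha + cnj (v 7) * cnj alpha) / 8 \<in> \<int>"
      proof (rule cyclic_8_Ints[OF \<psi> u])
        show "\<psi> id = v 0" using v[of 0 id] idC by simp
        have "class_types11 ! 1 = types11 ! 1" "class_types11 ! 3 = types11 ! 3" by (simp_all add: class_types11_def nth_append)
        then show "\<psi> h = v 1" if "h \<in> of_type (types11 ! 1)" for h using v[of 1 h] F(4)[of 1] that by simp
        show "\<psi> h = v 3" if "h \<in> of_type (types11 ! 3)" for h
          using v[of 3 h] F(4)[of 3] that \<open>class_types11 ! 3 = types11 ! 3\<close> by simp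
      qed (use v[of 6] v[of 7] F(7,8) in simp_all)
      moreover have "c 2 = (\<Sum>j<10. of_int (rows11 ! 8 ! j) * w j)
          + (cnj (v 0) - cnj (v 1) + cnj (v 6) * alpha + cnj (v 7) * cnj alpha) / 8"
        by (simp add: c_def w lessThan_nat_numeral lessThan_Suc class_sizes11_def table_11_def rows11_def field_simps)
      moreover have "(\<Sum>j<10. of_int (rows11 ! 8 ! j) * w j) \<in> \<int>" by (rule rows(1)) (simp add: rows11_def)
      ultimately show ?thesis by simp
    qed
    have "c 3 = (c 2 + c 3) - c 2" by simp
    then have c3: "c 3 \<in> \<int>" using pairs(1) c2 by (metis Ints_diff)
    have rational: "c i \<in> \<int>" if "i < 10" "i \<noteq> 5" "i \<noteq> 6" for i
    proof (cases "i = 2 \<or> i = 3")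
      case True
      then show ?thesis using c2 c3 by auto
    next
      case False
      then have "i \<notin> {2, 3, 5, 6}" using \<open>i \<noteq> 5\<close> \<open>i \<noteq> 6\<close> by simp
      with \<open>i < 10\<close> obtain r where r: "r \<in> set rows11" "table_11 ! i = map of_int r" by (rule table_11_rational)
      then show ?thesis using rows[OF r(1)] by (simp add: c_def)
    qed
    have CG: "Cs ! j \<subseteq> G" "Cs ! j \<noteq> {}" if "j < 10" for j
    proof -
      have "Cs ! j \<in> cl ` G" using that F(1,3) nth_mem[of j Cs] unfolding conj_classes_M by simp
      then show "Cs ! j \<subseteq> G" "Cs ! j \<noteq> {}" using cl_subset self_cl by blast+
    qed
    \<comment> \<open>Only six columns are claimed: inversion exchanges the two classes of type 2.8,
      but rows 5 and 6 vanish there.\<close>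
    have real: "cnj (v j) = v j" if "j < 6" for j
    proof -
      obtain h where h: "h \<in> Cs ! j" using CG(2)[of j] \<open>j < 6\<close> by fastforce
      then have "inv' h \<in> Cs ! j" using of_type_inv F(4)[OF \<open>j < 6\<close>] by simp
      moreover have "h \<in> G" using h CG(1)[of j] \<open>j < 6\<close> by auto
      ultimately show ?thesis using v[of j h] v[of j "inv' h"] h character_inv[OF \<psi>, of h] \<open>j < 6\<close> by simp
    qed
    have conj: "v 9 = cnj (v 8)"
    proof -
      have "g \<in> G" using g by (simp add: of_type_def)
      then show ?thesis using v[of 8 g] v[of 9 "inv' g"] character_inv[OF \<psi>, of g] self_cl by (simp add: F(9,10))
    qed
    have "cnj (c 5) = c 5" "cnj (c 6) = c 6"
      unfolding c_def
      by (simp_all add: w real conj lessThan_nat_numeral lessThan_Suc class_sizes11_def table_11_def)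
    then have reals: "c 5 \<in> \<real>" "c 6 \<in> \<real>" unfolding Reals_cnj_iff by simp_all
    have deg: "(\<Sum>i<10. table_11 ! i ! 0 * c i) = cnj (v 0)"
    proof -
      have col0: "cnj (table_11 ! i ! 0) = table_11 ! i ! 0" if "i < 10" for i
      proof -
        have "list_all (\<lambda>r. cnj (r ! 0) = r ! 0) table_11" by (simp add: table_11_def)
        then show ?thesis using \<open>i < 10\<close> table_11_shape(1) by (simp add: list_all_length)
      qed
      have "(\<Sum>i<10. table_11 ! i ! 0 * c i) = (\<Sum>j<10. (\<Sum>i<10. table_11 ! i ! j * cnj (table_11 ! i ! 0)) * w j)"
        unfolding c_def sum_distrib_left sum_distrib_right
        by (subst sum.swap) (intro sum.cong refl, simp add: col0)
      also have "\<dots> = (\<Sum>j<10::nat. if j = 0 then cnj (v 0) else 0)"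
      proof (rule sum.cong[OF refl])
        fix j :: nat assume "j \<in> {..<10}"
        then have j: "j < 10" by simp
        have o: "(\<Sum>i<10. table_11 ! i ! j * cnj (table_11 ! i ! 0)) * of_nat (class_sizes11 ! j) = (if j = 0 then 7920 else 0)"
          by (rule table_11_orthogonality[OF j]) simp
        have "(\<Sum>i<10. table_11 ! i ! j * cnj (table_11 ! i ! 0)) * w j
          = ((\<Sum>i<10. table_11 ! i ! j * cnj (table_11 ! i ! 0)) * of_nat (class_sizes11 ! j)) * cnj (v j) / 7920"
          by (simp add: w[OF j])
        also have "\<dots> = (if j = 0 then cnj (v 0) else 0)" unfolding o by simp
        finally show "(\<Sum>i<10. table_11 ! i ! j * cnj (table_11 ! i ! 0)) * w j = (if j = 0 then cnj (v 0) else 0)" .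
      qed
      also have "\<dots> = cnj (v 0)" by simp
      finally show ?thesis .
    qed
    obtain n :: nat where "n > 0" "\<psi> \<one>\<^bsub>M\<^esub> = of_nat n" using \<psi> by (rule M.irr_character_one)
    then have "v 0 \<noteq> 0" using v[of 0 id] idC by (simp add: M_simps)
    then have nz: "(\<Sum>i<10. table_11 ! i ! 0 * c i) \<noteq> 0" unfolding deg by simp
    have "table_11 ! 5 ! 0 = table_11 ! 6 ! 0" by (simp add: table_11_def)
    show ?thesis unfolding c
      by (rule pair_Ints[where n = 10 and a = 5 and b = 6 and d = "\<lambda>i. table_11 ! i ! 0"])
        (use norm[unfolded c] rational reals pairs nz \<open>table_11 ! 5 ! 0 = table_11 ! 6 ! 0\<close> i in simp_all)
  qed
  moreover have "\<exists>d>0. table_11 ! i ! 0 = of_nat d" if "i < 10" for i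
  proof -
    let ?ds = "[1, 10, 10, 10, 11, 16, 16, 44, 45, 55] :: nat list"
    have m: "map (\<lambda>r. r ! 0) table_11 = map of_nat ?ds" by (simp add: table_11_def)
    have "table_11 ! i ! 0 = map (\<lambda>r. r ! 0) table_11 ! i"
      by (rule nth_map[symmetric]) (use that table_11_shape(1) in simp)
    also have "\<dots> = of_nat (?ds ! i)" unfolding m by (rule nth_map) (use that in simp)
    finally have "table_11 ! i ! 0 = of_nat (?ds ! i)" .
    moreover have "list_all (\<lambda>d. d > 0) ?ds" by simp
    then have "?ds ! i > 0" using that unfolding list_all_length by simp
    ultimately show ?thesis by blast
  qed
  ultimately show ?thesis unfolding Cs_def[symmetric]
    using F(1) table_11_shape finG
    by (intro M.character_table_recognition[where ?j0.0 = 0])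
      (simp_all add: M_simps F(2,3) card_G_11 sizes table_11_orthogonality)
qed

end

section \<open>Sharply transitive subgroups of the alternating group\<close>

lemma alt_subgroup_permutations:
  assumes "subgroup G (alt_group n)"
  shows "g \<in> G \<Longrightarrow> g permutes {1..n}" "g \<in> G \<Longrightarrow> evenperm g" "id \<in> G"
    "g \<in> G \<Longrightarrow> h \<in> G \<Longrightarrow> g \<circ> h \<in> G" "g \<in> G \<Longrightarrow> inv' g \<in> G"
proof -
  interpret subgroup G "alt_group n" by fact
  show "g permutes {1..n}" "evenperm g" if "g \<in> G" for g
    using mem_carrier[OF that] alt_group_carrier by auto
  show "id \<in> G" using one_closed by (simp add: alt_group_one)
  show "g \<circ> h \<in> G" if "g \<in> G" "h \<in> G" for g h using m_closed[OF that] by (simp add: alt_group_mult)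
  show "inv' g \<in> G" if "g \<in> G" for g
    using m_inv_closed[OF that] alt_group_inv_equality[of g n] mem_carrier[OF that] by simp
qed

text \<open>The right-hand side is the record \<open>M\<close>, so the results about
  \<open>M\<close> transfer by rewriting.\<close>

lemma alt_subgroup_monoid:
  "(alt_group n)\<lparr>carrier := G\<rparr> = \<lparr>carrier = G, mult = (\<circ>), one = id\<rparr>"
  by (simp add: alt_group_def sym_group_def)

lemma sharp_alt_groupI:
  assumes "subgroup G (alt_group n)" "sharply_transitive k {1..n} G" "k \<le> n"
  shows "sharp_alt_group {1..n} G k"
  using alt_subgroup_permutations[OF assms(1)] assms by unfold_locales auto

context sharp_alt_group
begin

text \<open>\<open>cycle_type\<close> forgets the fixed points. Within a fixed degree they can be
  restored, which is expressed as injectivity on the list of candidates.\<close>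

lemma of_type_cycle_type:
  assumes ts: "\<And>g. g \<in> G \<Longrightarrow> cyc_list g \<in> set ts" "x \<in> set ts"
    and inj: "inj_on (\<lambda>xs. filter_mset (\<lambda>c. c \<noteq> 1) (mset xs)) (set ts)"
  shows "of_type x = {g \<in> G. cycle_type g = filter_mset (\<lambda>c. c \<noteq> 1) (mset x)}"
proof -
  have "cycle_type g = filter_mset (\<lambda>c. c \<noteq> 1) (mset (cyc_list g))" if "g \<in> G" for g
    using cycle_type_eq_filter[OF perm[OF that] finS] by (simp add: mset_cyc_list)
  then show ?thesis using inj_onD[OF inj _ ts(1) ts(2)] unfolding of_type_def by auto
qed

end

text \<open>Sorting replaces multisets by lists, on which distinctness can be evaluated.\<close>

lemma inj_on_cycle_types:
  assumes "distinct (map (\<lambda>xs. sort (filter (\<lambda>c. c \<noteq> 1) xs)) ts)"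
  shows "inj_on (\<lambda>xs :: nat list. filter_mset (\<lambda>c. c \<noteq> 1) (mset xs)) (set ts)"
proof (rule inj_onI)
  fix xs ys assume xs: "xs \<in> set ts" "ys \<in> set ts"
    and "filter_mset (\<lambda>c. c \<noteq> 1) (mset xs) = filter_mset (\<lambda>c. c \<noteq> 1) (mset ys)"
  then have "sorted_list_of_multiset (mset (filter (\<lambda>c. c \<noteq> 1) xs)) = sorted_list_of_multiset (mset (filter (\<lambda>c. c \<noteq> 1) ys))"
    by simp
  then have "sort (filter (\<lambda>c. c \<noteq> 1) xs) = sort (filter (\<lambda>c. c \<noteq> 1) ys)"
    by (simp only: sorted_list_of_multiset_mset)
  moreover have "inj_on (\<lambda>xs. sort (filter (\<lambda>c. c \<noteq> 1) xs)) (set ts)" using assms unfolding distinct_map by simp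
  ultimately show "xs = ys" using xs by (simp add: inj_on_def)
qed

lemma class_types12_eq: "map (\<lambda>xs. filter_mset (\<lambda>c. c \<noteq> 1) (mset xs)) class_types12 = types_12"
  by (simp add: class_types12_def types12_def types_12_def upt_rec)

lemma class_types11_eq: "map (\<lambda>xs. filter_mset (\<lambda>c. c \<noteq> 1) (mset xs)) class_types11 = types_11"
  by (simp add: class_types11_def types11_def types_11_def upt_rec)

lemma (in sharp5_12) of_type_class_types12:
  assumes "j < 15"
  shows "of_type (class_types12 ! j) = {g \<in> G. cycle_type g = types_12 ! j}"
proof -
  have inj: "inj_on (\<lambda>xs. filter_mset (\<lambda>c. c \<noteq> 1) (mset xs)) (set types12)"
    by (rule inj_on_cycle_types, unfold types12_def) code_simp
  have l: "length class_types12 = 15" by (simp add: class_types12_def)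
  have "set class_types12 \<subseteq> set types12" by (auto simp: class_types12_def types12_length)
  then have "class_types12 ! j \<in> set types12" using nth_mem[of j class_types12] assms l by auto
  then have "of_type (class_types12 ! j) = {g \<in> G. cycle_type g = filter_mset (\<lambda>c. c \<noteq> 1) (mset (class_types12 ! j))}"
    by (intro of_type_cycle_type[OF _ _ inj] cyc_list_types12)
  then show ?thesis unfolding class_types12_eq[symmetric] using assms l by simp
qed

lemma (in sharp4_11) of_type_class_types11:
  assumes "j < 10"
  shows "of_type (class_types11 ! j) = {g \<in> G. cycle_type g = types_11 ! j}"
proof -
  have inj: "inj_on (\<lambda>xs. filter_mset (\<lambda>c. c \<noteq> 1) (mset xs)) (set types11)"
    by (rule inj_on_cycle_types, unfold types11_def) code_simp
  have l: "length class_types11 = 10" by (simp add: class_types11_def)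
  have "set class_types11 \<subseteq> set types11" by (auto simp: class_types11_def types11_length)
  then have "class_types11 ! j \<in> set types11" using nth_mem[of j class_types11] assms l by auto
  then have "of_type (class_types11 ! j) = {g \<in> G. cycle_type g = filter_mset (\<lambda>c. c \<noteq> 1) (mset (class_types11 ! j))}"
    by (intro of_type_cycle_type[OF _ _ inj] cyc_list_types11)
  then show ?thesis unfolding class_types11_eq[symmetric] using assms l by simp
qed

theorem theorem1:
  shows "(\<forall>G. subgroup G (alt_group 12) \<and> sharply_transitive 5 {1..12} G \<longrightarrow>
    (\<exists>Cs chis.
       length Cs = 15 \<and> length chis = 15 \<and>
       is_character_table ((alt_group 12)\<lparr>carrier := G\<rparr>) Cs chis table_12 \<and>
       (\<forall>j<13. Cs ! j = {g \<in> G. cycle_type g = types_12 ! j}) \<and>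
       (\<forall>j\<in>{13, 14}. Cs ! j \<subseteq> {g \<in> G. cycle_type g = types_12 ! j})))
  \<and> (\<forall>G. subgroup G (alt_group 11) \<and> sharply_transitive 4 {1..11} G \<longrightarrow>
    (\<exists>Cs chis.
       length Cs = 10 \<and> length chis = 10 \<and>
       is_character_table ((alt_group 11)\<lparr>carrier := G\<rparr>) Cs chis table_11 \<and>
       (\<forall>j<6. Cs ! j = {g \<in> G. cycle_type g = types_11 ! j}) \<and>
       (\<forall>j\<in>{6, 7, 8, 9}. Cs ! j \<subseteq> {g \<in> G. cycle_type g = types_11 ! j})))"
proof (rule conjI; intro allI impI; elim conjE)
  fix G assume G: "subgroup G (alt_group 12)" "sharply_transitive 5 {1..12} G"
  interpret sharp_alt_group "{1..12}" G 5 using sharp_alt_groupI[OF G] by simp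
  interpret sharp5_12 "{1..12}" G by unfold_locales simp
  obtain g where g: "g \<in> of_type (types12 ! 15)" using of_type12_nonempty[of 15] by auto
  note F = classes_12_facts[OF g]
  have "is_character_table ((alt_group 12)\<lparr>carrier := G\<rparr>) (classes_12 g) (map (M.table_char (classes_12 g)) table_12) table_12"
    using character_table_12[OF g] unfolding alt_subgroup_monoid M_def[symmetric] .
  moreover have "\<forall>j<13. classes_12 g ! j = {g \<in> G. cycle_type g = types_12 ! j}"
    using F(4) of_type_class_types12 by simp
  moreover have "\<forall>j\<in>{13, 14}. classes_12 g ! j \<subseteq> {g \<in> G. cycle_type g = types_12 ! j}"
    using F(5)[of 13] F(5)[of 14] of_type_class_types12[of 13] of_type_class_types12[of 14] by simp
  ultimately show "\<exists>Cs chis. length Cs = 15 \<and> length chis = 15 \<and>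
       is_character_table ((alt_group 12)\<lparr>carrier := G\<rparr>) Cs chis table_12 \<and>
       (\<forall>j<13. Cs ! j = {g \<in> G. cycle_type g = types_12 ! j}) \<and>
       (\<forall>j\<in>{13, 14}. Cs ! j \<subseteq> {g \<in> G. cycle_type g = types_12 ! j})"
    using F(1) table_12_shape(1) by (intro exI conjI) simp_all
next
  fix G assume G: "subgroup G (alt_group 11)" "sharply_transitive 4 {1..11} G"
  interpret sharp_alt_group "{1..11}" G 4 using sharp_alt_groupI[OF G] by simp
  interpret sharp4_11 "{1..11}" G by unfold_locales simp
  obtain u where u: "u \<in> of_type (types11 ! 6)" using of_type11_nonempty[of 6] by auto
  obtain g where g: "g \<in> of_type (types11 ! 8)" using of_type11_nonempty[of 8] by auto
  note F = classes_11_facts[OF u g]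
  have "is_character_table ((alt_group 11)\<lparr>carrier := G\<rparr>) (classes_11 u g) (map (M.table_char (classes_11 u g)) table_11) table_11"
    using character_table_11[OF u g] unfolding alt_subgroup_monoid M_def[symmetric] .
  moreover have "\<forall>j<6. classes_11 u g ! j = {g \<in> G. cycle_type g = types_11 ! j}"
    using F(4) of_type_class_types11 by simp
  moreover have "\<forall>j\<in>{6, 7, 8, 9}. classes_11 u g ! j \<subseteq> {g \<in> G. cycle_type g = types_11 ! j}"
    using F(5)[of 6] F(5)[of 7] F(5)[of 8] F(5)[of 9] of_type_class_types11 by simp
  ultimately show "\<exists>Cs chis. length Cs = 10 \<and> length chis = 10 \<and>
       is_character_table ((alt_group 11)\<lparr>carrier := G\<rparr>) Cs chis table_11 \<and>
       (\<forall>j<6. Cs ! j = {g \<in> G. cycle_type g = types_11 ! j}) \<and>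
       (\<forall>j\<in>{6, 7, 8, 9}. Cs ! j \<subseteq> {g \<in> G. cycle_type g = types_11 ! j})"
    using F(1) table_11_shape(1) by (intro exI conjI) simp_all
qed

end
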